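(* Let $d>0$ be any integer and let $\mu,\mu'$ be partitions of $n$. If the two unipotent characters $\chi_\mu$ and $\chi_{\mu'}$ of $G=GL(V)$ are in the same unipotent $d$-block of $G$, then $\mu$ and $\mu'$ have the same $d$-core.
   Context: $n$ is a positive integer, $q$ a power of a prime, $V$ an $n$-dimensional vector space over $\mathbf F_q$, and $G=GL(V)$. An element of $G$ is $d$-regular if its minimal polynomial has no irreducible factor of degree divisible by $d$, except possibly $X-1$; $\mathcal Y_d(1)$ denotes the set of $d$-regular elements. Two irreducible complex characters $\chi,\psi$ of $G$ are directly linked across $d$-regular elements if $\frac1{|G|}\sum_{y\in\mathcal Y_d(1)}\chi(y)\overline{\psi(y)}\ne0$. The unipotent characters of $G$ are the irreducible constituents of the permutation character of $G$ on the cosets of a Borel subgroup. They are labeled by partitions of $n$ in the standard way: $\chi_\lambda$ is labeled so that, for every composition $\nu$ of $n$, the multiplicity of $\chi_\lambda$ in the permutation character of $G$ on the cosets of the standard parabolic subgroup $P_\nu$ equals the multiplicity of the irreducible character $\varphi_\lambda$ of $S_n$ in the permutation character of $S_n$ on the cosets of the Young subgroup $S_\nu$ (so $\chi_{(n)}=1_G$). Write $\mathrm{Unip}(G)=\{\chi_\lambda : \lambda\vdash n\}$. The unipotent $d$-blocks of $G$ are the equivalence classes of the transitive closure, on $\mathrm{Unip}(G)$, of the relation of direct linking across $d$-regular elements. The $d$-core of a partition is the partition obtained by removing $d$-hooks (rim hooks of length $d$) until none is left. *)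

theory Defs
  imports
    "HOL-Algebra.Sym_Groups"
    "HOL-Algebra.Left_Coset"
    "HOL-Computational_Algebra.Polynomial"
    "Jordan_Normal_Form.Matrix"
begin

section \<open>Complex characters of finite groups\<close>

definition complex_rep :: "('g, 'x) monoid_scheme \<Rightarrow> nat \<Rightarrow> ('g \<Rightarrow> complex mat) \<Rightarrow> bool" where
  "complex_rep G m \<rho> \<longleftrightarrow> \<rho> \<in> hom G (units_of (ring_mat TYPE(complex) m ()))"

definition invariant_subspace ::
    "('g, 'x) monoid_scheme \<Rightarrow> nat \<Rightarrow> ('g \<Rightarrow> complex mat) \<Rightarrow> complex vec set \<Rightarrow> bool" where
  "invariant_subspace G m \<rho> W \<longleftrightarrow>
     W \<subseteq> carrier_vec m \<and> 0\<^sub>v m \<in> W \<and>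
     (\<forall>v\<in>W. \<forall>w\<in>W. v + w \<in> W) \<and> (\<forall>c. \<forall>v\<in>W. c \<cdot>\<^sub>v v \<in> W) \<and>
     (\<forall>g\<in>carrier G. \<forall>v\<in>W. \<rho> g *\<^sub>v v \<in> W)"

definition irreducible_rep :: "('g, 'x) monoid_scheme \<Rightarrow> nat \<Rightarrow> ('g \<Rightarrow> complex mat) \<Rightarrow> bool" where
  "irreducible_rep G m \<rho> \<longleftrightarrow>
     complex_rep G m \<rho> \<and> m > 0 \<and>
     (\<forall>W. invariant_subspace G m \<rho> W \<longrightarrow> W = {0\<^sub>v m} \<or> W = carrier_vec m)"

text \<open>Characters are total functions on the element type; they are extended by 0 outside
  the carrier, so that equality of characters is equality of functions.\<close>

definition rep_character ::
    "('g, 'x) monoid_scheme \<Rightarrow> nat \<Rightarrow> ('g \<Rightarrow> complex mat) \<Rightarrow> 'g \<Rightarrow> complex" where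
  "rep_character G m \<rho> g = (if g \<in> carrier G then \<Sum>i<m. \<rho> g $$ (i, i) else 0)"

definition irr_characters :: "('g, 'x) monoid_scheme \<Rightarrow> ('g \<Rightarrow> complex) set" where
  "irr_characters G = {rep_character G m \<rho> | m \<rho>. irreducible_rep G m \<rho>}"

definition char_inner_on ::
    "('g, 'x) monoid_scheme \<Rightarrow> 'g set \<Rightarrow> ('g \<Rightarrow> complex) \<Rightarrow> ('g \<Rightarrow> complex) \<Rightarrow> complex" where
  "char_inner_on G Y \<chi> \<psi> = 1 / of_nat (card (carrier G)) * (\<Sum>y\<in>Y. \<chi> y * cnj (\<psi> y))"

text \<open>The multiplicity of an irreducible character \<open>\<chi>\<close> in a character \<open>\<theta>\<close>.\<close>

definition multiplicity_in ::
    "('g, 'x) monoid_scheme \<Rightarrow> ('g \<Rightarrow> complex) \<Rightarrow> ('g \<Rightarrow> complex) \<Rightarrow> complex" where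
  "multiplicity_in G \<chi> \<theta> = char_inner_on G (carrier G) \<theta> \<chi>"

definition irr_constituents ::
    "('g, 'x) monoid_scheme \<Rightarrow> ('g \<Rightarrow> complex) \<Rightarrow> ('g \<Rightarrow> complex) set" where
  "irr_constituents G \<theta> = {\<chi> \<in> irr_characters G. multiplicity_in G \<chi> \<theta> \<noteq> 0}"

definition perm_character :: "('g, 'x) monoid_scheme \<Rightarrow> 'g set \<Rightarrow> 'g \<Rightarrow> complex" where
  "perm_character G H g =
     (if g \<in> carrier G then of_nat (card {C \<in> lcosets\<^bsub>G\<^esub> H. g <#\<^bsub>G\<^esub> C = C}) else 0)"

section \<open>Partitions, compositions and cores\<close>

definition is_composition :: "nat \<Rightarrow> nat list \<Rightarrow> bool" where
  "is_composition n \<nu> \<longleftrightarrow> 0 \<notin> set \<nu> \<and> sum_list \<nu> = n"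

definition is_partition :: "nat \<Rightarrow> nat list \<Rightarrow> bool" where
  "is_partition n \<alpha> \<longleftrightarrow> is_composition n \<alpha> \<and> sorted_wrt (\<ge>) \<alpha>"

definition conjugate_partition :: "nat list \<Rightarrow> nat list" where
  "conjugate_partition \<alpha> = map (\<lambda>j. length (filter (\<lambda>p. j < p) \<alpha>)) [0..<foldr max \<alpha> 0]"

definition young_diagram :: "nat list \<Rightarrow> (nat \<times> nat) set" where
  "young_diagram \<alpha> = {(i, j). i < length \<alpha> \<and> j < \<alpha> ! i}"

definition adjacent_cells :: "nat \<times> nat \<Rightarrow> nat \<times> nat \<Rightarrow> bool" where
  "adjacent_cells c c' \<longleftrightarrow>
     (fst c = fst c' \<and> (snd c' = Suc (snd c) \<or> snd c = Suc (snd c'))) \<or>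
     (snd c = snd c' \<and> (fst c' = Suc (fst c) \<or> fst c = Suc (fst c')))"

definition connected_cells :: "(nat \<times> nat) set \<Rightarrow> bool" where
  "connected_cells S \<longleftrightarrow>
     (\<forall>c\<in>S. \<forall>c'\<in>S. (c, c') \<in> {(a, b). a \<in> S \<and> b \<in> S \<and> adjacent_cells a b}\<^sup>*)"

text \<open>\<open>\<kappa>\<close> arises from \<open>\<alpha>\<close> by removing one rim hook of length \<open>d\<close>: the removed cells form a
  connected skew diagram without a 2-by-2 square. Rows and columns are numbered from 0.\<close>

definition removes_hook :: "nat \<Rightarrow> nat list \<Rightarrow> nat list \<Rightarrow> bool" where
  "removes_hook d \<alpha> \<kappa> \<longleftrightarrow>
     is_partition (sum_list \<alpha>) \<alpha> \<and> is_partition (sum_list \<kappa>) \<kappa> \<and>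
     young_diagram \<kappa> \<subseteq> young_diagram \<alpha> \<and>
     (let S = young_diagram \<alpha> - young_diagram \<kappa> in
        card S = d \<and> connected_cells S \<and>
        (\<nexists>i j. {(i, j), (Suc i, j), (i, Suc j), (Suc i, Suc j)} \<subseteq> S))"

definition d_core :: "nat \<Rightarrow> nat list \<Rightarrow> nat list" where
  "d_core d \<alpha> = (THE \<kappa>. (removes_hook d)\<^sup>*\<^sup>* \<alpha> \<kappa> \<and> (\<nexists>\<kappa>'. removes_hook d \<kappa> \<kappa>'))"

section \<open>Irreducible characters of symmetric groups\<close>

definition young_subgroup :: "nat list \<Rightarrow> (nat \<Rightarrow> nat) set" where
  "young_subgroup \<nu> = {p \<in> carrier (sym_group (sum_list \<nu>)).
     \<forall>j<length \<nu>. p ` {sum_list (take j \<nu>) <.. sum_list (take (Suc j) \<nu>)}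
                     = {sum_list (take j \<nu>) <.. sum_list (take (Suc j) \<nu>)}}"

text \<open>The irreducible character of the symmetric group labeled by \<open>\<alpha>\<close>, as in James and Kerber:
  the unique irreducible character that is a constituent both of the character induced from the
  trivial character of the Young subgroup of \<open>\<alpha>\<close> and of the one induced from the sign character
  of the Young subgroup of the conjugate partition. The latter induced character is the product
  of the sign character with the permutation character. The label \<open>[n]\<close> gives the trivial
  character.\<close>

definition sym_character :: "nat list \<Rightarrow> (nat \<Rightarrow> nat) \<Rightarrow> complex" where
  "sym_character \<alpha> =
     (let S = sym_group (sum_list \<alpha>) in
      THE \<phi>. \<phi> \<in> irr_constituents S (perm_character S (young_subgroup \<alpha>)) \<and>
             \<phi> \<in> irr_constituents S
                   (\<lambda>p. of_int (sign p) *
                        perm_character S (young_subgroup (conjugate_partition \<alpha>)) p))"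

section \<open>General linear groups\<close>

text \<open>The vector space is the whole type \<open>'v\<close> with scalar multiplication \<open>scale\<close>; the ground field
  is a finite field given as a type, so that \<open>q = CARD('k)\<close>.\<close>

definition GL_group :: "('k::field \<Rightarrow> 'v::ab_group_add \<Rightarrow> 'v) \<Rightarrow> ('v \<Rightarrow> 'v) monoid" where
  "GL_group scale =
     \<lparr>carrier = {g. Vector_Spaces.linear scale scale g \<and> bij g}, mult = (\<circ>), one = id\<rparr>"

definition poly_at_endo ::
    "('k::field \<Rightarrow> 'v::ab_group_add \<Rightarrow> 'v) \<Rightarrow> 'k poly \<Rightarrow> ('v \<Rightarrow> 'v) \<Rightarrow> 'v \<Rightarrow> 'v" where
  "poly_at_endo scale p g v = (\<Sum>i\<le>degree p. scale (coeff p i) ((g ^^ i) v))"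

definition minimal_poly :: "('k::field \<Rightarrow> 'v::ab_group_add \<Rightarrow> 'v) \<Rightarrow> ('v \<Rightarrow> 'v) \<Rightarrow> 'k poly" where
  "minimal_poly scale g =
     (THE m. lead_coeff m = 1 \<and> (\<forall>v. poly_at_endo scale m g v = 0) \<and>
             (\<forall>p. p \<noteq> 0 \<and> (\<forall>v. poly_at_endo scale p g v = 0) \<longrightarrow> degree m \<le> degree p))"

definition d_regular :: "nat \<Rightarrow> ('k::field \<Rightarrow> 'v::ab_group_add \<Rightarrow> 'v) \<Rightarrow> ('v \<Rightarrow> 'v) set" where
  "d_regular d scale = {g \<in> carrier (GL_group scale).
     \<forall>f. irreducible f \<and> lead_coeff f = 1 \<and> f dvd minimal_poly scale g \<and> d dvd degree f
          \<longrightarrow> f = [:-1, 1:]}"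

definition ordered_basis :: "('k::field \<Rightarrow> 'v::ab_group_add \<Rightarrow> 'v) \<Rightarrow> 'v list \<Rightarrow> bool" where
  "ordered_basis scale bs \<longleftrightarrow>
     distinct bs \<and> \<not> module.dependent scale (set bs) \<and> module.span scale (set bs) = UNIV"

text \<open>Standard parabolic subgroups are taken with respect to an ordered basis \<open>bs\<close>: they are the
  stabilizers of the flags spanned by initial segments of \<open>bs\<close>.\<close>

definition parabolic ::
    "('k::field \<Rightarrow> 'v::ab_group_add \<Rightarrow> 'v) \<Rightarrow> 'v list \<Rightarrow> nat list \<Rightarrow> ('v \<Rightarrow> 'v) set" where
  "parabolic scale bs \<nu> = {g \<in> carrier (GL_group scale).
     \<forall>j\<le>length \<nu>. g ` module.span scale (set (take (sum_list (take j \<nu>)) bs))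
                     = module.span scale (set (take (sum_list (take j \<nu>)) bs))}"

definition borel :: "('k::field \<Rightarrow> 'v::ab_group_add \<Rightarrow> 'v) \<Rightarrow> 'v list \<Rightarrow> ('v \<Rightarrow> 'v) set" where
  "borel scale bs = parabolic scale bs (replicate (length bs) 1)"

definition unipotent_characters ::
    "('k::field \<Rightarrow> 'v::ab_group_add \<Rightarrow> 'v) \<Rightarrow> 'v list \<Rightarrow> (('v \<Rightarrow> 'v) \<Rightarrow> complex) set" where
  "unipotent_characters scale bs =
     irr_constituents (GL_group scale) (perm_character (GL_group scale) (borel scale bs))"

definition unipotent_character ::
    "('k::field \<Rightarrow> 'v::ab_group_add \<Rightarrow> 'v) \<Rightarrow> 'v list \<Rightarrow> nat list \<Rightarrow> ('v \<Rightarrow> 'v) \<Rightarrow> complex" where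
  "unipotent_character scale bs \<alpha> =
     (THE \<chi>. \<chi> \<in> unipotent_characters scale bs \<and>
        (\<forall>\<nu>. is_composition (sum_list \<alpha>) \<nu> \<longrightarrow>
           multiplicity_in (GL_group scale) \<chi>
             (perm_character (GL_group scale) (parabolic scale bs \<nu>))
           = multiplicity_in (sym_group (sum_list \<alpha>)) (sym_character \<alpha>)
             (perm_character (sym_group (sum_list \<alpha>)) (young_subgroup \<nu>))))"

section \<open>Unipotent blocks\<close>

definition directly_linked ::
    "nat \<Rightarrow> ('k::field \<Rightarrow> 'v::ab_group_add \<Rightarrow> 'v) \<Rightarrow>
     (('v \<Rightarrow> 'v) \<Rightarrow> complex) \<Rightarrow> (('v \<Rightarrow> 'v) \<Rightarrow> complex) \<Rightarrow> bool" where
  "directly_linked d scale \<chi> \<psi> \<longleftrightarrow>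
     char_inner_on (GL_group scale) (d_regular d scale) \<chi> \<psi> \<noteq> 0"

definition unipotent_blocks ::
    "nat \<Rightarrow> ('k::field \<Rightarrow> 'v::ab_group_add \<Rightarrow> 'v) \<Rightarrow> 'v list \<Rightarrow>
     (('v \<Rightarrow> 'v) \<Rightarrow> complex) set set" where
  "unipotent_blocks d scale bs =
     unipotent_characters scale bs //
     {(\<chi>, \<psi>). \<chi> \<in> unipotent_characters scale bs \<and> \<psi> \<in> unipotent_characters scale bs \<and>
               directly_linked d scale \<chi> \<psi>}\<^sup>+"

end

theory Submission
  imports
    Defs
    "HOL-Library.Poly_Mapping"
    "HOL-Computational_Algebra.Formal_Power_Series"
    "HOL-Computational_Algebra.Polynomial_Factorial"
    "HOL-Algebra.Multiplicative_Group"
    "Jordan_Normal_Form.Spectral_Radius"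
begin

text \<open>
  Let \<open>\<delta> i = n - 1 - i\<close>, and let \<open>h a\<close> be the permutation character on flags with dimension jumps \<open>a\<close>, or,
  for the symmetric group, on colourings with \<open>a i\<close> points of colour \<open>i\<close>. In both groups the inner product
  of \<open>h a\<close> and \<open>h b\<close> counts the matrices of natural numbers with margins \<open>a\<close> and \<open>b\<close>, by Burnside's lemma. By
  the Cauchy determinant the alternating sums \<open>S \<beta> = (\<Sum>w. sign w * h (\<beta> - \<delta> \<circ> w))\<close> are therefore orthonormal up
  to permutation of \<open>\<beta>\<close>; the unipotent character of \<open>\<mu>\<close> is \<open>S (\<mu> + \<delta>)\<close>, and every unipotent character is
  \<open>S \<beta>\<close> up to sign for some \<open>\<beta>\<close>.

  An automorphism \<open>g\<close> of \<open>W\<close> splits \<open>W\<close> into a part on which it is \<open>d\<close>-regular and a part \<open>V\<close> on which all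
  factors of its minimal polynomial are excluded ones. Stable flags split accordingly, and on \<open>V\<close> all
  dimension jumps are divisible by \<open>d\<close>, so that passing to the regular part does not change \<open>\<beta>\<close> modulo \<open>d\<close>.
  By induction on \<open>dim W\<close> the sum of \<open>S \<beta> * S \<gamma>\<close> over the \<open>d\<close>-regular elements vanishes, like the sum over all
  elements, when \<open>\<beta>\<close> and \<open>\<gamma>\<close> have different multisets of residues modulo \<open>d\<close>. Hence these residues are constant
  on a block, and the residues of \<open>\<mu> + \<delta>\<close> modulo \<open>d\<close> determine the \<open>d\<close>-core of \<open>\<mu>\<close>.
\<close>

text \<open>The characters are never constructed; they are recognized by inner products. An
  alternating sum of norm one is, as an integral combination of irreducible characters, irreducible
  up to sign. For a partition the sign is fixed by a pairing equal to one with a genuine character: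
  a permutation character of the general linear group, a sign-twisted one of the symmetric group.
  Since both groups give the same matrix counts, the two labellings match. The sum over regular
  elements cannot be treated within one group and for partitions alone: splitting off the singular
  part replaces \<open>W\<close> by a proper subspace and \<beta> by \<open>\<beta> - b\<close> for
  arbitrary jumps \<open>b\<close>. Hence the induction concerns automorphisms of all subspaces and
  all integer sequences, also those with negative entries or the wrong total, for which the
  alternating sum is zero. The number \<open>N\<close> of steps stays the same on every subspace, so
  the same \<open>delta\<close> serves throughout. Residues modulo \<open>d\<close> enter twice:
  removing a \<open>d\<close>-hook lowers, up to order, one beta number by \<open>d\<close>; and a
  stable subspace of the singular part has composition factors whose dimensions are degrees of
  excluded factors, hence multiples of \<open>d\<close>.\<close>

definition rows_of_size :: "nat \<Rightarrow> int \<Rightarrow> nat multiset set" where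
  "rows_of_size N a = {X. set_mset X \<subseteq> {..<N} \<and> int (size X) = a}"

text \<open>A matrix of natural numbers is encoded by its rows, row \<open>i\<close> being the multiset in which
  \<open>j\<close> has the \<open>(i, j)\<close> entry as multiplicity.\<close>

definition nat_mats :: "nat \<Rightarrow> (nat \<Rightarrow> int) \<Rightarrow> (nat \<Rightarrow> int) \<Rightarrow> (nat \<Rightarrow> nat multiset) set" where
  "nat_mats N a b = {A \<in> PiE {..<N} (\<lambda>i. rows_of_size N (a i)).
     \<forall>j<N. (\<Sum>i<N. int (count (A i) j)) = b j}"

text \<open>The staircase \<open>N - 1, ..., 0\<close>. Integers are used because the differences
  \<open>\<beta> i - delta N (w i)\<close> can be negative; there are then no rows, no flags and no
  colourings of that type, which is the convention that symmetric functions of negative degree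
  vanish.\<close>

definition delta :: "nat \<Rightarrow> nat \<Rightarrow> int" where
  "delta N i = int N - 1 - int i"

lemma finite_rows_of_size: "finite (rows_of_size N a)"
proof -
  have "rows_of_size N a \<subseteq> multisets_of_size {..<N} (nat a)"
    by (auto simp: rows_of_size_def multisets_of_size_def)
  then show ?thesis by (rule finite_subset) auto
qed

subsection \<open>The Cauchy determinant\<close>

text \<open>With integer exponents, multiplying by a monomial shifts coefficients by an exact
  subtraction, and coefficients can be taken at sequences with negative entries such as \<gamma>
  minus a permuted \<open>delta N\<close>.\<close>

type_synonym laurent = "(nat \<Rightarrow>\<^sub>0 int) \<Rightarrow>\<^sub>0 int"

definition expo :: "nat \<Rightarrow> (nat \<Rightarrow> int) \<Rightarrow> nat \<Rightarrow>\<^sub>0 int" where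
  "expo N f = (\<Sum>k<N. Poly_Mapping.single k (f k))"

definition lmon :: "nat \<Rightarrow> (nat \<Rightarrow> int) \<Rightarrow> laurent" where
  "lmon N f = Poly_Mapping.single (expo N f) 1"

definition lcoeff :: "nat \<Rightarrow> laurent \<Rightarrow> (nat \<Rightarrow> int) \<Rightarrow> int" where
  "lcoeff N p f = Poly_Mapping.lookup p (expo N f)"

lemma lookup_expo: "Poly_Mapping.lookup (expo N f) k = (if k < N then f k else 0)"
  unfolding expo_def by (simp add: lookup_sum lookup_single when_def)

lemma expo_eq_iff: "expo N f = expo N g \<longleftrightarrow> (\<forall>k<N. f k = g k)"
  by (metis (no_types, lifting) lookup_expo poly_mapping_eqI)

lemma expo_add: "expo N f + expo N g = expo N (\<lambda>k. f k + g k)"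
  by (rule poly_mapping_eqI) (simp add: lookup_add lookup_expo)

lemma expo_diff: "expo N f - expo N g = expo N (\<lambda>k. f k - g k)"
  by (rule poly_mapping_eqI) (simp add: lookup_minus lookup_expo)

lemma lmon_mult: "lmon N f * lmon N g = lmon N (\<lambda>k. f k + g k)"
  unfolding lmon_def by (simp add: mult_single expo_add)

lemma lmon_cong: "(\<And>k. k < N \<Longrightarrow> f k = g k) \<Longrightarrow> lmon N f = lmon N g"
  unfolding lmon_def by (metis expo_eq_iff)

lemma lmon_zero: "lmon N (\<lambda>k. 0) = 1"
  unfolding lmon_def expo_def by simp

lemma lmon_prod: "(\<Prod>i\<in>I. lmon N (F i)) = lmon N (\<lambda>k. \<Sum>i\<in>I. F i k)"
  by (induction I rule: infinite_finite_induct) (simp_all add: lmon_zero lmon_mult)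

lemma lmon_power: "lmon N f ^ m = lmon N (\<lambda>k. int m * f k)"
  by (induction m) (simp_all add: lmon_zero lmon_mult algebra_simps)

lemma lcoeff_lmon: "lcoeff N (lmon N f) g = (if \<forall>k<N. g k = f k then 1 else 0)"
  unfolding lcoeff_def lmon_def by (auto simp: lookup_single when_def expo_eq_iff)

lemma lcoeff_sum: "lcoeff N (\<Sum>i\<in>I. F i) g = (\<Sum>i\<in>I. lcoeff N (F i) g)"
  unfolding lcoeff_def by (simp add: lookup_sum)

lemma lcoeff_of_int_mult: "lcoeff N (of_int c * p) g = c * lcoeff N p g"
proof -
  have "lcoeff N (of_nat m * p) g = int m * lcoeff N p g" for m
    by (induction m) (simp_all add: lcoeff_def lookup_add algebra_simps)
  then show ?thesis
    by (cases c) (auto simp: lcoeff_def lookup_uminus lookup_add algebra_simps simp flip: of_nat_Suc)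
qed

lemma lcoeff_lmon_mult: "lcoeff N (lmon N f * p) g = lcoeff N p (\<lambda>k. g k - f k)"
proof -
  have "Poly_Mapping.lookup (Poly_Mapping.single e 1 * p) k = Poly_Mapping.lookup p (k - e)" for e k
  proof -
    have "Poly_Mapping.lookup (Poly_Mapping.single e 1 * p) k
        = (\<Sum>l. (\<Sum>q. Poly_Mapping.lookup p q when k = l + q) when l = e)"
      unfolding lookup_mult
      by (intro arg_cong[of _ _ Sum_any] ext) (auto simp: lookup_single when_def)
    also have "\<dots> = (\<Sum>q. Poly_Mapping.lookup p q when k = e + q)" by simp
    also have "\<dots> = (\<Sum>q. Poly_Mapping.lookup p q when q = k - e)"
      by (intro arg_cong[of _ _ Sum_any] ext) (auto simp: when_def)
    finally show ?thesis by simp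
  qed
  then show ?thesis unfolding lcoeff_def lmon_def by (simp add: expo_diff)
qed

definition lvar :: "nat \<Rightarrow> nat \<Rightarrow> laurent" where
  "lvar N k = lmon N (\<lambda>j. if j = k then 1 else 0)"

text \<open>The complete homogeneous symmetric polynomial of degree \<open>a\<close> in
  \<open>N\<close> variables, read off from its generating function, a product of geometric
  series.\<close>

definition hpoly :: "nat \<Rightarrow> int \<Rightarrow> laurent" where
  "hpoly N a = (if a < 0 then 0 else fps_nth (\<Prod>k<N. Abs_fps (\<lambda>m. lvar N k ^ m)) (nat a))"

lemma hpoly_eq: "hpoly N a = (\<Sum>X\<in>rows_of_size N a. lmon N (\<lambda>j. int (count X j)))"
proof (cases "a < 0")
  case True
  then have "rows_of_size N a = {}" by (auto simp: rows_of_size_def)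
  with True show ?thesis by (simp add: hpoly_def)
next
  case False
  then have *: "rows_of_size N a = multisets_of_size {..<N} (nat a)"
    by (auto simp: rows_of_size_def multisets_of_size_def)
  have "hpoly N a = (\<Sum>X\<in>multisets_of_size {..<N} (nat a). \<Prod>k<N. lvar N k ^ count X k)"
    using False by (simp add: hpoly_def fps_prod_nth')
  also have "\<dots> = (\<Sum>X\<in>rows_of_size N a. lmon N (\<lambda>j. int (count X j)))"
    unfolding * lvar_def lmon_power lmon_prod
    by (intro sum.cong refl lmon_cong) (simp add: if_distrib cong: if_cong)
  finally show ?thesis .
qed

lemma hpoly_0: "hpoly N 0 = 1"
proof -
  have "rows_of_size N 0 = {{#}}" by (auto simp: rows_of_size_def)
  then show ?thesis by (simp add: hpoly_eq lmon_zero)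
qed

text \<open>Expanding the product chooses a multiset, that is a row, from each factor; the exponents
  of the resulting monomial are the column sums.\<close>

lemma lcoeff_hpoly_prod:
  "lcoeff N (\<Prod>i<N. hpoly N (a i)) b = int (card (nat_mats N a b))"
proof -
  have "(\<Prod>i<N. hpoly N (a i))
      = (\<Sum>A\<in>PiE {..<N} (\<lambda>i. rows_of_size N (a i)). \<Prod>i<N. lmon N (\<lambda>j. int (count (A i) j)))"
    unfolding hpoly_eq by (rule prod_sum_PiE) (auto simp: finite_rows_of_size)
  then have "lcoeff N (\<Prod>i<N. hpoly N (a i)) b
      = (\<Sum>A\<in>PiE {..<N} (\<lambda>i. rows_of_size N (a i)).
           if \<forall>j<N. b j = (\<Sum>i<N. int (count (A i) j)) then 1 else 0)"
    by (simp only: lmon_prod lcoeff_sum lcoeff_lmon)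
  also have "\<dots> = int (card (nat_mats N a b))"
    unfolding nat_mats_def
    by (subst sum.If_cases) (auto intro!: finite_PiE finite_rows_of_size arg_cong[of _ _ card])
  finally show ?thesis .
qed

lemma geometric_fps: "(1 - fps_const y * fps_X) * Abs_fps (\<lambda>m. y ^ m) = (1::'a::comm_ring_1 fps)"
proof (rule fps_ext)
  fix n
  show "fps_nth ((1 - fps_const y * fps_X) * Abs_fps (\<lambda>m. y ^ m)) n = fps_nth (1::'a fps) n"
    by (cases n) (simp_all add: left_diff_distrib mult.assoc)
qed

lemma fps_linear_prod_nth_eq_0:
  assumes "finite I" "card I < n"
  shows "fps_nth (\<Prod>j\<in>I. 1 - fps_const (y j) * fps_X) n = (0::'a::comm_ring_1)"
  using assms
proof (induction I arbitrary: n rule: finite_induct)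
  case (insert j I)
  then obtain m where "n = Suc m" "card I < m" by (cases n) auto
  with insert show ?case by (simp add: left_diff_distrib mult.assoc)
qed simp

text \<open>Up to the sign \<open>(-1)^i\<close>, the elementary symmetric polynomial of degree
  \<open>i\<close> in the variables other than number \<open>k\<close>.\<close>

definition epoly :: "nat \<Rightarrow> nat \<Rightarrow> nat \<Rightarrow> laurent" where
  "epoly N k i = fps_nth (\<Prod>j\<in>{..<N} - {k}. 1 - fps_const (lvar N j) * fps_X) i"

text \<open>Multiplying the generating function of the \<open>hpoly\<close> by the linear factors of
  all variables other than number \<open>k\<close> cancels every geometric series but one. Powers of
  a single variable thus become combinations of \<open>hpoly\<close> whose coefficients do not
  depend on \<open>m\<close>.\<close>

lemma lvar_power_eq:
  assumes "k < N"
  shows "lvar N k ^ m = (\<Sum>j<N. hpoly N (int m - delta N j) * epoly N k (nat (delta N j)))"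
proof -
  let ?H = "\<Prod>k<N. Abs_fps (\<lambda>m. lvar N k ^ m)"
  let ?E = "\<Prod>j\<in>{..<N} - {k}. 1 - fps_const (lvar N j) * fps_X"
  have "?H * ?E = Abs_fps (\<lambda>m. lvar N k ^ m) *
      (\<Prod>j\<in>{..<N} - {k}. (1 - fps_const (lvar N j) * fps_X) * Abs_fps (\<lambda>m. lvar N j ^ m))"
    using assms by (simp add: prod.remove[of "{..<N}" k] prod.distrib mult_ac)
  also have "\<dots> = Abs_fps (\<lambda>m. lvar N k ^ m)" by (simp add: geometric_fps)
  finally have "lvar N k ^ m = fps_nth (?E * ?H) m" by (simp add: mult.commute)
  also have "\<dots> = (\<Sum>i=0..m. epoly N k i * fps_nth ?H (m - i))"
    by (simp add: fps_mult_nth epoly_def)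
  \<comment> \<open>A product of \<open>N - 1\<close> linear factors has no coefficients from degree
    \<open>N\<close> on, so the range of \<open>i\<close> is bounded independently of
    \<open>m\<close>.\<close>
  also have "\<dots> = (\<Sum>i\<in>{0..m} \<inter> {..<N}. epoly N k i * fps_nth ?H (m - i))"
    using assms
    by (intro sum.mono_neutral_right) (auto simp: epoly_def intro!: fps_linear_prod_nth_eq_0)
  also have "\<dots> = (\<Sum>i\<in>{0..m} \<inter> {..<N}. epoly N k i * hpoly N (int m - int i))"
    by (intro sum.cong refl) (auto simp: hpoly_def nat_diff_distrib')
  also have "\<dots> = (\<Sum>i<N. epoly N k i * hpoly N (int m - int i))"
    by (intro sum.mono_neutral_left) (auto simp: hpoly_def)
  \<comment> \<open>Reversing the order makes the index a staircase value, so that the sum is an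
    entry of a matrix product with \<open>hmat\<close>.\<close>
  also have "\<dots> = (\<Sum>j<N. epoly N k (N - Suc j) * hpoly N (int m - int (N - Suc j)))"
    by (rule sum.nat_diff_reindex[symmetric])
  also have "\<dots> = (\<Sum>j<N. hpoly N (int m - delta N j) * epoly N k (nat (delta N j)))"
  proof (intro sum.cong refl)
    fix j assume "j \<in> {..<N}"
    then have "int (N - Suc j) = delta N j" by (auto simp: delta_def)
    moreover from this have "N - Suc j = nat (delta N j)" by simp
    ultimately show "epoly N k (N - Suc j) * hpoly N (int m - int (N - Suc j))
        = hpoly N (int m - delta N j) * epoly N k (nat (delta N j))"
      by (simp add: mult.commute)
  qed
  finally show ?thesis .
qed

text \<open>The Jacobi-Trudi matrix. Its determinant is the Schur polynomial with shifted exponents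
  \<beta>.\<close>

definition hmat :: "nat \<Rightarrow> (nat \<Rightarrow> int) \<Rightarrow> laurent mat" where
  "hmat N \<beta> = mat N N (\<lambda>(i, j). hpoly N (\<beta> i - delta N j))"

text \<open>The matrix of an alternant; for \<beta> equal to \<open>delta N\<close> it is a
  Vandermonde matrix.\<close>

definition vmat :: "nat \<Rightarrow> (nat \<Rightarrow> int) \<Rightarrow> laurent mat" where
  "vmat N \<beta> = mat N N (\<lambda>(i, k). lvar N k ^ nat (\<beta> i))"

text \<open>The bialternant formula. \<open>lvar_power_eq\<close> factors
  \<open>vmat N \<gamma>\<close> as \<open>hmat N \<gamma>\<close> times a matrix \<open>E\<close>
  independent of \<gamma>. For \<gamma> equal to \<open>delta N\<close> the first factor is
  unitriangular, so \<open>det E\<close> is the Vandermonde determinant.\<close>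

lemma det_vmat_factor:
  assumes "\<And>i. i < N \<Longrightarrow> 0 \<le> \<beta> i"
  shows "det (vmat N \<beta>) = det (hmat N \<beta>) * det (vmat N (delta N))"
proof -
  define E where "E = mat N N (\<lambda>(j, k). epoly N k (nat (delta N j)))"
  have E: "E \<in> carrier_mat N N" by (simp add: E_def)
  have H: "hmat N \<gamma> \<in> carrier_mat N N" for \<gamma> by (simp add: hmat_def)
  have fact: "det (vmat N \<gamma>) = det (hmat N \<gamma>) * det E" if "\<And>i. i < N \<Longrightarrow> 0 \<le> \<gamma> i" for \<gamma>
  proof -
    have "vmat N \<gamma> = hmat N \<gamma> * E"
    proof (rule eq_matI)
      fix i k assume "i < dim_row (hmat N \<gamma> * E)" "k < dim_col (hmat N \<gamma> * E)"
      then have ik: "i < N" "k < N" by (auto simp: hmat_def E_def)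
      with that[OF ik(1)] show "vmat N \<gamma> $$ (i, k) = (hmat N \<gamma> * E) $$ (i, k)"
        by (simp add: vmat_def hmat_def E_def scalar_prod_def lvar_power_eq atLeast0LessThan)
    qed (auto simp: vmat_def hmat_def E_def)
    then show ?thesis using det_mult[OF H E] by simp
  qed
  have "det (hmat N (delta N)) = 1"
  proof -
    have "upper_triangular (hmat N (delta N))"
      by (rule upper_triangularI) (auto simp: hmat_def delta_def hpoly_def)
    then have "det (hmat N (delta N)) = prod_list (diag_mat (hmat N (delta N)))"
      using H by (rule det_upper_triangular)
    also have "diag_mat (hmat N (delta N)) = map (\<lambda>i. 1) [0..<N]"
      unfolding diag_mat_def by (rule map_cong) (auto simp: hmat_def hpoly_0)
    also have "prod_list \<dots> = (1::laurent)" by (induction N) auto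
    finally show ?thesis .
  qed
  with fact[of "delta N"] have "det (vmat N (delta N)) = det E" by (simp add: delta_def)
  with fact[OF assms] show ?thesis by simp
qed

lemma permutes_lessThan: "w permutes {..<N} \<Longrightarrow> i < N \<Longrightarrow> w i < N"
  using permutes_in_image[of w "{..<N}" i] by simp

lemma sign_inv_lessThan: "w permutes {..<N::nat} \<Longrightarrow> sign (inv' w) = sign w"
  by (rule sign_inverse) (auto simp: permutation_permutes)

lemma det_vmat:
  assumes "\<And>i. i < N \<Longrightarrow> 0 \<le> \<beta> i"
  shows "det (vmat N \<beta>) = (\<Sum>w | w permutes {..<N}. of_int (sign w) * lmon N (\<lambda>k. \<beta> (w k)))"
proof -
  have "det (vmat N \<beta>)
      = (\<Sum>w | w permutes {..<N}. of_int (sign w) * (\<Prod>i<N. lvar N (w i) ^ nat (\<beta> i)))"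
    by (subst det_def'[of _ N])
      (auto simp: vmat_def atLeast0LessThan permutes_lessThan intro!: sum.cong prod.cong arg_cong2[of _ _ _ _ times])
  also have "\<dots> = (\<Sum>w | w permutes {..<N}. of_int (sign w) * lmon N (\<lambda>k. \<beta> (inv' w k)))"
  proof (intro sum.cong refl arg_cong2[of _ _ _ _ times])
    fix w assume "w \<in> {w. w permutes {..<N}}"
    then have w: "w permutes {..<N}" by simp
    show "(\<Prod>i<N. lvar N (w i) ^ nat (\<beta> i)) = lmon N (\<lambda>k. \<beta> (inv' w k))"
      unfolding lvar_def lmon_power lmon_prod
    proof (rule lmon_cong)
      fix k assume k: "k < N"
      have "(\<Sum>i<N. int (nat (\<beta> i)) * (if k = w i then 1 else 0))
          = (\<Sum>i<N. if i = inv' w k then \<beta> i else 0)"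
        using assms w by (intro sum.cong refl) (auto simp: permutes_inverses)
      also have "\<dots> = \<beta> (inv' w k)"
        using k permutes_in_image[OF permutes_inv[OF w], of k] by simp
      finally show "(\<Sum>i<N. int (nat (\<beta> i)) * (if k = w i then 1 else 0)) = \<beta> (inv' w k)" .
    qed
  qed
  also have "\<dots> = (\<Sum>w | w permutes {..<N}. of_int (sign w) * lmon N (\<lambda>k. \<beta> (w k)))"
    by (rule sum.reindex_bij_witness[of _ inv' inv'])
      (auto simp: permutes_inv permutes_inv_inv sign_inv_lessThan)
  finally show ?thesis .
qed

lemma lcoeff_det_hmat:
  "lcoeff N (det (hmat N \<beta>)) \<gamma> = (\<Sum>w | w permutes {..<N}.
     sign w * int (card (nat_mats N (\<lambda>i. \<beta> i - delta N (w i)) \<gamma>)))"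
proof -
  have "det (hmat N \<beta>) = (\<Sum>w | w permutes {..<N}. of_int (sign w) *
      (\<Prod>i<N. hpoly N (\<beta> i - delta N (w i))))"
    by (subst det_def'[of _ N])
      (auto simp: hmat_def atLeast0LessThan permutes_lessThan intro!: sum.cong prod.cong arg_cong2[of _ _ _ _ times])
  then show ?thesis
    by (simp add: lcoeff_sum lcoeff_of_int_mult lcoeff_hpoly_prod)
qed

text \<open>Both sides are the coefficient at \<gamma> of the alternant of \<beta>. Its direct
  expansion gives the signed matches on the right; as Jacobi-Trudi times Vandermonde determinant it
  gives the sum over \<open>w\<close> from the first factor and over \<open>v\<close> from the
  second.\<close>

theorem cauchy_nat_mats:
  assumes "\<And>i. i < N \<Longrightarrow> 0 \<le> \<beta> i"
  shows "(\<Sum>w | w permutes {..<N}. \<Sum>v | v permutes {..<N}. sign w * sign v *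
           int (card (nat_mats N (\<lambda>i. \<beta> i - delta N (w i)) (\<lambda>i. \<gamma> i - delta N (v i)))))
       = (\<Sum>w | w permutes {..<N}. if \<forall>i<N. \<gamma> i = \<beta> (w i) then sign w else 0)"
proof -
  have "(\<Sum>w | w permutes {..<N}. if \<forall>i<N. \<gamma> i = \<beta> (w i) then sign w else 0)
      = lcoeff N (det (vmat N \<beta>)) \<gamma>"
    by (auto simp: det_vmat[OF assms] lcoeff_sum lcoeff_of_int_mult lcoeff_lmon intro!: sum.cong)
  also have "\<dots> = lcoeff N (det (hmat N \<beta>) * det (vmat N (delta N))) \<gamma>"
    by (simp add: det_vmat_factor[OF assms])
  also have "\<dots> = (\<Sum>v | v permutes {..<N}.
      sign v * lcoeff N (lmon N (\<lambda>k. delta N (v k)) * det (hmat N \<beta>)) \<gamma>)"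
  proof -
    have "det (hmat N \<beta>) * det (vmat N (delta N)) = (\<Sum>v | v permutes {..<N}.
        of_int (sign v) * (lmon N (\<lambda>k. delta N (v k)) * det (hmat N \<beta>)))"
      by (subst det_vmat) (auto simp: delta_def sum_distrib_left mult_ac)
    then show ?thesis by (simp add: lcoeff_sum lcoeff_of_int_mult)
  qed
  also have "\<dots> = (\<Sum>v | v permutes {..<N}. \<Sum>w | w permutes {..<N}. sign w * sign v *
           int (card (nat_mats N (\<lambda>i. \<beta> i - delta N (w i)) (\<lambda>i. \<gamma> i - delta N (v i)))))"
    unfolding lcoeff_lmon_mult lcoeff_det_hmat by (simp add: sum_distrib_left mult_ac)
  finally show ?thesis by (subst sum.swap) simp
qed

section \<open>Traces of complex matrices of finite order\<close>

definition mtrace :: "complex mat \<Rightarrow> complex" where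
  "mtrace A = (\<Sum>i<dim_row A. A $$ (i, i))"

lemma mat_mult_entry:
  assumes "A \<in> carrier_mat n k" "B \<in> carrier_mat k m" "i < n" "j < m"
  shows "(A * B) $$ (i, j) = (\<Sum>l<k. A $$ (i, l) * B $$ (l, j))"
  using assms by (auto simp: scalar_prod_def atLeast0LessThan)

lemma mtrace_comm:
  assumes "A \<in> carrier_mat n k" "B \<in> carrier_mat k n"
  shows "mtrace (A * B) = mtrace (B * A)"
proof -
  have "mtrace (A * B) = (\<Sum>i<n. \<Sum>l<k. A $$ (i, l) * B $$ (l, i))"
    using assms by (auto simp: mtrace_def mat_mult_entry[OF assms] simp del: index_mult_mat(1))
  also have "\<dots> = (\<Sum>l<k. \<Sum>i<n. B $$ (l, i) * A $$ (i, l))"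
    by (subst sum.swap) (simp add: mult.commute)
  also have "\<dots> = mtrace (B * A)"
    using assms by (auto simp: mtrace_def mat_mult_entry[OF assms(2,1)] simp del: index_mult_mat(1))
  finally show ?thesis .
qed

lemma upper_triangular_pow:
  assumes "B \<in> carrier_mat n n" "upper_triangular (B :: complex mat)"
  shows "upper_triangular (B ^\<^sub>m l) \<and> (\<forall>i<n. (B ^\<^sub>m l) $$ (i, i) = (B $$ (i, i)) ^ l)"
proof (induction l)
  case 0
  then show ?case using assms by auto
next
  case (Suc l)
  have P: "B ^\<^sub>m l \<in> carrier_mat n n" using assms by auto
  have z: "(B ^\<^sub>m l) $$ (i, j) = 0" if "j < i" "i < n" for i j
    using Suc that P by auto
  have z': "B $$ (i, j) = 0" if "j < i" "i < n" for i j
    using assms that by auto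
  have e: "(B ^\<^sub>m Suc l) $$ (i, j) = (\<Sum>k<n. (B ^\<^sub>m l) $$ (i, k) * B $$ (k, j))" if "i < n" "j < n" for i j
    using that assms mat_mult_entry[OF P assms(1)] by auto
  have "(B ^\<^sub>m Suc l) $$ (i, j) = 0" if "j < i" "i < n" for i j
  proof -
    have "(B ^\<^sub>m l) $$ (i, k) * B $$ (k, j) = 0" if "k < n" for k
      using z[of k i] z'[of j k] \<open>j < i\<close> \<open>i < n\<close> that by (cases "k < i") auto
    then have "(\<Sum>k<n. (B ^\<^sub>m l) $$ (i, k) * B $$ (k, j)) = 0" by (intro sum.neutral) auto
    then show ?thesis using e that by auto
  qed
  moreover have "(B ^\<^sub>m Suc l) $$ (i, i) = (B $$ (i, i)) ^ Suc l" if "i < n" for i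
  proof -
    have "(B ^\<^sub>m l) $$ (i, k) * B $$ (k, i) = (if k = i then (B $$ (i, i)) ^ Suc l else 0)" if "k < n" for k
      using z[of k i] z'[of i k] \<open>i < n\<close> that Suc by (cases k i rule: linorder_cases) auto
    then show ?thesis using e[OF that that] that by simp
  qed
  ultimately show ?case using P assms by auto
qed

text \<open>After triangularization the diagonal entries are roots of unity, whose inverses, here
  the powers with exponent \<open>l\<close>, are their conjugates. This yields the value of a
  character at an inverse without passing to a unitary form.\<close>

lemma mtrace_finite_order:
  assumes A: "A \<in> carrier_mat n n" and "A ^\<^sub>m Suc l = 1\<^sub>m n"
  shows "mtrace (A ^\<^sub>m l) = cnj (mtrace A)"
proof -
  obtain es where es: "char_poly A = (\<Prod>a\<leftarrow>es. [:- a, 1:])"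
    using char_poly_factorized[OF A] by auto
  obtain B where B: "B \<in> carrier_mat n n" "upper_triangular B" "similar_mat A B"
    using schur_decomposition_exists[OF A es] by auto
  from B(3) obtain P Q where w: "similar_mat_wit A B P Q" unfolding similar_mat_def by auto
  note wD = similar_mat_witD2[OF A w]
  have tr: "mtrace (A ^\<^sub>m k) = mtrace (B ^\<^sub>m k)" for k
  proof -
    have Bk: "B ^\<^sub>m k \<in> carrier_mat n n" using B by auto
    have "mtrace (A ^\<^sub>m k) = mtrace ((P * B ^\<^sub>m k) * Q)"
      using similar_mat_wit_pow_id[OF w] by simp
    also have "\<dots> = mtrace (Q * (P * B ^\<^sub>m k))"
      using wD Bk by (intro mtrace_comm[of _ n n]) auto
    also have "Q * (P * B ^\<^sub>m k) = (Q * P) * B ^\<^sub>m k"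
      using wD Bk by (intro assoc_mult_mat[symmetric]) auto
    finally show ?thesis using wD Bk by simp
  qed
  have "B ^\<^sub>m Suc l = 1\<^sub>m n"
  proof -
    have "similar_mat_wit (B ^\<^sub>m Suc l) (A ^\<^sub>m Suc l) Q P"
      by (rule similar_mat_wit_sym[OF similar_mat_wit_pow[OF w]])
    then have "B ^\<^sub>m Suc l = Q * 1\<^sub>m n * P" using assms(2) similar_mat_witD2(3) B(1)
      by (metis pow_carrier_mat)
    then show ?thesis using wD by auto
  qed
  then have b1: "(B $$ (i, i)) ^ Suc l = 1" if "i < n" for i
    using upper_triangular_pow[OF B(1,2), of "Suc l"] that by auto
  have d: "(B $$ (i, i)) ^ l = cnj (B $$ (i, i))" if "i < n" for i
  proof -
    let ?b = "B $$ (i, i)"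
    have p: "?b ^ Suc l = 1" using b1 that .
    then have "norm ?b ^ Suc l = 1" by (metis norm_one norm_power)
    then have "norm ?b = 1" by (metis norm_ge_zero power_eq_1_iff nat.distinct(1) real_norm_def abs_of_nonneg)
    then have "?b * cnj ?b = 1" by (simp add: complex_norm_square[symmetric])
    then have "?b ^ l = ?b ^ l * (?b * cnj ?b)" by (simp only: mult_1_right)
    also have "\<dots> = ?b ^ Suc l * cnj ?b" by simp
    finally show ?thesis by (simp only: p mult_1_left)
  qed
  have "mtrace (A ^\<^sub>m l) = (\<Sum>i<n. (B $$ (i, i)) ^ l)"
    using tr[of l] upper_triangular_pow[OF B(1,2), of l] B(1) by (simp add: mtrace_def)
  also have "\<dots> = cnj (\<Sum>i<n. B $$ (i, i))" using d by simp
  also have "(\<Sum>i<n. B $$ (i, i)) = mtrace A"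
    using tr[of 1] B(1) A by (simp add: mtrace_def)
  finally show ?thesis .
qed

section \<open>Complex representations and characters of a finite group\<close>

locale fin_group = group G for G :: "('g, 'x) monoid_scheme" (structure) +
  assumes fin: "finite (carrier G)"
begin

lemma card_carrier_pos: "card (carrier G) > 0"
  using fin one_closed by (auto simp: card_gt_0_iff)

lemma complex_repI:
  assumes "\<And>g. g \<in> carrier G \<Longrightarrow> \<rho> g \<in> carrier_mat m m"
    and "\<And>g h. g \<in> carrier G \<Longrightarrow> h \<in> carrier G \<Longrightarrow> \<rho> (g \<otimes> h) = \<rho> g * \<rho> h"
    and "\<rho> \<one> = 1\<^sub>m m"
  shows "complex_rep G m \<rho>"
proof -
  have "\<rho> g \<in> Units (ring_mat TYPE(complex) m ())" if "g \<in> carrier G" for g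
    unfolding Units_def
    using assms(1)[OF that] assms(1)[OF inv_closed[OF that]] assms(2)[of g "inv g"]
      assms(2)[of "inv g" g] assms(3) that
    by (auto simp: ring_mat_simps intro!: bexI[of _ "\<rho> (inv g)"])
  then show ?thesis
    unfolding complex_rep_def hom_def units_of_def
    using assms by (auto simp: ring_mat_simps)
qed

lemma complex_rep_carrier: "complex_rep G m \<rho> \<Longrightarrow> g \<in> carrier G \<Longrightarrow> \<rho> g \<in> carrier_mat m m"
  unfolding complex_rep_def hom_def units_of_def Units_def by (auto simp: ring_mat_simps)

lemma complex_rep_mult:
  "complex_rep G m \<rho> \<Longrightarrow> g \<in> carrier G \<Longrightarrow> h \<in> carrier G \<Longrightarrow> \<rho> (g \<otimes> h) = \<rho> g * \<rho> h"
  unfolding complex_rep_def hom_def units_of_def by (auto simp: ring_mat_simps)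

lemma complex_rep_one:
  assumes "complex_rep G m \<rho>"
  shows "\<rho> \<one> = 1\<^sub>m m"
proof -
  have "\<rho> \<one> \<in> Units (ring_mat TYPE(complex) m ())"
    using assms unfolding complex_rep_def hom_def units_of_def by auto
  then obtain B where B: "B \<in> carrier_mat m m" "B * \<rho> \<one> = 1\<^sub>m m"
    unfolding Units_def by (auto simp: ring_mat_simps)
  have R: "\<rho> \<one> \<in> carrier_mat m m" using complex_rep_carrier[OF assms] by simp
  have "\<rho> \<one> * \<rho> \<one> = \<rho> \<one>" using complex_rep_mult[OF assms, of \<one> \<one>] by simp
  then have "B * \<rho> \<one> = B * (\<rho> \<one> * \<rho> \<one>)" by simp
  also have "\<dots> = (B * \<rho> \<one>) * \<rho> \<one>" using B R by (intro assoc_mult_mat[symmetric]) auto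
  finally show ?thesis using B R by simp
qed

lemma complex_rep_pow:
  assumes "complex_rep G m \<rho>" "g \<in> carrier G"
  shows "\<rho> (g [^] (l::nat)) = \<rho> g ^\<^sub>m l"
  using complex_rep_carrier[OF assms]
  by (induction l) (auto simp: complex_rep_one[OF assms(1)] complex_rep_mult[OF assms(1)] assms(2))

lemma rep_character_eq_mtrace:
  "complex_rep G m \<rho> \<Longrightarrow> g \<in> carrier G \<Longrightarrow> rep_character G m \<rho> g = mtrace (\<rho> g)"
  using complex_rep_carrier by (fastforce simp: rep_character_def mtrace_def)

lemma rep_character_inv:
  assumes "complex_rep G m \<rho>" "g \<in> carrier G"
  shows "rep_character G m \<rho> (inv g) = cnj (rep_character G m \<rho> g)"
proof -
  obtain l where l: "Coset.order G = Suc l"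
    using card_carrier_pos unfolding Coset.order_def by (cases "card (carrier G)") auto
  have o: "g [^] Suc l = \<one>" using pow_order_eq_1[OF assms(2)] l by simp
  then have "g [^] l \<otimes> g = \<one>" by simp
  then have "inv g = g [^] l" using assms(2) by (metis inv_equality nat_pow_closed)
  moreover have "\<rho> g ^\<^sub>m Suc l = 1\<^sub>m m"
    using complex_rep_pow[OF assms, of "Suc l"] o complex_rep_one[OF assms(1)] by metis
  ultimately show ?thesis
    using mtrace_finite_order[OF complex_rep_carrier[OF assms]] complex_rep_pow[OF assms]
      rep_character_eq_mtrace[OF assms(1)] assms(2) by simp
qed

subsection \<open>Schur's lemma\<close>

text \<open>The kernel of an intertwiner is invariant; once it contains a nonzero vector,
  irreducibility makes it everything.\<close>

lemma intertwiner_kernel: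
  assumes "irreducible_rep G k \<sigma>" "complex_rep G m \<rho>" "T \<in> carrier_mat m k"
    and comm: "\<And>g. g \<in> carrier G \<Longrightarrow> \<rho> g * T = T * \<sigma> g"
    and u: "u \<in> carrier_vec k" "u \<noteq> 0\<^sub>v k" "T *\<^sub>v u = 0\<^sub>v m"
  shows "T = 0\<^sub>m m k"
proof -
  have cs: "complex_rep G k \<sigma>" using assms(1) by (simp add: irreducible_rep_def)
  let ?K = "{v \<in> carrier_vec k. T *\<^sub>v v = 0\<^sub>v m}"
  have "invariant_subspace G k \<sigma> ?K"
    unfolding invariant_subspace_def
  proof (intro conjI ballI allI)
    fix g v assume g: "g \<in> carrier G" and v: "v \<in> ?K"
    have S: "\<sigma> g \<in> carrier_mat k k" "\<rho> g \<in> carrier_mat m m"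
      using complex_rep_carrier cs assms(2) g by auto
    have "T *\<^sub>v (\<sigma> g *\<^sub>v v) = (T * \<sigma> g) *\<^sub>v v" using assms(3) S v by auto
    also have "\<dots> = \<rho> g *\<^sub>v (T *\<^sub>v v)" using assms(3) S v comm[OF g, symmetric] by auto
    also have "\<dots> = 0\<^sub>v m" using v S by auto
    finally show "\<sigma> g *\<^sub>v v \<in> ?K" using S v by auto
  qed (use assms(3) in \<open>auto simp: mult_add_distrib_mat_vec[of T m k] mult_mat_vec[of T m k]\<close>)
  with assms(1) u have "?K = carrier_vec k" unfolding irreducible_rep_def by blast
  then have K: "T *\<^sub>v v = 0\<^sub>v m" if "v \<in> carrier_vec k" for v using that by blast
  show ?thesis
  proof (rule eq_matI)
    fix i j assume ij: "i < dim_row (0\<^sub>m m k)" "j < dim_col (0\<^sub>m m k)"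
    then have "T $$ (i, j) = (T *\<^sub>v unit_vec k j) $ i" using assms(3) by auto
    then show "T $$ (i, j) = 0\<^sub>m m k $$ (i, j)" using K[of "unit_vec k j"] ij by auto
  qed (use assms(3) in auto)
qed

text \<open>Dually, the image of an intertwiner is invariant, and it is not zero.\<close>

lemma intertwiner_surj:
  assumes "irreducible_rep G m \<rho>" "complex_rep G k \<sigma>" "T \<in> carrier_mat m k"
    and comm: "\<And>g. g \<in> carrier G \<Longrightarrow> \<rho> g * T = T * \<sigma> g"
    and "T \<noteq> 0\<^sub>m m k" and w: "w \<in> carrier_vec m"
  shows "\<exists>v\<in>carrier_vec k. T *\<^sub>v v = w"
proof -
  have cr: "complex_rep G m \<rho>" using assms(1) by (simp add: irreducible_rep_def)
  let ?W = "(\<lambda>v. T *\<^sub>v v) ` carrier_vec k"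
  have "invariant_subspace G m \<rho> ?W"
    unfolding invariant_subspace_def
  proof (intro conjI ballI allI)
    show "0\<^sub>v m \<in> ?W" using assms(3) by (intro image_eqI[of _ _ "0\<^sub>v k"]) auto
  next
    fix g v assume g: "g \<in> carrier G" and v: "v \<in> ?W"
    then obtain u where u: "u \<in> carrier_vec k" "v = T *\<^sub>v u" by auto
    have S: "\<sigma> g \<in> carrier_mat k k" "\<rho> g \<in> carrier_mat m m"
      using complex_rep_carrier cr assms(2) g by auto
    have "\<rho> g *\<^sub>v v = (\<rho> g * T) *\<^sub>v u" using assms(3) S u by auto
    also have "\<dots> = T *\<^sub>v (\<sigma> g *\<^sub>v u)" using assms(3) S u comm[OF g] by auto
    finally show "\<rho> g *\<^sub>v v \<in> ?W" using S u by auto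
  next
    fix v w assume "v \<in> ?W" "w \<in> ?W"
    then show "v + w \<in> ?W" using assms(3)
      by (auto simp: mult_add_distrib_mat_vec[of T m k, symmetric])
  next
    fix v c assume "v \<in> ?W"
    then show "c \<cdot>\<^sub>v v \<in> ?W" using assms(3)
      by (auto simp: mult_mat_vec[of T m k, symmetric])
  qed (use assms(3) in auto)
  moreover have "?W \<noteq> {0\<^sub>v m}"
  proof
    assume W: "?W = {0\<^sub>v m}"
    have "T = 0\<^sub>m m k"
    proof (rule eq_matI)
      fix i j assume ij: "i < dim_row (0\<^sub>m m k)" "j < dim_col (0\<^sub>m m k)"
      then have "T $$ (i, j) = (T *\<^sub>v unit_vec k j) $ i" using assms(3) by auto
      moreover have "T *\<^sub>v unit_vec k j = 0\<^sub>v m" using W by auto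
      ultimately show "T $$ (i, j) = 0\<^sub>m m k $$ (i, j)" using ij by auto
    qed (use assms(3) in auto)
    with assms(5) show False by simp
  qed
  ultimately have "?W = carrier_vec m" using assms(1) unfolding irreducible_rep_def by blast
  with w show ?thesis by (metis (no_types, lifting) image_iff)
qed

text \<open>A nonzero intertwiner between irreducible representations is invertible, so the two are
  conjugate and have equal traces.\<close>

lemma intertwiner_character_eq:
  assumes "irreducible_rep G m \<rho>" "irreducible_rep G k \<sigma>" "T \<in> carrier_mat m k"
    and comm: "\<And>g. g \<in> carrier G \<Longrightarrow> \<rho> g * T = T * \<sigma> g"
    and "T \<noteq> 0\<^sub>m m k"
  shows "rep_character G m \<rho> = rep_character G k \<sigma>"
proof -
  have c: "complex_rep G m \<rho>" "complex_rep G k \<sigma>" using assms by (auto simp: irreducible_rep_def)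
  have "\<exists>v. v \<in> carrier_vec k \<and> T *\<^sub>v v = unit_vec m j" for j
    using intertwiner_surj[OF assms(1) c(2) assms(3) comm assms(5)] by (metis unit_vec_carrier)
  then obtain s where s: "\<And>j. s j \<in> carrier_vec k" "\<And>j. T *\<^sub>v s j = unit_vec m j" by metis
  \<comment> \<open>The columns of \<open>S\<close> are preimages of the unit vectors, which makes
    \<open>S\<close> a right inverse of \<open>T\<close>.\<close>
  define S where "S = mat k m (\<lambda>(i, j). s j $ i)"
  have S: "S \<in> carrier_mat k m" by (simp add: S_def)
  have "col S j = s j" if "j < m" for j using that s(1)[of j] by (auto simp: S_def)
  then have TS: "T * S = 1\<^sub>m m"
    using S assms(3) s(2) by (intro mat_col_eqI) (auto simp: col_mult2[of T m k S m])
  \<comment> \<open>\<open>T\<close> kills every column of \<open>S * T - 1\<close>, so a nonzero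
    column would force \<open>T\<close> to vanish.\<close>
  have ST: "S * T = 1\<^sub>m k"
  proof -
    define X where "X = S * T - 1\<^sub>m k"
    have X: "X \<in> carrier_mat k k" unfolding X_def by (rule minus_carrier_mat) simp
    have "T * X = T * (S * T) - T * 1\<^sub>m k"
      unfolding X_def using S assms(3) by (intro mult_minus_distrib_mat) auto
    also have "T * (S * T) = T" using S assms(3) TS assoc_mult_mat[of T m k S m T k] by simp
    finally have TX: "T * X = 0\<^sub>m m k" using assms(3) by auto
    have "col X j = 0\<^sub>v k" if "j < k" for j
    proof (rule ccontr)
      assume "col X j \<noteq> 0\<^sub>v k"
      moreover have "T *\<^sub>v col X j = 0\<^sub>v m"
        using col_mult2[OF assms(3) X that] TX that by auto
      ultimately show False
        using intertwiner_kernel[OF assms(2) c(1) assms(3) comm, of "col X j"] X assms(5) that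
          col_carrier_vec[OF that X] by blast
    qed
    then have "X = 0\<^sub>m k k" using X by (intro mat_col_eqI) auto
    then show ?thesis
      using S assms(3) unfolding X_def by (auto simp: mat_eq_iff)
  qed
  show ?thesis
  proof
    fix g
    show "rep_character G m \<rho> g = rep_character G k \<sigma> g"
    proof (cases "g \<in> carrier G")
      case True
      have R: "\<rho> g \<in> carrier_mat m m" "\<sigma> g \<in> carrier_mat k k"
        using complex_rep_carrier c True by auto
      have "mtrace (\<rho> g) = mtrace ((\<rho> g * T) * S)"
        using R S assms(3) TS assoc_mult_mat[of "\<rho> g" m m T k S m] by simp
      also have "\<dots> = mtrace (S * (T * \<sigma> g))"
        using R S assms(3) comm[OF True] by (subst mtrace_comm[of _ m k]) auto
      also have "S * (T * \<sigma> g) = \<sigma> g"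
        using R S assms(3) ST assoc_mult_mat[of S k m T k "\<sigma> g" k] by simp
      finally show ?thesis using rep_character_eq_mtrace c True by simp
    qed (simp add: rep_character_def)
  qed
qed

text \<open>Subtracting an eigenvalue from \<open>T\<close> leaves an intertwiner with nonzero
  kernel, which must vanish.\<close>

lemma intertwiner_scalar:
  assumes "irreducible_rep G m \<rho>" "T \<in> carrier_mat m m"
    and comm: "\<And>g. g \<in> carrier G \<Longrightarrow> \<rho> g * T = T * \<rho> g"
  shows "\<exists>c. T = c \<cdot>\<^sub>m 1\<^sub>m m"
proof -
  have c: "complex_rep G m \<rho>" "m > 0" using assms by (auto simp: irreducible_rep_def)
  obtain e where "e \<in> spectrum T" using spectrum_non_empty[OF assms(2) c(2)] by auto
  then obtain v where v: "v \<in> carrier_vec m" "v \<noteq> 0\<^sub>v m" "T *\<^sub>v v = e \<cdot>\<^sub>v v"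
    using assms(2) by (auto simp: spectrum_def eigenvalue_def eigenvector_def)
  let ?X = "T - e \<cdot>\<^sub>m 1\<^sub>m m"
  have X: "?X \<in> carrier_mat m m" using assms(2) by auto
  have "?X *\<^sub>v v = T *\<^sub>v v - (e \<cdot>\<^sub>m 1\<^sub>m m) *\<^sub>v v"
    using v assms(2) by (intro minus_mult_distrib_mat_vec) auto
  also have "(e \<cdot>\<^sub>m 1\<^sub>m m) *\<^sub>v v = e \<cdot>\<^sub>v v" using v(1) by auto
  finally have Xv: "?X *\<^sub>v v = 0\<^sub>v m" using v by auto
  have "\<rho> g * ?X = ?X * \<rho> g" if "g \<in> carrier G" for g
  proof -
    have R: "\<rho> g \<in> carrier_mat m m" using complex_rep_carrier c that by auto
    have "\<rho> g * ?X = \<rho> g * T - \<rho> g * (e \<cdot>\<^sub>m 1\<^sub>m m)"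
      using R assms(2) by (intro mult_minus_distrib_mat) auto
    moreover have "?X * \<rho> g = T * \<rho> g - (e \<cdot>\<^sub>m 1\<^sub>m m) * \<rho> g"
      using R assms(2) by (intro minus_mult_distrib_mat) auto
    ultimately show ?thesis using R comm[OF that] by (simp add: mult_smult_distrib[of _ m m _ m] mult_smult_assoc_mat[of _ m m _ m])
  qed
  from intertwiner_kernel[OF assms(1) c(1) X this v(1,2) Xv] have "?X = 0\<^sub>m m m" .
  then show ?thesis using assms(2) by (intro exI[of _ e]) (auto simp: mat_eq_iff)
qed

text \<open>The sum of \<open>\<rho> g * E * \<sigma> (inv g)\<close> over the group, where
  \<open>E\<close> is the matrix unit with entry one at \<open>(a, b)\<close>.\<close>

definition avg_intertwiner ::
    "nat \<Rightarrow> nat \<Rightarrow> ('g \<Rightarrow> complex mat) \<Rightarrow> ('g \<Rightarrow> complex mat) \<Rightarrow> nat \<Rightarrow> nat \<Rightarrow> complex mat" where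
  "avg_intertwiner m k \<rho> \<sigma> a b =
     mat m k (\<lambda>(i, j). \<Sum>g\<in>carrier G. \<rho> g $$ (i, a) * \<sigma> (inv g) $$ (b, j))"

lemma sum_carrier_left:
  assumes "h \<in> carrier G"
  shows "(\<Sum>g\<in>carrier G. f (h \<otimes> g)) = (\<Sum>g\<in>carrier G. f g)"
  by (rule sum.reindex_bij_witness[of _ "\<lambda>g. inv h \<otimes> g" "\<lambda>g. h \<otimes> g"])
    (use assms in \<open>auto simp: m_assoc[symmetric]\<close>)

lemma avg_intertwiner_comm:
  assumes "complex_rep G m \<rho>" "complex_rep G k \<sigma>" "a < m" "b < k" "h \<in> carrier G"
  shows "\<rho> h * avg_intertwiner m k \<rho> \<sigma> a b = avg_intertwiner m k \<rho> \<sigma> a b * \<sigma> h"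
proof (rule eq_matI)
  have T: "avg_intertwiner m k \<rho> \<sigma> a b \<in> carrier_mat m k" by (simp add: avg_intertwiner_def)
  have R: "\<rho> g \<in> carrier_mat m m" "\<sigma> g \<in> carrier_mat k k" if "g \<in> carrier G" for g
    using complex_rep_carrier assms that by auto
  fix i j assume "i < dim_row (avg_intertwiner m k \<rho> \<sigma> a b * \<sigma> h)"
    "j < dim_col (avg_intertwiner m k \<rho> \<sigma> a b * \<sigma> h)"
  then have ij: "i < m" "j < k" using T R assms by auto
  have "(\<rho> h * avg_intertwiner m k \<rho> \<sigma> a b) $$ (i, j)
      = (\<Sum>l<m. \<rho> h $$ (i, l) * (\<Sum>g\<in>carrier G. \<rho> g $$ (l, a) * \<sigma> (inv g) $$ (b, j)))"
    using mat_mult_entry[OF R(1)[OF assms(5)] T ij] ij by (simp add: avg_intertwiner_def)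
  also have "\<dots> = (\<Sum>g\<in>carrier G. (\<Sum>l<m. \<rho> h $$ (i, l) * \<rho> g $$ (l, a)) * \<sigma> (inv g) $$ (b, j))"
    unfolding sum_distrib_left sum_distrib_right by (subst sum.swap) (simp add: mult_ac)
  also have "\<dots> = (\<Sum>g\<in>carrier G. \<rho> (h \<otimes> g) $$ (i, a) * \<sigma> (inv g) $$ (b, j))"
    using assms ij by (intro sum.cong refl)
      (simp add: complex_rep_mult[OF assms(1)] mat_mult_entry[OF R(1) R(1)])
  also have "\<dots> = (\<Sum>g\<in>carrier G. \<rho> (h \<otimes> g) $$ (i, a) * \<sigma> (inv (h \<otimes> g) \<otimes> h) $$ (b, j))"
    using assms(5) by (intro sum.cong refl) (simp add: inv_mult_group m_assoc)
  also have "\<dots> = (\<Sum>g\<in>carrier G. \<rho> g $$ (i, a) * \<sigma> (inv g \<otimes> h) $$ (b, j))"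
    by (rule sum_carrier_left[OF assms(5)])
  also have "\<dots> = (\<Sum>g\<in>carrier G. \<rho> g $$ (i, a) * (\<Sum>l<k. \<sigma> (inv g) $$ (b, l) * \<sigma> h $$ (l, j)))"
    using assms ij by (intro sum.cong refl)
      (simp add: complex_rep_mult[OF assms(2)] mat_mult_entry[OF R(2) R(2)])
  also have "\<dots> = (\<Sum>l<k. (\<Sum>g\<in>carrier G. \<rho> g $$ (i, a) * \<sigma> (inv g) $$ (b, l)) * \<sigma> h $$ (l, j))"
    unfolding sum_distrib_left sum_distrib_right by (subst sum.swap) (simp add: mult_ac)
  also have "\<dots> = (avg_intertwiner m k \<rho> \<sigma> a b * \<sigma> h) $$ (i, j)"
    using mat_mult_entry[OF T R(2)[OF assms(5)] ij] ij by (simp add: avg_intertwiner_def)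
  finally show "(\<rho> h * avg_intertwiner m k \<rho> \<sigma> a b) $$ (i, j)
      = (avg_intertwiner m k \<rho> \<sigma> a b * \<sigma> h) $$ (i, j)" .
qed (use complex_rep_carrier[OF assms(1,5)] complex_rep_carrier[OF assms(2,5)] in
    \<open>auto simp: avg_intertwiner_def\<close>)

text \<open>The conjugate of a character value is the value at the inverse. Expanding both traces,
  the diagonal positions \<open>i\<close> and \<open>j\<close> contribute the entry
  \<open>(i, j)\<close> of the intertwiner made from the matrix unit at
  \<open>(i, j)\<close>.\<close>

lemma char_inner_irreducible_reps:
  assumes "irreducible_rep G m \<rho>" "irreducible_rep G k \<sigma>"
  shows "(\<Sum>g\<in>carrier G. rep_character G m \<rho> g * cnj (rep_character G k \<sigma> g))
       = (\<Sum>i<m. \<Sum>j<k. avg_intertwiner m k \<rho> \<sigma> i j $$ (i, j))"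
proof -
  have c: "complex_rep G m \<rho>" "complex_rep G k \<sigma>" using assms by (auto simp: irreducible_rep_def)
  have "(\<Sum>g\<in>carrier G. rep_character G m \<rho> g * cnj (rep_character G k \<sigma> g))
      = (\<Sum>g\<in>carrier G. (\<Sum>i<m. \<rho> g $$ (i, i)) * (\<Sum>j<k. \<sigma> (inv g) $$ (j, j)))"
    by (intro sum.cong refl) (simp add: rep_character_inv[OF c(2), symmetric], simp add: rep_character_def)
  also have "\<dots> = (\<Sum>i<m. \<Sum>j<k. \<Sum>g\<in>carrier G. \<rho> g $$ (i, i) * \<sigma> (inv g) $$ (j, j))"
    unfolding sum_product by (subst sum.swap, rule sum.cong[OF refl], rule sum.swap)
  finally show ?thesis by (simp add: avg_intertwiner_def)
qed

theorem irr_characters_orthonormal: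
  assumes "\<chi> \<in> irr_characters G" "\<psi> \<in> irr_characters G"
  shows "char_inner_on G (carrier G) \<chi> \<psi> = (if \<chi> = \<psi> then 1 else 0)"
proof (cases "\<chi> = \<psi>")
  case False
  from assms obtain m \<rho> k \<sigma> where r: "irreducible_rep G m \<rho>" "irreducible_rep G k \<sigma>"
    "\<chi> = rep_character G m \<rho>" "\<psi> = rep_character G k \<sigma>"
    by (auto simp: irr_characters_def)
  then have c: "complex_rep G m \<rho>" "complex_rep G k \<sigma>" by (auto simp: irreducible_rep_def)
  have "avg_intertwiner m k \<rho> \<sigma> i j = 0\<^sub>m m k" if "i < m" "j < k" for i j
  proof (rule ccontr)
    assume "avg_intertwiner m k \<rho> \<sigma> i j \<noteq> 0\<^sub>m m k"
    from intertwiner_character_eq[OF r(1,2) _ avg_intertwiner_comm[OF c that] this]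
    have "\<chi> = \<psi>" using r by (simp add: avg_intertwiner_def)
    with False show False ..
  qed
  then have "(\<Sum>i<m. \<Sum>j<k. avg_intertwiner m k \<rho> \<sigma> i j $$ (i, j)) = 0" by simp
  then show ?thesis using char_inner_irreducible_reps[OF r(1,2)] False r by (simp add: char_inner_on_def)
next
  case True
  from assms obtain m \<rho> where r: "irreducible_rep G m \<rho>" "\<chi> = rep_character G m \<rho>"
    by (auto simp: irr_characters_def)
  then have c: "complex_rep G m \<rho>" "m > 0" by (auto simp: irreducible_rep_def)
  let ?n = "of_nat (card (carrier G)) :: complex"
  have T: "avg_intertwiner m m \<rho> \<rho> a b $$ (i, j) = (if i = j \<and> a = b then ?n / of_nat m else 0)"
    if ab: "a < m" "b < m" and ij: "i < m" "j < m" for a b i j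
  proof -
    let ?T = "avg_intertwiner m m \<rho> \<rho> a b"
    have "?T \<in> carrier_mat m m" by (simp add: avg_intertwiner_def)
    then obtain x where x: "?T = x \<cdot>\<^sub>m 1\<^sub>m m"
      using intertwiner_scalar[OF r(1) _ avg_intertwiner_comm[OF c(1,1) ab]] by auto
    have R: "\<rho> g \<in> carrier_mat m m" if "g \<in> carrier G" for g
      using complex_rep_carrier c that by auto
    \<comment> \<open>The scalar is found from the trace: summing over the diagonal collapses
      \<open>\<rho> (inv g) * \<rho> g\<close> to the identity matrix.\<close>
    have "of_nat m * x = (\<Sum>l<m. ?T $$ (l, l))" by (simp add: x)
    also have "\<dots> = (\<Sum>g\<in>carrier G. \<Sum>l<m. \<rho> (inv g) $$ (b, l) * \<rho> g $$ (l, a))"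
      by (simp add: avg_intertwiner_def) (subst sum.swap, simp add: mult.commute)
    also have "\<dots> = (\<Sum>g\<in>carrier G. \<rho> (inv g \<otimes> g) $$ (b, a))"
    proof (intro sum.cong refl)
      fix g assume g: "g \<in> carrier G"
      show "(\<Sum>l<m. \<rho> (inv g) $$ (b, l) * \<rho> g $$ (l, a)) = \<rho> (inv g \<otimes> g) $$ (b, a)"
        unfolding complex_rep_mult[OF c(1) inv_closed[OF g] g]
        using mat_mult_entry[OF R[OF inv_closed[OF g]] R[OF g]] ab by simp
    qed
    also have "\<dots> = (if a = b then ?n else 0)"
      using ab by (simp add: complex_rep_one[OF c(1)])
    finally have "x = (if a = b then ?n / of_nat m else 0)" using c(2) by (auto simp: field_simps)
    then show ?thesis using ij by (simp add: x)
  qed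
  have "(\<Sum>i<m. \<Sum>j<m. avg_intertwiner m m \<rho> \<rho> i j $$ (i, j))
      = (\<Sum>i<m. \<Sum>j<m. if i = j then ?n / of_nat m else 0)"
    by (intro sum.cong refl) (simp add: T)
  also have "\<dots> = ?n" using c(2) by simp
  finally show ?thesis
    using char_inner_irreducible_reps[OF r(1,1)] True r card_carrier_pos by (simp add: char_inner_on_def)
qed


subsection \<open>Decomposition into irreducible characters\<close>

definition is_character :: "('g \<Rightarrow> complex) \<Rightarrow> bool" where
  "is_character \<theta> \<longleftrightarrow> (\<exists>m \<rho>. complex_rep G m \<rho> \<and> \<theta> = rep_character G m \<rho>)"

text \<open>Matrices indexed by an arbitrary finite set: permutation representations are indexed by
  points, diagonal blocks by subsets of the coordinates.\<close>

lemma is_character_of_kernel: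
  fixes R :: "'g \<Rightarrow> 'i \<Rightarrow> 'i \<Rightarrow> complex"
  assumes I: "finite I"
    and mult: "\<And>g h i j. g \<in> carrier G \<Longrightarrow> h \<in> carrier G \<Longrightarrow> i \<in> I \<Longrightarrow> j \<in> I \<Longrightarrow>
       R (g \<otimes> h) i j = (\<Sum>l\<in>I. R g i l * R h l j)"
    and one: "\<And>i j. i \<in> I \<Longrightarrow> j \<in> I \<Longrightarrow> R \<one> i j = (if i = j then 1 else 0)"
  shows "\<exists>\<rho>. complex_rep G (card I) \<rho> \<and>
    rep_character G (card I) \<rho> = (\<lambda>g. if g \<in> carrier G then \<Sum>i\<in>I. R g i i else 0)"
proof -
  obtain f where f: "bij_betw f {..<card I} I"
    using I by (metis atLeast0LessThan ex_bij_betw_nat_finite)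
  then have fI: "f a \<in> I" if "a < card I" for a using that by (auto simp: bij_betw_def)
  have inj: "f a = f b \<longleftrightarrow> a = b" if "a < card I" "b < card I" for a b
    using f that by (auto simp: bij_betw_def inj_on_def)
  define \<rho> where "\<rho> g = mat (card I) (card I) (\<lambda>(a, b). R g (f a) (f b))" for g
  have "complex_rep G (card I) \<rho>"
  proof (rule complex_repI)
    fix g h assume gh: "g \<in> carrier G" "h \<in> carrier G"
    show "\<rho> (g \<otimes> h) = \<rho> g * \<rho> h"
    proof (rule eq_matI)
      fix a b assume "a < dim_row (\<rho> g * \<rho> h)" "b < dim_col (\<rho> g * \<rho> h)"
      then have ab: "a < card I" "b < card I" by (auto simp: \<rho>_def)
      have "(\<rho> g * \<rho> h) $$ (a, b) = (\<Sum>l<card I. R g (f a) (f l) * R h (f l) (f b))"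
        by (subst mat_mult_entry[of _ "card I" "card I" _ "card I"]) (auto simp: \<rho>_def ab)
      also have "\<dots> = (\<Sum>l\<in>I. R g (f a) l * R h l (f b))"
        by (rule sum.reindex_bij_betw[OF f])
      finally show "\<rho> (g \<otimes> h) $$ (a, b) = (\<rho> g * \<rho> h) $$ (a, b)"
        using ab gh fI by (simp add: \<rho>_def mult)
    qed (auto simp: \<rho>_def)
  qed (auto simp: \<rho>_def one fI inj)
  moreover have "rep_character G (card I) \<rho> g = (if g \<in> carrier G then \<Sum>i\<in>I. R g i i else 0)" for g
    using sum.reindex_bij_betw[OF f, of "\<lambda>i. R g i i"] by (simp add: rep_character_def \<rho>_def)
  ultimately show ?thesis by blast
qed

end

section \<open>Multiplicities and coordinates\<close>

lemma sum_list_eq_sum_count_list: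
  fixes f :: "'b \<Rightarrow> complex"
  shows "(\<Sum>x\<leftarrow>L. f x) = (\<Sum>x\<in>set L. of_nat (count_list L x) * f x)"
proof -
  have "(\<Sum>x\<leftarrow>L. f x) = (\<Sum>x\<in>S. of_nat (count_list L x) * f x)" if "finite S" "set L \<subseteq> S" for S
    using that
  proof (induction L)
    case (Cons a L)
    have "(\<Sum>x\<in>S. of_nat (count_list (a # L) x) * f x)
        = (\<Sum>x\<in>S. of_nat (count_list L x) * f x + (if x = a then f a else 0))"
      by (intro sum.cong) (auto simp: algebra_simps)
    with Cons show ?case by (simp add: sum.distrib)
  qed simp
  then show ?thesis by simp
qed

lemma mat_unit_vec_col: "dim_col A = m \<Longrightarrow> j < m \<Longrightarrow> A *\<^sub>v unit_vec m j = col (A :: complex mat) j"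
  by (rule eq_vecI) (auto simp: scalar_prod_right_unit)

lemma mult_mat_vec_zero: "P \<in> carrier_mat n m \<Longrightarrow> P *\<^sub>v 0\<^sub>v m = (0\<^sub>v n :: complex vec)"
  by auto

lemma invertible_matE:
  assumes "P \<in> carrier_mat m m" "det P \<noteq> (0 :: complex)"
  obtains Q where "Q \<in> carrier_mat m m" "P * Q = 1\<^sub>m m" "Q * P = 1\<^sub>m m"
  using det_non_zero_imp_unit[OF assms, of "()"] by (auto simp: Units_def ring_mat_simps)

text \<open>Every subspace is a coordinate subspace with respect to a suitable basis, the columns of
  \<open>P\<close>; the basis is found by an exchange argument.\<close>
lemma subspace_coordinates:
  fixes W :: "complex vec set"
  assumes W: "W \<subseteq> carrier_vec m" "0\<^sub>v m \<in> W" "\<And>v w. v \<in> W \<Longrightarrow> w \<in> W \<Longrightarrow> v + w \<in> W"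
    "\<And>c v. v \<in> W \<Longrightarrow> c \<cdot>\<^sub>v v \<in> W"
  obtains P Q I where "P \<in> carrier_mat m m" "Q \<in> carrier_mat m m" "P * Q = 1\<^sub>m m" "Q * P = 1\<^sub>m m"
    "I \<subseteq> {..<m}" "W = {v \<in> carrier_vec m. \<forall>i<m. i \<notin> I \<longrightarrow> (Q *\<^sub>v v) $ i = 0}"
proof -
  \<comment> \<open>Pairs of an invertible matrix and a set of its columns lying in
    \<open>W\<close>; for a largest such set, these columns will turn out to span
    \<open>W\<close>.\<close>
  define ok where "ok = (\<lambda>(P :: complex mat, I). P \<in> carrier_mat m m \<and> det P \<noteq> 0 \<and> I \<subseteq> {..<m} \<and>
    (\<forall>i\<in>I. col P i \<in> W))"
  have "ok (1\<^sub>m m, {})" by (simp add: ok_def)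
  moreover have "card (snd x) < Suc m" if "ok x" for x
    using that card_mono[of "{..<m}" "snd x"] by (auto simp: ok_def split: prod.splits)
  ultimately obtain PI where "ok PI" and mx: "\<And>y. ok y \<Longrightarrow> card (snd y) \<le> card (snd PI)"
    using ex_has_greatest_nat[of ok "(1\<^sub>m m, {})" "\<lambda>x. card (snd x)" "Suc m"] by (metis less_imp_le)
  obtain P I where eq: "PI = (P, I)" by (cases PI)
  have PI: "P \<in> carrier_mat m m" "det P \<noteq> 0" "I \<subseteq> {..<m}" "\<And>i. i \<in> I \<Longrightarrow> col P i \<in> W"
    using \<open>ok PI\<close> by (auto simp: ok_def eq)
  have mx: "\<And>y. ok y \<Longrightarrow> card (snd y) \<le> card I" using mx by (simp add: eq)
  obtain Q where Q: "Q \<in> carrier_mat m m" "P * Q = 1\<^sub>m m" "Q * P = 1\<^sub>m m"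
    by (rule invertible_matE[OF PI(1,2)]) (rule that; assumption)
  have finI: "finite I" using PI(3) by (rule finite_subset) simp
  have 1: "(Q *\<^sub>v w) $ j = 0" if w: "w \<in> W" and j: "j < m" "j \<notin> I" for w j
  proof (rule ccontr)
    assume nz: "(Q *\<^sub>v w) $ j \<noteq> 0"
    define x where "x = Q *\<^sub>v w"
    have wc: "w \<in> carrier_vec m" using w W by auto
    then have x: "x \<in> carrier_vec m" using Q by (auto simp: x_def)
    have Px: "P *\<^sub>v x = w"
      using PI(1) Q wc unfolding x_def by (metis assoc_mult_mat_vec one_mult_mat_vec)
    \<comment> \<open>\<open>P * E\<close> is \<open>P\<close> with column \<open>j\<close> replaced
      by \<open>w\<close>. It is invertible because the coordinate of \<open>w\<close> at
      \<open>j\<close> is nonzero, and it has one more column in \<open>W\<close>.\<close>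
    define E where "E = mat m m (\<lambda>(i, l). if l = j then x $ i else if i = l then 1 else (0::complex))"
    have E: "E \<in> carrier_mat m m" by (simp add: E_def)
    have "det E \<noteq> 0"
    proof
      assume "det E = 0"
      then obtain z where z: "z \<in> carrier_vec m" "z \<noteq> 0\<^sub>v m" "E *\<^sub>v z = 0\<^sub>v m"
        using det_0_iff_vec_prod_zero[OF E] by auto
      have Ez: "(E *\<^sub>v z) $ i = x $ i * z $ j + (if i = j then 0 else z $ i)" if "i < m" for i
      proof -
        have "(E *\<^sub>v z) $ i = (\<Sum>l<m. (if l = j then x $ i else if i = l then 1 else 0) * z $ l)"
          using that z(1) by (auto simp: E_def scalar_prod_def atLeast0LessThan)
        also have "\<dots> = (\<Sum>l\<in>{..<m} - {j}. (if i = l then 1 else 0) * z $ l) + x $ i * z $ j"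
          using j by (subst sum.remove[of _ j]) (auto intro!: sum.cong)
        also have "(\<Sum>l\<in>{..<m} - {j}. (if i = l then 1 else 0) * z $ l) = (if i = j then 0 else z $ i)"
          using that by (auto simp: if_distrib[of "\<lambda>c. c * _"] sum.delta' cong: if_cong)
        finally show ?thesis by simp
      qed
      have zj: "z $ j = 0" using Ez[OF j(1)] z(3) nz j by (simp add: x_def)
      have "z $ i = 0" if "i < m" for i
        using Ez[OF that] z(3) zj that by (cases "i = j") auto
      then have "z = 0\<^sub>v m" using z(1) by (intro eq_vecI) auto
      with z(2) show False ..
    qed
    have cE: "col E l = (if l = j then x else unit_vec m l)" if "l < m" for l
      using that x j by (intro eq_vecI) (auto simp: E_def)
    have "ok (P * E, insert j I)"
      unfolding ok_def prod.case
    proof (intro conjI ballI)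
      show "det (P * E) \<noteq> 0" using det_mult[OF PI(1) E] PI(2) \<open>det E \<noteq> 0\<close> by simp
      fix l assume l: "l \<in> insert j I"
      then have lm: "l < m" using PI(3) j by auto
      have "col (P * E) l = P *\<^sub>v col E l" by (rule col_mult2[OF PI(1) E lm])
      also have "\<dots> = (if l = j then w else col P l)"
        using cE[OF lm] Px PI(1) lm by (auto simp: mat_unit_vec_col)
      finally show "col (P * E) l \<in> W" using l w PI(4) by auto
    qed (use PI E j in auto)
    from mx[OF this] finI j show False by simp
  qed
  have 2: "v \<in> W" if v: "v \<in> carrier_vec m" "\<And>i. i < m \<Longrightarrow> i \<notin> I \<Longrightarrow> (Q *\<^sub>v v) $ i = 0" for v
  proof -
    define x where "x = Q *\<^sub>v v"
    have x: "x \<in> carrier_vec m" using Q v by (auto simp: x_def)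
    have Px: "P *\<^sub>v x = v"
      using PI(1) Q v(1) unfolding x_def by (metis assoc_mult_mat_vec one_mult_mat_vec)
    have "P *\<^sub>v vec m (\<lambda>i. if i \<in> J then x $ i else 0) \<in> W" if "finite J" "J \<subseteq> I" for J
      using that
    proof (induction J rule: finite_induct)
      case empty
      have "vec m (\<lambda>i. if i \<in> {} then x $ i else 0) = 0\<^sub>v m" by auto
      then show ?case using W(2) mult_mat_vec_zero[OF PI(1)] by (simp only:)
    next
      case (insert i J)
      have i: "i < m" using insert PI(3) by auto
      have "vec m (\<lambda>l. if l \<in> insert i J then x $ l else 0)
          = vec m (\<lambda>l. if l \<in> J then x $ l else 0) + x $ i \<cdot>\<^sub>v unit_vec m i"
        using insert i by (intro eq_vecI) auto
      then have "P *\<^sub>v vec m (\<lambda>l. if l \<in> insert i J then x $ l else 0)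
          = P *\<^sub>v vec m (\<lambda>l. if l \<in> J then x $ l else 0) + x $ i \<cdot>\<^sub>v col P i"
        using PI(1) i by (simp add: mult_add_distrib_mat_vec[of _ m m] mult_mat_vec[of _ m m] mat_unit_vec_col)
      then show ?case using insert W PI(4) by auto
    qed
    from this[OF finI subset_refl]
    have "P *\<^sub>v vec m (\<lambda>i. if i \<in> I then x $ i else 0) \<in> W" .
    moreover have "vec m (\<lambda>i. if i \<in> I then x $ i else 0) = x"
      using x v(2)[folded x_def] by (intro eq_vecI) auto
    ultimately show ?thesis using Px by simp
  qed
  have "W = {v \<in> carrier_vec m. \<forall>i<m. i \<notin> I \<longrightarrow> (Q *\<^sub>v v) $ i = 0}"
    using 1 2 W by blast
  with that PI(1,3) Q show thesis by blast
qed

definition fix_count :: "('g \<Rightarrow> 'e \<Rightarrow> 'e) \<Rightarrow> 'e set \<Rightarrow> 'g \<Rightarrow> nat" where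
  "fix_count act X g = card {x \<in> X. act g x = x}"

context fin_group
begin

text \<open>In coordinates adapted to \<open>W\<close> the matrices are block triangular. The
  diagonal blocks are the representations on \<open>W\<close> and on the quotient, and the traces
  add up.\<close>

lemma rep_character_split:
  assumes \<rho>: "complex_rep G m \<rho>" and W: "invariant_subspace G m \<rho> W" "W \<noteq> {0\<^sub>v m}" "W \<noteq> carrier_vec m"
  obtains k \<sigma> l \<tau> where "complex_rep G k \<sigma>" "k < m" "complex_rep G l \<tau>" "l < m"
    "\<And>g. rep_character G m \<rho> g = rep_character G k \<sigma> g + rep_character G l \<tau> g"
proof -
  obtain P Q I where PQ: "P \<in> carrier_mat m m" "Q \<in> carrier_mat m m" "P * Q = 1\<^sub>m m" "Q * P = 1\<^sub>m m"
    and I: "I \<subseteq> {..<m}" and WI: "W = {v \<in> carrier_vec m. \<forall>i<m. i \<notin> I \<longrightarrow> (Q *\<^sub>v v) $ i = 0}"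
  proof -
    have Wd: "W \<subseteq> carrier_vec m" "0\<^sub>v m \<in> W" "\<And>v w. v \<in> W \<Longrightarrow> w \<in> W \<Longrightarrow> v + w \<in> W"
      "\<And>c v. v \<in> W \<Longrightarrow> c \<cdot>\<^sub>v v \<in> W"
      using W(1) by (auto simp: invariant_subspace_def)
    show thesis by (rule subspace_coordinates[OF Wd]) (assumption | rule that)+
  qed
  define J where "J = {..<m} - I"
  have IJ: "finite I" "finite J" "I \<inter> J = {}" "I \<union> J = {..<m}"
    using I by (auto simp: J_def intro: finite_subset)
  have R: "\<rho> g \<in> carrier_mat m m" if "g \<in> carrier G" for g
    using complex_rep_carrier \<rho> that by auto
  define R where "R g i j = (Q * \<rho> g * P) $$ (i, j)" for g i j
  have Rc: "Q * \<rho> g * P \<in> carrier_mat m m" if "g \<in> carrier G" for g using PQ R[OF that] by auto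
  have Rmult: "R (g \<otimes> h) i j = (\<Sum>l<m. R g i l * R h l j)"
    if "g \<in> carrier G" "h \<in> carrier G" "i < m" "j < m" for g h i j
  proof -
    have "(Q * \<rho> g * P) * (Q * \<rho> h * P) = Q * \<rho> g * (P * Q) * \<rho> h * P"
      using PQ(1,2) R that by (simp add: assoc_mult_mat[of _ m m _ m _ m] mult_carrier_mat[of _ m m _ m])
    also have "\<dots> = Q * \<rho> (g \<otimes> h) * P"
      using PQ R that by (simp add: assoc_mult_mat[of _ m m _ m _ m] mult_carrier_mat[of _ m m _ m] left_mult_one_mat[of _ m m] complex_rep_mult[OF \<rho>])
    finally have "R (g \<otimes> h) i j = ((Q * \<rho> g * P) * (Q * \<rho> h * P)) $$ (i, j)" by (simp add: R_def)
    also have "\<dots> = (\<Sum>l<m. R g i l * R h l j)"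
      unfolding R_def by (rule mat_mult_entry[OF Rc Rc]) (use that in auto)
    finally show ?thesis .
  qed
  have Rone: "R \<one> i j = (if i = j then 1 else 0)" if "i < m" "j < m" for i j
    using PQ that by (simp add: R_def complex_rep_one[OF \<rho>])
  \<comment> \<open>Invariance of \<open>W\<close>: a basis vector of \<open>W\<close>, with index
    in \<open>I\<close>, acquires no coordinates in \<open>J\<close>.\<close>
  have R0: "R g i j = 0" if g: "g \<in> carrier G" and ij: "i \<in> J" "j \<in> I" for g i j
  proof -
    have ijm: "i < m" "i \<notin> I" "j < m" using that I by (auto simp: J_def)
    have "Q *\<^sub>v (P *\<^sub>v unit_vec m j) = unit_vec m j"
      using PQ by (metis assoc_mult_mat_vec one_mult_mat_vec unit_vec_carrier)
    then have "P *\<^sub>v unit_vec m j \<in> W"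
      unfolding WI mem_Collect_eq
    proof (intro conjI allI impI)
      fix l assume "l < m" "l \<notin> I"
      then show "(Q *\<^sub>v (P *\<^sub>v unit_vec m j)) $ l = 0"
        unfolding \<open>Q *\<^sub>v (P *\<^sub>v unit_vec m j) = unit_vec m j\<close> using ij ijm by auto
    qed (use PQ in auto)
    then have "\<rho> g *\<^sub>v (P *\<^sub>v unit_vec m j) \<in> W"
      using W(1) g unfolding invariant_subspace_def by blast
    then have "(Q *\<^sub>v (\<rho> g *\<^sub>v (P *\<^sub>v unit_vec m j))) $ i = 0"
      unfolding WI using ijm by auto
    also have "Q *\<^sub>v (\<rho> g *\<^sub>v (P *\<^sub>v unit_vec m j)) = (Q * \<rho> g * P) *\<^sub>v unit_vec m j"
      using PQ R[OF g] by (simp add: assoc_mult_mat_vec[of _ m m _ m] mult_carrier_mat[of _ m m _ m]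
          mult_mat_vec_carrier[of _ m m])
    also have "\<dots> $ i = R g i j"
      using Rc[OF g] ijm unfolding R_def
      by (subst mat_unit_vec_col[of _ m]) (auto intro: index_col carrier_matD simp del: index_mult_mat(1,2,3))
    finally show ?thesis .
  qed
  have split: "(\<Sum>l<m. f l) = (\<Sum>l\<in>I. f l) + (\<Sum>l\<in>J. f l)" for f :: "nat \<Rightarrow> complex"
    using IJ by (metis sum.union_disjoint)
  have lt: "i < m" if "i \<in> I \<or> i \<in> J" for i using that IJ(4) by blast
  obtain \<sigma> where \<sigma>: "complex_rep G (card I) \<sigma>"
    "rep_character G (card I) \<sigma> = (\<lambda>g. if g \<in> carrier G then \<Sum>i\<in>I. R g i i else 0)"
    using is_character_of_kernel[OF IJ(1), of R] Rmult Rone R0 lt split by auto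
  obtain \<tau> where \<tau>: "complex_rep G (card J) \<tau>"
    "rep_character G (card J) \<tau> = (\<lambda>g. if g \<in> carrier G then \<Sum>i\<in>J. R g i i else 0)"
    using is_character_of_kernel[OF IJ(2), of R] Rmult Rone R0 lt split by auto
  have "I \<noteq> {..<m}" using W(3) unfolding WI by auto
  have "I \<noteq> {}"
  proof
    assume "I = {}"
    have "v = 0\<^sub>v m" if "v \<in> W" for v
    proof -
      have v: "v \<in> carrier_vec m" "\<And>i. i < m \<Longrightarrow> (Q *\<^sub>v v) $ i = 0"
        using that \<open>I = {}\<close> WI by auto
      then have "Q *\<^sub>v v = 0\<^sub>v m" using PQ by (intro eq_vecI) auto
      then have "P *\<^sub>v (Q *\<^sub>v v) = 0\<^sub>v m" using PQ by auto
      then show ?thesis using PQ v by (metis assoc_mult_mat_vec one_mult_mat_vec)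
    qed
    moreover have "0\<^sub>v m \<in> W" using W(1) by (simp add: invariant_subspace_def)
    ultimately show False using W(2) by blast
  qed
  have "card I < m" using psubset_card_mono[of "{..<m}" I] \<open>I \<noteq> {..<m}\<close> I by auto
  moreover have "card J < m"
    using psubset_card_mono[of "{..<m}" J] \<open>I \<noteq> {}\<close> I by (auto simp: J_def)
  moreover have "rep_character G m \<rho> g
      = rep_character G (card I) \<sigma> g + rep_character G (card J) \<tau> g" for g
  proof (cases "g \<in> carrier G")
    case True
    have "mtrace (Q * \<rho> g * P) = mtrace (P * (Q * \<rho> g))"
      using PQ R[OF True] by (intro mtrace_comm) auto
    also have "P * (Q * \<rho> g) = \<rho> g"
      using PQ R[OF True] by (simp add: assoc_mult_mat[of P m m Q m _ m, symmetric] left_mult_one_mat[of _ m m])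
    finally have "mtrace (\<rho> g) = (\<Sum>l<m. R g l l)" using Rc[OF True] PQ by (simp add: mtrace_def R_def)
    then show ?thesis
      using True by (simp add: rep_character_eq_mtrace[OF \<rho>] \<sigma> \<tau> split)
  qed (simp add: rep_character_def)
  ultimately show thesis using that \<sigma>(1) \<tau>(1) by blast
qed

lemma rep_character_decomposition:
  "complex_rep G m \<rho> \<Longrightarrow>
     \<exists>L. set L \<subseteq> irr_characters G \<and> (\<forall>g. rep_character G m \<rho> g = (\<Sum>\<chi>\<leftarrow>L. \<chi> g))"
proof (induction m arbitrary: \<rho> rule: less_induct)
  case (less m)
  show ?case
  proof (cases "irreducible_rep G m \<rho>")
    case True
    then show ?thesis by (intro exI[of _ "[rep_character G m \<rho>]"]) (auto simp: irr_characters_def)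
  next
    case False
    show ?thesis
    proof (cases "m = 0")
      case True
      then show ?thesis by (intro exI[of _ "[]"]) (auto simp: rep_character_def)
    next
      case m: False
      with False less.prems obtain W where "invariant_subspace G m \<rho> W" "W \<noteq> {0\<^sub>v m}" "W \<noteq> carrier_vec m"
        by (auto simp: irreducible_rep_def)
      then obtain k \<sigma> l \<tau> where s: "complex_rep G k \<sigma>" "k < m" "complex_rep G l \<tau>" "l < m"
        "\<And>g. rep_character G m \<rho> g = rep_character G k \<sigma> g + rep_character G l \<tau> g"
        using rep_character_split[OF less.prems] by metis
      obtain L1 where L1: "set L1 \<subseteq> irr_characters G" "\<And>g. rep_character G k \<sigma> g = (\<Sum>\<chi>\<leftarrow>L1. \<chi> g)"
        using less.IH[OF s(2,1)] by auto
      obtain L2 where L2: "set L2 \<subseteq> irr_characters G" "\<And>g. rep_character G l \<tau> g = (\<Sum>\<chi>\<leftarrow>L2. \<chi> g)"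
        using less.IH[OF s(4,3)] by auto
      show ?thesis by (rule exI[of _ "L1 @ L2"]) (use L1 L2 s(5) in auto)
    qed
  qed
qed

abbreviation ip :: "('g \<Rightarrow> complex) \<Rightarrow> ('g \<Rightarrow> complex) \<Rightarrow> complex" where
  "ip \<equiv> char_inner_on G (carrier G)"

lemma ip_sum_left: "ip (\<lambda>g. \<Sum>i\<in>I. c i * f i g) h = (\<Sum>i\<in>I. c i * ip (f i) h)"
  unfolding char_inner_on_def sum_distrib_left sum_distrib_right
  by (subst sum.swap) (simp add: mult_ac)

lemma ip_sum_right: "ip f (\<lambda>g. \<Sum>i\<in>I. c i * h i g) = (\<Sum>i\<in>I. cnj (c i) * ip f (h i))"
  unfolding char_inner_on_def sum_distrib_left sum_distrib_right cnj_sum complex_cnj_mult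
  by (subst sum.swap) (simp add: mult_ac)

definition is_virtual :: "('g \<Rightarrow> complex) \<Rightarrow> bool" where
  "is_virtual f \<longleftrightarrow> (\<exists>I c. finite I \<and> I \<subseteq> irr_characters G \<and> f = (\<lambda>g. \<Sum>\<chi>\<in>I. of_int (c \<chi>) * \<chi> g))"

lemma ip_irr_sum:
  assumes "finite I" "I \<subseteq> irr_characters G" "\<psi> \<in> irr_characters G"
  shows "ip (\<lambda>g. \<Sum>\<chi>\<in>I. c \<chi> * \<chi> g) \<psi> = (if \<psi> \<in> I then c \<psi> else 0)"
proof -
  have "ip (\<lambda>g. \<Sum>\<chi>\<in>I. c \<chi> * \<chi> g) \<psi> = (\<Sum>\<chi>\<in>I. c \<chi> * (if \<chi> = \<psi> then 1 else 0))"
    using assms by (subst ip_sum_left) (intro sum.cong refl, simp add: irr_characters_orthonormal subset_iff)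
  then show ?thesis using assms(1) by (simp add: if_distrib cong: if_cong)
qed

lemma is_character_expansion:
  assumes "is_character \<theta>"
  obtains n :: "('g \<Rightarrow> complex) \<Rightarrow> nat" where "finite {\<chi>. n \<chi> \<noteq> 0}" "{\<chi>. n \<chi> \<noteq> 0} \<subseteq> irr_characters G"
    "\<theta> = (\<lambda>g. \<Sum>\<chi> | n \<chi> \<noteq> 0. of_nat (n \<chi>) * \<chi> g)"
    "\<forall>\<chi>\<in>irr_characters G. ip \<theta> \<chi> = of_nat (n \<chi>)"
proof -
  from assms obtain m \<rho> where "complex_rep G m \<rho>" "\<theta> = rep_character G m \<rho>"
    by (auto simp: is_character_def)
  then obtain L where L: "set L \<subseteq> irr_characters G" "\<And>g. \<theta> g = (\<Sum>\<chi>\<leftarrow>L. \<chi> g)"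
    using rep_character_decomposition by metis
  have s: "{\<chi>. count_list L \<chi> \<noteq> 0} = set L" by (auto simp: count_list_0_iff)
  have e: "\<theta> = (\<lambda>g. \<Sum>\<chi>\<in>set L. of_nat (count_list L \<chi>) * \<chi> g)"
    by (rule ext) (simp add: L(2) sum_list_eq_sum_count_list)
  show thesis
  proof (rule that[of "count_list L"])
    show "\<forall>\<chi>\<in>irr_characters G. ip \<theta> \<chi> = of_nat (count_list L \<chi>)"
      unfolding e by (intro ballI, subst ip_irr_sum) (use L in \<open>auto simp: count_list_0_iff\<close>)
  qed (use L e in \<open>simp_all only: s, simp_all\<close>)
qed

lemma is_character_virtual: "is_character \<theta> \<Longrightarrow> is_virtual \<theta>"
proof -
  assume "is_character \<theta>"
  then obtain n where n: "finite {\<chi>. n \<chi> \<noteq> (0::nat)}" "{\<chi>. n \<chi> \<noteq> 0} \<subseteq> irr_characters G"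
    "\<theta> = (\<lambda>g. \<Sum>\<chi> | n \<chi> \<noteq> 0. of_nat (n \<chi>) * \<chi> g)"
    by (rule is_character_expansion) (rule that; assumption)
  then show ?thesis unfolding is_virtual_def
    by (intro exI[of _ "{\<chi>. n \<chi> \<noteq> 0}"] exI[of _ "\<lambda>\<chi>. int (n \<chi>)"]) auto
qed

lemma is_virtual_sum:
  assumes "finite A" "\<And>a. a \<in> A \<Longrightarrow> is_virtual (f a)"
  shows "is_virtual (\<lambda>g. \<Sum>a\<in>A. of_int (z a) * f a g)"
proof -
  define good where "good a p \<longleftrightarrow> finite (fst p) \<and> fst p \<subseteq> irr_characters G \<and>
      f a = (\<lambda>g. \<Sum>\<chi>\<in>fst p. of_int (snd p \<chi>) * \<chi> g)" for a and p :: "_ \<times> (_ \<Rightarrow> int)"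
  have "\<forall>a\<in>A. \<exists>p. good a p"
    using assms(2) unfolding is_virtual_def good_def by fastforce
  then obtain p where p: "\<forall>a\<in>A. good a (p a)" using bchoice by blast
  define I where "I a = fst (p a)" for a
  define c where "c a = snd (p a)" for a
  have Ic: "finite (I a)" "I a \<subseteq> irr_characters G" "f a = (\<lambda>g. \<Sum>\<chi>\<in>I a. of_int (c a \<chi>) * \<chi> g)"
    if "a \<in> A" for a
    using p that by (auto simp: good_def I_def c_def)
  define J where "J = (\<Union>a\<in>A. I a)"
  have J: "finite J" using assms(1) Ic(1) by (auto simp: J_def)
  have "(\<Sum>a\<in>A. of_int (z a) * f a g)
      = (\<Sum>\<chi>\<in>J. of_int (\<Sum>a\<in>A. z a * (if \<chi> \<in> I a then c a \<chi> else 0)) * \<chi> g)" for g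
  proof -
    have "f a g = (\<Sum>\<chi>\<in>J. of_int (if \<chi> \<in> I a then c a \<chi> else 0) * \<chi> g)" if "a \<in> A" for a
      unfolding Ic(3)[OF that] using J that by (intro sum.mono_neutral_cong_left) (auto simp: J_def)
    then have "(\<Sum>a\<in>A. of_int (z a) * f a g)
        = (\<Sum>a\<in>A. of_int (z a) * (\<Sum>\<chi>\<in>J. of_int (if \<chi> \<in> I a then c a \<chi> else 0) * \<chi> g))" by simp
    then show ?thesis
      by (simp only: sum_distrib_left of_int_sum sum_distrib_right of_int_mult) (subst sum.swap, simp add: mult_ac)
  qed
  then show ?thesis
    unfolding is_virtual_def using J Ic(2)
    by (intro exI[of _ J] exI[of _ "\<lambda>\<chi>. \<Sum>a\<in>A. z a * (if \<chi> \<in> I a then c a \<chi> else 0)"]) (auto simp: J_def)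
qed

text \<open>The norm is the sum of the squares of the integral coefficients; if it is one, a single
  coefficient is nonzero, and it is \<open>1\<close> or \<open>-1\<close>.\<close>

lemma is_virtual_norm_one:
  assumes "is_virtual f" "ip f f = 1"
  shows "f \<in> irr_characters G \<or> (\<lambda>g. - f g) \<in> irr_characters G"
proof -
  from assms(1) obtain I c where Ic: "finite I" "I \<subseteq> irr_characters G"
    "f = (\<lambda>g. \<Sum>\<chi>\<in>I. of_int (c \<chi>) * \<chi> g)"
    unfolding is_virtual_def by auto
  have fx: "ip f \<chi> = of_int (c \<chi>)" if "\<chi> \<in> I" for \<chi>
    unfolding Ic(3) using that Ic by (subst ip_irr_sum) auto
  have "ip f f = (\<Sum>\<chi>\<in>I. of_int (c \<chi>) * of_int (c \<chi>))"
    by (subst (2) Ic(3), subst ip_sum_right) (simp add: fx)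
  then have "of_int (\<Sum>\<chi>\<in>I. (c \<chi>)\<^sup>2) = (of_int 1 :: complex)"
    using assms(2) by (simp add: power2_eq_square)
  then have s: "(\<Sum>\<chi>\<in>I. (c \<chi>)\<^sup>2) = 1" by (rule iffD1[OF of_int_eq_iff])
  have "\<exists>\<psi>\<in>I. c \<psi> \<noteq> 0"
  proof (rule ccontr)
    assume "\<not> (\<exists>\<psi>\<in>I. c \<psi> \<noteq> 0)"
    then have "(\<Sum>\<chi>\<in>I. (c \<chi>)\<^sup>2) = 0" by (intro sum.neutral) auto
    with s show False by simp
  qed
  then obtain \<psi> where \<psi>: "\<psi> \<in> I" "c \<psi> \<noteq> 0" by blast
  have "(\<Sum>\<chi>\<in>I. (c \<chi>)\<^sup>2) = (c \<psi>)\<^sup>2 + (\<Sum>\<chi>\<in>I - {\<psi>}. (c \<chi>)\<^sup>2)"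
    using Ic(1) \<psi>(1) by (rule sum.remove)
  moreover have "(\<Sum>\<chi>\<in>I - {\<psi>}. (c \<chi>)\<^sup>2) \<ge> 0" by (rule sum_nonneg) simp
  moreover have "(c \<psi>)\<^sup>2 \<ge> 1" using \<psi>(2) by (simp add: int_one_le_iff_zero_less)
  ultimately have "(c \<psi>)\<^sup>2 = 1" "(\<Sum>\<chi>\<in>I - {\<psi>}. (c \<chi>)\<^sup>2) = 0" using s by linarith+
  then have c: "c \<psi> = 1 \<or> c \<psi> = -1" "\<And>\<chi>. \<chi> \<in> I - {\<psi>} \<Longrightarrow> c \<chi> = 0"
    using Ic(1) by (auto simp: power2_eq_1_iff sum_nonneg_eq_0_iff)
  have "f g = of_int (c \<psi>) * \<psi> g" for g
    using Ic(1) \<psi>(1) c(2) by (simp add: Ic(3) sum.remove[of _ \<psi>])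
  with c(1) have "f = \<psi> \<or> (\<lambda>g. - f g) = \<psi>" by auto
  then show ?thesis using \<psi> Ic(2) by auto
qed

text \<open>The inner product of two characters is the sum of the products of their multiplicities.
  \<open>n\<close> records these products, which are nonzero exactly at common constituents.\<close>

lemma ip_characters:
  assumes "is_character \<theta>" "is_character \<eta>"
  obtains n :: "('g \<Rightarrow> complex) \<Rightarrow> nat" and I where "finite I" "I \<subseteq> irr_characters G"
    "ip \<theta> \<eta> = of_nat (\<Sum>\<chi>\<in>I. n \<chi>)"
    "\<forall>\<chi>\<in>irr_characters G. ip \<theta> \<chi> \<noteq> 0 \<and> ip \<eta> \<chi> \<noteq> 0 \<longleftrightarrow> \<chi> \<in> I \<and> n \<chi> \<noteq> 0"
proof -
  obtain n where n: "finite {\<chi>. n \<chi> \<noteq> (0::nat)}" "{\<chi>. n \<chi> \<noteq> 0} \<subseteq> irr_characters G"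
    "\<theta> = (\<lambda>g. \<Sum>\<chi> | n \<chi> \<noteq> 0. of_nat (n \<chi>) * \<chi> g)"
    "\<forall>\<chi>\<in>irr_characters G. ip \<theta> \<chi> = of_nat (n \<chi>)"
    by (rule is_character_expansion[OF assms(1)]) (rule that; assumption)
  obtain k where k: "finite {\<chi>. k \<chi> \<noteq> (0::nat)}" "{\<chi>. k \<chi> \<noteq> 0} \<subseteq> irr_characters G"
    "\<eta> = (\<lambda>g. \<Sum>\<chi> | k \<chi> \<noteq> 0. of_nat (k \<chi>) * \<chi> g)"
    "\<forall>\<chi>\<in>irr_characters G. ip \<eta> \<chi> = of_nat (k \<chi>)"
    by (rule is_character_expansion[OF assms(2)]) (rule that; assumption)
  show thesis
  proof (rule that[of "{\<chi>. k \<chi> \<noteq> 0}" "\<lambda>\<chi>. k \<chi> * n \<chi>"])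
    show "ip \<theta> \<eta> = of_nat (\<Sum>\<chi> | k \<chi> \<noteq> 0. k \<chi> * n \<chi>)"
      by (subst k(3), subst ip_sum_right) (use k(2) n(4) in \<open>auto intro!: sum.cong\<close>)
  qed (use k n in auto)
qed

text \<open>A sum of products of multiplicities equal to one has exactly one nonzero term. This
  makes the definite description in \<open>sym_character\<close> meaningful.\<close>

lemma common_constituent_unique:
  assumes "is_character \<theta>" "is_character \<eta>" "ip \<theta> \<eta> = 1"
  shows "\<exists>!\<chi>. \<chi> \<in> irr_characters G \<and> ip \<theta> \<chi> \<noteq> 0 \<and> ip \<eta> \<chi> \<noteq> 0"
proof -
  obtain n :: "('g \<Rightarrow> complex) \<Rightarrow> nat" and I where nI: "finite I" "I \<subseteq> irr_characters G"
    "ip \<theta> \<eta> = of_nat (\<Sum>\<chi>\<in>I. n \<chi>)"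
    "\<forall>\<chi>\<in>irr_characters G. ip \<theta> \<chi> \<noteq> 0 \<and> ip \<eta> \<chi> \<noteq> 0 \<longleftrightarrow> \<chi> \<in> I \<and> n \<chi> \<noteq> 0"
    by (rule ip_characters[OF assms(1,2)]) (rule that; assumption)
  then have "(of_nat (\<Sum>\<chi>\<in>I. n \<chi>) :: complex) = of_nat 1" using assms(3) by simp
  then have s: "(\<Sum>\<chi>\<in>I. n \<chi>) = 1" by (rule iffD1[OF of_nat_eq_iff])
  then obtain \<psi> where \<psi>: "\<psi> \<in> I" "n \<psi> = 1" "\<And>\<chi>. \<chi> \<in> I \<Longrightarrow> \<chi> \<noteq> \<psi> \<Longrightarrow> n \<chi> = 0"
    using iffD1[OF sum_eq_1_iff[OF nI(1)] s] by metis
  show ?thesis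
  proof (rule ex1I[of _ \<psi>])
    have "\<psi> \<in> irr_characters G" using nI(2) \<psi>(1) by blast
    with \<psi> nI(4) show "\<psi> \<in> irr_characters G \<and> ip \<theta> \<psi> \<noteq> 0 \<and> ip \<eta> \<psi> \<noteq> 0" by auto
    fix \<chi> assume "\<chi> \<in> irr_characters G \<and> ip \<theta> \<chi> \<noteq> 0 \<and> ip \<eta> \<chi> \<noteq> 0"
    with nI(4) have "\<chi> \<in> I" "n \<chi> \<noteq> 0" by auto
    with \<psi>(3)[of \<chi>] show "\<chi> = \<psi>" by (rule_tac ccontr) simp
  qed
qed

lemma common_constituent_ip_nonzero:
  assumes "is_character \<theta>" "is_character \<eta>" "\<chi> \<in> irr_characters G" "ip \<theta> \<chi> \<noteq> 0" "ip \<eta> \<chi> \<noteq> 0"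
  shows "ip \<theta> \<eta> \<noteq> 0"
proof -
  obtain n :: "('g \<Rightarrow> complex) \<Rightarrow> nat" and I where nI: "finite I" "I \<subseteq> irr_characters G"
    "ip \<theta> \<eta> = of_nat (\<Sum>\<chi>\<in>I. n \<chi>)"
    "\<forall>\<chi>\<in>irr_characters G. ip \<theta> \<chi> \<noteq> 0 \<and> ip \<eta> \<chi> \<noteq> 0 \<longleftrightarrow> \<chi> \<in> I \<and> n \<chi> \<noteq> 0"
    by (rule ip_characters[OF assms(1,2)]) (rule that; assumption)
  then have "\<chi> \<in> I" "n \<chi> \<noteq> 0" using assms(3-5) by auto
  then have "(\<Sum>\<chi>\<in>I. n \<chi>) \<noteq> 0" using nI(1) by (auto simp: sum_eq_0_iff)
  then show ?thesis unfolding nI(3) by (simp only: of_nat_eq_0_iff not_False_eq_True)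
qed

lemma ip_character_irr_nat:
  assumes "is_character \<theta>" "\<chi> \<in> irr_characters G"
  shows "\<exists>k. ip \<theta> \<chi> = of_nat k"
  by (rule is_character_expansion[OF assms(1)]) (use assms(2) in blast)

subsection \<open>Permutation characters\<close>

definition is_action :: "('g \<Rightarrow> 'e \<Rightarrow> 'e) \<Rightarrow> 'e set \<Rightarrow> bool" where
  "is_action act X \<longleftrightarrow> finite X \<and> (\<forall>g\<in>carrier G. \<forall>x\<in>X. act g x \<in> X) \<and> (\<forall>x\<in>X. act \<one> x = x) \<and>
     (\<forall>g\<in>carrier G. \<forall>h\<in>carrier G. \<forall>x\<in>X. act (g \<otimes> h) x = act g (act h x))"

lemma is_actionD:
  assumes "is_action act X"
  shows "finite X" "\<And>g x. g \<in> carrier G \<Longrightarrow> x \<in> X \<Longrightarrow> act g x \<in> X" "\<And>x. x \<in> X \<Longrightarrow> act \<one> x = x"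
    "\<And>g h x. g \<in> carrier G \<Longrightarrow> h \<in> carrier G \<Longrightarrow> x \<in> X \<Longrightarrow> act (g \<otimes> h) x = act g (act h x)"
  using assms by (auto simp: is_action_def)

text \<open>The monomial representation on the points with \<epsilon> as common entry. Trivial
  \<epsilon> gives permutation characters, the sign gives their twists in the symmetric
  group.\<close>

lemma is_character_twisted_action:
  assumes a: "is_action act X"
    and e: "\<epsilon> \<one> = 1" "\<And>g h. g \<in> carrier G \<Longrightarrow> h \<in> carrier G \<Longrightarrow> \<epsilon> (g \<otimes> h) = \<epsilon> g * (\<epsilon> h :: complex)"
  shows "is_character (\<lambda>g. if g \<in> carrier G then \<epsilon> g * of_nat (fix_count act X g) else 0)"
proof -
  note act = is_actionD[OF a]
  define R where "R g x y = (if x = act g y then \<epsilon> g else 0)" for g x y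
  have "\<exists>\<rho>. complex_rep G (card X) \<rho> \<and>
      rep_character G (card X) \<rho> = (\<lambda>g. if g \<in> carrier G then \<Sum>x\<in>X. R g x x else 0)"
  proof (rule is_character_of_kernel[where R = R, OF act(1)])
    fix g h i j assume gh: "g \<in> carrier G" "h \<in> carrier G" "i \<in> X" "j \<in> X"
    have "(\<Sum>l\<in>X. R g i l * R h l j) = (\<Sum>l\<in>X. if l = act h j then R g i l * \<epsilon> h else 0)"
      by (intro sum.cong) (auto simp: R_def)
    also have "\<dots> = R (g \<otimes> h) i j" using gh act by (auto simp: R_def e)
    finally show "R (g \<otimes> h) i j = (\<Sum>l\<in>X. R g i l * R h l j)" ..
  qed (auto simp: R_def e act)
  then obtain \<rho> where r: "complex_rep G (card X) \<rho>"
    "rep_character G (card X) \<rho> = (\<lambda>g. if g \<in> carrier G then \<Sum>x\<in>X. R g x x else 0)" by auto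
  have tr: "(\<Sum>x\<in>X. R g x x) = \<epsilon> g * of_nat (fix_count act X g)" for g
  proof -
    have "(\<Sum>x\<in>X. R g x x) = (\<Sum>x\<in>X. if act g x = x then \<epsilon> g else 0)"
      by (intro sum.cong) (auto simp: R_def)
    also have "\<dots> = (\<Sum>x | x \<in> X \<and> act g x = x. \<epsilon> g)"
      using act(1) by (simp add: sum.If_cases Int_def conj_commute)
    finally show ?thesis by (simp add: fix_count_def mult.commute)
  qed
  have "(\<lambda>g. if g \<in> carrier G then \<epsilon> g * of_nat (fix_count act X g) else 0) = rep_character G (card X) \<rho>"
    unfolding r(2) by (rule ext) (simp add: tr)
  with r(1) show ?thesis unfolding is_character_def by (intro exI conjI)
qed

lemma is_action_inv:
  assumes "is_action act X" "g \<in> carrier G" "x \<in> X"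
  shows "act (inv g) (act g x) = x" "act g (act (inv g) x) = x"
  using is_actionD[OF assms(1)] assms(2,3) by (metis inv_closed l_inv, metis inv_closed r_inv)

text \<open>A left coset of the stabilizer of \<open>x0\<close> is the set of group elements
  carrying \<open>x0\<close> to one fixed point, so cosets and points correspond compatibly with the
  action.\<close>

lemma perm_character_action:
  assumes a: "is_action act X" and x0: "x0 \<in> X"
    and tr: "\<And>x. x \<in> X \<Longrightarrow> \<exists>g\<in>carrier G. act g x0 = x"
  shows "perm_character G {g \<in> carrier G. act g x0 = x0}
       = (\<lambda>g. if g \<in> carrier G then of_nat (fix_count act X g) else 0)"
proof
  fix g
  note act = is_actionD[OF a]
  let ?H = "{g \<in> carrier G. act g x0 = x0}"
  define K where "K x = {b \<in> carrier G. act b x0 = x}" for x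
  have Kinj: "K x = K y \<longleftrightarrow> x = y" if xy: "x \<in> X" "y \<in> X" for x y
    using tr[OF xy(1)] by (auto simp: K_def)
  have coset: "b <# K x = K (act b x)" if b: "b \<in> carrier G" and x: "x \<in> X" for b x
  proof
    show "b <# K x \<subseteq> K (act b x)"
      using b act x0 by (auto simp: l_coset_def K_def)
    show "K (act b x) \<subseteq> b <# K x"
    proof
      fix c assume c: "c \<in> K (act b x)"
      then have cc: "c \<in> carrier G" "act c x0 = act b x" by (auto simp: K_def)
      have "act (inv b \<otimes> c) x0 = x" using cc b x0 act(4) is_action_inv[OF a b x] by simp
      then have "inv b \<otimes> c \<in> K x" using b cc by (simp add: K_def)
      moreover have "c = b \<otimes> (inv b \<otimes> c)" using b cc by (simp add: m_assoc[symmetric])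
      ultimately show "c \<in> b <# K x" by (auto simp: l_coset_def)
    qed
  qed
  have H: "?H = K x0" by (auto simp: K_def)
  have lc: "lcosets\<^bsub>G\<^esub> ?H = K ` X"
    unfolding H LCOSETS_def using coset[OF _ x0] act(2)[OF _ x0] tr by (fastforce simp: image_iff)
  show "perm_character G ?H g = (if g \<in> carrier G then of_nat (fix_count act X g) else 0)"
  proof (cases "g \<in> carrier G")
    case True
    have "{C \<in> lcosets\<^bsub>G\<^esub> ?H. g <# C = C} = K ` {x \<in> X. act g x = x}"
      unfolding lc using True coset Kinj act by (auto simp: image_iff)
    moreover have "inj_on K {x \<in> X. act g x = x}" using Kinj by (auto simp: inj_on_def)
    ultimately show ?thesis using True by (simp add: perm_character_def fix_count_def card_image)
  qed (simp add: perm_character_def)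
qed

text \<open>Burnside's lemma with orbits replaced by the values of a complete orbit invariant
  \<open>f\<close>: among the pairs of a group element and a fixed point, each orbit contributes as
  many as the group has elements.\<close>

lemma burnside_invariant:
  assumes a: "is_action act X"
    and f: "\<And>x y. x \<in> X \<Longrightarrow> y \<in> X \<Longrightarrow> f x = f y \<longleftrightarrow> (\<exists>g\<in>carrier G. act g x = y)"
  shows "(\<Sum>g\<in>carrier G. fix_count act X g) = card (carrier G) * card (f ` X)"
proof -
  note act = is_actionD[OF a]
  have "(\<Sum>g\<in>carrier G. fix_count act X g) = (\<Sum>g\<in>carrier G. \<Sum>x\<in>X. if act g x = x then 1 else 0)"
    using act(1) by (simp add: fix_count_def sum.If_cases Int_def conj_commute)
  also have "\<dots> = (\<Sum>x\<in>X. \<Sum>g\<in>carrier G. if act g x = x then 1 else 0)" by (rule sum.swap)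
  also have "\<dots> = (\<Sum>x\<in>X. card {g \<in> carrier G. act g x = x})"
    using fin by (simp add: sum.If_cases Int_def conj_commute)
  also have "\<dots> = (\<Sum>t\<in>f ` X. \<Sum>x | x \<in> X \<and> f x = t. card {g \<in> carrier G. act g x = x})"
    using sum.group[where g = f and h = "\<lambda>x. card {g \<in> carrier G. act g x = x}",
        OF act(1) finite_imageI[OF act(1)] subset_refl]
    by simp
  also have "\<dots> = (\<Sum>t\<in>f ` X. card (carrier G))"
  proof (intro sum.cong refl)
    fix t assume "t \<in> f ` X"
    then obtain x0 where x0: "x0 \<in> X" "f x0 = t" by auto
    \<comment> \<open>The elements fixing \<open>x\<close> are as many as those carrying
      \<open>x0\<close> to \<open>x\<close>, and over the orbit the latter sets partition the
      group.\<close>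
    have "card {g \<in> carrier G. act g x = x} = card {g \<in> carrier G. act g x0 = x}"
      if x: "x \<in> X" "f x = t" for x
    proof -
      obtain h where h: "h \<in> carrier G" "act h x0 = x" using f[OF x0(1) x(1)] x0 x by auto
      have hx: "act (inv h) x = x0" using is_action_inv[OF a h(1) x0(1)] h by simp
      show ?thesis
        by (rule bij_betw_same_card[of "\<lambda>g. g \<otimes> h"], rule bij_betw_byWitness[of _ "\<lambda>g. g \<otimes> inv h"])
          (use h hx x x0 act in \<open>auto simp: m_assoc\<close>)
    qed
    then have "(\<Sum>x | x \<in> X \<and> f x = t. card {g \<in> carrier G. act g x = x})
        = (\<Sum>x | x \<in> X \<and> f x = t. card {g \<in> carrier G. act g x0 = x})" by (intro sum.cong) auto
    also have "\<dots> = card (\<Union>x\<in>{x \<in> X. f x = t}. {g \<in> carrier G. act g x0 = x})"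
      using act(1) fin by (subst card_UN_disjoint) auto
    also have "(\<Union>x\<in>{x \<in> X. f x = t}. {g \<in> carrier G. act g x0 = x}) = carrier G"
    proof -
      have "act g x0 \<in> X \<and> f (act g x0) = t" if "g \<in> carrier G" for g
        using f[OF x0(1) act(2)[OF that x0(1)]] x0 act(2)[OF that x0(1)] that by metis
      then show ?thesis by auto
    qed
    finally show "(\<Sum>x | x \<in> X \<and> f x = t. card {g \<in> carrier G. act g x = x}) = card (carrier G)" .
  qed
  finally show ?thesis by (simp add: mult.commute)
qed

end

subsection \<open>Pairs of colourings\<close>

text \<open>An ordered partition of \<open>B\<close> into \<open>N\<close> possibly empty classes of
  prescribed sizes. On points it stands for a coset of a Young subgroup, on a basis for a coordinate
  flag.\<close>

definition colouring :: "nat \<Rightarrow> (nat \<Rightarrow> int) \<Rightarrow> 'e set \<Rightarrow> ('e \<Rightarrow> nat) \<Rightarrow> bool" where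
  "colouring N a B c \<longleftrightarrow> c ` B \<subseteq> {..<N} \<and> (\<forall>i<N. int (card {x \<in> B. c x = i}) = a i)"

text \<open>The entry \<open>(i, j)\<close> is the number of points coloured \<open>i\<close> by
  \<open>c\<close> and \<open>j\<close> by \<open>e\<close>, in the encoding of
  \<open>nat_mats\<close>.\<close>

definition colour_matrix :: "nat \<Rightarrow> 'e set \<Rightarrow> ('e \<Rightarrow> nat) \<Rightarrow> ('e \<Rightarrow> nat) \<Rightarrow> nat \<Rightarrow> nat multiset" where
  "colour_matrix N B c e = (\<lambda>i\<in>{..<N}. image_mset e (mset_set {x \<in> B. c x = i}))"

lemma count_image_mset_set:
  assumes "finite S"
  shows "count (image_mset e (mset_set S)) j = card {x \<in> S. e x = j}"
proof -
  have "count (image_mset e (mset_set S)) j = (\<Sum>x\<in>e -` {j} \<inter> S. count (mset_set S) x)"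
    using assms by (simp add: count_image_mset)
  also have "\<dots> = (\<Sum>x | x \<in> S \<and> e x = j. 1)"
    using assms by (intro sum.cong) auto
  finally show ?thesis by simp
qed

lemma count_colour_matrix:
  "finite B \<Longrightarrow> i < N \<Longrightarrow> count (colour_matrix N B c e i) j = card {x \<in> B. c x = i \<and> e x = j}"
  by (simp add: colour_matrix_def count_image_mset_set)

lemma card_fibres:
  assumes "finite B" "e ` B \<subseteq> {..<N::nat}"
  shows "(\<Sum>j<N. card {x \<in> B. e x = j}) = card B"
proof -
  have "(\<Sum>j<N. card {x \<in> B. e x = j}) = card (\<Union>j<N. {x \<in> B. e x = j})"
    using assms(1) by (subst card_UN_disjoint) auto
  also have "(\<Union>j<N. {x \<in> B. e x = j}) = B" using assms(2) by auto
  finally show ?thesis .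
qed

lemma colour_matrix_in_nat_mats:
  assumes "finite B" "colouring N a B c" "colouring N b B e"
  shows "colour_matrix N B c e \<in> nat_mats N a b"
  unfolding nat_mats_def
proof (intro CollectI conjI allI impI PiE_I)
  fix i assume i: "i \<in> {..<N}"
  show "colour_matrix N B c e i \<in> rows_of_size N (a i)"
    using assms i by (auto simp: colour_matrix_def rows_of_size_def colouring_def)
next
  fix j assume j: "j < N"
  have "(\<Sum>i<N. int (count (colour_matrix N B c e i) j)) = int (\<Sum>i<N. card {x \<in> {x \<in> B. e x = j}. c x = i})"
    using assms(1) by (simp add: count_colour_matrix conj_ac)
  also have "\<dots> = int (card {x \<in> B. e x = j})"
    using assms by (subst card_fibres) (auto simp: colouring_def)
  finally show "(\<Sum>i<N. int (count (colour_matrix N B c e i) j)) = b j"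
    using assms(3) j by (simp add: colouring_def)
qed (simp add: colour_matrix_def)

lemma exists_map_with_fibres:
  assumes "finite B" "finite T" "(\<Sum>t\<in>T. k t) = card B"
  shows "\<exists>p. p ` B \<subseteq> T \<and> (\<forall>t\<in>T. card {x \<in> B. p x = t} = k t)"
proof -
  let ?S = "SIGMA t:T. {..<k t}"
  have "card ?S = card B" using assms by simp
  then obtain f where f: "bij_betw f B ?S"
    using finite_same_card_bij[OF assms(1), of ?S] assms(2) by auto
  have "card {x \<in> B. fst (f x) = t} = k t" if t: "t \<in> T" for t
  proof -
    have "{s \<in> f ` B. fst s = t} = f ` {x \<in> B. fst (f x) = t}" by auto
    then have "card {s \<in> f ` B. fst s = t} = card {x \<in> B. fst (f x) = t}"
      using f unfolding bij_betw_def by (auto simp: inj_on_def intro!: card_image)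
    moreover have "f ` B = ?S" using f by (simp add: bij_betw_def)
    ultimately have "card {x \<in> B. fst (f x) = t} = card {s \<in> ?S. fst s = t}" by simp
    also have "{s \<in> ?S. fst s = t} = Pair t ` {..<k t}" using t by auto
    finally show ?thesis by (simp add: card_image inj_on_def)
  qed
  moreover have "fst (f x) \<in> T" if "x \<in> B" for x
  proof -
    have "f x \<in> ?S" using bij_betwE[OF f] that by blast
    then show ?thesis by auto
  qed
  ultimately show ?thesis by (intro exI[of _ "\<lambda>x. fst (f x)"]) auto
qed

text \<open>The entries of \<open>A\<close> add up to \<open>card B\<close>, so the points can be
  distributed over the cells of the matrix with the prescribed fibre sizes; the two colours of a
  point are the coordinates of its cell.\<close>

lemma exists_colourings:
  assumes "finite B" "A \<in> nat_mats N a b" "(\<Sum>i<N. a i) = int (card B)"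
  obtains c e where "colouring N a B c" "colouring N b B e" "colour_matrix N B c e = A"
proof -
  have A: "\<And>i. i < N \<Longrightarrow> set_mset (A i) \<subseteq> {..<N}" "\<And>i. i < N \<Longrightarrow> int (size (A i)) = a i"
    "\<And>j. j < N \<Longrightarrow> (\<Sum>i<N. int (count (A i) j)) = b j" "A \<in> extensional {..<N}"
    using assms(2) by (auto simp: nat_mats_def rows_of_size_def PiE_def Pi_def)
  have sz: "size (A i) = (\<Sum>j<N. count (A i) j)" if "i < N" for i
    unfolding size_multiset_overloaded_eq using A(1)[OF that]
    by (intro sum.mono_neutral_left) (auto simp: not_in_iff)
  have "int (\<Sum>t\<in>{..<N} \<times> {..<N}. count (A (fst t)) (snd t)) = (\<Sum>i<N. int (size (A i)))"
    by (simp add: sz sum.cartesian_product case_prod_unfold)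
  also have "\<dots> = int (card B)" using assms(3) A(2) by simp
  finally have "(\<Sum>t\<in>{..<N} \<times> {..<N}. count (A (fst t)) (snd t)) = card B"
    by (rule iffD1[OF of_nat_eq_iff])
  from exists_map_with_fibres[OF assms(1) _ this]
  obtain p where p: "p ` B \<subseteq> {..<N} \<times> {..<N}"
    "\<And>i j. i < N \<Longrightarrow> j < N \<Longrightarrow> card {x \<in> B. p x = (i, j)} = count (A i) j"
    by auto
  let ?c = "\<lambda>x. fst (p x)" and ?e = "\<lambda>x. snd (p x)"
  have ce: "?c ` B \<subseteq> {..<N}" "?e ` B \<subseteq> {..<N}" using p(1) by force+
  have cnt: "card {x \<in> B. ?c x = i \<and> ?e x = j} = count (A i) j" if "i < N" "j < N" for i j
    using p(2)[OF that] by (simp add: prod_eq_iff)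
  have "colouring N a B ?c"
    unfolding colouring_def
  proof (intro conjI allI impI ce)
    fix i assume i: "i < N"
    have "card {x \<in> B. ?c x = i} = (\<Sum>j<N. card {x \<in> {x \<in> B. ?c x = i}. ?e x = j})"
      by (rule card_fibres[symmetric]) (use assms(1) ce in auto)
    then show "int (card {x \<in> B. ?c x = i}) = a i"
      using A(2)[OF i] sz[OF i] cnt[OF i] by (simp add: conj_assoc)
  qed
  moreover have "colouring N b B ?e"
    unfolding colouring_def
  proof (intro conjI allI impI ce)
    fix j assume j: "j < N"
    have "card {x \<in> B. ?e x = j} = (\<Sum>i<N. card {x \<in> {x \<in> B. ?e x = j}. ?c x = i})"
      by (rule card_fibres[symmetric]) (use assms(1) ce in auto)
    also have "\<dots> = (\<Sum>i<N. count (A i) j)"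
      by (intro sum.cong) (auto simp: cnt[OF _ j, symmetric] conj_ac)
    finally show "int (card {x \<in> B. ?e x = j}) = b j" using A(3)[OF j] by simp
  qed
  moreover have "colour_matrix N B ?c ?e = A"
  proof
    fix i
    show "colour_matrix N B ?c ?e i = A i"
    proof (cases "i < N")
      case i: True
      show ?thesis
      proof (rule multiset_eqI)
        fix j
        show "count (colour_matrix N B ?c ?e i) j = count (A i) j"
        proof (cases "j < N")
          case False
          then have "{x \<in> B. ?c x = i \<and> ?e x = j} = {}" using ce by auto
          moreover have "count (A i) j = 0" using A(1)[OF i] False by (auto simp: count_eq_zero_iff)
          ultimately show ?thesis using count_colour_matrix[OF assms(1) i, of ?c ?e j] by (simp only: card.empty)
        qed (simp add: count_colour_matrix[OF assms(1) i] cnt[OF i])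
      qed
    qed (use A(4) in \<open>auto simp: colour_matrix_def extensional_def\<close>)
  qed
  ultimately show thesis using that by blast
qed

lemma exists_bij_between_fibres:
  assumes "finite B" "finite C" "\<And>t. card {x \<in> B. p x = t} = card {y \<in> C. q y = t}"
  shows "\<exists>\<phi>. bij_betw \<phi> B C \<and> (\<forall>x\<in>B. q (\<phi> x) = p x)"
proof -
  have "\<forall>t. \<exists>f. bij_betw f {x \<in> B. p x = t} {y \<in> C. q y = t}"
    using assms by (intro allI finite_same_card_bij) auto
  then obtain f where f: "\<And>t. bij_betw (f t) {x \<in> B. p x = t} {y \<in> C. q y = t}" by metis
  let ?\<phi> = "\<lambda>x. f (p x) x"
  have 1: "?\<phi> x \<in> C \<and> q (?\<phi> x) = p x" if "x \<in> B" for x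
    using f[of "p x"] that unfolding bij_betw_def by auto
  have "bij_betw ?\<phi> B C"
  proof (rule bij_betw_imageI)
    show "inj_on ?\<phi> B"
    proof (rule inj_onI)
      fix x y assume xy: "x \<in> B" "y \<in> B" "?\<phi> x = ?\<phi> y"
      then have "p x = p y" using 1 by metis
      then show "x = y" using f[of "p x"] xy unfolding bij_betw_def inj_on_def by auto
    qed
    show "?\<phi> ` B = C"
    proof
      show "C \<subseteq> ?\<phi> ` B"
      proof
        fix y assume "y \<in> C"
        then have "y \<in> f (q y) ` {x \<in> B. p x = q y}" using f[of "q y"] unfolding bij_betw_def by auto
        then obtain x where "y = f (q y) x" "x \<in> B" "p x = q y" by auto
        then show "y \<in> ?\<phi> ` B" by (intro image_eqI[of _ _ x]) auto
      qed
    qed (use 1 in auto)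
  qed
  with 1 show ?thesis by blast
qed

text \<open>Equal matrices mean equally many points for each pair of colours, and bijections between
  the fibres glue. With \<open>colour_matrix_bij\<close>, the matrix is a complete invariant of
  pairs of colourings.\<close>

lemma colour_matrix_eq_imp_bij:
  assumes "finite B" "finite C" "c ` B \<subseteq> {..<N}" "c' ` C \<subseteq> {..<N}"
    "colour_matrix N B c e = colour_matrix N C c' e'"
  shows "\<exists>\<phi>. bij_betw \<phi> B C \<and> (\<forall>x\<in>B. c' (\<phi> x) = c x \<and> e' (\<phi> x) = e x)"
proof -
  have "card {x \<in> B. (c x, e x) = t} = card {y \<in> C. (c' y, e' y) = t}" for t
  proof (cases "fst t < N")
    case True
    then show ?thesis
      using count_colour_matrix[OF assms(1) True, of c e "snd t"]
        count_colour_matrix[OF assms(2) True, of c' e' "snd t"] assms(5)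
      by (simp add: prod_eq_iff)
  next
    case False
    then have "{x \<in> B. (c x, e x) = t} = {}" "{y \<in> C. (c' y, e' y) = t} = {}"
      using assms(3,4) by auto
    then show ?thesis by (simp only: card.empty)
  qed
  from exists_bij_between_fibres[OF assms(1,2) this] show ?thesis by auto
qed

lemma colour_matrix_bij:
  assumes "finite B" "bij_betw \<phi> B C" "\<And>x. x \<in> B \<Longrightarrow> c' (\<phi> x) = c x \<and> e' (\<phi> x) = e x"
  shows "colour_matrix N B c e = colour_matrix N C c' e'"
proof
  fix i
  have "bij_betw \<phi> {x \<in> B. c x = i} {y \<in> C. c' y = i}"
    using assms(2,3) unfolding bij_betw_def by (auto simp: inj_on_def)
  then have "image_mset \<phi> (mset_set {x \<in> B. c x = i}) = mset_set {y \<in> C. c' y = i}"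
    by (simp add: image_mset_mset_set bij_betw_def)
  then have "image_mset e' (mset_set {y \<in> C. c' y = i}) = image_mset (e' \<circ> \<phi>) (mset_set {x \<in> B. c x = i})"
    by (metis multiset.map_comp)
  also have "\<dots> = image_mset e (mset_set {x \<in> B. c x = i})"
    using assms by (intro image_mset_cong) auto
  finally show "colour_matrix N B c e i = colour_matrix N C c' e' i"
    by (simp add: colour_matrix_def)
qed

subsection \<open>Residues\<close>

text \<open>Read as an abacus with \<open>d\<close> runners, the multiplicity of a residue is the
  number of beads on its runner.\<close>

definition residues_mset :: "nat \<Rightarrow> nat \<Rightarrow> (nat \<Rightarrow> int) \<Rightarrow> int multiset" where
  "residues_mset d N \<beta> = image_mset (\<lambda>i. \<beta> i mod int d) (mset_set {..<N})"

lemma residues_mset_permute: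
  assumes "w permutes {..<N}" "\<And>i. i < N \<Longrightarrow> \<gamma> i mod int d = \<beta> (w i) mod int d"
  shows "residues_mset d N \<gamma> = residues_mset d N \<beta>"
proof -
  have "residues_mset d N \<gamma> = image_mset (\<lambda>i. \<beta> (w i) mod int d) (mset_set {..<N})"
    unfolding residues_mset_def using assms(2) by (intro image_mset_cong) auto
  also have "\<dots> = image_mset (\<lambda>i. \<beta> i mod int d) (image_mset w (mset_set {..<N}))"
    by (simp add: multiset.map_comp comp_def)
  also have "image_mset w (mset_set {..<N}) = mset_set {..<N}"
    using assms(1) by (simp add: image_mset_mset_set permutes_inj_on permutes_image)
  finally show ?thesis by (simp add: residues_mset_def)
qed

lemma residues_mset_shift:
  assumes "\<And>i. i < N \<Longrightarrow> int d dvd b i"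
  shows "residues_mset d N (\<lambda>i. \<beta> i - b i) = residues_mset d N \<beta>"
  unfolding residues_mset_def
proof (rule image_mset_cong)
  fix i assume "i \<in># mset_set {..<N}"
  then have "int d dvd b i" using assms by simp
  then show "(\<beta> i - b i) mod int d = \<beta> i mod int d"
    by (metis diff_zero dvd_imp_mod_0 mod_diff_right_eq)
qed

section \<open>Linear algebra and flags over a finite field\<close>

locale fin_vs = vector_space scale
  for scale :: "'k::{field, finite} \<Rightarrow> 'v::ab_group_add \<Rightarrow> 'v" +
  assumes fin_space: "finite (UNIV :: 'v set)"
begin

sublocale finite_dimensional_vector_space scale "extend_basis {}"
  by unfold_locales
    (auto intro: finite_subset[OF subset_UNIV fin_space] simp: independent_extend_basis[OF independent_empty] span_extend_basis[OF independent_empty])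

lemma fin_sub: "finite (S :: 'v set)"
  by (rule finite_subset[OF subset_UNIV fin_space])

subsection \<open>Automorphism groups of subspaces\<close>

text \<open>Automorphisms of a subspace are functions on the whole space, extended by 0.\<close>
definition aut :: "'v set \<Rightarrow> ('v \<Rightarrow> 'v) set" where
  "aut W = {g. (\<forall>x\<in>W. \<forall>y\<in>W. g (x + y) = g x + g y) \<and> (\<forall>c. \<forall>x\<in>W. g (scale c x) = scale c (g x)) \<and>
     bij_betw g W W \<and> (\<forall>x. x \<notin> W \<longrightarrow> g x = 0)}"

definition aut_group :: "'v set \<Rightarrow> ('v \<Rightarrow> 'v) monoid" where
  "aut_group W = \<lparr>carrier = aut W, mult = (\<lambda>g h x. if x \<in> W then g (h x) else 0),
     one = (\<lambda>x. if x \<in> W then x else 0)\<rparr>"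

lemma aut_group_simps [simp]:
  "carrier (aut_group W) = aut W"
  "mult (aut_group W) g h = (\<lambda>x. if x \<in> W then g (h x) else 0)"
  "one (aut_group W) = (\<lambda>x. if x \<in> W then x else 0)"
  by (simp_all add: aut_group_def)

lemma autD:
  assumes "g \<in> aut W"
  shows "\<And>x y. x \<in> W \<Longrightarrow> y \<in> W \<Longrightarrow> g (x + y) = g x + g y"
    "\<And>c x. x \<in> W \<Longrightarrow> g (scale c x) = scale c (g x)"
    "inj_on g W" "g ` W = W" "\<And>x. x \<in> W \<Longrightarrow> g x \<in> W" "\<And>x. x \<notin> W \<Longrightarrow> g x = 0"
  using assms by (auto simp: aut_def bij_betw_def)

text \<open>Injectivity follows from surjectivity by finiteness.\<close>

lemma autI:
  assumes "\<And>x y. x \<in> W \<Longrightarrow> y \<in> W \<Longrightarrow> g (x + y) = g x + g y"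
    "\<And>c x. x \<in> W \<Longrightarrow> g (scale c x) = scale c (g x)"
    "g ` W = W" "\<And>x. x \<notin> W \<Longrightarrow> g x = 0"
  shows "g \<in> aut W"
  using assms eq_card_imp_inj_on[OF fin_sub, of g W] by (auto simp: aut_def bij_betw_def)

lemma aut_group_UNIV: "aut_group UNIV = GL_group scale"
  using vector_space_axioms
  by (auto simp: aut_group_def GL_group_def aut_def Vector_Spaces.linear_iff fun_eq_iff)

lemma aut_0:
  assumes "subspace W" "g \<in> aut W"
  shows "g 0 = 0"
  using autD(1)[OF assms(2), of 0 0] subspace_0[OF assms(1)] by simp

lemma finite_aut: "finite (aut W)"
proof -
  have "finite (PiE (UNIV :: 'v set) (\<lambda>_. UNIV :: 'v set))"
    by (rule finite_PiE) (auto simp: fin_space)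
  then show ?thesis by (rule rev_finite_subset) (auto simp: PiE_def extensional_def)
qed

lemma aut_group_fin_group:
  assumes W: "subspace W"
  shows "fin_group (aut_group W)"
proof -
  have "group (aut_group W)"
  proof (rule groupI)
    fix g h assume "g \<in> carrier (aut_group W)" "h \<in> carrier (aut_group W)"
    then have gh: "g \<in> aut W" "h \<in> aut W" by auto
    note G = autD[OF gh(1)] and H = autD[OF gh(2)]
    have "(\<lambda>x. if x \<in> W then g (h x) else 0) \<in> aut W"
    proof (rule autI)
      have "(\<lambda>x. if x \<in> W then g (h x) else 0) ` W = g ` (h ` W)" by (auto simp: image_iff)
      then show "(\<lambda>x. if x \<in> W then g (h x) else 0) ` W = W" using G(4) H(4) by simp
    qed (use G H W in \<open>auto simp: subspace_add subspace_scale\<close>)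
    then show "g \<otimes>\<^bsub>aut_group W\<^esub> h \<in> carrier (aut_group W)" by simp
  next
    show "\<one>\<^bsub>aut_group W\<^esub> \<in> carrier (aut_group W)"
      using W by (auto simp: subspace_add subspace_scale intro!: autI)
  next
    fix g assume "g \<in> carrier (aut_group W)"
    then have g: "g \<in> aut W" by simp
    note G = autD[OF g]
    define h where "h x = (if x \<in> W then inv_into W g x else 0)" for x
    have gh: "g (h x) = x" "h x \<in> W" if "x \<in> W" for x
      using that G(4) by (auto simp: h_def f_inv_into_f inv_into_into)
    have hg: "h (g x) = x" if "x \<in> W" for x
      using that G(3,5) by (auto simp: h_def inv_into_f_f)
    have "h \<in> aut W"
    proof (rule autI)
      fix x y assume xy: "x \<in> W" "y \<in> W"
      then have "g (h x + h y) = x + y" using gh G(1) by simp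
      then show "h (x + y) = h x + h y" using hg[of "h x + h y"] gh xy W by (simp add: subspace_add)
    next
      fix c x assume x: "x \<in> W"
      then have "g (scale c (h x)) = scale c x" using gh G(2) by simp
      then show "h (scale c x) = scale c (h x)" using hg[of "scale c (h x)"] gh x W by (simp add: subspace_scale)
    next
      show "h ` W = W" using gh hg G(5) by (auto simp: image_iff) metis
    qed (simp add: h_def)
    then show "\<exists>y\<in>carrier (aut_group W). y \<otimes>\<^bsub>aut_group W\<^esub> g = \<one>\<^bsub>aut_group W\<^esub>"
      using hg by (intro bexI[of _ h]) (auto simp: fun_eq_iff)
  qed (auto simp: fun_eq_iff dest: autD(5) autD(6))
  then show ?thesis
    by (intro fin_group.intro fin_group_axioms.intro) (simp_all add: finite_aut)
qed

lemma aut_image_subspace: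
  assumes "g \<in> aut W" "subspace U" "U \<subseteq> W"
  shows "subspace (g ` U)"
proof -
  note G = autD[OF assms(1)]
  have "0 \<in> g ` U"
    using subspace_0[OF assms(2)] assms(3) G(1)[of 0 0] by (intro image_eqI[of _ _ 0]) auto
  moreover have "g x + g y \<in> g ` U" if "x \<in> U" "y \<in> U" for x y
    using that assms by (intro image_eqI[of _ _ "x + y"]) (auto simp: subspace_add G subsetD)
  moreover have "scale c (g x) \<in> g ` U" if "x \<in> U" for c x
    using that assms by (intro image_eqI[of _ _ "scale c x"]) (auto simp: subspace_scale G subsetD)
  ultimately show ?thesis by (auto simp: subspace_def)
qed

lemma aut_image_span:
  assumes "subspace W" "g \<in> aut W" "S \<subseteq> W"
  shows "g ` span S = span (g ` S)"
proof
  note G = autD[OF assms(2)]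
  have sW: "span S \<subseteq> W" using span_minimal[OF assms(3,1)] .
  show "span (g ` S) \<subseteq> g ` span S"
    by (rule span_minimal) (use aut_image_subspace[OF assms(2) subspace_span sW] in \<open>auto intro: span_base\<close>)
  have "subspace {x \<in> W. g x \<in> span (g ` S)}"
    using assms(1) aut_0[OF assms(1,2)]
    by (auto simp: subspace_def G span_add span_scale span_zero)
  then have "span S \<subseteq> {x \<in> W. g x \<in> span (g ` S)}"
    by (rule span_minimal[rotated]) (use assms(3) in \<open>auto intro: span_base\<close>)
  then show "g ` span S \<subseteq> span (g ` S)" by auto
qed

text \<open>Each further basis vector multiplies the number of elements by the size of the field.
  Dimensions are later compared by counting elements.\<close>

lemma card_span_independent:
  assumes "independent B"
  shows "card (span B) = card (UNIV :: 'k set) ^ card B"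
proof -
  have "finite B" by (rule fin_sub)
  then show ?thesis using assms
  proof (induction B rule: finite_induct)
    case (insert a B)
    have ind: "independent B" "a \<notin> span B"
      using insert.prems insert.hyps by (auto simp: independent_insert)
    have "bij_betw (\<lambda>(c, u). scale c a + u) (UNIV \<times> span B) (span (insert a B))"
    proof (rule bij_betw_imageI)
      show "inj_on (\<lambda>(c, u). scale c a + u) (UNIV \<times> span B)"
      proof (rule inj_onI, clarsimp)
        fix c u c' u' assume u: "u \<in> span B" "u' \<in> span B" and eq: "scale c a + u = scale c' a + u'"
        have "scale (c - c') a = u' - u" using eq by (simp add: scale_left_diff_distrib algebra_simps)
        then have m: "scale (c - c') a \<in> span B" using u by (simp add: span_diff)
        have "c = c'"
        proof (rule ccontr)
          assume "c \<noteq> c'"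
          then have "scale (inverse (c - c')) (scale (c - c') a) = a" by simp
          moreover have "scale (inverse (c - c')) (scale (c - c') a) \<in> span B" by (rule span_scale[OF m])
          ultimately show False using ind(2) by simp
        qed
        then show "c = c' \<and> u = u'" using eq by simp
      qed
      show "(\<lambda>(c, u). scale c a + u) ` (UNIV \<times> span B) = span (insert a B)"
        unfolding span_insert
      proof (intro equalityI subsetI)
        fix x assume "x \<in> {x. \<exists>k. x - scale k a \<in> span B}"
        then obtain k where "x - scale k a \<in> span B" by auto
        then show "x \<in> (\<lambda>(c, u). scale c a + u) ` (UNIV \<times> span B)"
          by (intro image_eqI[of _ _ "(k, x - scale k a)"]) auto
      next
        fix x assume "x \<in> (\<lambda>(c, u). scale c a + u) ` (UNIV \<times> span B)"
        then obtain c u where "x = scale c a + u" "u \<in> span B" by auto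
        then show "x \<in> {x. \<exists>k. x - scale k a \<in> span B}" by (intro CollectI exI[of _ c]) simp
      qed
    qed
    then have "card (span (insert a B)) = card (UNIV \<times> span B :: ('k \<times> 'v) set)"
      by (simp add: bij_betw_same_card)
    then show ?case using insert ind by (simp add: card_cartesian_product)
  qed simp
qed

lemma card_subspace:
  assumes "subspace U"
  shows "card U = card (UNIV :: 'k set) ^ dim U"
proof -
  obtain B where B: "B \<subseteq> U" "independent B" "U \<subseteq> span B" "card B = dim U"
    using basis_exists by metis
  then have "U = span B" using assms span_minimal[of B U] by auto
  then show ?thesis using card_span_independent[OF B(2)] B(4) by simp
qed

lemma CARD_field_gt_1: "card (UNIV :: 'k set) > 1"
proof -
  have "card {0, 1 :: 'k} \<le> card (UNIV :: 'k set)" by (rule card_mono) auto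
  then show ?thesis by simp
qed

lemma dim_eq_iff_card_eq:
  assumes "subspace U" "subspace U'"
  shows "dim U = dim U' \<longleftrightarrow> card U = card U'"
  using CARD_field_gt_1 by (simp add: card_subspace[OF assms(1)] card_subspace[OF assms(2)] power_inject_exp)

lemma aut_image_dim:
  assumes "g \<in> aut W" "subspace U" "U \<subseteq> W"
  shows "dim (g ` U) = dim U"
proof -
  have "card (g ` U) = card U"
    using autD(3)[OF assms(1)] assms(3) by (intro card_image) (rule inj_on_subset)
  then show ?thesis using dim_eq_iff_card_eq[OF aut_image_subspace[OF assms] assms(2)] by simp
qed

text \<open>The linear extension of \<phi> is onto \<open>W\<close> because \<open>C\<close> spans,
  hence bijective by finiteness.\<close>

lemma exists_aut_extending:
  assumes B: "independent B" "span B = W" and C: "span C = W" and \<phi>: "\<phi> ` B = C"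
  obtains g where "g \<in> aut W" "\<And>x. x \<in> B \<Longrightarrow> g x = \<phi> x"
proof -
  interpret vp: vector_space_pair scale scale ..
  obtain f where f: "Vector_Spaces.linear scale scale f" "\<And>x. x \<in> B \<Longrightarrow> f x = \<phi> x"
    using vp.linear_independent_extend[OF B(1), of \<phi>] by auto
  have "f ` W = span (f ` B)" using vp.linear_span_image[OF f(1), of B] B(2) by simp
  also have "f ` B = C" using f(2) \<phi> by auto
  finally have fW: "f ` W = W" using C by simp
  define g where "g x = (if x \<in> W then f x else 0)" for x
  have sW: "subspace W" using B(2) by (metis subspace_span)
  have "g \<in> aut W"
  proof (rule autI)
    show "g ` W = W" using fW by (auto simp: g_def image_iff)
  qed (use f(1) sW in \<open>auto simp: g_def Vector_Spaces.linear_iff subspace_add subspace_scale\<close>)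
  moreover have "g x = \<phi> x" if "x \<in> B" for x
    using that f(2) span_base[OF that] B(2) by (simp add: g_def)
  ultimately show thesis using that by blast
qed

lemma span_Int_independent:
  assumes "independent B" "S \<subseteq> B" "T \<subseteq> B"
  shows "span S \<inter> span T = span (S \<inter> T)"
proof
  show "span (S \<inter> T) \<subseteq> span S \<inter> span T" by (simp add: span_mono)
  show "span S \<inter> span T \<subseteq> span (S \<inter> T)"
  proof
    fix x assume x: "x \<in> span S \<inter> span T"
    have "representation B x = representation S x" "representation B x = representation T x"
      using x assms by (auto intro: representation_extend)
    then have "b \<in> S \<inter> T" if "representation B x b \<noteq> 0" for b
      using that by (auto intro!: representation_ne_zero[of S x b] representation_ne_zero[of T x b])
    moreover have "x \<in> span B" using x assms(2) span_mono by blast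
    then have "(\<Sum>b | representation B x b \<noteq> 0. scale (representation B x b) b) = x"
      using sum_nonzero_representation_eq[OF assms(1)] by simp
    ultimately show "x \<in> span (S \<inter> T)"
      by (metis (mono_tags, lifting) mem_Collect_eq span_base span_scale span_sum)
  qed
qed

subsection \<open>Flags\<close>

text \<open>Values beyond \<open>N\<close> are empty, so that equality of functions is equality of
  flags. Zero jumps are allowed, because intersecting a flag with a summand of \<open>W\<close>
  keeps the number of steps.\<close>

definition flags :: "nat \<Rightarrow> 'v set \<Rightarrow> (nat \<Rightarrow> int) \<Rightarrow> (nat \<Rightarrow> 'v set) set" where
  "flags N W a = {F. (\<forall>i>N. F i = {}) \<and> (\<forall>i\<le>N. subspace (F i)) \<and> F 0 = {0} \<and> F N = W \<and>
     (\<forall>i<N. F i \<subseteq> F (Suc i) \<and> int (dim (F (Suc i))) = int (dim (F i)) + a i)}"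

lemma flagsD:
  assumes "F \<in> flags N W a"
  shows "\<And>i. i > N \<Longrightarrow> F i = {}" "\<And>i. i \<le> N \<Longrightarrow> subspace (F i)" "F 0 = {0}" "F N = W"
    "\<And>i. i < N \<Longrightarrow> F i \<subseteq> F (Suc i)" "\<And>i. i < N \<Longrightarrow> int (dim (F (Suc i))) = int (dim (F i)) + a i"
  using assms by (auto simp: flags_def)

lemma flags_mono:
  assumes "F \<in> flags N W a" "i \<le> j" "j \<le> N"
  shows "F i \<subseteq> F j"
  using assms(2,3)
proof (induction j rule: dec_induct)
  case (step n)
  then show ?case using flagsD(5)[OF assms(1), of n] by auto
qed simp

lemma flags_subset: "F \<in> flags N W a \<Longrightarrow> F i \<subseteq> W"
  using flags_mono[of F N W a i N] flagsD(1)[of F N W a i] flagsD(4)[of F N W a] by (cases "i \<le> N") auto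

lemma flags_cong: "(\<And>i. i < N \<Longrightarrow> a i = b i) \<Longrightarrow> flags N W a = flags N W b"
  by (auto simp: flags_def)

lemma flags_dim:
  assumes "F \<in> flags N W a" "i \<le> N"
  shows "int (dim (F i)) = (\<Sum>j<i. a j)"
  using assms(2)
proof (induction i)
  case 0
  then show ?case using flagsD(3)[OF assms(1)] by simp
next
  case (Suc i)
  then show ?case using flagsD(6)[OF assms(1), of i] by simp
qed

lemma finite_flags: "finite (flags N W a)"
proof -
  have "finite (PiE {..N} (\<lambda>_. UNIV :: 'v set set))"
    by (rule finite_PiE) (auto simp: fin_space Finite_Set.finite_set)
  then have "finite ((\<lambda>F i. if i \<le> N then F i else {}) ` PiE {..N} (\<lambda>_. UNIV :: 'v set set))" by simp
  moreover have "flags N W a \<subseteq> (\<lambda>F i. if i \<le> N then F i else {}) ` PiE {..N} (\<lambda>_. UNIV :: 'v set set)"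
  proof
    fix F assume F: "F \<in> flags N W a"
    then have "F = (\<lambda>i. if i \<le> N then (restrict F {..N}) i else {})"
      using flagsD(1)[OF F] by (auto simp: fun_eq_iff)
    then show "F \<in> (\<lambda>F i. if i \<le> N then F i else {}) ` PiE {..N} (\<lambda>_. UNIV :: 'v set set)"
      by (rule image_eqI[where x = "restrict F {..N}"]) auto
  qed
  ultimately show ?thesis by (rule finite_subset[rotated])
qed

definition flag_act :: "('v \<Rightarrow> 'v) \<Rightarrow> (nat \<Rightarrow> 'v set) \<Rightarrow> nat \<Rightarrow> 'v set" where
  "flag_act g F = (\<lambda>i. g ` F i)"

lemma flag_act_action:
  assumes W: "subspace W"
  shows "fin_group.is_action (aut_group W) flag_act (flags N W a)"
proof -
  interpret G: fin_group "aut_group W" by (rule aut_group_fin_group[OF W])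
  show ?thesis
    unfolding G.is_action_def
  proof (intro conjI ballI finite_flags)
    fix g F assume g: "g \<in> carrier (aut_group W)" and F: "F \<in> flags N W a"
    then have g: "g \<in> aut W" by simp
    have "dim (g ` F i) = dim (F i)" if "i \<le> N" for i
      using that g flags_subset[OF F] flagsD(2)[OF F] by (intro aut_image_dim) auto
    then show "flag_act g F \<in> flags N W a"
      using flagsD[OF F] flags_subset[OF F] aut_image_subspace[OF g] autD(4)[OF g] aut_0[OF W g]
      unfolding flags_def flag_act_def by (auto simp: image_mono)
  next
    fix F assume F: "F \<in> flags N W a"
    show "flag_act \<one>\<^bsub>aut_group W\<^esub> F = F"
      using flags_subset[OF F] by (fastforce simp: flag_act_def fun_eq_iff image_iff)
  next
    fix g h F assume F: "F \<in> flags N W a"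
    show "flag_act (g \<otimes>\<^bsub>aut_group W\<^esub> h) F = flag_act g (flag_act h F)"
    proof
      fix i
      have "(\<lambda>x. if x \<in> W then g (h x) else 0) ` F i = (\<lambda>x. g (h x)) ` F i"
        using flags_subset[OF F] by (intro image_cong) auto
      then show "flag_act (g \<otimes>\<^bsub>aut_group W\<^esub> h) F i = flag_act g (flag_act h F) i"
        by (simp add: flag_act_def image_image)
    qed
  qed
qed

text \<open>Basis vectors are added in the order of their colours; those of colour \<open>i\<close>
  enter at index \<open>Suc i\<close>.\<close>

definition colour_flag :: "nat \<Rightarrow> 'v set \<Rightarrow> ('v \<Rightarrow> nat) \<Rightarrow> nat \<Rightarrow> 'v set" where
  "colour_flag N B c = (\<lambda>i. if i \<le> N then span {x \<in> B. c x < i} else {})"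

lemma card_less_Suc:
  assumes "finite B"
  shows "card {x \<in> B. c x < Suc i} = card {x \<in> B. c x < (i::nat)} + card {x \<in> B. c x = i}"
proof -
  have "{x \<in> B. c x < Suc i} = {x \<in> B. c x < i} \<union> {x \<in> B. c x = i}" by auto
  also have "card \<dots> = card {x \<in> B. c x < i} + card {x \<in> B. c x = i}"
    using assms by (intro card_Un_disjoint) auto
  finally show ?thesis .
qed

lemma dim_span_subset_independent: "independent B \<Longrightarrow> S \<subseteq> B \<Longrightarrow> dim (span S) = card S"
  using dim_span_eq_card_independent independent_mono by blast

lemma colour_flag_in_flags:
  assumes B: "independent B" "span B = W" and c: "c ` B \<subseteq> {..<N}"
  shows "colour_flag N B c \<in> flags N W a \<longleftrightarrow> colouring N a B c"
proof -
  have BN: "{x \<in> B. c x < N} = B" using c by auto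
  have dim: "dim {x \<in> B. c x < i} = card {x \<in> B. c x < i}" for i
    using dim_span_subset_independent[OF B(1), of "{x \<in> B. c x < i}"] by auto
  have "span {x \<in> B. c x < i} \<subseteq> span {x \<in> B. c x < Suc i}" for i by (intro span_mono) auto
  then show ?thesis
    using c B(2) BN
    by (auto simp: flags_def colour_flag_def colouring_def dim card_less_Suc[OF fin_sub] subspace_span)
qed

lemma colour_flag_act:
  assumes W: "subspace W" and g: "g \<in> aut W" and B: "span B = W"
    and gB: "g ` B = C" "\<And>x. x \<in> B \<Longrightarrow> e (g x) = c x"
  shows "flag_act g (colour_flag N B c) = colour_flag N C e"
proof
  fix i
  have "g ` {x \<in> B. c x < i} = {y \<in> C. e y < i}" using gB by auto
  moreover have "{x \<in> B. c x < i} \<subseteq> W" using B span_superset by blast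
  ultimately show "flag_act g (colour_flag N B c) i = colour_flag N C e i"
    using aut_image_span[OF W g, of "{x \<in> B. c x < i}"] by (simp add: flag_act_def colour_flag_def)
qed

text \<open>The new vectors are taken from \<open>K\<close>. Subtracting their contribution from a
  vector of \<open>K\<close> leaves a vector of \<open>span B \<inter> K\<close>, to which the
  assumption applies.\<close>

lemma adapted_extension:
  assumes B: "independent B" and K: "subspace K" and BK: "span B \<inter> K \<subseteq> span (B \<inter> K)"
  shows "\<exists>B'. B \<subseteq> B' \<and> independent B' \<and> span B' = span (B \<union> K) \<and> K \<subseteq> span (B' \<inter> K)"
proof -
  obtain B' where B': "B \<subseteq> B'" "B' \<subseteq> B \<union> K" "independent B'" "B \<union> K \<subseteq> span B'"
    using maximal_independent_subset_extend[of B "B \<union> K"] B by auto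
  have "K \<subseteq> span (B' \<inter> K)"
  proof
    fix v assume v: "v \<in> K"
    have "B' = B \<union> (B' \<inter> K)" using B'(1,2) by auto
    moreover have "v \<in> span B'" using v B'(4) by auto
    ultimately have "v \<in> span (B \<union> (B' \<inter> K))" by metis
    then obtain t u where tu: "t \<in> span B" "u \<in> span (B' \<inter> K)" "v = t + u"
      unfolding span_Un by auto
    have "u \<in> K" using tu(2) span_minimal[of "B' \<inter> K" K] K by auto
    then have "t \<in> K" using v tu(3) K by (metis add_diff_cancel_right' subspace_diff)
    then have "t \<in> span (B \<inter> K)" using tu(1) BK by auto
    then have "t \<in> span (B' \<inter> K)" using B'(1) span_mono[of "B \<inter> K" "B' \<inter> K"] by auto
    then show "v \<in> span (B' \<inter> K)" using tu by (simp add: span_add)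
  qed
  moreover have "span B' = span (B \<union> K)"
    using B'(2,4) span_mono span_minimal[OF B'(4) subspace_span] by (metis subset_antisym)
  ultimately show ?thesis using B' by blast
qed

lemma span_eq_subspace: "subspace U \<Longrightarrow> span U = U"
  by (simp add: span_eq_iff)

text \<open>A basis adapted to two flags at once, the linear form of the Bruhat decomposition. It
  grows through the refinement of the second flag by the subspaces
  \<open>F' j + (F i \<inter> F' (Suc j))\<close>.\<close>

lemma adapted_basis:
  assumes F: "F \<in> flags N W a" and F': "F' \<in> flags N W b"
  shows "\<exists>B. independent B \<and> span B = W \<and> (\<forall>i\<le>N. F i \<subseteq> span (B \<inter> F i) \<and> F' i \<subseteq> span (B \<inter> F' i))"
proof -
  have step: "\<exists>B'. B \<subseteq> B' \<and> independent B' \<and> span B' = span (F' j \<union> (F i \<inter> F' (Suc j))) \<and>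
      (\<forall>i'\<le>i. F i' \<inter> F' (Suc j) \<subseteq> span (B' \<inter> F i' \<inter> F' (Suc j)))"
    if B: "independent B" "span B = F' j" "\<forall>i\<le>N. F i \<inter> F' j \<subseteq> span (B \<inter> F i \<inter> F' j)"
      and j: "j < N" and i: "i \<le> N" for B j i
    using i
  proof (induction i)
    case 0
    have "0 \<in> F' (Suc j)" "0 \<in> F' j" using flagsD(2)[OF F'] j by (auto intro: subspace_0)
    then have "F' j \<union> (F 0 \<inter> F' (Suc j)) = F' j" using flagsD(3)[OF F] by auto
    then have "span (F' j \<union> (F 0 \<inter> F' (Suc j))) = F' j"
      using span_eq_subspace[OF flagsD(2)[OF F'], of j] j by simp
    moreover have "F 0 \<inter> F' (Suc j) \<subseteq> span S" for S using flagsD(3)[OF F] by (auto intro: span_zero)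
    ultimately show ?case using B by (intro exI[of _ B]) auto
  next
    case (Suc i)
    then obtain B' where B': "B \<subseteq> B'" "independent B'" "span B' = span (F' j \<union> (F i \<inter> F' (Suc j)))"
      "\<forall>i'\<le>i. F i' \<inter> F' (Suc j) \<subseteq> span (B' \<inter> F i' \<inter> F' (Suc j))" by auto
    define K where "K = F (Suc i) \<inter> F' (Suc j)"
    have sub: "subspace (F (Suc i))" "subspace (F i)" "subspace (F' j)" "subspace (F' (Suc j))"
      using flagsD(2)[OF F] flagsD(2)[OF F'] j Suc.prems by auto
    have inc: "F i \<subseteq> F (Suc i)" "F' j \<subseteq> F' (Suc j)"
      using flagsD(5)[OF F] flagsD(5)[OF F'] j Suc.prems by auto
    have K: "subspace K" using sub by (simp add: K_def subspace_inter)
    \<comment> \<open>The modular law: a vector of \<open>K\<close> minus its component in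
      \<open>F i\<close> stays in \<open>F (Suc i)\<close> and lies in \<open>F' j\<close>, where
      \<open>B\<close> is adapted already.\<close>
    have BK: "span B' \<inter> K \<subseteq> span (B' \<inter> K)"
    proof
      fix x assume x: "x \<in> span B' \<inter> K"
      then obtain u v where uv: "u \<in> span (F' j)" "v \<in> span (F i \<inter> F' (Suc j))" "x = u + v"
        unfolding B'(3) span_Un by auto
      have uv': "u \<in> F' j" "v \<in> F i \<inter> F' (Suc j)"
        using uv sub span_eq_subspace subspace_inter by auto
      then have "x - v \<in> F (Suc i)" using x inc sub(1) by (auto simp: K_def intro: subspace_diff)
      then have "u \<in> F (Suc i) \<inter> F' j" using uv' uv(3) by simp
      then have "u \<in> span (B \<inter> F (Suc i) \<inter> F' j)" using B(3) Suc.prems by auto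
      moreover have "B \<inter> F (Suc i) \<inter> F' j \<subseteq> B' \<inter> K" using B'(1) inc by (auto simp: K_def)
      ultimately have "u \<in> span (B' \<inter> K)" using span_mono by blast
      moreover have "v \<in> span (B' \<inter> F i \<inter> F' (Suc j))" using uv' B'(4) by auto
      moreover have "B' \<inter> F i \<inter> F' (Suc j) \<subseteq> B' \<inter> K" using inc by (auto simp: K_def)
      ultimately show "x \<in> span (B' \<inter> K)" using uv(3) span_mono span_add by blast
    qed
    obtain C where C: "B' \<subseteq> C" "independent C" "span C = span (B' \<union> K)" "K \<subseteq> span (C \<inter> K)"
      using adapted_extension[OF B'(2) K BK] by auto
    have "span (B' \<union> K) = span (F' j \<union> K)"
    proof -
      have "span (B' \<union> K) = span (span B' \<union> K)"
        by (simp add: span_Un span_span)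
      also have "\<dots> = span ((F' j \<union> (F i \<inter> F' (Suc j))) \<union> K)"
        unfolding B'(3) by (simp only: span_Un[of "span _"] span_span span_Un[of "F' j \<union> (F i \<inter> F' (Suc j))" K])
      also have "(F' j \<union> (F i \<inter> F' (Suc j))) \<union> K = F' j \<union> K" using inc by (auto simp: K_def)
      finally show ?thesis .
    qed
    moreover have "F i' \<inter> F' (Suc j) \<subseteq> span (C \<inter> F i' \<inter> F' (Suc j))" if "i' \<le> Suc i" for i'
    proof (cases "i' = Suc i")
      case True
      then show ?thesis using C(4) by (simp add: K_def Int_assoc)
    next
      case False
      then have "F i' \<inter> F' (Suc j) \<subseteq> span (B' \<inter> F i' \<inter> F' (Suc j))" using B'(4) that by auto
      also have "\<dots> \<subseteq> span (C \<inter> F i' \<inter> F' (Suc j))" using C(1) by (intro span_mono) auto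
      finally show ?thesis .
    qed
    ultimately show ?case using C B'(1) by (intro exI[of _ C]) (auto simp: K_def)
  qed
  have "\<exists>B. independent B \<and> span B = F' j \<and>
      (\<forall>i\<le>N. \<forall>j'\<le>j. F i \<inter> F' j' \<subseteq> span (B \<inter> F i \<inter> F' j'))" if "j \<le> N" for j
    using that
  proof (induction j)
    case 0
    then show ?case using flagsD(3)[OF F'] independent_empty
      by (intro exI[of _ "{}"]) auto
  next
    case (Suc j)
    then obtain B where B: "independent B" "span B = F' j"
      "\<forall>i\<le>N. \<forall>j'\<le>j. F i \<inter> F' j' \<subseteq> span (B \<inter> F i \<inter> F' j')" by auto
    obtain B' where B': "B \<subseteq> B'" "independent B'" "span B' = span (F' j \<union> (F N \<inter> F' (Suc j)))"
      "\<forall>i'\<le>N. F i' \<inter> F' (Suc j) \<subseteq> span (B' \<inter> F i' \<inter> F' (Suc j))"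
      using step[of B j N] B Suc.prems by auto
    have "F' j \<union> (F N \<inter> F' (Suc j)) = F' (Suc j)"
      using flagsD(4)[OF F] flags_subset[OF F', of "Suc j"] flagsD(5)[OF F', of j] Suc.prems by auto
    then have "span B' = F' (Suc j)"
      using B'(3) span_eq_subspace[OF flagsD(2)[OF F', of "Suc j"]] Suc.prems by simp
    moreover have "F i \<inter> F' j' \<subseteq> span (B' \<inter> F i \<inter> F' j')" if "i \<le> N" "j' \<le> Suc j" for i j'
    proof (cases "j' = Suc j")
      case True
      then show ?thesis using B'(4) that by simp
    next
      case False
      then have "F i \<inter> F' j' \<subseteq> span (B \<inter> F i \<inter> F' j')" using B(3) that by auto
      also have "\<dots> \<subseteq> span (B' \<inter> F i \<inter> F' j')" using B'(1) by (intro span_mono) auto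
      finally show ?thesis .
    qed
    ultimately show ?case using B'(2) by (intro exI[of _ B']) auto
  qed
  from this[of N] obtain B where B: "independent B" "span B = W"
    "\<And>i j. i \<le> N \<Longrightarrow> j \<le> N \<Longrightarrow> F i \<inter> F' j \<subseteq> span (B \<inter> F i \<inter> F' j)"
    using flagsD(4)[OF F'] by auto
  have BW: "B \<subseteq> W" using B(2) span_superset by blast
  have "F i \<subseteq> span (B \<inter> F i) \<and> F' i \<subseteq> span (B \<inter> F' i)" if i: "i \<le> N" for i
  proof -
    have "F i \<inter> W = F i" "B \<inter> F i \<inter> W = B \<inter> F i" "W \<inter> F' i = F' i" "B \<inter> W \<inter> F' i = B \<inter> F' i"
      using BW flags_subset[OF F, of i] flags_subset[OF F', of i] by auto
    then show ?thesis
      using B(3)[OF i, of N] B(3)[OF _ i, of N] flagsD(4)[OF F] flagsD(4)[OF F'] by auto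
  qed
  with B show ?thesis by blast
qed

lemma colour_flag_of_adapted:
  assumes F: "F \<in> flags N W a" and B: "independent B" "span B = W" "\<And>i. i \<le> N \<Longrightarrow> F i \<subseteq> span (B \<inter> F i)"
  obtains c where "c ` B \<subseteq> {..<N}" "F = colour_flag N B c"
proof -
  \<comment> \<open>One less than the first index at which \<open>x\<close> lies in the flag; that
    index is positive because basis vectors are nonzero and \<open>F 0 = {0}\<close>.\<close>
  define c where "c x = (LEAST i. x \<in> F (Suc i))" for x
  have nz: "x \<noteq> 0" if "x \<in> B" for x using that B(1) dependent_zero by blast
  have iff: "x \<in> F i \<longleftrightarrow> c x < i" if x: "x \<in> B" and i: "i \<le> N" for x i
  proof
    assume "x \<in> F i"
    moreover from this nz[OF x] flagsD(3)[OF F] obtain i' where "i = Suc i'" by (cases i) auto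
    ultimately show "c x < i" unfolding c_def by (auto intro: Least_le le_imp_less_Suc)
  next
    assume lt: "c x < i"
    have "x \<in> F N" using x B(2) flagsD(4)[OF F] span_base by blast
    moreover from this nz[OF x] flagsD(3)[OF F] obtain N' where "N = Suc N'" by (cases N) auto
    ultimately have "x \<in> F (Suc (c x))" unfolding c_def by (metis (mono_tags, lifting) LeastI)
    then show "x \<in> F i" using flags_mono[OF F, of "Suc (c x)" i] lt i by auto
  qed
  have "c ` B \<subseteq> {..<N}" using iff[of _ N] B(2) flagsD(4)[OF F] span_base by fastforce
  moreover have "F = colour_flag N B c"
  proof
    fix i
    show "F i = colour_flag N B c i"
    proof (cases "i \<le> N")
      case True
      have "{x \<in> B. c x < i} = B \<inter> F i" using iff True by auto
      moreover have "span (B \<inter> F i) \<subseteq> F i"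
        using flagsD(2)[OF F True] by (intro span_minimal) auto
      ultimately show ?thesis using B(3)[OF True] True by (simp add: colour_flag_def)
    qed (use flagsD(1)[OF F] in \<open>auto simp: colour_flag_def\<close>)
  qed
  ultimately show thesis using that by blast
qed

lemma flags_pair_coloured:
  assumes "F \<in> flags N W a" "F' \<in> flags N W b"
  obtains B c e where "independent B" "span B = W" "colouring N a B c" "colouring N b B e"
    "F = colour_flag N B c" "F' = colour_flag N B e"
proof -
  obtain B where B: "independent B" "span B = W"
    "\<And>i. i \<le> N \<Longrightarrow> F i \<subseteq> span (B \<inter> F i)" "\<And>i. i \<le> N \<Longrightarrow> F' i \<subseteq> span (B \<inter> F' i)"
    using adapted_basis[OF assms] by blast
  obtain c where c: "c ` B \<subseteq> {..<N}" "F = colour_flag N B c"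
    using colour_flag_of_adapted[OF assms(1) B(1,2,3)] by metis
  obtain e where e: "e ` B \<subseteq> {..<N}" "F' = colour_flag N B e"
    using colour_flag_of_adapted[OF assms(2) B(1,2,4)] by metis
  show thesis
    using that[of B c e] B(1,2) c e colour_flag_in_flags[OF B(1,2)] assms by metis
qed

lemma dim_colour_flags_Int:
  assumes "independent B" "i \<le> N" "j \<le> N"
  shows "dim (colour_flag N B c i \<inter> colour_flag N B e j) = card {x \<in> B. c x < i \<and> e x < j}"
proof -
  have "colour_flag N B c i \<inter> colour_flag N B e j = span ({x \<in> B. c x < i} \<inter> {x \<in> B. e x < j})"
    using assms by (simp add: colour_flag_def) (intro span_Int_independent, auto)
  also have "{x \<in> B. c x < i} \<inter> {x \<in> B. e x < j} = {x \<in> B. c x < i \<and> e x < j}" by auto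
  finally show ?thesis
    using dim_span_subset_independent[OF assms(1), of "{x \<in> B. c x < i \<and> e x < j}"] by auto
qed

text \<open>The entry \<open>(i, j)\<close> is the mixed second difference of the dimensions of the
  intersections of members of the two flags. These dimensions do not depend on the adapted
  basis.\<close>

lemma colour_matrix_unique:
  assumes B: "independent B" "c ` B \<subseteq> {..<N}" "e ` B \<subseteq> {..<N}"
    and C: "independent C" "c' ` C \<subseteq> {..<N}" "e' ` C \<subseteq> {..<N}"
    and eq: "colour_flag N B c = colour_flag N C c'" "colour_flag N B e = colour_flag N C e'"
  shows "colour_matrix N B c e = colour_matrix N C c' e'"
proof
  fix i
  have r: "card {x \<in> B. c x < i \<and> e x < j} = card {x \<in> C. c' x < i \<and> e' x < j}" if "i \<le> N" "j \<le> N" for i j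
    using dim_colour_flags_Int[OF B(1) that, of c e] dim_colour_flags_Int[OF C(1) that, of c' e'] eq by simp
  have cell: "int (card {x \<in> S. f x = i \<and> h x = j})
      = int (card {x \<in> S. f x < Suc i \<and> h x < Suc j}) - int (card {x \<in> S. f x < i \<and> h x < Suc j})
      - (int (card {x \<in> S. f x < Suc i \<and> h x < j}) - int (card {x \<in> S. f x < i \<and> h x < j}))"
    for f h :: "'v \<Rightarrow> nat" and S i j
  proof -
    have 1: "card {x \<in> {x \<in> S. h x < k}. f x < Suc i}
        = card {x \<in> {x \<in> S. h x < k}. f x < i} + card {x \<in> {x \<in> S. h x < k}. f x = i}" for k
      by (rule card_less_Suc[OF fin_sub])
    have 2: "card {x \<in> {x \<in> S. f x = i}. h x < Suc j}
        = card {x \<in> {x \<in> S. f x = i}. h x < j} + card {x \<in> {x \<in> S. f x = i}. h x = j}"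
      by (rule card_less_Suc[OF fin_sub])
    show ?thesis using 1[of "Suc j"] 1[of j] 2 by (simp add: conj_ac)
  qed
  show "colour_matrix N B c e i = colour_matrix N C c' e' i"
  proof (cases "i < N")
    case i: True
    show ?thesis
    proof (rule multiset_eqI)
      fix j
      have "card {x \<in> B. c x = i \<and> e x = j} = card {x \<in> C. c' x = i \<and> e' x = j}"
      proof (cases "j < N")
        case True
        then have "int (card {x \<in> B. c x = i \<and> e x = j}) = int (card {x \<in> C. c' x = i \<and> e' x = j})"
          unfolding cell using i r by simp
        then show ?thesis by simp
      next
        case False
        then have "{x \<in> B. c x = i \<and> e x = j} = {}" "{x \<in> C. c' x = i \<and> e' x = j} = {}"
          using B(3) C(3) by auto
        then show ?thesis by (simp only: card.empty)
      qed
      then show "count (colour_matrix N B c e i) j = count (colour_matrix N C c' e' i) j"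
        by (simp add: count_colour_matrix[OF fin_sub i])
    qed
  qed (simp add: colour_matrix_def)
qed

text \<open>The relative position of two flags. By \<open>colour_matrix_unique\<close> every adapted
  basis gives the same matrix.\<close>

definition flag_pair_matrix :: "nat \<Rightarrow> 'v set \<Rightarrow> (nat \<Rightarrow> 'v set) \<times> (nat \<Rightarrow> 'v set) \<Rightarrow> nat \<Rightarrow> nat multiset" where
  "flag_pair_matrix N W p = (SOME m. \<exists>B c e. independent B \<and> span B = W \<and> c ` B \<subseteq> {..<N} \<and>
     e ` B \<subseteq> {..<N} \<and> p = (colour_flag N B c, colour_flag N B e) \<and> m = colour_matrix N B c e)"

lemma flag_pair_matrix_eq:
  assumes "independent B" "span B = W" "c ` B \<subseteq> {..<N}" "e ` B \<subseteq> {..<N}"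
  shows "flag_pair_matrix N W (colour_flag N B c, colour_flag N B e) = colour_matrix N B c e"
  unfolding flag_pair_matrix_def
proof (rule some_equality)
  fix m assume "\<exists>B' c' e'. independent B' \<and> span B' = W \<and> c' ` B' \<subseteq> {..<N} \<and> e' ` B' \<subseteq> {..<N} \<and>
    (colour_flag N B c, colour_flag N B e) = (colour_flag N B' c', colour_flag N B' e') \<and>
    m = colour_matrix N B' c' e'"
  then show "m = colour_matrix N B c e"
    using colour_matrix_unique[OF assms(1,3,4)] by (metis prod.inject)
qed (use assms in blast)

definition hchar :: "nat \<Rightarrow> 'v set \<Rightarrow> (nat \<Rightarrow> int) \<Rightarrow> ('v \<Rightarrow> 'v) \<Rightarrow> nat" where
  "hchar N W a g = card {F \<in> flags N W a. \<forall>i. g ` F i = F i}"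

lemma hchar_eq_fix_count: "hchar N W a g = fix_count flag_act (flags N W a) g"
  by (simp add: hchar_def fix_count_def flag_act_def fun_eq_iff)

text \<open>The relative position is a complete invariant of the orbits on pairs of flags, and it
  takes all matrices with margins \<open>a\<close> and \<open>b\<close> as values, so Burnside's
  lemma applies.\<close>

theorem hchar_inner:
  assumes W: "subspace W" and a: "(\<Sum>i<N. a i) = int (dim W)"
  shows "(\<Sum>g\<in>aut W. hchar N W a g * hchar N W b g) = card (aut W) * card (nat_mats N a b)"
proof -
  interpret G: fin_group "aut_group W" by (rule aut_group_fin_group[OF W])
  let ?X = "flags N W a \<times> flags N W b"
  define act where "act g = map_prod (flag_act g) (flag_act g)" for g
  note A = G.is_actionD[OF flag_act_action[OF W, of N a]]
  note A' = G.is_actionD[OF flag_act_action[OF W, of N b]]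
  have act: "G.is_action act ?X"
    unfolding G.is_action_def act_def using A A' by auto
  have fc: "fix_count act ?X g = hchar N W a g * hchar N W b g" for g
  proof -
    have "{x \<in> ?X. act g x = x}
        = {F \<in> flags N W a. flag_act g F = F} \<times> {F \<in> flags N W b. flag_act g F = F}"
      by (auto simp: act_def)
    then show ?thesis by (simp add: hchar_eq_fix_count fix_count_def card_cartesian_product)
  qed
  have inv: "flag_pair_matrix N W x = flag_pair_matrix N W y
      \<longleftrightarrow> (\<exists>g\<in>carrier (aut_group W). act g x = y)" if x: "x \<in> ?X" and y: "y \<in> ?X" for x y
  proof -
    obtain F F' where x_eq: "x = (F, F')" "F \<in> flags N W a" "F' \<in> flags N W b" using x by auto
    obtain E E' where y_eq: "y = (E, E')" "E \<in> flags N W a" "E' \<in> flags N W b" using y by auto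
    obtain B c e where B: "independent B" "span B = W" "colouring N a B c" "colouring N b B e"
      "F = colour_flag N B c" "F' = colour_flag N B e"
      using flags_pair_coloured[OF x_eq(2,3)] .
    obtain C c' e' where C: "independent C" "span C = W" "colouring N a C c'" "colouring N b C e'"
      "E = colour_flag N C c'" "E' = colour_flag N C e'"
      using flags_pair_coloured[OF y_eq(2,3)] .
    have im: "c ` B \<subseteq> {..<N}" "e ` B \<subseteq> {..<N}" "c' ` C \<subseteq> {..<N}" "e' ` C \<subseteq> {..<N}"
      using B C by (auto simp: colouring_def)
    have mx: "flag_pair_matrix N W x = colour_matrix N B c e"
      using flag_pair_matrix_eq[OF B(1,2) im(1,2)] x_eq B by simp
    have my: "flag_pair_matrix N W y = colour_matrix N C c' e'"
      using flag_pair_matrix_eq[OF C(1,2) im(3,4)] y_eq C by simp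
    show ?thesis
    proof
      assume "flag_pair_matrix N W x = flag_pair_matrix N W y"
      then have "colour_matrix N B c e = colour_matrix N C c' e'" using mx my by simp
      from colour_matrix_eq_imp_bij[OF fin_sub fin_sub im(1,3) this]
      obtain \<phi> where \<phi>: "bij_betw \<phi> B C" "\<forall>x\<in>B. c' (\<phi> x) = c x \<and> e' (\<phi> x) = e x" by auto
      obtain g where g: "g \<in> aut W" "\<And>x. x \<in> B \<Longrightarrow> g x = \<phi> x"
        using exists_aut_extending[OF B(1,2) C(2)] \<phi>(1) unfolding bij_betw_def by metis
      have gB: "g ` B = C" using g(2) \<phi>(1) by (auto simp: bij_betw_def image_iff)
      have "flag_act g F = E" "flag_act g F' = E'"
        unfolding B(5,6) C(5,6) using g \<phi>(2) by (auto intro!: colour_flag_act[OF W g(1) B(2) gB])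
      then show "\<exists>g\<in>carrier (aut_group W). act g x = y"
        using g(1) x_eq y_eq by (intro bexI[of _ g]) (auto simp: act_def)
    next
      assume "\<exists>g\<in>carrier (aut_group W). act g x = y"
      then obtain g where g: "g \<in> aut W" "act g x = y" by auto
      have BW: "B \<subseteq> W" using B(2) span_superset by blast
      have inj: "inj_on g B" using autD(3)[OF g(1)] BW by (rule inj_on_subset)
      \<comment> \<open>The colours are carried along by \<open>g\<close>, so that the image basis
        is adapted to the second pair of flags and has the same matrix.\<close>
      define c2 where "c2 y = c (inv_into B g y)" for y
      define e2 where "e2 y = e (inv_into B g y)" for y
      have c2: "c2 (g x) = c x" "e2 (g x) = e x" if "x \<in> B" for x
        using that inj by (auto simp: c2_def e2_def)
      have sp: "span (g ` B) = W"
        using aut_image_span[OF W g(1) BW] B(2) autD(4)[OF g(1)] by simp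
      have "card (g ` B) = dim W"
        using card_image[OF inj] dim_span_eq_card_independent[OF B(1)] B(2) by simp
      then have ind: "independent (g ` B)"
        using card_eq_dim[of "g ` B" W] sp span_superset[of "g ` B"] fin_sub by auto
      have "E = colour_flag N (g ` B) c2" "E' = colour_flag N (g ` B) e2"
        using g(2) x_eq(1) y_eq(1) colour_flag_act[OF W g(1) B(2) refl, of c2 c] B(5)
          colour_flag_act[OF W g(1) B(2) refl, of e2 e] B(6) c2 by (auto simp: act_def)
      moreover have "c2 ` (g ` B) \<subseteq> {..<N}" "e2 ` (g ` B) \<subseteq> {..<N}"
        using c2 im(1,2) by (auto simp: image_subset_iff)
      ultimately have "flag_pair_matrix N W y = colour_matrix N (g ` B) c2 e2"
        using flag_pair_matrix_eq[OF ind sp, of c2 N e2] y_eq(1) by simp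
      also have "\<dots> = colour_matrix N B c e"
        using c2 inj by (intro colour_matrix_bij[of B g, symmetric]) (auto simp: bij_betw_def fin_sub)
      finally show "flag_pair_matrix N W x = flag_pair_matrix N W y" using mx by simp
    qed
  qed
  have "flag_pair_matrix N W ` ?X = nat_mats N a b"
  proof
    show "flag_pair_matrix N W ` ?X \<subseteq> nat_mats N a b"
    proof
      fix m assume "m \<in> flag_pair_matrix N W ` ?X"
      then obtain F F' where FF: "F \<in> flags N W a" "F' \<in> flags N W b" "m = flag_pair_matrix N W (F, F')" by auto
      obtain B c e where B: "independent B" "span B = W" "colouring N a B c" "colouring N b B e"
        "F = colour_flag N B c" "F' = colour_flag N B e"
        using flags_pair_coloured[OF FF(1,2)] .
      then have "m = colour_matrix N B c e"
        using flag_pair_matrix_eq[OF B(1,2)] FF(3) by (simp add: colouring_def)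
      then show "m \<in> nat_mats N a b" using colour_matrix_in_nat_mats[OF fin_sub B(3,4)] by simp
    qed
    show "nat_mats N a b \<subseteq> flag_pair_matrix N W ` ?X"
    proof
      fix m assume m: "m \<in> nat_mats N a b"
      obtain B where B: "B \<subseteq> W" "independent B" "W \<subseteq> span B" "card B = dim W"
        using basis_exists by metis
      have sB: "span B = W" using span_minimal[OF B(1) W] B(3) by auto
      obtain c e where ce: "colouring N a B c" "colouring N b B e" "colour_matrix N B c e = m"
        using exists_colourings[OF fin_sub m] a B(4) by metis
      have im: "c ` B \<subseteq> {..<N}" "e ` B \<subseteq> {..<N}" using ce by (auto simp: colouring_def)
      have "m = flag_pair_matrix N W (colour_flag N B c, colour_flag N B e)"
        using flag_pair_matrix_eq[OF B(2) sB im] ce(3) by simp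
      then show "m \<in> flag_pair_matrix N W ` ?X"
        using colour_flag_in_flags[OF B(2) sB im(1)] colour_flag_in_flags[OF B(2) sB im(2)] ce by auto
    qed
  qed
  then show ?thesis using G.burnside_invariant[OF act inv] fc by simp
qed

end

subsection \<open>Polynomials over a field\<close>

text \<open>\<open>e\<close> is a nonzero element of least degree in the ideal generated by
  \<open>p\<close> and \<open>q\<close>; division with remainder shows that it divides both.\<close>

lemma poly_bezout:
  fixes p q :: "'a::field poly"
  assumes "p \<noteq> 0"
  obtains e u w where "e = u * p + w * q" "e dvd p" "e dvd q"
proof -
  define I where "I = {u * p + w * q | u w. True}"
  have "p \<in> I" unfolding I_def by (auto intro: exI[of _ 1] exI[of _ 0])
  then have "\<exists>e. e \<in> I \<and> e \<noteq> 0" using assms by auto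
  then obtain e where e: "e \<in> I" "e \<noteq> 0" "\<And>f. f \<in> I \<Longrightarrow> f \<noteq> 0 \<Longrightarrow> degree e \<le> degree f"
    using ex_has_least_nat[of "\<lambda>e. e \<in> I \<and> e \<noteq> 0" _ degree] by metis
  have dvd: "e dvd f" if f: "f \<in> I" for f
  proof (rule ccontr)
    assume "\<not> e dvd f"
    then have nz: "f mod e \<noteq> 0" by (simp add: dvd_eq_mod_eq_0)
    obtain u w where uw: "e = u * p + w * q" using e(1) by (auto simp: I_def)
    obtain u' w' where uw': "f = u' * p + w' * q" using f by (auto simp: I_def)
    have "f mod e = f - (f div e) * e" by (simp add: minus_div_mult_eq_mod)
    also have "\<dots> = (u' - (f div e) * u) * p + (w' - (f div e) * w) * q"
      by (subst (2) uw, subst (1) uw') (simp add: algebra_simps)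
    finally have "f mod e \<in> I" unfolding I_def by blast
    from e(3)[OF this nz] show False using degree_mod_less[OF e(2), of f] nz by auto
  qed
  have "q \<in> I" unfolding I_def by (auto intro: exI[of _ 0] exI[of _ 1])
  moreover obtain u w where "e = u * p + w * q" using e(1) by (auto simp: I_def)
  ultimately show thesis using that dvd \<open>p \<in> I\<close> by blast
qed

definition monic_irreducible :: "'a::field poly \<Rightarrow> bool" where
  "monic_irreducible f \<longleftrightarrow> irreducible f \<and> lead_coeff f = 1"

lemma exists_monic_irreducible_factor:
  fixes e :: "'a::field poly"
  assumes "degree e > 0"
  shows "\<exists>f. monic_irreducible f \<and> f dvd e"
proof -
  obtain f where f: "f dvd e" "degree f > 0" "\<And>h. h dvd e \<Longrightarrow> degree h > 0 \<Longrightarrow> degree f \<le> degree h"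
    using ex_has_least_nat[of "\<lambda>f. f dvd e \<and> degree f > 0" e degree] assms by auto
  have f0: "f \<noteq> 0" using f(2) by auto
  define h where "h = Polynomial.smult (inverse (lead_coeff f)) f"
  have h: "degree h = degree f" "lead_coeff h = 1" "h dvd e" "h \<noteq> 0"
    using f0 f(1) by (auto simp: h_def smult_dvd_iff)
  have "irreducible h"
  proof (rule irreducibleI)
    fix a b assume ab: "h = a * b"
    then have nz: "a \<noteq> 0" "b \<noteq> 0" using h(4) by auto
    have "a dvd e" using ab h(3) by (metis dvd_mult_left)
    then have "degree a = 0 \<or> degree f \<le> degree a" using f(3) by blast
    moreover have "degree f = degree a + degree b" using ab nz h(1) by (simp add: degree_mult_eq)
    ultimately show "a dvd 1 \<or> b dvd 1" using nz by (auto simp: is_unit_iff_degree)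
  qed (use h f(2) in \<open>auto simp: is_unit_iff_degree\<close>)
  then show ?thesis using h unfolding monic_irreducible_def by blast
qed

lemma monic_irreducible_prime: "monic_irreducible f \<Longrightarrow> f dvd p * q \<longleftrightarrow> f dvd p \<or> f dvd q"
  by (metis dvd_mult dvd_mult2 field_poly_irreducible_imp_prime monic_irreducible_def prime_elem_dvd_mult_iff)

lemma monic_irreducible_degree: "monic_irreducible f \<Longrightarrow> degree f > 0"
  unfolding monic_irreducible_def irreducible_def by (auto simp: is_unit_iff_degree)

lemma monic_irreducible_dvd_eq:
  assumes "monic_irreducible f" "monic_irreducible h" "h dvd f"
  shows "h = f"
proof -
  from assms(3) obtain c where c: "f = h * c" by (rule dvdE) (rule that)
  have "\<not> h dvd 1" using assms(2) by (auto simp: monic_irreducible_def irreducible_def)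
  moreover have "h dvd 1 \<or> c dvd 1" using assms(1) c irreducibleD by (metis monic_irreducible_def)
  ultimately have "c dvd 1" by blast
  then obtain k where k: "c = [:k:]" by (metis is_unit_poly_iff)
  have "lead_coeff f = lead_coeff h * k" unfolding c k by (simp add: lead_coeff_mult)
  then have "k = 1" using assms(1,2) by (simp add: monic_irreducible_def)
  with c k show ?thesis by simp
qed

text \<open>The irreducible factors that the minimal polynomial of a \<open>d\<close>-regular
  element must not have.\<close>

definition singular_factor :: "nat \<Rightarrow> 'a::field poly \<Rightarrow> bool" where
  "singular_factor d f \<longleftrightarrow> monic_irreducible f \<and> d dvd degree f \<and> f \<noteq> [:-1, 1:]"

definition regular_poly :: "nat \<Rightarrow> 'a::field poly \<Rightarrow> bool" where
  "regular_poly d p \<longleftrightarrow> p \<noteq> 0 \<and> (\<forall>f. singular_factor d f \<longrightarrow> \<not> f dvd p)"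

definition singular_poly :: "nat \<Rightarrow> 'a::field poly \<Rightarrow> bool" where
  "singular_poly d p \<longleftrightarrow> p \<noteq> 0 \<and> (\<forall>f. monic_irreducible f \<and> f dvd p \<longrightarrow> singular_factor d f)"

lemma regular_poly_1: "regular_poly d 1"
  unfolding regular_poly_def singular_factor_def monic_irreducible_def irreducible_def by auto

lemma singular_poly_1: "singular_poly d 1"
  unfolding singular_poly_def monic_irreducible_def irreducible_def by auto

lemma regular_poly_mult: "regular_poly d p \<Longrightarrow> regular_poly d q \<Longrightarrow> regular_poly d (p * q)"
  unfolding regular_poly_def singular_factor_def by (auto simp: monic_irreducible_prime)

lemma singular_poly_mult: "singular_poly d p \<Longrightarrow> singular_poly d q \<Longrightarrow> singular_poly d (p * q)"
  unfolding singular_poly_def by (auto simp: monic_irreducible_prime)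

lemma singular_factor_singular_poly: "singular_factor d f \<Longrightarrow> singular_poly d f"
  unfolding singular_poly_def
  using monic_irreducible_dvd_eq[of f] by (auto simp: singular_factor_def monic_irreducible_def)

text \<open>A common divisor of positive degree would have a monic irreducible factor that is both
  singular and not singular.\<close>

lemma regular_singular_bezout:
  assumes "regular_poly d p" "singular_poly d q"
  obtains u w where "u * p + w * q = 1"
proof -
  obtain e u w where e: "e = u * p + w * q" "e dvd p" "e dvd q"
    using poly_bezout[of p q] assms(1) by (auto simp: regular_poly_def)
  have "degree e = 0"
  proof (rule ccontr)
    assume "degree e \<noteq> 0"
    then obtain f where f: "monic_irreducible f" "f dvd e" using exists_monic_irreducible_factor[of e] by auto
    then have "f dvd p" "f dvd q" using e(2,3) dvd_trans by blast+
    then show False using assms f(1) by (auto simp: regular_poly_def singular_poly_def)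
  qed
  moreover have "e \<noteq> 0" using e(2) assms(1) by (auto simp: regular_poly_def)
  ultimately have "e dvd 1" by (simp add: is_unit_iff_degree)
  then obtain c where "1 = e * c" by (rule dvdE) (rule that)
  then have "(u * c) * p + (w * c) * q = 1" using e(1) by (simp add: algebra_simps)
  then show thesis by (rule that)
qed

lemma regular_singular_factorization:
  fixes p :: "'a::field poly"
  assumes "p \<noteq> 0"
  shows "\<exists>r s. p = r * s \<and> regular_poly d r \<and> singular_poly d s"
  using assms
proof (induction "degree p" arbitrary: p rule: less_induct)
  case less
  show ?case
  proof (cases "regular_poly d p")
    case True
    then show ?thesis using singular_poly_1 by (intro exI[of _ p] exI[of _ 1]) simp
  next
    case False
    then obtain f p' where f: "singular_factor d f" "p = f * p'" using less.prems by (auto simp: regular_poly_def)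
    then have nz: "f \<noteq> 0" "p' \<noteq> 0" using less.prems by auto
    have "degree p' < degree p"
      using f nz monic_irreducible_degree[of f] by (simp add: degree_mult_eq singular_factor_def)
    from less.hyps[OF this nz(2)] obtain r s where "p' = r * s" "regular_poly d r" "singular_poly d s" by auto
    then show ?thesis
      using f singular_poly_mult[OF singular_factor_singular_poly[OF f(1)]]
      by (intro exI[of _ r] exI[of _ "f * s"]) auto
  qed
qed

section \<open>Regular and singular parts of an automorphism\<close>

context fin_vs
begin

subsection \<open>Polynomials in an automorphism\<close>

definition pev :: "'k poly \<Rightarrow> ('v \<Rightarrow> 'v) \<Rightarrow> 'v \<Rightarrow> 'v" where
  "pev p g v = poly_at_endo scale p g v"

lemma aut_pow_mem: "g \<in> aut W \<Longrightarrow> v \<in> W \<Longrightarrow> (g ^^ i) v \<in> W"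
  by (induction i) (auto intro: autD(5))

lemma pev_eq_sum: "degree p \<le> n \<Longrightarrow> pev p g v = (\<Sum>i\<le>n. scale (poly.coeff p i) ((g ^^ i) v))"
  unfolding pev_def poly_at_endo_def
  by (rule sum.mono_neutral_left) (auto simp: coeff_eq_0)

lemma pev_0 [simp]: "pev 0 g v = 0"
  by (simp add: pev_def poly_at_endo_def)

lemma pev_const: "pev [:a:] g v = scale a v"
  by (simp add: pev_def poly_at_endo_def)

lemma pev_1 [simp]: "pev 1 g v = v"
  by (simp add: pev_def poly_at_endo_def)

lemma pev_add: "pev (p + q) g v = pev p g v + pev q g v"
proof -
  let ?n = "max (degree p) (degree q)"
  have "degree (p + q) \<le> ?n" by (rule degree_add_le) auto
  then show ?thesis
    by (simp add: pev_eq_sum[of _ ?n] scale_left_distrib sum.distrib)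
qed

lemma pev_smult: "pev (Polynomial.smult c p) g v = scale c (pev p g v)"
  by (simp add: pev_eq_sum[of _ "degree p"] degree_smult_le scale_sum_right)

lemma pev_diff: "pev (p - q) g v = pev p g v - pev q g v"
  using pev_add[of "p - q" q g v] by (simp add: algebra_simps)

lemma pev_mem_stable:
  assumes "subspace U" "\<And>x. x \<in> U \<Longrightarrow> g x \<in> U" "v \<in> U"
  shows "pev p g v \<in> U"
proof -
  have "(g ^^ i) v \<in> U" for i using assms by (induction i) auto
  then show ?thesis unfolding pev_def poly_at_endo_def
    using assms(1) by (auto intro!: subspace_sum subspace_scale)
qed

lemma pev_cong_on:
  assumes "\<And>x. x \<in> U \<Longrightarrow> g x = h x" "\<And>x. x \<in> U \<Longrightarrow> h x \<in> U" "v \<in> U"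
  shows "pev p g v = pev p h v"
proof -
  have "(g ^^ i) v = (h ^^ i) v \<and> (h ^^ i) v \<in> U" for i using assms by (induction i) auto
  then show ?thesis unfolding pev_def poly_at_endo_def by simp
qed

context
  fixes W g
  assumes W: "subspace W" and g: "g \<in> aut W"
begin

lemma aut_sum:
  assumes "finite I" "\<And>i. i \<in> I \<Longrightarrow> f i \<in> W"
  shows "g (\<Sum>i\<in>I. f i) = (\<Sum>i\<in>I. g (f i))"
  using assms
proof (induction I rule: finite_induct)
  case (insert i I)
  then have "(\<Sum>i\<in>I. f i) \<in> W" using W by (auto intro: subspace_sum)
  with insert show ?case using autD(1)[OF g] by simp
qed (simp add: aut_0[OF W g])

lemma pev_mem: "v \<in> W \<Longrightarrow> pev p g v \<in> W"
  using pev_mem_stable[OF W] autD(5)[OF g] by blast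

lemma pev_pCons:
  assumes "v \<in> W"
  shows "pev (pCons a p) g v = scale a v + g (pev p g v)"
proof -
  have m: "scale (poly.coeff p i) ((g ^^ i) v) \<in> W" for i
    using aut_pow_mem[OF g assms] W by (simp add: subspace_scale)
  have "pev (pCons a p) g v = (\<Sum>i\<le>Suc (degree p). scale (poly.coeff (pCons a p) i) ((g ^^ i) v))"
    by (rule pev_eq_sum) (rule degree_pCons_le)
  also have "\<dots> = scale a v + (\<Sum>i\<le>degree p. scale (poly.coeff p i) (g ((g ^^ i) v)))"
    by (simp add: sum.atMost_Suc_shift del: sum.atMost_Suc)
  also have "(\<Sum>i\<le>degree p. scale (poly.coeff p i) (g ((g ^^ i) v))) = g (pev p g v)"
    unfolding pev_def poly_at_endo_def
    using m aut_pow_mem[OF g assms] autD(2)[OF g] by (subst aut_sum) auto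
  finally show ?thesis .
qed

lemma pev_mult:
  assumes "v \<in> W"
  shows "pev (p * q) g v = pev p g (pev q g v)"
proof (induction p)
  case (pCons a p)
  have "pev (pCons a p * q) g v = scale a (pev q g v) + pev (pCons 0 (p * q)) g v"
    by (simp add: pev_add pev_smult)
  also have "pev (pCons 0 (p * q)) g v = g (pev p g (pev q g v))"
    using pev_pCons[OF assms, of 0 "p * q"] pCons by simp
  finally show ?case using pev_pCons[OF pev_mem[OF assms], of a p q] by simp
qed simp

lemma pev_commute: "v \<in> W \<Longrightarrow> pev p g (pev q g v) = pev q g (pev p g v)"
  using pev_mult[of v p q] pev_mult[of v q p] by (simp add: mult.commute)

lemma pev_add_right: "v \<in> W \<Longrightarrow> w \<in> W \<Longrightarrow> pev p g (v + w) = pev p g v + pev p g w"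
  by (induction p) (simp_all add: pev_pCons W subspace_add scale_right_distrib autD(1)[OF g] pev_mem)

lemma pev_scale_right: "v \<in> W \<Longrightarrow> pev p g (scale c v) = scale c (pev p g v)"
  by (induction p)
    (simp_all add: pev_pCons W subspace_scale scale_right_distrib autD(2)[OF g] pev_mem mult.commute)

lemma pev_zero_right [simp]: "pev p g 0 = 0"
  using pev_scale_right[of 0 p 0] subspace_0[OF W] by simp

lemma pev_aut: "v \<in> W \<Longrightarrow> pev p g (g v) = g (pev p g v)"
  using pev_commute[of v p "pCons 0 1"] by (simp add: pev_pCons pev_mem autD(5)[OF g])

text \<open>Only finitely many maps occur as powers of \<open>g\<close>, so two powers agree and the
  difference of the monomials annihilates.\<close>

lemma exists_annihilator: "\<exists>m. m \<noteq> 0 \<and> (\<forall>v\<in>W. pev m g v = 0)"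
proof -
  have "finite (range (\<lambda>i. g ^^ i))"
  proof (rule finite_subset)
    show "finite (PiE (UNIV :: 'v set) (\<lambda>_. UNIV :: 'v set))"
      by (rule finite_PiE) (auto simp: fin_space)
  qed (auto simp: PiE_def extensional_def)
  then have "\<not> inj (\<lambda>i::nat. g ^^ i)" using finite_imageD infinite_UNIV_nat by blast
  then obtain i j where ij: "i \<noteq> j" "g ^^ i = g ^^ j" by (auto simp: inj_on_def)
  have mon: "pev (Polynomial.monom 1 i) g v = (g ^^ i) v" for i v
    by (simp add: pev_def poly_at_endo_def degree_monom_eq if_distrib[of "\<lambda>c. scale c _"] cong: if_cong)
  have "Polynomial.monom 1 i - Polynomial.monom 1 j \<noteq> (0 :: 'k poly)" using ij(1) by (simp add: monom_eq_iff')
  then show ?thesis using ij(2) by (intro exI[of _ "Polynomial.monom 1 i - Polynomial.monom 1 j"]) (simp add: pev_diff mon)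
qed

end

text \<open>Defined vector by vector rather than through a minimal polynomial, so that restriction
  to a stable subspace is simply intersection.\<close>

definition reg_part :: "nat \<Rightarrow> 'v set \<Rightarrow> ('v \<Rightarrow> 'v) \<Rightarrow> 'v set" where
  "reg_part d W g = {v \<in> W. \<exists>p. regular_poly d p \<and> pev p g v = 0}"

definition sing_part :: "nat \<Rightarrow> 'v set \<Rightarrow> ('v \<Rightarrow> 'v) \<Rightarrow> 'v set" where
  "sing_part d W g = {v \<in> W. \<exists>p. singular_poly d p \<and> pev p g v = 0}"

lemma torsion_subspace:
  assumes W: "subspace W" and g: "g \<in> aut W"
    and P: "P 1" "\<And>p q. P p \<Longrightarrow> P q \<Longrightarrow> P (p * q)"
  shows "subspace {v \<in> W. \<exists>p. P p \<and> pev p g v = 0}" (is "subspace ?U")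
    and "g ` {v \<in> W. \<exists>p. P p \<and> pev p g v = 0} = {v \<in> W. \<exists>p. P p \<and> pev p g v = 0}"
proof -
  show "subspace ?U"
    unfolding subspace_def
  proof (intro conjI ballI allI)
    show "0 \<in> ?U" using subspace_0[OF W] P(1) pev_zero_right[OF W g] by auto
  next
    fix x y assume x: "x \<in> ?U" and y: "y \<in> ?U"
    then obtain p q where pq: "x \<in> W" "y \<in> W" "P p" "P q" "pev p g x = 0" "pev q g y = 0" by auto
    have "pev (p * q) g (x + y) = pev q g (pev p g x) + pev p g (pev q g y)"
      using pq W by (simp add: pev_mult[OF W g] pev_add_right[OF W g] pev_commute[OF W g, of x p q] subspace_add)
    then have "pev (p * q) g (x + y) = 0" using pq pev_zero_right[OF W g] by simp
    then show "x + y \<in> ?U" using pq P(2) W by (auto simp: subspace_add)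
  next
    fix c x assume "x \<in> ?U"
    then show "scale c x \<in> ?U" using W pev_scale_right[OF W g] by (auto simp: subspace_scale)
  qed
  have sub: "g ` ?U \<subseteq> ?U"
    using pev_aut[OF W g] autD(5)[OF g] aut_0[OF W g] by fastforce
  have "card (g ` ?U) = card ?U"
    by (rule card_image, rule inj_on_subset[OF autD(3)[OF g]]) auto
  then show "g ` ?U = ?U" using sub fin_sub card_subset_eq by blast
qed

lemma reg_part_subspace:
  assumes "subspace W" "g \<in> aut W"
  shows "subspace (reg_part d W g)" "g ` reg_part d W g = reg_part d W g"
proof -
  note * = torsion_subspace[OF assms, where P = "regular_poly d", OF regular_poly_1 regular_poly_mult]
  show "subspace (reg_part d W g)" unfolding reg_part_def by (rule *(1))
  show "g ` reg_part d W g = reg_part d W g" unfolding reg_part_def by (rule *(2))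
qed

lemma sing_part_subspace:
  assumes "subspace W" "g \<in> aut W"
  shows "subspace (sing_part d W g)" "g ` sing_part d W g = sing_part d W g"
proof -
  note * = torsion_subspace[OF assms, where P = "singular_poly d", OF singular_poly_1 singular_poly_mult]
  show "subspace (sing_part d W g)" unfolding sing_part_def by (rule *(1))
  show "g ` sing_part d W g = sing_part d W g" unfolding sing_part_def by (rule *(2))
qed

lemma reg_sing_Int:
  assumes "subspace W" "g \<in> aut W" "v \<in> reg_part d W g" "v \<in> sing_part d W g"
  shows "v = 0"
proof -
  obtain p q where pq: "v \<in> W" "regular_poly d p" "singular_poly d q" "pev p g v = 0" "pev q g v = 0"
    using assms(3,4) by (auto simp: reg_part_def sing_part_def)
  obtain u w where uw: "u * p + w * q = 1" using regular_singular_bezout[OF pq(2,3)] .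
  have "v = pev (u * p + w * q) g v" by (simp add: uw)
  also have "\<dots> = 0"
    using pq pev_zero_right[OF assms(1,2)] by (simp add: pev_add pev_mult[OF assms(1,2)])
  finally show ?thesis .
qed

text \<open>With an annihilator factored as \<open>r * s\<close> and
  \<open>u * r + w * s = 1\<close>, both projections are polynomials in \<open>g\<close>. They map
  every stable \<open>U\<close> to itself, so the decomposition takes place inside
  \<open>U\<close>.\<close>

lemma reg_sing_decomp:
  assumes W: "subspace W" and g: "g \<in> aut W" and U: "subspace U" "U \<subseteq> W" "\<And>x. x \<in> U \<Longrightarrow> g x \<in> U"
    and v: "v \<in> U"
  obtains x y where "x \<in> U \<inter> reg_part d W g" "y \<in> U \<inter> sing_part d W g" "v = x + y"
proof -
  obtain m where m: "m \<noteq> 0" "\<And>v. v \<in> W \<Longrightarrow> pev m g v = 0" using exists_annihilator[OF W g] by auto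
  obtain r s where rs: "m = r * s" "regular_poly d r" "singular_poly d s"
    using regular_singular_factorization[OF m(1)] by metis
  obtain u w where uw: "u * r + w * s = 1" using regular_singular_bezout[OF rs(2,3)] .
  have vW: "v \<in> W" using v U by auto
  \<comment> \<open>\<open>y\<close> contains the factor \<open>r\<close> and is killed by
    \<open>s\<close>, hence is the singular component; \<open>x\<close> is the regular one.\<close>
  define y where "y = pev (u * r) g v"
  define x where "x = pev (w * s) g v"
  have "v = x + y" using pev_add[of "u * r" "w * s" g v] by (simp add: uw x_def y_def add.commute)
  moreover have mem: "x \<in> U" "y \<in> U" using pev_mem_stable[OF U(1,3) v] by (auto simp: x_def y_def)
  moreover have "pev s g y = pev (u * m) g v" "pev r g x = pev (w * m) g v"
    using vW unfolding x_def y_def rs(1) by (simp_all add: pev_mult[OF W g, symmetric] mult_ac)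
  then have "pev s g y = 0" "pev r g x = 0"
    using vW m(2) pev_zero_right[OF W g] by (simp_all add: pev_mult[OF W g])
  ultimately show thesis
    using that[of x y] rs(2,3) U(2) unfolding reg_part_def sing_part_def by blast
qed

subsection \<open>Direct sums\<close>

definition direct_sum :: "'v set \<Rightarrow> 'v set \<Rightarrow> 'v set \<Rightarrow> bool" where
  "direct_sum V1 V2 W \<longleftrightarrow> subspace V1 \<and> subspace V2 \<and> V1 \<inter> V2 = {0} \<and> W = {x + y | x y. x \<in> V1 \<and> y \<in> V2}"

lemma direct_sum_unique:
  assumes "direct_sum V1 V2 W" "x \<in> V1" "y \<in> V2" "x' \<in> V1" "y' \<in> V2" "x + y = x' + y'"
  shows "x = x' \<and> y = y'"
proof -
  have "x - x' = y' - y" using assms(6) by (simp add: algebra_simps)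
  moreover have "x - x' \<in> V1" "y' - y \<in> V2" using assms by (auto simp: direct_sum_def subspace_diff)
  ultimately have "x - x' \<in> V1 \<inter> V2" by simp
  moreover have "V1 \<inter> V2 = {0}" using assms(1) by (simp add: direct_sum_def)
  ultimately have "x - x' = 0" by blast
  then show ?thesis using assms(6) by simp
qed

lemma direct_sum_subset:
  assumes "direct_sum V1 V2 W"
  shows "V1 \<subseteq> W" "V2 \<subseteq> W" "subspace W" "subspace V1" "subspace V2"
proof -
  have *: "subspace V1" "subspace V2" "W = {x + y | x y. x \<in> V1 \<and> y \<in> V2}"
    using assms by (auto simp: direct_sum_def)
  show "V1 \<subseteq> W" unfolding *(3) using subspace_0[OF *(2)] by force
  show "V2 \<subseteq> W" unfolding *(3) using subspace_0[OF *(1)] by force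
  show "subspace W" unfolding *(3) by (rule subspace_sums[OF *(1,2)])
  show "subspace V1" "subspace V2" by fact+
qed

lemma direct_sum_dim:
  assumes "direct_sum V1 V2 W"
  shows "dim W = dim V1 + dim V2"
proof -
  note s = direct_sum_subset[OF assms]
  have "bij_betw (\<lambda>(x, y). x + y) (V1 \<times> V2) W"
    using direct_sum_unique[OF assms] assms unfolding bij_betw_def direct_sum_def
    by (auto simp: inj_on_def image_iff)
  then have "card W = card V1 * card V2" by (simp add: bij_betw_same_card[symmetric] card_cartesian_product)
  then have "card (UNIV :: 'k set) ^ dim W = card (UNIV :: 'k set) ^ (dim V1 + dim V2)"
    using s by (simp add: card_subspace power_add)
  then show ?thesis using CARD_field_gt_1 by simp
qed

lemma reg_sing_direct_sum:
  assumes W: "subspace W" and g: "g \<in> aut W" and U: "subspace U" "U \<subseteq> W" "\<And>x. x \<in> U \<Longrightarrow> g x \<in> U"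
  shows "direct_sum (U \<inter> reg_part d W g) (U \<inter> sing_part d W g) U"
  unfolding direct_sum_def
proof (intro conjI)
  show "subspace (U \<inter> reg_part d W g)" "subspace (U \<inter> sing_part d W g)"
    using reg_part_subspace[OF W g] sing_part_subspace[OF W g] U(1) by (simp_all add: subspace_inter)
  show "U \<inter> reg_part d W g \<inter> (U \<inter> sing_part d W g) = {0}"
    using reg_sing_Int[OF W g] subspace_0[OF U(1)] subspace_0[OF reg_part_subspace(1)[OF W g]]
      subspace_0[OF sing_part_subspace(1)[OF W g]] by blast
  show "U = {x + y |x y. x \<in> U \<inter> reg_part d W g \<and> y \<in> U \<inter> sing_part d W g}"
    using reg_sing_decomp[OF W g U] subspace_add[OF U(1)] by blast
qed

definition restr :: "'v set \<Rightarrow> ('v \<Rightarrow> 'v) \<Rightarrow> 'v \<Rightarrow> 'v" where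
  "restr U g = (\<lambda>x. if x \<in> U then g x else 0)"

lemma restr_aut:
  assumes "g \<in> aut W" "subspace U" "U \<subseteq> W" "g ` U = U"
  shows "restr U g \<in> aut U"
proof (rule autI)
  show "restr U g ` U = U" using assms(4) by (auto simp: restr_def image_iff)
qed (use assms autD[OF assms(1)] in \<open>auto simp: restr_def subspace_add subspace_scale subsetD\<close>)

lemma hchar_restr: "V \<subseteq> U \<Longrightarrow> hchar N V a (restr U g) = hchar N V a g"
proof -
  assume "V \<subseteq> U"
  then have "restr U g ` F i = g ` F i" if "F \<in> flags N V a" for F i
    using flags_subset[OF that, of i] by (intro image_cong) (auto simp: restr_def)
  then show ?thesis
    unfolding hchar_def by (intro arg_cong[of _ _ card] Collect_cong conj_cong refl) simp
qed

definition reg_auts :: "nat \<Rightarrow> 'v set \<Rightarrow> ('v \<Rightarrow> 'v) set" where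
  "reg_auts d W = {g \<in> aut W. reg_part d W g = W}"

definition sing_auts :: "nat \<Rightarrow> 'v set \<Rightarrow> ('v \<Rightarrow> 'v) set" where
  "sing_auts d W = {g \<in> aut W. sing_part d W g = W}"

lemma parts_restr:
  assumes "U \<subseteq> W" "g ` U = U"
  shows "reg_part d U (restr U g) = U \<inter> reg_part d W g" "sing_part d U (restr U g) = U \<inter> sing_part d W g"
proof -
  have "pev p (restr U g) v = pev p g v" if "v \<in> U" for p v
    by (rule pev_cong_on[of U]) (use assms that in \<open>auto simp: restr_def\<close>)
  then show "reg_part d U (restr U g) = U \<inter> reg_part d W g" "sing_part d U (restr U g) = U \<inter> sing_part d W g"
    using assms(1) by (auto simp: reg_part_def sing_part_def)
qed

lemma glue_exists:
  assumes D: "direct_sum V1 V2 W" and g1: "g1 \<in> aut V1" and g2: "g2 \<in> aut V2"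
  obtains g where "g \<in> aut W" "\<And>x. x \<in> V1 \<Longrightarrow> g x = g1 x" "\<And>x. x \<in> V2 \<Longrightarrow> g x = g2 x"
proof -
  note s = direct_sum_subset[OF D]
  define g where "g v = (if v \<in> W then (THE z. \<exists>x\<in>V1. \<exists>y\<in>V2. v = x + y \<and> z = g1 x + g2 y) else 0)" for v
  have xyW: "x + y \<in> W" if "x \<in> V1" "y \<in> V2" for x y using that D by (auto simp: direct_sum_def)
  have ge: "g (x + y) = g1 x + g2 y" if "x \<in> V1" "y \<in> V2" for x y
    using that xyW[OF that] direct_sum_unique[OF D] unfolding g_def
    by (auto intro!: the_equality)
  have dec: "\<exists>x\<in>V1. \<exists>y\<in>V2. v = x + y" if "v \<in> W" for v using that D by (auto simp: direct_sum_def)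
  have 0: "0 \<in> V1" "0 \<in> V2" "g1 0 = 0" "g2 0 = 0" using s g1 g2 by (auto intro: subspace_0 aut_0)
  have "g \<in> aut W"
  proof (rule autI)
    fix v w assume "v \<in> W" "w \<in> W"
    then obtain x y x' y' where xy: "x \<in> V1" "y \<in> V2" "v = x + y" "x' \<in> V1" "y' \<in> V2" "w = x' + y'"
      using dec by metis
    have "v + w = (x + x') + (y + y')" using xy by (simp add: algebra_simps)
    then have "g (v + w) = g ((x + x') + (y + y'))" by (rule arg_cong)
    also have "\<dots> = g1 (x + x') + g2 (y + y')" using ge[of "x + x'" "y + y'"] xy s by (simp add: subspace_add)
    finally have "g (v + w) = g1 (x + x') + g2 (y + y')" .
    then show "g (v + w) = g v + g w"
      using xy ge autD(1)[OF g1] autD(1)[OF g2] by (simp add: algebra_simps)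
  next
    fix c v assume "v \<in> W"
    then obtain x y where xy: "x \<in> V1" "y \<in> V2" "v = x + y" using dec by metis
    then have "g (scale c v) = g1 (scale c x) + g2 (scale c y)"
      using ge[of "scale c x" "scale c y"] s by (simp add: subspace_scale scale_right_distrib)
    then show "g (scale c v) = scale c (g v)"
      using xy ge autD(2)[OF g1] autD(2)[OF g2] by (simp add: scale_right_distrib)
  next
    show "g ` W = W"
    proof
      show "g ` W \<subseteq> W"
      proof
        fix z assume "z \<in> g ` W"
        then obtain v where v: "v \<in> W" "z = g v" by auto
        then obtain x y where "x \<in> V1" "y \<in> V2" "v = x + y" using dec by metis
        then show "z \<in> W" using v ge xyW autD(5)[OF g1] autD(5)[OF g2] by simp
      qed
      show "W \<subseteq> g ` W"
      proof
        fix z assume "z \<in> W"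
        then obtain x y where xy: "x \<in> V1" "y \<in> V2" "z = x + y" using dec by metis
        obtain x' y' where "x' \<in> V1" "x = g1 x'" "y' \<in> V2" "y = g2 y'"
          using xy autD(4)[OF g1] autD(4)[OF g2] by blast
        then show "z \<in> g ` W" using xy ge xyW by (intro image_eqI[of _ _ "x' + y'"]) auto
      qed
    qed
  qed (simp add: g_def)
  moreover have "g x = g1 x" if "x \<in> V1" for x using ge[OF that 0(2)] 0 by simp
  moreover have "g x = g2 x" if "x \<in> V2" for x using ge[OF 0(1) that] 0 by simp
  ultimately show thesis using that by blast
qed

text \<open>An automorphism with parts \<open>V1\<close> and \<open>V2\<close> amounts to a regular
  automorphism of \<open>V1\<close> and a singular one of \<open>V2\<close>, chosen
  independently.\<close>

lemma sum_parts_product: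
  fixes A B :: "('v \<Rightarrow> 'v) \<Rightarrow> int"
  assumes D: "direct_sum V1 V2 W"
  shows "(\<Sum>g | g \<in> aut W \<and> reg_part d W g = V1 \<and> sing_part d W g = V2. A (restr V1 g) * B (restr V2 g))
       = (\<Sum>g\<in>reg_auts d V1. A g) * (\<Sum>g\<in>sing_auts d V2. B g)"
proof -
  note s = direct_sum_subset[OF D]
  let ?S = "{g \<in> aut W. reg_part d W g = V1 \<and> sing_part d W g = V2}"
  let ?f = "\<lambda>g. (restr V1 g, restr V2 g)"
  have stab: "g ` V1 = V1" "g ` V2 = V2" if "g \<in> ?S" for g
    using that reg_part_subspace(2)[OF s(3), of g d] sing_part_subspace(2)[OF s(3), of g d] by auto
  have "bij_betw ?f ?S (reg_auts d V1 \<times> sing_auts d V2)"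
  proof (rule bij_betw_imageI)
    show "inj_on ?f ?S"
    proof (rule inj_onI)
      fix g h assume g: "g \<in> ?S" and h: "h \<in> ?S" and eq: "?f g = ?f h"
      have e: "g x = h x" if "x \<in> V1 \<or> x \<in> V2" for x
        using that eq by (auto simp: restr_def fun_eq_iff split: if_splits)
      show "g = h"
      proof
        fix v
        show "g v = h v"
        proof (cases "v \<in> W")
          case True
          then obtain x y where "x \<in> V1" "y \<in> V2" "v = x + y" using D by (auto simp: direct_sum_def)
          moreover from this s have "x \<in> W" "y \<in> W" by auto
          ultimately show ?thesis using e[of x] e[of y] g h autD(1)[of g W x y] autD(1)[of h W x y] by simp
        next
          case False
          then show ?thesis using g h autD(6)[of g W v] autD(6)[of h W v] by simp
        qed
      qed
    qed
    show "?f ` ?S = reg_auts d V1 \<times> sing_auts d V2"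
    proof
      show "?f ` ?S \<subseteq> reg_auts d V1 \<times> sing_auts d V2"
      proof
        fix z assume "z \<in> ?f ` ?S"
        then obtain g where g: "g \<in> ?S" "z = ?f g" by auto
        then show "z \<in> reg_auts d V1 \<times> sing_auts d V2"
          using restr_aut[of g W V1] restr_aut[of g W V2] stab[OF g(1)] s
            parts_restr[of V1 W g d] parts_restr[of V2 W g d]
          by (auto simp: reg_auts_def sing_auts_def)
      qed
      show "reg_auts d V1 \<times> sing_auts d V2 \<subseteq> ?f ` ?S"
      proof
        fix z assume "z \<in> reg_auts d V1 \<times> sing_auts d V2"
        then obtain g1 g2 where z: "z = (g1, g2)" "g1 \<in> aut V1" "reg_part d V1 g1 = V1"
          "g2 \<in> aut V2" "sing_part d V2 g2 = V2"
          by (auto simp: reg_auts_def sing_auts_def)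
        obtain g where g: "g \<in> aut W" "\<And>x. x \<in> V1 \<Longrightarrow> g x = g1 x" "\<And>x. x \<in> V2 \<Longrightarrow> g x = g2 x"
          using glue_exists[OF D z(2,4)] by metis
        have r: "restr V1 g = g1" "restr V2 g = g2"
          using g(2,3) autD(6)[OF z(2)] autD(6)[OF z(4)] by (auto simp: restr_def fun_eq_iff)
        have st: "g ` V1 = V1" "g ` V2 = V2"
          using g(2,3) autD(4)[OF z(2)] autD(4)[OF z(4)] by (auto simp: image_iff)
        \<comment> \<open>For the glued map only these inclusions are immediate. They are equalities
          because \<open>V1\<close>, \<open>V2\<close> and the two parts both give direct
          decompositions of \<open>W\<close>.\<close>
        have sub: "V1 \<subseteq> reg_part d W g" "V2 \<subseteq> sing_part d W g"
          using parts_restr[OF s(1) st(1), of d] parts_restr[OF s(2) st(2), of d] r z(3,5) by auto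
        have D': "direct_sum (W \<inter> reg_part d W g) (W \<inter> sing_part d W g) W"
          using autD(5)[OF g(1)] by (intro reg_sing_direct_sum[OF s(3) g(1) s(3)]) auto
        have W_parts: "reg_part d W g \<subseteq> W" "sing_part d W g \<subseteq> W" by (auto simp: reg_part_def sing_part_def)
        then have D'': "direct_sum (reg_part d W g) (sing_part d W g) W"
          using D' by (simp add: Int_absorb1)
        have "reg_part d W g \<subseteq> V1"
        proof
          fix v assume v: "v \<in> reg_part d W g"
          then obtain x y where xy: "x \<in> V1" "y \<in> V2" "v = x + y" using W_parts D by (auto simp: direct_sum_def)
          have "v = x \<and> 0 = y"
            using direct_sum_unique[OF D'', of v 0 x y] v xy sub subspace_0[OF sing_part_subspace(1)[OF s(3) g(1)]] by auto
          then show "v \<in> V1" using xy by simp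
        qed
        moreover have "sing_part d W g \<subseteq> V2"
        proof
          fix v assume v: "v \<in> sing_part d W g"
          then obtain x y where xy: "x \<in> V1" "y \<in> V2" "v = x + y" using W_parts D by (auto simp: direct_sum_def)
          have "0 = x \<and> v = y"
            using direct_sum_unique[OF D'', of 0 v x y] v xy sub subspace_0[OF reg_part_subspace(1)[OF s(3) g(1)]] by auto
          then show "v \<in> V2" using xy by simp
        qed
        ultimately have "g \<in> ?S" using g(1) sub by auto
        then show "z \<in> ?f ` ?S" using z(1) r by (intro image_eqI[of _ _ g]) auto
      qed
    qed
  qed
  then have "(\<Sum>g\<in>?S. A (restr V1 g) * B (restr V2 g))
      = (\<Sum>z\<in>reg_auts d V1 \<times> sing_auts d V2. A (fst z) * B (snd z))"
    by (rule sum.reindex_bij_betw[of ?f ?S _ "\<lambda>z. A (fst z) * B (snd z)", simplified])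
  also have "\<dots> = (\<Sum>g\<in>reg_auts d V1. A g) * (\<Sum>g\<in>sing_auts d V2. B g)"
    by (simp add: sum_product sum.cartesian_product case_prod_unfold)
  finally show ?thesis .
qed


subsection \<open>Flags in a direct sum\<close>

lemma Int_direct_sum_eq:
  assumes "direct_sum V1 V2 W" "U1 \<subseteq> V1" "U2 \<subseteq> V2" "0 \<in> U1" "0 \<in> U2"
  shows "{x + y | x y. x \<in> U1 \<and> y \<in> U2} \<inter> V1 = U1" "{x + y | x y. x \<in> U1 \<and> y \<in> U2} \<inter> V2 = U2"
proof -
  note s = direct_sum_subset[OF assms(1)]
  have "x + y \<in> U1" if "x \<in> U1" "y \<in> U2" "x + y \<in> V1" for x y
  proof -
    have "x + y = x \<and> 0 = y"
      by (rule direct_sum_unique[OF assms(1)]) (use that assms subspace_0[OF s(5)] in auto)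
    then show ?thesis using that by simp
  qed
  moreover have "x + y \<in> U2" if "x \<in> U1" "y \<in> U2" "x + y \<in> V2" for x y
  proof -
    have "0 = x \<and> x + y = y"
      by (rule direct_sum_unique[OF assms(1)]) (use that assms subspace_0[OF s(4)] in auto)
    then show ?thesis using that by simp
  qed
  moreover have "x \<in> {x + y | x y. x \<in> U1 \<and> y \<in> U2}" if "x \<in> U1 \<or> x \<in> U2" for x
    using that assms(4,5) by (auto intro: exI[of _ x] exI[of _ 0])
  ultimately show "{x + y | x y. x \<in> U1 \<and> y \<in> U2} \<inter> V1 = U1"
    "{x + y | x y. x \<in> U1 \<and> y \<in> U2} \<inter> V2 = U2"
    using assms(2,3) by auto
qed

definition stable_flags :: "nat \<Rightarrow> 'v set \<Rightarrow> (nat \<Rightarrow> int) \<Rightarrow> ('v \<Rightarrow> 'v) \<Rightarrow> (nat \<Rightarrow> 'v set) set" where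
  "stable_flags N W a g = {F \<in> flags N W a. \<forall>i. g ` F i = F i}"

lemma hchar_eq_card: "hchar N W a g = card (stable_flags N W a g)"
  by (simp add: hchar_def stable_flags_def)

lemma finite_stable_flags: "finite (stable_flags N W a g)"
  unfolding stable_flags_def by (rule finite_subset[OF _ finite_flags]) auto

lemma flags_dims_nonneg: "F \<in> flags N W a \<Longrightarrow> i < N \<Longrightarrow> a i \<ge> 0"
  using flagsD(5,6)[of F N W a i] dim_subset[of "F i" "F (Suc i)"] by force

lemma flags_dims_le:
  assumes "F \<in> flags N W a" "i < N"
  shows "a i \<le> int (dim W)"
  using flagsD(6)[OF assms] dim_subset[OF flags_subset[OF assms(1), of "Suc i"]] by simp

text \<open>A finite range for the jumps of the singular component of a flag. The functions are
  extensional, so that a flag determines its jumps and the union over \<open>b\<close> is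
  disjoint.\<close>

definition flag_box :: "nat \<Rightarrow> nat \<Rightarrow> (nat \<Rightarrow> int) set" where
  "flag_box N m = PiE {..<N} (\<lambda>_. {0..int m})"

lemma finite_flag_box: "finite (flag_box N m)"
  unfolding flag_box_def by (rule finite_PiE) auto

text \<open>Every stable subspace is the sum of its intersections with \<open>V1\<close> and
  \<open>V2\<close>, so a stable flag is a pair of stable flags; if the second has jumps
  \<open>b\<close>, the first has jumps \<open>a - b\<close>.\<close>

lemma hchar_direct_sum:
  assumes W: "subspace W" and g: "g \<in> aut W" and V: "reg_part d W g = V1" "sing_part d W g = V2"
  shows "hchar N W a g = (\<Sum>b\<in>flag_box N (dim W). hchar N V1 (\<lambda>i. a i - b i) g * hchar N V2 b g)"
proof -
  have VW: "V1 \<subseteq> W" "V2 \<subseteq> W" using V by (auto simp: reg_part_def sing_part_def)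
  have D0: "direct_sum (U \<inter> V1) (U \<inter> V2) U" if "subspace U" "U \<subseteq> W" "g ` U = U" for U
    using reg_sing_direct_sum[OF W g that(1,2), of d] that(3) V by auto
  have D: "direct_sum V1 V2 W"
    using D0[OF W subset_refl autD(4)[OF g]] VW by (simp add: Int_absorb1)
  note s = direct_sum_subset[OF D]
  have gV: "g ` V1 = V1" "g ` V2 = V2" using reg_part_subspace(2)[OF W g, of d] sing_part_subspace(2)[OF W g, of d] V by simp_all
  have g0: "g 0 = 0" by (rule aut_0[OF W g])
  have gInt: "g ` (U \<inter> V) = U \<inter> V" if "g ` U = U" "g ` V = V" "U \<subseteq> W" "V \<subseteq> W" for U V
    using that inj_on_image_Int[OF autD(3)[OF g]] by metis
  have dsF: "direct_sum (F i \<inter> V1) (F i \<inter> V2) (F i)" if "F \<in> stable_flags N W a g" "i \<le> N" for F i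
  proof -
    have f: "F \<in> flags N W a" "g ` F i = F i" using that by (simp_all add: stable_flags_def)
    show ?thesis by (rule D0[OF flagsD(2)[OF f(1) that(2)] flags_subset[OF f(1)] f(2)])
  qed
  let ?T = "\<lambda>b. stable_flags N V1 (\<lambda>i. a i - b i) g \<times> stable_flags N V2 b g"
  define \<Phi> where "\<Phi> F = ((\<lambda>i. F i \<inter> V1), (\<lambda>i. F i \<inter> V2))" for F :: "nat \<Rightarrow> 'v set"
  have "bij_betw \<Phi> (stable_flags N W a g) (\<Union>b\<in>flag_box N (dim W). ?T b)"
  proof (rule bij_betw_imageI)
    show "inj_on \<Phi> (stable_flags N W a g)"
    proof (rule inj_onI)
      fix F E assume F: "F \<in> stable_flags N W a g" and E: "E \<in> stable_flags N W a g" and eq: "\<Phi> F = \<Phi> E"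
      show "F = E"
      proof
        fix i
        show "F i = E i"
        proof (cases "i \<le> N")
          case True
          have "direct_sum (F i \<inter> V1) (F i \<inter> V2) (F i)" "direct_sum (E i \<inter> V1) (E i \<inter> V2) (E i)"
            using dsF F E True by blast+
          moreover have "F i \<inter> V1 = E i \<inter> V1" "F i \<inter> V2 = E i \<inter> V2"
            using eq by (auto simp: \<Phi>_def fun_eq_iff)
          ultimately show ?thesis unfolding direct_sum_def by metis
        next
          case False
          then show ?thesis
            using F E flagsD(1)[of F N W a i] flagsD(1)[of E N W a i] by (simp add: stable_flags_def)
        qed
      qed
    qed
    show "\<Phi> ` stable_flags N W a g = (\<Union>b\<in>flag_box N (dim W). ?T b)"
    proof
      show "\<Phi> ` stable_flags N W a g \<subseteq> (\<Union>b\<in>flag_box N (dim W). ?T b)"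
      proof
        fix z assume "z \<in> \<Phi> ` stable_flags N W a g"
        then obtain F where F: "F \<in> flags N W a" "\<And>i. g ` F i = F i" "z = \<Phi> F"
          by (auto simp: stable_flags_def)
        note FD = flagsD[OF F(1)]
        define b where "b = (\<lambda>i\<in>{..<N}. int (dim (F (Suc i) \<inter> V2)) - int (dim (F i \<inter> V2)))"
        have sub: "subspace (F i \<inter> V1)" "subspace (F i \<inter> V2)" if "i \<le> N" for i
          using FD(2)[OF that] s by (auto simp: subspace_inter)
        have dimF: "dim (F i) = dim (F i \<inter> V1) + dim (F i \<inter> V2)" if "i \<le> N" for i
          by (rule direct_sum_dim[OF D0]) (use that FD(2) flags_subset[OF F(1)] F(2) in auto)
        have step: "int (dim (F (Suc i) \<inter> V1)) = int (dim (F i \<inter> V1)) + (a i - b i)" if "i < N" for i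
          using FD(6)[OF that] dimF[of i] dimF[of "Suc i"] that by (simp add: b_def)
        have "(\<lambda>i. F i \<inter> V2) \<in> stable_flags N V2 b g"
          unfolding stable_flags_def flags_def
          using FD sub gInt[OF F(2) gV(2) flags_subset[OF F(1)] s(2)] s(2) subspace_0[OF s(5)]
          by (auto simp: b_def intro: subsetD[OF FD(5)])
        moreover have "(\<lambda>i. F i \<inter> V1) \<in> stable_flags N V1 (\<lambda>i. a i - b i) g"
          unfolding stable_flags_def flags_def
          using FD(1-5) sub step gInt[OF F(2) gV(1) flags_subset[OF F(1)] s(1)] s(1) subspace_0[OF s(4)]
          by (auto intro: subsetD[OF FD(5)])
        moreover have "b \<in> flag_box N (dim W)"
          unfolding flag_box_def
        proof (rule PiE_I)
          fix i assume i: "i \<in> {..<N}"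
          have "(\<lambda>i. F i \<inter> V2) \<in> flags N V2 b"
            using \<open>(\<lambda>i. F i \<inter> V2) \<in> stable_flags N V2 b g\<close> by (simp add: stable_flags_def)
          then show "b i \<in> {0..int (dim W)}"
            using flags_dims_nonneg flags_dims_le i dim_subset[OF s(2)] by fastforce
        qed (simp add: b_def)
        ultimately show "z \<in> (\<Union>b\<in>flag_box N (dim W). ?T b)" using F(3) by (auto simp: \<Phi>_def)
      qed
      show "(\<Union>b\<in>flag_box N (dim W). ?T b) \<subseteq> \<Phi> ` stable_flags N W a g"
      proof
        fix z assume "z \<in> (\<Union>b\<in>flag_box N (dim W). ?T b)"
        then obtain b F1 F2 where z: "z = (F1, F2)" "F1 \<in> flags N V1 (\<lambda>i. a i - b i)" "F2 \<in> flags N V2 b"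
          "\<And>i. g ` F1 i = F1 i" "\<And>i. g ` F2 i = F2 i"
          by (auto simp: stable_flags_def)
        note F1 = flagsD[OF z(2)] and F2 = flagsD[OF z(3)]
        define F where "F i = {x + y | x y. x \<in> F1 i \<and> y \<in> F2 i}" for i
        have sub: "F1 i \<subseteq> V1" "F2 i \<subseteq> V2" for i using flags_subset z(2,3) by auto
        have zero: "0 \<in> F1 i" "0 \<in> F2 i" if "i \<le> N" for i
          using F1(2) F2(2) that by (auto intro: subspace_0)
        have FV: "F i \<inter> V1 = F1 i" "F i \<inter> V2 = F2 i" if "i \<le> N" for i
          unfolding F_def by (rule Int_direct_sum_eq[OF D sub zero]; use that in simp)+
        have FV': "F i = {}" if "i > N" for i using F1(1) that by (simp add: F_def)
        have ds: "direct_sum (F1 i) (F2 i) (F i)" if "i \<le> N" for i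
          unfolding direct_sum_def
        proof (intro conjI)
          show "subspace (F1 i)" "subspace (F2 i)" using F1(2) F2(2) that by auto
          have "V1 \<inter> V2 = {0}" using D by (simp add: direct_sum_def)
          then show "F1 i \<inter> F2 i = {0}" using sub zero[OF that] by blast
        qed (simp add: F_def)
        have gF: "g ` F i = F i" for i
        proof (rule card_subset_eq[OF fin_sub])
          show sb: "g ` F i \<subseteq> F i"
          proof
            fix v assume "v \<in> g ` F i"
            then obtain x y where xy: "x \<in> F1 i" "y \<in> F2 i" "v = g (x + y)" by (auto simp: F_def)
            then have "v = g x + g y" using autD(1)[OF g] sub s by blast
            then show "v \<in> F i" using xy z(4,5) unfolding F_def by blast
          qed
          have "F i \<subseteq> W"
          proof
            fix v assume "v \<in> F i"
            then obtain x y where "x \<in> F1 i" "y \<in> F2 i" "v = x + y" by (auto simp: F_def)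
            then show "v \<in> W" using sub s by (metis subsetD subspace_add)
          qed
          then show "card (g ` F i) = card (F i)" by (intro card_image inj_on_subset[OF autD(3)[OF g]])
        qed
        have "F \<in> stable_flags N W a g"
          unfolding stable_flags_def flags_def
        proof (intro CollectI conjI allI impI gF)
          show "F 0 = {0}" using F1(3) F2(3) by (auto simp: F_def)
          show "F N = W" using F1(4) F2(4) D by (auto simp: F_def direct_sum_def)
          fix i assume i: "i < N"
          show "F i \<subseteq> F (Suc i)" using F1(5)[OF i] F2(5)[OF i] unfolding F_def by blast
          show "int (dim (F (Suc i))) = int (dim (F i)) + a i"
            using F1(6)[OF i] F2(6)[OF i] direct_sum_dim[OF ds, of i] direct_sum_dim[OF ds, of "Suc i"] i by simp
        qed (use FV' direct_sum_subset(3)[OF ds] in auto)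
        moreover have "\<Phi> F = (F1, F2)"
        proof -
          have "F i \<inter> V1 = F1 i \<and> F i \<inter> V2 = F2 i" for i
            using FV[of i] FV'[of i] F1(1)[of i] F2(1)[of i] by (cases "i \<le> N") auto
          then show ?thesis by (simp add: \<Phi>_def)
        qed
        ultimately show "z \<in> \<Phi> ` stable_flags N W a g" using z(1) by (metis image_eqI)
      qed
    qed
  qed
  then have "hchar N W a g = card (\<Union>b\<in>flag_box N (dim W). ?T b)"
    unfolding hchar_eq_card by (rule bij_betw_same_card)
  also have "\<dots> = (\<Sum>b\<in>flag_box N (dim W). card (?T b))"
  proof (rule card_UN_disjoint[OF finite_flag_box])
    show "\<forall>b\<in>flag_box N (dim W). finite (?T b)" by (auto intro: finite_stable_flags)
    have "b = b'" if "b \<in> flag_box N (dim W)" "b' \<in> flag_box N (dim W)" "F \<in> flags N V2 b" "F \<in> flags N V2 b'"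
      for b b' F
    proof
      fix i
      show "b i = b' i"
      proof (cases "i < N")
        case True
        then show ?thesis using flagsD(6)[OF that(3) True] flagsD(6)[OF that(4) True] by simp
      qed (use that in \<open>auto simp: flag_box_def PiE_def extensional_def\<close>)
    qed
    then show "\<forall>b\<in>flag_box N (dim W). \<forall>b'\<in>flag_box N (dim W). b \<noteq> b' \<longrightarrow> ?T b \<inter> ?T b' = {}"
      by (fastforce simp: stable_flags_def)
  qed
  also have "\<dots> = (\<Sum>b\<in>flag_box N (dim W). hchar N V1 (\<lambda>i. a i - b i) g * hchar N V2 b g)"
    by (simp add: card_cartesian_product hchar_eq_card)
  finally show ?thesis .
qed

subsection \<open>Stable subspaces of singular automorphisms\<close>

text \<open>Take \<open>u\<close> in \<open>U\<close> outside \<open>X\<close>, the polynomial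
  \<open>m\<close> of least degree sending \<open>u\<close> into \<open>X\<close>, and a monic
  irreducible factor \<open>f\<close> of \<open>m = f * r\<close>. The image \<open>w\<close> of
  \<open>u\<close> under \<open>r\<close> generates over \<open>X\<close> a stable subspace larger
  by \<open>degree f\<close>. As \<open>m\<close> divides a singular polynomial, \<open>d\<close>
  divides this degree.\<close>

lemma sing_extend:
  assumes W: "subspace W" and g: "g \<in> aut W" and U: "subspace U" "U \<subseteq> W" "\<And>x. x \<in> U \<Longrightarrow> g x \<in> U"
    and X: "subspace X" "X \<subset> U" "\<And>x. x \<in> X \<Longrightarrow> g x \<in> X"
    and S: "U \<subseteq> sing_part d W g"
  shows "\<exists>Y. subspace Y \<and> X \<subset> Y \<and> Y \<subseteq> U \<and> (\<forall>x\<in>Y. g x \<in> Y) \<and> d dvd (dim Y - dim X)"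
proof -
  obtain u where u: "u \<in> U" "u \<notin> X" using X(2) by auto
  have uW: "u \<in> W" using u U by auto
  obtain p where p: "singular_poly d p" "pev p g u = 0" using u S by (auto simp: sing_part_def)
  let ?P = "\<lambda>m. m \<noteq> 0 \<and> pev m g u \<in> X"
  have "?P p" using p subspace_0[OF X(1)] by (auto simp: singular_poly_def)
  then obtain m where m: "m \<noteq> 0" "pev m g u \<in> X" "\<And>q. q \<noteq> 0 \<Longrightarrow> pev q g u \<in> X \<Longrightarrow> degree m \<le> degree q"
    using ex_has_least_nat[of ?P p degree] by metis
  have mp: "m dvd p"
  proof (rule ccontr)
    assume "\<not> m dvd p"
    then have nz: "p mod m \<noteq> 0" by (simp add: dvd_eq_mod_eq_0)
    have "p mod m = p - (p div m) * m" by (simp add: minus_div_mult_eq_mod)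
    then have "pev (p mod m) g u = 0 - pev (p div m) g (pev m g u)"
      by (simp add: pev_diff p(2) pev_mult[OF W g uW])
    then have "pev (p mod m) g u \<in> X"
      using pev_mem_stable[OF X(1,3) m(2)] X(1) by (simp add: subspace_neg)
    from m(3)[OF nz this] show False using degree_mod_less[OF m(1), of p] nz by auto
  qed
  have "degree m > 0"
  proof (rule ccontr)
    assume "\<not> degree m > 0"
    then obtain c where c: "m = [:c:]" by (metis degree_eq_zeroE gr0I)
    then have "c \<noteq> 0" "scale c u \<in> X" using m(1,2) by (auto simp: pev_const)
    from subspace_scale[OF X(1) this(2), of "inverse c"] this(1) have "u \<in> X" by simp
    with u(2) show False ..
  qed
  then obtain f where f: "monic_irreducible f" "f dvd m" using exists_monic_irreducible_factor by blast
  have sf: "singular_factor d f" using f mp p(1) dvd_trans unfolding singular_poly_def by blast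
  obtain r where r: "m = f * r" using f(2) by (rule dvdE) (rule that)
  have f0: "f \<noteq> 0" "r \<noteq> 0" using m(1) r by auto
  define w where "w = pev r g u"
  have wU: "w \<in> U" unfolding w_def by (rule pev_mem_stable[OF U(1,3) u(1)])
  have wW: "w \<in> W" using wU U by auto
  have fw: "pev f g w \<in> X" using m(2) unfolding r w_def by (simp add: pev_mult[OF W g uW])
  have deg: "degree f > 0" by (rule monic_irreducible_degree[OF f(1)])
  \<comment> \<open>A polynomial of smaller degree than \<open>f\<close> sending \<open>w\<close>
    into \<open>X\<close> would, multiplied by \<open>r\<close>, contradict the choice of
    \<open>m\<close>. So the remainders modulo \<open>f\<close> parametrize \<open>Y\<close> over
    \<open>X\<close> without repetition.\<close>
  have low: "q = 0" if "pev q g w \<in> X" "degree q < degree f" for q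
  proof (rule ccontr)
    assume q: "q \<noteq> 0"
    have "pev (q * r) g u \<in> X" using that(1) by (simp add: pev_mult[OF W g uW] w_def)
    then have "degree m \<le> degree (q * r)" using m(3) q f0 by simp
    then show False using that(2) q f0 r by (simp add: degree_mult_eq)
  qed
  define Q where "Q = {q :: 'k poly. degree q < degree f}"
  define Y where "Y = {x + pev q g w | x q. x \<in> X \<and> q \<in> Q}"
  have red: "x + pev q g w \<in> Y" if "x \<in> X" for x q
  proof -
    have "q = f * (q div f) + q mod f" by simp
    then have "pev q g w = pev (q div f) g (pev f g w) + pev (q mod f) g w"
      by (metis pev_add pev_mult[OF W g wW] mult.commute)
    moreover have "pev (q div f) g (pev f g w) \<in> X" by (rule pev_mem_stable[OF X(1,3) fw])
    moreover have "q mod f \<in> Q" using degree_mod_less[OF f0(1), of q] deg by (auto simp: Q_def)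
    ultimately show ?thesis
      unfolding Y_def using that X(1) by (intro CollectI exI[of _ "x + pev (q div f) g (pev f g w)"] exI[of _ "q mod f"])
        (auto simp: subspace_add algebra_simps)
  qed
  have XY: "X \<subseteq> Y" using red[of _ 0] by auto
  have wY: "w \<in> Y" using red[OF subspace_0[OF X(1)], of 1] by simp
  have wX: "w \<notin> X" using low[of 1] deg by auto
  have Y_sub: "subspace Y"
    unfolding subspace_def
  proof (intro conjI ballI allI)
    show "0 \<in> Y" using XY subspace_0[OF X(1)] by auto
  next
    fix a b assume "a \<in> Y" "b \<in> Y"
    then obtain x q y t where "x \<in> X" "y \<in> X" "a = x + pev q g w" "b = y + pev t g w" by (auto simp: Y_def)
    then show "a + b \<in> Y" using red[of "x + y" "q + t"] X(1) by (simp add: pev_add subspace_add algebra_simps)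
  next
    fix c a assume "a \<in> Y"
    then obtain x q where "x \<in> X" "a = x + pev q g w" by (auto simp: Y_def)
    then show "scale c a \<in> Y"
      using red[of "scale c x" "Polynomial.smult c q"] X(1) by (simp add: pev_smult subspace_scale scale_right_distrib)
  qed
  have YU: "Y \<subseteq> U"
    using X(2) pev_mem_stable[OF U(1,3) wU] U(1) by (auto simp: Y_def intro!: subspace_add)
  have gY: "g a \<in> Y" if a: "a \<in> Y" for a
  proof -
    obtain x q where xq: "x \<in> X" "a = x + pev q g w" using a by (auto simp: Y_def)
    have "x \<in> W" "pev q g w \<in> W" using xq X(2) U(2) pev_mem[OF W g wW] by auto
    then have "g a = g x + pev (pCons 0 q) g w" using xq(2) autD(1)[OF g] pev_pCons[OF W g wW, of 0 q] by simp
    then show ?thesis using red X(3)[OF xq(1)] by simp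
  qed
  have "d dvd dim Y - dim X"
  proof -
    \<comment> \<open>The dimension of \<open>Y\<close> over \<open>X\<close> is read off from the
      number of elements, without forming a quotient space.\<close>
    have "bij_betw (\<lambda>(x, q). x + pev q g w) (X \<times> Q) Y"
    proof (rule bij_betw_imageI)
      show "inj_on (\<lambda>(x, q). x + pev q g w) (X \<times> Q)"
      proof (rule inj_onI, clarify)
        fix x q y t assume a: "x \<in> X" "q \<in> Q" "y \<in> X" "t \<in> Q" and eq: "x + pev q g w = y + pev t g w"
        have "pev (q - t) g w = y - x" using eq by (simp add: pev_diff algebra_simps)
        then have "pev (q - t) g w \<in> X" using a X(1) by (simp add: subspace_diff)
        moreover have "degree (q - t) < degree f" using a by (auto simp: Q_def intro: degree_diff_less)
        ultimately have "q - t = 0" by (rule low)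
        then show "x = y \<and> q = t" using eq by simp
      qed
    qed (auto simp: Y_def image_iff)
    then have "card Y = card X * card Q" by (simp add: bij_betw_same_card[symmetric] card_cartesian_product)
    moreover have "card Q = card (UNIV :: 'k set) ^ degree f"
    proof -
      have "bij_betw (\<lambda>q. (\<lambda>i\<in>{..<degree f}. poly.coeff q i)) Q (PiE {..<degree f} (\<lambda>_. UNIV :: 'k set))"
      proof (rule bij_betw_imageI)
        show "inj_on (\<lambda>q. \<lambda>i\<in>{..<degree f}. poly.coeff q i) Q"
        proof (rule inj_onI, rule poly_eqI)
          fix q t i assume a: "q \<in> Q" "t \<in> Q"
            and eq: "(\<lambda>i\<in>{..<degree f}. poly.coeff q i) = (\<lambda>i\<in>{..<degree f}. poly.coeff t i)"
          show "poly.coeff q i = poly.coeff t i"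
          proof (cases "i < degree f")
            case True
            then show ?thesis using fun_cong[OF eq, of i] by simp
          qed (use a in \<open>auto simp: Q_def coeff_eq_0\<close>)
        qed
        show "(\<lambda>q. \<lambda>i\<in>{..<degree f}. poly.coeff q i) ` Q = PiE {..<degree f} (\<lambda>_. UNIV :: 'k set)"
        proof
          show "PiE {..<degree f} (\<lambda>_. UNIV :: 'k set) \<subseteq> (\<lambda>q. \<lambda>i\<in>{..<degree f}. poly.coeff q i) ` Q"
          proof
            fix h assume h: "h \<in> PiE {..<degree f} (\<lambda>_. UNIV :: 'k set)"
            define q where "q = Poly (map h [0..<degree f])"
            have cq: "poly.coeff q i = (if i < degree f then h i else 0)" for i
              by (simp add: q_def nth_default_def)
            have "degree q \<le> degree f - 1" by (rule degree_le) (use cq in auto)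
            then have "q \<in> Q" using deg by (auto simp: Q_def)
            moreover have "h = (\<lambda>i\<in>{..<degree f}. poly.coeff q i)"
              using h by (auto simp: cq PiE_def extensional_def fun_eq_iff)
            ultimately show "h \<in> (\<lambda>q. \<lambda>i\<in>{..<degree f}. poly.coeff q i) ` Q" by (rule rev_image_eqI)
          qed
        qed (auto split: if_splits)
      qed
      then have "card Q = card (PiE {..<degree f} (\<lambda>_. UNIV :: 'k set))" by (rule bij_betw_same_card)
      then show ?thesis by (simp add: card_PiE)
    qed
    ultimately have "card (UNIV :: 'k set) ^ dim Y = card (UNIV :: 'k set) ^ (dim X + degree f)"
      using card_subspace[OF Y_sub] card_subspace[OF X(1)] by (simp add: power_add)
    then have "dim Y = dim X + degree f" using CARD_field_gt_1 by simp
    then show ?thesis using sf by (simp add: singular_factor_def)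
  qed
  then show ?thesis using Y_sub XY wY wX YU gY by (intro exI[of _ Y]) auto
qed

text \<open>Among the stable subspaces of dimension divisible by \<open>d\<close>, one of largest
  dimension is all of \<open>U\<close>, because \<open>sing_extend\<close> would enlarge a proper
  one.\<close>

lemma sing_stable_dim:
  assumes W: "subspace W" and g: "g \<in> aut W" and U: "subspace U" "U \<subseteq> W" "g ` U = U"
    and S: "U \<subseteq> sing_part d W g"
  shows "d dvd dim U"
proof -
  let ?P = "\<lambda>X. subspace X \<and> X \<subseteq> U \<and> (\<forall>x\<in>X. g x \<in> X) \<and> d dvd dim X"
  have "?P {0}" using subspace_0[OF U(1)] aut_0[OF W g] by (auto simp: subspace_def)
  moreover have "dim X < Suc (dim U)" if "?P X" for X using that dim_subset[of X U] by auto
  ultimately obtain X where X: "?P X" "\<And>Y. ?P Y \<Longrightarrow> dim Y \<le> dim X"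
    using ex_has_greatest_nat[of ?P "{0}" dim "Suc (dim U)"] by (metis less_imp_le)
  have "X = U"
  proof (rule ccontr)
    assume "X \<noteq> U"
    then have "X \<subset> U" using X(1) by auto
    then obtain Y where Y: "subspace Y" "X \<subset> Y" "Y \<subseteq> U" "\<forall>x\<in>Y. g x \<in> Y" "d dvd (dim Y - dim X)"
      using sing_extend[OF W g U(1,2) _ _ _ _ S, of X] X(1) U(3) by blast
    have le: "dim X < dim Y" using Y(1,2) X(1) dim_psubset[of X Y] by (simp add: span_eq_subspace)
    then have "d dvd dim Y" using Y(5) X(1) by (metis dvd_add le_add_diff_inverse less_imp_le)
    then show False using X(2)[of Y] Y le by auto
  qed
  then show ?thesis using X(1) by simp
qed

lemma sing_hchar_dvd:
  assumes "subspace W" "g \<in> sing_auts d W" "hchar N W b g \<noteq> 0" "i < N"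
  shows "int d dvd b i"
proof -
  obtain F where F: "F \<in> flags N W b" "\<And>i. g ` F i = F i"
    using assms(3) unfolding hchar_def by (metis (mono_tags, lifting) card.empty empty_Collect_eq)
  have "d dvd dim (F i)" if "i \<le> N" for i
    by (rule sing_stable_dim[OF assms(1), of g])
      (use assms(2) flagsD(2)[OF F(1)] flags_subset[OF F(1)] F(2) that in \<open>auto simp: sing_auts_def\<close>)
  from this[of i] this[of "Suc i"] have "int d dvd int (dim (F (Suc i))) - int (dim (F i))"
    using assms(4) by (intro dvd_diff) auto
  then show ?thesis using flagsD(6)[OF F(1) assms(4)] by simp
qed

subsection \<open>Linking across regular automorphisms\<close>

definition schar :: "nat \<Rightarrow> 'v set \<Rightarrow> (nat \<Rightarrow> int) \<Rightarrow> ('v \<Rightarrow> 'v) \<Rightarrow> int" where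
  "schar N W \<beta> g = (\<Sum>w | w permutes {..<N}. sign w * int (hchar N W (\<lambda>i. \<beta> i - delta N (w i)) g))"

lemma schar_restr: "V \<subseteq> U \<Longrightarrow> schar N V \<beta> (restr U g) = schar N V \<beta> g"
  by (simp add: schar_def hchar_restr)

lemma schar_inner:
  assumes W: "subspace W" and \<beta>: "\<And>i. i < N \<Longrightarrow> 0 \<le> \<beta> i"
    and sum: "(\<Sum>i<N. \<beta> i) = int (dim W) + (\<Sum>i<N. delta N i)"
  shows "(\<Sum>g\<in>aut W. schar N W \<beta> g * schar N W \<gamma> g)
       = int (card (aut W)) * (\<Sum>w | w permutes {..<N}. if \<forall>i<N. \<gamma> i = \<beta> (w i) then sign w else 0)"
proof -
  have s: "(\<Sum>i<N. \<beta> i - delta N (w i)) = int (dim W)" if "w permutes {..<N}" for w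
    using sum sum.permute[OF that, of "delta N"] by (simp add: sum_subtractf comp_def)
  have "(\<Sum>g\<in>aut W. schar N W \<beta> g * schar N W \<gamma> g)
      = (\<Sum>g\<in>aut W. \<Sum>w | w permutes {..<N}. \<Sum>v | v permutes {..<N}. sign w * sign v *
          int (hchar N W (\<lambda>i. \<beta> i - delta N (w i)) g * hchar N W (\<lambda>i. \<gamma> i - delta N (v i)) g))"
    unfolding schar_def sum_product by (simp add: mult_ac)
  also have "\<dots> = (\<Sum>w | w permutes {..<N}. \<Sum>v | v permutes {..<N}. sign w * sign v *
      int (\<Sum>g\<in>aut W. hchar N W (\<lambda>i. \<beta> i - delta N (w i)) g * hchar N W (\<lambda>i. \<gamma> i - delta N (v i)) g))"
    by (simp add: sum_distrib_left) (subst sum.swap, rule sum.cong[OF refl], rule sum.swap)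
  also have "\<dots> = (\<Sum>w | w permutes {..<N}. \<Sum>v | v permutes {..<N}. sign w * sign v *
      int (card (aut W) * card (nat_mats N (\<lambda>i. \<beta> i - delta N (w i)) (\<lambda>i. \<gamma> i - delta N (v i)))))"
    by (intro sum.cong refl arg_cong2[of _ _ _ _ times] arg_cong[of _ _ int] hchar_inner[OF W] s) simp
  also have "\<dots> = int (card (aut W)) * (\<Sum>w | w permutes {..<N}. \<Sum>v | v permutes {..<N}. sign w * sign v *
      int (card (nat_mats N (\<lambda>i. \<beta> i - delta N (w i)) (\<lambda>i. \<gamma> i - delta N (v i)))))"
    by (simp add: sum_distrib_left mult_ac)
  finally show ?thesis by (simp only: cauchy_nat_mats[OF \<beta>])
qed

text \<open>The jumps of an existing flag are nonnegative and add up to \<open>dim W\<close>. So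
  outside the range covered by \<open>schar_inner\<close> every term of the alternating sum
  vanishes.\<close>

lemma schar_eq_0:
  assumes "subspace W" "\<not> ((\<forall>i<N. 0 \<le> \<beta> i) \<and> (\<Sum>i<N. \<beta> i) = int (dim W) + (\<Sum>i<N. delta N i))"
  shows "schar N W \<beta> g = 0"
  unfolding schar_def
proof (rule sum.neutral, rule ballI)
  fix w assume "w \<in> {w. w permutes {..<N}}"
  then have w: "w permutes {..<N}" by simp
  have "flags N W (\<lambda>i. \<beta> i - delta N (w i)) = {}"
  proof (rule ccontr)
    assume "flags N W (\<lambda>i. \<beta> i - delta N (w i)) \<noteq> {}"
    then obtain F where F: "F \<in> flags N W (\<lambda>i. \<beta> i - delta N (w i))" by auto
    have "0 \<le> \<beta> i" if "i < N" for i
      using flags_dims_nonneg[OF F that] permutes_lessThan[OF w that] by (simp add: delta_def)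
    moreover have "(\<Sum>i<N. \<beta> i) = int (dim W) + (\<Sum>i<N. delta N i)"
      using flags_dim[OF F, of N] flagsD(4)[OF F] sum.permute[OF w, of "delta N"]
      by (simp add: sum_subtractf comp_def)
    ultimately show False using assms(2) by simp
  qed
  then show "sign w * int (hchar N W (\<lambda>i. \<beta> i - delta N (w i)) g) = 0" by (simp add: hchar_def)
qed

text \<open>The jumps \<open>b\<close> are subtracted from \<beta> and leave the permuted
  \<open>delta\<close> alone. The alternation therefore acts on the regular component only and
  reproduces there the same kind of sum.\<close>

lemma schar_direct_sum:
  assumes "subspace W" "g \<in> aut W" "reg_part d W g = V1" "sing_part d W g = V2"
  shows "schar N W \<beta> g = (\<Sum>b\<in>flag_box N (dim W). int (hchar N V2 b g) * schar N V1 (\<lambda>i. \<beta> i - b i) g)"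
proof -
  have "schar N W \<beta> g = (\<Sum>w | w permutes {..<N}. \<Sum>b\<in>flag_box N (dim W).
      sign w * (int (hchar N V1 (\<lambda>i. \<beta> i - delta N (w i) - b i) g) * int (hchar N V2 b g)))"
    by (simp add: schar_def hchar_direct_sum[OF assms] sum_distrib_left)
  also have "\<dots> = (\<Sum>b\<in>flag_box N (dim W). int (hchar N V2 b g) * schar N V1 (\<lambda>i. \<beta> i - b i) g)"
    unfolding schar_def sum_distrib_left
    by (subst sum.swap) (simp add: mult_ac diff_diff_add add.commute[of "delta _ _"] diff_diff_eq)
  finally show ?thesis .
qed

text \<open>A permutation matching \<beta> with \<gamma> would match their residues, so every term
  of the formula in \<open>schar_inner\<close> is zero.\<close>

lemma schar_aut_orthogonal:
  assumes "subspace W" "residues_mset d N \<beta> \<noteq> residues_mset d N \<gamma>"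
  shows "(\<Sum>g\<in>aut W. schar N W \<beta> g * schar N W \<gamma> g) = 0"
proof (cases "(\<forall>i<N. 0 \<le> \<beta> i) \<and> (\<Sum>i<N. \<beta> i) = int (dim W) + (\<Sum>i<N. delta N i)")
  case True
  have "(\<Sum>w | w permutes {..<N}. if \<forall>i<N. \<gamma> i = \<beta> (w i) then sign w else 0) = 0"
    using assms(2) residues_mset_permute[of _ N \<gamma> d \<beta>]
    by (intro sum.neutral) (metis (mono_tags, lifting) mem_Collect_eq)
  then show ?thesis using schar_inner[OF assms(1), of N \<beta> \<gamma>] True by simp
next
  case False
  then show ?thesis using schar_eq_0[OF assms(1) False] by simp
qed

text \<open>The automorphisms are sorted by their two parts. The class with parts \<open>W\<close>
  and \<open>{0}\<close> is that of the regular ones; every other class contributes zero by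
  induction, its regular part being a proper subspace, and so does the total.\<close>

theorem schar_reg_orthogonal:
  assumes "subspace W" "residues_mset d N \<beta> \<noteq> residues_mset d N \<gamma>"
  shows "(\<Sum>g\<in>reg_auts d W. schar N W \<beta> g * schar N W \<gamma> g) = 0"
  using assms
proof (induction "dim W" arbitrary: W \<beta> \<gamma> rule: less_induct)
  case less
  note W = less.prems(1)
  let ?f = "\<lambda>g. (reg_part d W g, sing_part d W g)"
  let ?h = "\<lambda>g. schar N W \<beta> g * schar N W \<gamma> g"
  have D: "direct_sum (reg_part d W g) (sing_part d W g) W" if "g \<in> aut W" for g
  proof -
    have "direct_sum (W \<inter> reg_part d W g) (W \<inter> sing_part d W g) W"
      using autD(5)[OF that] by (intro reg_sing_direct_sum[OF W that W]) auto
    then show ?thesis by (simp add: Int_absorb1 reg_part_def sing_part_def subset_iff)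
  qed
  have zero: "(\<Sum>g | g \<in> aut W \<and> ?f g = p. ?h g) = 0" if p: "p \<in> ?f ` aut W - {(W, {0})}" for p
  proof -
    obtain V1 V2 where V: "p = (V1, V2)" by (cases p)
    then obtain g0 where "g0 \<in> aut W" "reg_part d W g0 = V1" "sing_part d W g0 = V2" using p by auto
    then have ds: "direct_sum V1 V2 W" using D by auto
    note s = direct_sum_subset[OF ds]
    have "V2 \<noteq> {0}"
    proof
      assume "V2 = {0}"
      then have "V1 = W" using ds by (auto simp: direct_sum_def)
      with \<open>V2 = {0}\<close> p V show False by simp
    qed
    then have "dim V2 \<noteq> 0" using s(5) subspace_0 by (auto simp: dim_eq_0)
    then have lt: "dim V1 < dim W" using direct_sum_dim[OF ds] by linarith
    let ?B = "flag_box N (dim W)"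
    have "(\<Sum>g | g \<in> aut W \<and> ?f g = p. ?h g)
        = (\<Sum>g | g \<in> aut W \<and> reg_part d W g = V1 \<and> sing_part d W g = V2. \<Sum>b\<in>?B. \<Sum>c\<in>?B.
            (schar N V1 (\<lambda>i. \<beta> i - b i) (restr V1 g) * schar N V1 (\<lambda>i. \<gamma> i - c i) (restr V1 g)) *
            (int (hchar N V2 b (restr V2 g)) * int (hchar N V2 c (restr V2 g))))"
      by (rule sum.cong) (auto simp: V schar_direct_sum[OF W] sum_product schar_restr hchar_restr mult_ac)
    also have "\<dots> = (\<Sum>b\<in>?B. \<Sum>c\<in>?B. \<Sum>g | g \<in> aut W \<and> reg_part d W g = V1 \<and> sing_part d W g = V2.
            (schar N V1 (\<lambda>i. \<beta> i - b i) (restr V1 g) * schar N V1 (\<lambda>i. \<gamma> i - c i) (restr V1 g)) *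
            (int (hchar N V2 b (restr V2 g)) * int (hchar N V2 c (restr V2 g))))"
      by (subst sum.swap, rule sum.cong[OF refl], rule sum.swap)
    also have "\<dots> = (\<Sum>b\<in>?B. \<Sum>c\<in>?B.
            (\<Sum>g\<in>reg_auts d V1. schar N V1 (\<lambda>i. \<beta> i - b i) g * schar N V1 (\<lambda>i. \<gamma> i - c i) g) *
            (\<Sum>g\<in>sing_auts d V2. int (hchar N V2 b g) * int (hchar N V2 c g)))"
      by (intro sum.cong refl sum_parts_product[OF ds])
    also have "\<dots> = 0"
    proof (intro sum.neutral ballI)
      fix b c
      show "(\<Sum>g\<in>reg_auts d V1. schar N V1 (\<lambda>i. \<beta> i - b i) g * schar N V1 (\<lambda>i. \<gamma> i - c i) g) *
            (\<Sum>g\<in>sing_auts d V2. int (hchar N V2 b g) * int (hchar N V2 c g)) = 0"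
      \<comment> \<open>Either all jumps on \<open>V2\<close> are multiples of \<open>d\<close> and
        the shifted sequences still differ in residues, or no singular automorphism stabilizes flags
        of both types.\<close>
      proof (cases "(\<forall>i<N. int d dvd b i) \<and> (\<forall>i<N. int d dvd c i)")
        case True
        then have "residues_mset d N (\<lambda>i. \<beta> i - b i) \<noteq> residues_mset d N (\<lambda>i. \<gamma> i - c i)"
          using less.prems(2) by (simp add: residues_mset_shift)
        then show ?thesis using less.hyps[OF lt s(4)] by simp
      next
        case False
        then have "int (hchar N V2 b g) * int (hchar N V2 c g) = 0" if "g \<in> sing_auts d V2" for g
          using sing_hchar_dvd[OF s(5) that] by auto
        then show ?thesis by simp
      qed
    qed
    finally show ?thesis .
  qed
  have R: "reg_auts d W = {g \<in> aut W. ?f g = (W, {0})}"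
  proof -
    have "sing_part d W g = {0}" if "g \<in> aut W" "reg_part d W g = W" for g
    proof -
      have "W \<inter> sing_part d W g = {0}" using D[OF that(1)] that(2) by (simp add: direct_sum_def)
      then show ?thesis by (auto simp: sing_part_def)
    qed
    then show ?thesis by (auto simp: reg_auts_def)
  qed
  have "0 = (\<Sum>g\<in>aut W. ?h g)" using schar_aut_orthogonal[OF less.prems] by simp
  \<comment> \<open>Inserting the pair makes its class a summand without first exhibiting a regular
    automorphism.\<close>
  also have "\<dots> = (\<Sum>p\<in>insert (W, {0}) (?f ` aut W). \<Sum>g | g \<in> aut W \<and> ?f g = p. ?h g)"
    by (rule sum.group[symmetric]) (auto simp: finite_aut)
  also have "\<dots> = (\<Sum>g | g \<in> aut W \<and> ?f g = (W, {0}). ?h g)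
      + (\<Sum>p\<in>?f ` aut W - {(W, {0})}. \<Sum>g | g \<in> aut W \<and> ?f g = p. ?h g)"
    by (rule sum.insert_remove) (simp add: finite_aut)
  also have "(\<Sum>p\<in>?f ` aut W - {(W, {0})}. \<Sum>g | g \<in> aut W \<and> ?f g = p. ?h g) = 0"
    by (rule sum.neutral) (use zero in blast)
  finally show ?case by (simp add: R)
qed

end

subsection \<open>Partitions and beta numbers\<close>

text \<open>Parts beyond the length are zero, so that partitions of different lengths share the same
  number of rows.\<close>

definition part :: "nat list \<Rightarrow> nat \<Rightarrow> nat" where
  "part \<alpha> i = (if i < length \<alpha> then \<alpha> ! i else 0)"

definition beta :: "nat \<Rightarrow> nat list \<Rightarrow> nat \<Rightarrow> int" where
  "beta N \<alpha> i = int (part \<alpha> i) + delta N i"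

lemma young_diagram_part: "(i, j) \<in> young_diagram \<alpha> \<longleftrightarrow> j < part \<alpha> i"
  by (auto simp: young_diagram_def part_def)

lemma sum_part:
  assumes "length \<alpha> \<le> N"
  shows "(\<Sum>i<N. part \<alpha> i) = sum_list \<alpha>"
proof -
  have "(\<Sum>i<N. part \<alpha> i) = (\<Sum>i<length \<alpha>. part \<alpha> i)"
    using assms by (intro sum.mono_neutral_right) (auto simp: part_def)
  then show ?thesis by (simp add: part_def sum_list_sum_nth atLeast0LessThan)
qed

lemma part_antimono:
  assumes "is_partition n \<alpha>" "i \<le> j"
  shows "part \<alpha> j \<le> part \<alpha> i"
proof (cases "i = j \<or> j \<ge> length \<alpha>")
  case False
  then show ?thesis
    using assms sorted_wrt_nth_less[of "(\<ge>)" \<alpha> i j] by (auto simp: is_partition_def part_def)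
qed (auto simp: part_def)

lemma part_pos_iff: "is_partition n \<alpha> \<Longrightarrow> 0 < part \<alpha> i \<longleftrightarrow> i < length \<alpha>"
  by (auto simp: is_partition_def is_composition_def part_def in_set_conv_nth)

lemma partition_eqI:
  assumes "is_partition n \<alpha>" "is_partition m \<kappa>" "\<And>i. part \<alpha> i = part \<kappa> i"
  shows "\<alpha> = \<kappa>"
proof (rule nth_equalityI)
  have "i < length \<alpha> \<longleftrightarrow> i < length \<kappa>" for i
    unfolding part_pos_iff[OF assms(1), symmetric] part_pos_iff[OF assms(2), symmetric] assms(3) ..
  from this[of "length \<alpha>"] this[of "length \<kappa>"] show l: "length \<alpha> = length \<kappa>" by linarith
  fix i assume "i < length \<alpha>"
  then show "\<alpha> ! i = \<kappa> ! i" using assms(3)[of i] l by (simp add: part_def)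
qed

lemma exists_partition:
  assumes "\<And>i j. i \<le> j \<Longrightarrow> f j \<le> f i" "\<And>i. i \<ge> N \<Longrightarrow> f i = 0"
  shows "\<exists>\<kappa>. is_partition (sum_list \<kappa>) \<kappa> \<and> length \<kappa> \<le> N \<and> (\<forall>i. part \<kappa> i = f i)"
proof -
  define l where "l = (LEAST i. f i = 0)"
  have l: "f l = 0" unfolding l_def using assms(2)[of N] LeastI[of "\<lambda>i. f i = 0" N] by simp
  have pos: "f i > 0" if "i < l" for i using not_less_Least[of i "\<lambda>i. f i = 0"] that by (auto simp: l_def)
  have "l \<le> N" unfolding l_def using assms(2)[of N] by (auto intro: Least_le)
  let ?k = "map f [0..<l]"
  have "sorted_wrt (\<ge>) ?k" using assms(1) by (auto simp: sorted_wrt_iff_nth_less)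
  moreover have "0 \<notin> set ?k" using pos by fastforce
  moreover have "part ?k i = f i" for i using l assms(1)[of l i] by (auto simp: part_def)
  ultimately show ?thesis
    using \<open>l \<le> N\<close> by (intro exI[of _ ?k]) (auto simp: is_partition_def is_composition_def)
qed

lemma beta_less:
  assumes "is_partition n \<alpha>" "i < j"
  shows "beta N \<alpha> j < beta N \<alpha> i"
  using part_antimono[OF assms(1), of i j] assms(2) by (simp add: beta_def delta_def)

lemma beta_nonneg: "i < N \<Longrightarrow> 0 \<le> beta N \<alpha> i"
  by (simp add: beta_def delta_def)

lemma beta_inj: "is_partition n \<alpha> \<Longrightarrow> inj_on (beta N \<alpha>) A"
  using beta_less[of n \<alpha>] by (intro inj_onI) (metis linorder_neqE_nat less_irrefl)

definition beta_set :: "nat \<Rightarrow> nat list \<Rightarrow> int set" where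
  "beta_set N \<alpha> = beta N \<alpha> ` {..<N}"

text \<open>Beta numbers strictly decrease, so the one of row \<open>i\<close> is exceeded by
  exactly \<open>i\<close> others; the set recovers the sequence, and the sequence the
  partition.\<close>

lemma beta_set_eq_imp_eq:
  assumes \<alpha>: "is_partition n \<alpha>" "length \<alpha> \<le> N" and \<kappa>: "is_partition m \<kappa>" "length \<kappa> \<le> N"
    and eq: "beta_set N \<alpha> = beta_set N \<kappa>"
  shows "\<alpha> = \<kappa>"
proof -
  have rank: "card {x \<in> beta_set N \<nu>. beta N \<nu> i < x} = i" if "is_partition k \<nu>" "i < N" for \<nu> i k
  proof -
    have "{x \<in> beta_set N \<nu>. beta N \<nu> i < x} = beta N \<nu> ` {..<i}"
      using beta_less[OF that(1)] that(2) unfolding beta_set_def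
      by (auto simp: image_iff) (metis less_asym linorder_neqE_nat lessThan_iff less_irrefl)
    then show ?thesis using beta_inj[OF that(1)] by (simp add: card_image)
  qed
  have "part \<alpha> i = part \<kappa> i" for i
  proof (cases "i < N")
    case True
    then have "beta N \<alpha> i \<in> beta_set N \<kappa>" using eq by (auto simp: beta_set_def)
    then obtain j where j: "j < N" "beta N \<alpha> i = beta N \<kappa> j" by (auto simp: beta_set_def)
    have "i = j" using rank[OF \<alpha>(1) True] rank[OF \<kappa>(1) j(1)] j(2) eq by simp
    then show ?thesis using j by (simp add: beta_def)
  qed (use \<alpha>(2) \<kappa>(2) in \<open>auto simp: part_def\<close>)
  then show ?thesis using partition_eqI[OF \<alpha>(1) \<kappa>(1)] by blast
qed

subsection \<open>Removing hooks\<close>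

lemma skew_cells_card:
  assumes "length \<alpha> \<le> N" "\<And>i. part \<kappa> i \<le> part \<alpha> i"
  shows "card (young_diagram \<alpha> - young_diagram \<kappa>) = (\<Sum>i<N. part \<alpha> i - part \<kappa> i)"
proof -
  have "young_diagram \<alpha> - young_diagram \<kappa> = (SIGMA i:{..<N}. {part \<kappa> i..<part \<alpha> i})"
    using assms(1) by (auto simp: young_diagram_part) (auto simp: part_def split: if_splits)
  then show ?thesis by simp
qed

text \<open>A path from row \<open>i\<close> to row \<open>j\<close> must at some point step from
  row \<open>k\<close> to row \<open>Suc k\<close>, and it does so within one column.\<close>

lemma connected_rows:
  assumes "connected_cells S" "(i, a) \<in> S" "(j, b) \<in> S" "i \<le> k" "k < j"
  shows "\<exists>c. (k, c) \<in> S \<and> (Suc k, c) \<in> S"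
proof (rule ccontr)
  assume no: "\<not> (\<exists>c. (k, c) \<in> S \<and> (Suc k, c) \<in> S)"
  let ?R = "{(a, b). a \<in> S \<and> b \<in> S \<and> adjacent_cells a b}"
  have "((i, a), (j, b)) \<in> ?R\<^sup>*" using assms(1-3) by (auto simp: connected_cells_def)
  then have "fst (j, b) \<le> k"
  proof (induction rule: rtrancl_induct)
    case base
    then show ?case using assms(4) by simp
  next
    case (step y z)
    show ?case
    proof (rule ccontr)
      assume "\<not> fst z \<le> k"
      then have "snd y = snd z" "fst y = k" "fst z = Suc k"
        using step by (auto simp: adjacent_cells_def)
      then have "(k, snd z) \<in> S" "(Suc k, snd z) \<in> S" using step by (metis (mono_tags, lifting) case_prodD mem_Collect_eq prod.collapse)+
      with no show False by blast
    qed
  qed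
  with assms(5) show False by simp
qed

text \<open>If the hook occupies rows \<open>r\<close> to \<open>s\<close>, connectedness and
  absence of squares force \<open>part \<alpha> (Suc k) = Suc (part \<kappa> k)\<close> for
  \<open>k\<close> from \<open>r\<close> to \<open>s - 1\<close>. Thus the beta numbers below row
  \<open>r\<close> move up by one row, and that of row \<open>r\<close>, lowered by
  \<open>d\<close>, goes to row \<open>s\<close>.\<close>

lemma removes_hook_beta:
  assumes rh: "removes_hook d \<alpha> \<kappa>" and d: "d > 0" and N: "length \<alpha> \<le> N"
  shows "length \<kappa> \<le> N" "residues_mset d N (beta N \<kappa>) = residues_mset d N (beta N \<alpha>)"
    "sum_list \<kappa> < sum_list \<alpha>"
proof -
  define S where "S = young_diagram \<alpha> - young_diagram \<kappa>"
  have pa: "is_partition (sum_list \<alpha>) \<alpha>" and pk: "is_partition (sum_list \<kappa>) \<kappa>"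
    and sub: "young_diagram \<kappa> \<subseteq> young_diagram \<alpha>" and cS: "card S = d" and con: "connected_cells S"
    and sq: "\<And>i j. \<not> {(i, j), (Suc i, j), (i, Suc j), (Suc i, Suc j)} \<subseteq> S"
    using rh by (auto simp: removes_hook_def Let_def S_def)
  have S: "(i, j) \<in> S \<longleftrightarrow> part \<kappa> i \<le> j \<and> j < part \<alpha> i" for i j
    by (auto simp: S_def young_diagram_part)
  have le: "part \<kappa> i \<le> part \<alpha> i" for i
  proof (rule ccontr)
    assume "\<not> part \<kappa> i \<le> part \<alpha> i"
    then have "(i, part \<alpha> i) \<in> young_diagram \<kappa>" by (simp add: young_diagram_part)
    then have "(i, part \<alpha> i) \<in> young_diagram \<alpha>" using sub by blast
    then show False by (simp add: young_diagram_part)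
  qed
  have "part \<kappa> N = 0" using le[of N] N by (simp add: part_def)
  then show lk: "length \<kappa> \<le> N" using part_pos_iff[OF pk, of N] by simp
  have dsum: "d = (\<Sum>i<N. part \<alpha> i - part \<kappa> i)" using skew_cells_card[OF N le] cS by (simp add: S_def)
  have "(\<Sum>i<N. part \<alpha> i) = (\<Sum>i<N. part \<kappa> i) + d"
    unfolding dsum sum.distrib[symmetric] using le by (intro sum.cong) auto
  then have sums: "sum_list \<alpha> = sum_list \<kappa> + d" using sum_part[OF N] sum_part[OF lk] by simp
  then show "sum_list \<kappa> < sum_list \<alpha>" using d by simp
  define rows where "rows = {i. i < N \<and> part \<kappa> i < part \<alpha> i}"
  have fr: "finite rows" by (simp add: rows_def)
  have "rows \<noteq> {}"
  proof
    assume "rows = {}"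
    then have "part \<alpha> i - part \<kappa> i = 0" if "i < N" for i using that by (auto simp: rows_def)
    then have "(\<Sum>i<N. part \<alpha> i - part \<kappa> i) = 0" by simp
    then show False using dsum d by simp
  qed
  define r where "r = Min rows"
  define s where "s = Max rows"
  have rs: "r \<in> rows" "s \<in> rows" "\<And>i. i \<in> rows \<Longrightarrow> r \<le> i \<and> i \<le> s"
    using fr \<open>rows \<noteq> {}\<close> by (auto simp: r_def s_def)
  then have rsN: "r \<le> s" "s < N" by (auto simp: rows_def)
  have step: "part \<alpha> (Suc k) = Suc (part \<kappa> k)" if k: "r \<le> k" "k < s" for k
  proof -
    have "(r, part \<kappa> r) \<in> S" "(s, part \<kappa> s) \<in> S" using rs by (auto simp: S rows_def)
    from connected_rows[OF con this k] obtain c where c: "(k, c) \<in> S" "(Suc k, c) \<in> S" by auto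
    \<comment> \<open>Consecutive rows of the hook share a column by connectedness; two shared
      columns would contain a square.\<close>
    have "\<not> Suc (part \<kappa> k) < part \<alpha> (Suc k)"
    proof
      assume lt: "Suc (part \<kappa> k) < part \<alpha> (Suc k)"
      then have "{(k, part \<kappa> k), (Suc k, part \<kappa> k), (k, Suc (part \<kappa> k)), (Suc k, Suc (part \<kappa> k))} \<subseteq> S"
        using part_antimono[OF pa, of k "Suc k"] part_antimono[OF pk, of k "Suc k"] by (auto simp: S)
      with sq show False by blast
    qed
    then show ?thesis using c by (auto simp: S)
  qed
  define w where "w i = (if r \<le> i \<and> i < s then Suc i else if i = s then r else i)" for i
  have w: "w permutes {..<N}"
  proof (rule bij_imp_permutes)
    have "inj_on w {..<N}" using rsN by (auto simp: inj_on_def w_def split: if_splits)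
    moreover have "w ` {..<N} \<subseteq> {..<N}" using rsN by (auto simp: w_def)
    ultimately show "bij_betw w {..<N} {..<N}" by (simp add: bij_betw_def endo_inj_surj)
  qed (use rsN in \<open>auto simp: w_def\<close>)
  have eq: "beta N \<kappa> i = beta N \<alpha> (w i)" if "i < N" "i \<noteq> s" for i
  proof (cases "r \<le> i \<and> i < s")
    case True
    then show ?thesis using step[of i] by (simp add: w_def beta_def delta_def)
  next
    case False
    then have "i \<notin> rows" using that rs(3) by force
    then show ?thesis using False that le[of i] by (auto simp: rows_def w_def beta_def)
  qed
  \<comment> \<open>All beta numbers but one are merely permuted, so the remaining one changes by
    the change of the sum, which is the number of removed cells.\<close>
  have "int d = (\<Sum>i<N. beta N \<alpha> i) - (\<Sum>i<N. beta N \<kappa> i)"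
    unfolding dsum sum_subtractf[symmetric] of_nat_sum using le
    by (intro sum.cong) (auto simp: beta_def of_nat_diff)
  also have "(\<Sum>i<N. beta N \<alpha> i) = (\<Sum>i<N. beta N \<alpha> (w i))"
    using sum.permute[OF w, of "beta N \<alpha>"] by (simp add: comp_def)
  also have "\<dots> - (\<Sum>i<N. beta N \<kappa> i) = beta N \<alpha> (w s) - beta N \<kappa> s"
    using rsN(2) eq by (simp add: sum.remove[of "{..<N}" s])
  finally have "beta N \<alpha> (w s) = beta N \<kappa> s + int d" by simp
  then have "beta N \<kappa> i mod int d = beta N \<alpha> (w i) mod int d" if "i < N" for i
    using eq[OF that] by (cases "i = s") auto
  then show "residues_mset d N (beta N \<kappa>) = residues_mset d N (beta N \<alpha>)"
    by (rule residues_mset_permute[OF w])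
qed

text \<open>Conversely, a bead that can slide down by \<open>d\<close> gives a removable hook: the
  lowered value of row \<open>r\<close> is inserted at row \<open>s\<close> in decreasing order, and
  the rows in between move up.\<close>

lemma removable_hook_exists:
  assumes pa: "is_partition (sum_list \<alpha>) \<alpha>" and N: "length \<alpha> \<le> N" and d: "d > 0"
    and x: "x \<in> beta_set N \<alpha>" "x - int d \<ge> 0" "x - int d \<notin> beta_set N \<alpha>"
  shows "\<exists>\<kappa>. removes_hook d \<alpha> \<kappa>"
proof -
  obtain r where r: "r < N" "x = beta N \<alpha> r" using x(1) by (auto simp: beta_set_def)
  let ?b = "beta N \<alpha>"
  define rows where "rows = {i. i < N \<and> ?b i > x - int d}"
  have "r \<in> rows" using r d by (simp add: rows_def)
  define s where "s = Max rows"
  have s: "s \<in> rows" "\<And>i. i \<in> rows \<Longrightarrow> i \<le> s" 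
  proof -
    have "finite rows" "rows \<noteq> {}" using \<open>r \<in> rows\<close> by (auto simp: rows_def)
    then show "s \<in> rows" "\<And>i. i \<in> rows \<Longrightarrow> i \<le> s" by (auto simp: s_def)
  qed
  then have sN: "r \<le> s" "s < N" "?b s > x - int d" using \<open>r \<in> rows\<close> by (auto simp: rows_def)
  have after: "?b i < x - int d" if "s < i" "i < N" for i
  proof -
    have "i \<notin> rows" using s(2) that by force
    moreover have "?b i \<noteq> x - int d" using x(3) that(2) by (metis beta_set_def imageI lessThan_iff)
    ultimately show ?thesis using that by (auto simp: rows_def)
  qed
  \<comment> \<open>The new beta numbers in decreasing order. Strictly decreasing and nonnegative,
    they dominate the staircase and so belong to a partition.\<close>
  define g where "g i = (if r \<le> i \<and> i < s then ?b (Suc i) else if i = s then x - int d else ?b i)" for i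
  have gdec: "g (Suc i) < g i" if "Suc i < N" for i
    using beta_less[OF pa, of i "Suc i" N] beta_less[OF pa, of "Suc i" "Suc (Suc i)" N]
      beta_less[OF pa, of i "Suc (Suc i)" N] after[of "Suc i"] sN that d r(2)
    by (auto simp: g_def not_less le_less_Suc_eq)
  have gge: "g i \<ge> delta N i" if "i < N" for i
    using that
  proof (induction "N - Suc i" arbitrary: i)
    case 0
    then have "i = N - 1" by simp
    then show ?case using 0 x(2) beta_nonneg[of _ N \<alpha>] sN(2) by (auto simp: g_def delta_def)
  next
    case (Suc m)
    then have "g (Suc i) \<ge> delta N (Suc i)" by auto
    moreover have "Suc i < N" using Suc.hyps(2) by simp
    ultimately show ?case using gdec[of i] by (simp add: delta_def)
  qed
  define f where "f i = (if i < N then nat (g i - delta N i) else 0)" for i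
  have gf: "g i = int (f i) + delta N i" if "i < N" for i using gge[OF that] that by (simp add: f_def)
  have dec: "f (Suc i) \<le> f i" for i
  proof (cases "Suc i < N")
    case True
    then have "g (Suc i) < g i" "g i = int (f i) + delta N i" "g (Suc i) = int (f (Suc i)) + delta N (Suc i)"
      using gdec gf by auto
    then show ?thesis by (simp add: delta_def)
  qed (simp add: f_def)
  have anti: "f j \<le> f i" if "i \<le> j" for i j by (rule lift_Suc_antimono_le[of f, OF dec that])
  obtain \<kappa> where \<kappa>: "is_partition (sum_list \<kappa>) \<kappa>" "length \<kappa> \<le> N" "\<And>i. part \<kappa> i = f i"
    using exists_partition[of f N] anti by (auto simp: f_def)
  have bf: "?b i = int (part \<alpha> i) + delta N i" for i by (simp add: beta_def)
  have inner: "Suc (part \<kappa> i) = part \<alpha> (Suc i)" if "r \<le> i" "i < s" for i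
    using gf[of i] bf[of "Suc i"] that sN \<kappa>(3) by (simp add: g_def delta_def)
  have last: "part \<kappa> s < part \<alpha> s" using gf[of s] bf[of s] sN \<kappa>(3) by (simp add: g_def)
  have outer: "part \<kappa> i = part \<alpha> i" if "\<not> (r \<le> i \<and> i \<le> s)" for i
  proof (cases "i < N")
    case True
    have "g i = ?b i" using that sN(1) by (auto simp: g_def)
    then show ?thesis using gf[OF True] bf[of i] \<kappa>(3) by simp
  qed (use N \<kappa>(3) in \<open>auto simp: f_def part_def\<close>)
  have lt: "part \<kappa> i < part \<alpha> i" if "r \<le> i" "i \<le> s" for i
    using inner[of i] part_antimono[OF pa, of i "Suc i"] last that by (cases "i = s") auto
  have le: "part \<kappa> i \<le> part \<alpha> i" for i using lt[of i] outer[of i] by (cases "r \<le> i \<and> i \<le> s") auto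
  define S where "S = young_diagram \<alpha> - young_diagram \<kappa>"
  have S: "(i, j) \<in> S \<longleftrightarrow> part \<kappa> i \<le> j \<and> j < part \<alpha> i" for i j
    by (auto simp: S_def young_diagram_part)
  have Srow: "r \<le> i \<and> i \<le> s" if "(i, j) \<in> S" for i j using that outer[of i] by (auto simp: S)
  have "young_diagram \<kappa> \<subseteq> young_diagram \<alpha>" by (auto simp: young_diagram_part intro: less_le_trans[OF _ le])
  moreover have "card S = d"
  proof -
    define w where "w i = (if r \<le> i \<and> i < s then Suc i else if i = s then r else i)" for i
    have w: "w permutes {..<N}"
    proof (rule bij_imp_permutes)
      have "inj_on w {..<N}" using sN by (auto simp: inj_on_def w_def split: if_splits)
      moreover have "w ` {..<N} \<subseteq> {..<N}" using sN by (auto simp: w_def)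
      ultimately show "bij_betw w {..<N} {..<N}" by (simp add: bij_betw_def endo_inj_surj)
    qed (use sN in \<open>auto simp: w_def\<close>)
    have "int (card S) = (\<Sum>i<N. ?b i) - (\<Sum>i<N. g i)"
      unfolding S_def skew_cells_card[OF N le] sum_subtractf[symmetric] of_nat_sum
      using le gf bf \<kappa>(3) by (intro sum.cong) (auto simp: of_nat_diff)
    also have "(\<Sum>i<N. ?b i) = (\<Sum>i<N. ?b (w i))"
      using sum.permute[OF w, of ?b] by (simp add: comp_def)
    also have "\<dots> - (\<Sum>i<N. g i) = ?b (w s) - g s"
    proof -
      have "(\<Sum>i\<in>{..<N} - {s}. ?b (w i)) = (\<Sum>i\<in>{..<N} - {s}. g i)"
        by (intro sum.cong) (auto simp: w_def g_def)
      then show ?thesis using sN(2) by (simp add: sum.remove[of "{..<N}" s])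
    qed
    also have "\<dots> = int d" using r(2) by (simp add: w_def g_def)
    finally show ?thesis by simp
  qed
  moreover have "connected_cells S"
  proof -
    let ?R = "{(a, b). a \<in> S \<and> b \<in> S \<and> adjacent_cells a b}"
    have sR: "sym (?R\<^sup>*)" by (rule sym_rtrancl) (auto simp: sym_def adjacent_cells_def)
    have sym: "(b, a) \<in> ?R\<^sup>*" if "(a, b) \<in> ?R\<^sup>*" for a b by (rule symD[OF sR that])
    have row: "((i, part \<kappa> i), (i, j)) \<in> ?R\<^sup>*" if "(i, j) \<in> S" for i j
    proof -
      have "part \<kappa> i \<le> j" using that by (simp add: S)
      then show ?thesis using that
      proof (induction j rule: dec_induct)
        case (step j)
        then have m: "(i, j) \<in> S" "(i, Suc j) \<in> S" by (auto simp: S)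
        then have "((i, j), (i, Suc j)) \<in> ?R" by (auto simp: adjacent_cells_def)
        with step.IH[OF m(1)] show ?case by (rule rtrancl_into_rtrancl)
      qed simp
    qed
    have base: "((r, part \<kappa> r), (i, part \<kappa> i)) \<in> ?R\<^sup>*" if "r \<le> i" "i \<le> s" for i
      using that
    proof (induction i rule: dec_induct)
      case (step i)
      have m: "(i, part \<kappa> i) \<in> S" "(Suc i, part \<kappa> i) \<in> S"
        using inner[of i] lt[of i] lt[of "Suc i"] step by (auto simp: S)
      then have "((i, part \<kappa> i), (Suc i, part \<kappa> i)) \<in> ?R" by (auto simp: adjacent_cells_def)
      moreover have "((Suc i, part \<kappa> i), (Suc i, part \<kappa> (Suc i))) \<in> ?R\<^sup>*" by (rule sym[OF row[OF m(2)]])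
      ultimately show ?case using step by (meson Suc_leD rtrancl_into_rtrancl rtrancl_trans)
    qed simp
    have "((r, part \<kappa> r), c) \<in> ?R\<^sup>*" if "c \<in> S" for c
    proof -
      obtain i j where c: "c = (i, j)" by (cases c)
      then show ?thesis using that base[of i] Srow[of i j] row[of i j] by (auto intro: rtrancl_trans)
    qed
    then show ?thesis unfolding connected_cells_def using sym rtrancl_trans by (metis (no_types, lifting))
  qed
  moreover have "\<not> {(i, j), (Suc i, j), (i, Suc j), (Suc i, Suc j)} \<subseteq> S" for i j
  proof
    assume a: "{(i, j), (Suc i, j), (i, Suc j), (Suc i, Suc j)} \<subseteq> S"
    then have "r \<le> i" "i < s" using Srow[of i j] Srow[of "Suc i" j] by auto
    then have "Suc (part \<kappa> i) = part \<alpha> (Suc i)" by (rule inner)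
    then show False using a by (auto simp: S)
  qed
  ultimately have "removes_hook d \<alpha> \<kappa>"
    unfolding removes_hook_def Let_def S_def using pa \<kappa>(1) by simp
  then show ?thesis by blast
qed

subsection \<open>Cores\<close>

text \<open>On each runner the beads are pushed down without gaps, so their number determines them.
  If \<open>x\<close> were missing from \<open>B2\<close>, all beads of \<open>B2\<close> on its
  runner would lie below \<open>x\<close>, hence in \<open>B1\<close>, which would then have more
  beads there.\<close>

lemma core_beta_set_subset:
  assumes d: "d > 0" and B1: "finite B1" "\<And>x. x \<in> B1 \<Longrightarrow> 0 \<le> x" "\<And>x. x \<in> B1 \<Longrightarrow> 0 \<le> x - int d \<Longrightarrow> x - int d \<in> B1"
    and B2: "finite B2" "\<And>x. x \<in> B2 \<Longrightarrow> 0 \<le> x" "\<And>x. x \<in> B2 \<Longrightarrow> 0 \<le> x - int d \<Longrightarrow> x - int d \<in> B2"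
    and card: "\<And>\<rho>. card {x \<in> B1. x mod int d = \<rho>} = card {x \<in> B2. x mod int d = \<rho>}"
  shows "B1 \<subseteq> B2"
proof
  fix x assume x: "x \<in> B1"
  have down: "y \<in> B" if "z \<in> B" "0 \<le> y" "y \<le> z" "y mod int d = z mod int d"
    and B: "\<And>x. x \<in> B \<Longrightarrow> 0 \<le> x - int d \<Longrightarrow> x - int d \<in> B" for B y z
  proof -
    have "int d dvd z - y" using that(4) by (metis mod_eq_dvd_iff)
    then obtain k where k: "z - y = int d * k" by auto
    have "k \<ge> 0" using k that(3) d by (metis diff_ge_0_iff_ge of_nat_0_less_iff zero_le_mult_iff not_less)
    then obtain m where m: "k = int m" by (metis nonneg_int_cases)
    have "z - int d * int l \<in> B" if "l \<le> m" for l
      using that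
    proof (induction l)
      case (Suc l)
      have "int d * int (Suc l) \<le> int d * int m" using Suc.prems by (intro mult_left_mono) auto
      then have "0 \<le> z - int d * int l - int d" using k m \<open>0 \<le> y\<close> by (simp add: algebra_simps)
      then show ?case using B[of "z - int d * int l"] Suc by (simp add: algebra_simps)
    qed (simp add: \<open>z \<in> B\<close>)
    from this[of m] have "z - int d * int m \<in> B" by simp
    moreover have "y = z - int d * int m" using k m by simp
    ultimately show ?thesis by simp
  qed
  show "x \<in> B2"
  proof (rule ccontr)
    assume nx: "x \<notin> B2"
    let ?\<rho> = "x mod int d"
    have "{y \<in> B2. y mod int d = ?\<rho>} \<subset> {y \<in> B1. y mod int d = ?\<rho>}"
    proof
      show "{y \<in> B2. y mod int d = ?\<rho>} \<subseteq> {y \<in> B1. y mod int d = ?\<rho>}"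
      proof
        fix y assume y: "y \<in> {y \<in> B2. y mod int d = ?\<rho>}"
        have "y \<le> x"
        proof (rule ccontr)
          assume "\<not> y \<le> x"
          then have "x \<in> B2" using y B1(2)[OF x] by (intro down[of y B2 x] B2(3)) auto
          with nx show False ..
        qed
        then have "y \<in> B1" using y x B2(2) by (intro down[of x B1 y] B1(3)) auto
        with y show "y \<in> {y \<in> B1. y mod int d = ?\<rho>}" by simp
      qed
    qed (use x nx in auto)
    then have "card {y \<in> B2. y mod int d = ?\<rho>} < card {y \<in> B1. y mod int d = ?\<rho>}"
      using B1(1) by (intro psubset_card_mono) auto
    then show False using card[of ?\<rho>] by simp
  qed
qed

lemma count_residues_mset_beta:
  assumes "is_partition n \<alpha>"
  shows "count (residues_mset d N (beta N \<alpha>)) \<rho> = card {x \<in> beta_set N \<alpha>. x mod int d = \<rho>}"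
proof -
  have "count (residues_mset d N (beta N \<alpha>)) \<rho> = card {i \<in> {..<N}. beta N \<alpha> i mod int d = \<rho>}"
    unfolding residues_mset_def by (rule count_image_mset_set) simp
  also have "\<dots> = card (beta N \<alpha> ` {i \<in> {..<N}. beta N \<alpha> i mod int d = \<rho>})"
    by (rule card_image[symmetric]) (rule beta_inj[OF assms])
  also have "beta N \<alpha> ` {i \<in> {..<N}. beta N \<alpha> i mod int d = \<rho>} = {x \<in> beta_set N \<alpha>. x mod int d = \<rho>}"
    by (auto simp: beta_set_def)
  finally show ?thesis .
qed

lemma core_unique:
  assumes d: "d > 0"
    and 1: "is_partition (sum_list \<kappa>1) \<kappa>1" "length \<kappa>1 \<le> N" "\<nexists>\<kappa>. removes_hook d \<kappa>1 \<kappa>"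
    and 2: "is_partition (sum_list \<kappa>2) \<kappa>2" "length \<kappa>2 \<le> N" "\<nexists>\<kappa>. removes_hook d \<kappa>2 \<kappa>"
    and eq: "residues_mset d N (beta N \<kappa>1) = residues_mset d N (beta N \<kappa>2)"
  shows "\<kappa>1 = \<kappa>2"
proof -
  have card: "card {x \<in> beta_set N \<kappa>1. x mod int d = \<rho>} = card {x \<in> beta_set N \<kappa>2. x mod int d = \<rho>}" for \<rho>
    using count_residues_mset_beta[OF 1(1), of d N \<rho>] count_residues_mset_beta[OF 2(1), of d N \<rho>] eq by simp
  have fin: "finite (beta_set N \<kappa>)" for \<kappa> by (simp add: beta_set_def)
  have nonneg: "0 \<le> x" if "x \<in> beta_set N \<kappa>" for x \<kappa> using that beta_nonneg by (auto simp: beta_set_def)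
  \<comment> \<open>Without a removable hook no bead can slide down.\<close>
  have closed1: "x - int d \<in> beta_set N \<kappa>1" if "x \<in> beta_set N \<kappa>1" "0 \<le> x - int d" for x
    using removable_hook_exists[OF 1(1,2) d that] 1(3) by blast
  have closed2: "x - int d \<in> beta_set N \<kappa>2" if "x \<in> beta_set N \<kappa>2" "0 \<le> x - int d" for x
    using removable_hook_exists[OF 2(1,2) d that] 2(3) by blast
  have "beta_set N \<kappa>1 \<subseteq> beta_set N \<kappa>2"
    by (rule core_beta_set_subset[OF d fin nonneg closed1 fin nonneg closed2 card])
  moreover have "beta_set N \<kappa>2 \<subseteq> beta_set N \<kappa>1"
    by (rule core_beta_set_subset[OF d fin nonneg closed2 fin nonneg closed1 card[symmetric]])
  ultimately show ?thesis using beta_set_eq_imp_eq[OF 1(1,2) 2(1,2)] by simp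
qed

lemma removes_hooks_invariant:
  assumes "(removes_hook d)\<^sup>*\<^sup>* \<alpha> \<kappa>" "d > 0" "is_partition (sum_list \<alpha>) \<alpha>" "length \<alpha> \<le> N"
  shows "is_partition (sum_list \<kappa>) \<kappa> \<and> length \<kappa> \<le> N \<and>
    residues_mset d N (beta N \<kappa>) = residues_mset d N (beta N \<alpha>)"
  using assms(1)
proof (induction rule: rtranclp_induct)
  case (step \<kappa> \<kappa>')
  then have "is_partition (sum_list \<kappa>') \<kappa>'" by (simp add: removes_hook_def)
  with step removes_hook_beta[OF step(2) assms(2), of N] show ?case by simp
qed (use assms in simp)

lemma core_exists:
  assumes "d > 0"
  shows "\<exists>\<kappa>. (removes_hook d)\<^sup>*\<^sup>* \<alpha> \<kappa> \<and> (\<nexists>\<kappa>'. removes_hook d \<kappa> \<kappa>')"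
proof (induction "sum_list \<alpha>" arbitrary: \<alpha> rule: less_induct)
  case less
  show ?case
  proof (cases "\<exists>\<kappa>. removes_hook d \<alpha> \<kappa>")
    case True
    then obtain \<kappa> where \<kappa>: "removes_hook d \<alpha> \<kappa>" by auto
    from less[OF removes_hook_beta(3)[OF \<kappa> assms order_refl]] \<kappa> show ?thesis
      by (meson converse_rtranclp_into_rtranclp)
  qed auto
qed

text \<open>The definite description in \<open>d_core\<close> needs uniqueness of the final
  partition. Invariance of residues gives it for removals from \<mu> and from \<mu>' at once, with
  the same result.\<close>

theorem d_core_eqI:
  assumes d: "d > 0" and \<mu>: "is_partition n \<mu>" "length \<mu> \<le> N" and \<mu>': "is_partition n' \<mu>'" "length \<mu>' \<le> N"
    and eq: "residues_mset d N (beta N \<mu>) = residues_mset d N (beta N \<mu>')"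
  shows "d_core d \<mu> = d_core d \<mu>'"
proof -
  have p: "is_partition (sum_list \<mu>) \<mu>" "is_partition (sum_list \<mu>') \<mu>'"
    using \<mu>(1) \<mu>'(1) by (auto simp: is_partition_def is_composition_def)
  obtain \<kappa> where \<kappa>: "(removes_hook d)\<^sup>*\<^sup>* \<mu> \<kappa>" "\<nexists>\<kappa>'. removes_hook d \<kappa> \<kappa>'"
    using core_exists[OF d, of \<mu>] by blast
  note i = removes_hooks_invariant[OF \<kappa>(1) d p(1) \<mu>(2)]
  have uniq: "\<kappa>' = \<kappa>" if k: "(removes_hook d)\<^sup>*\<^sup>* \<nu> \<kappa>' \<and> (\<nexists>\<kappa>''. removes_hook d \<kappa>' \<kappa>'')" and \<nu>: "\<nu> = \<mu> \<or> \<nu> = \<mu>'" for \<kappa>' \<nu>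
  proof -
    have n: "is_partition (sum_list \<nu>) \<nu>" "length \<nu> \<le> N" "residues_mset d N (beta N \<nu>) = residues_mset d N (beta N \<mu>)"
      using \<nu> p \<mu>(2) \<mu>'(2) eq by auto
    have "is_partition (sum_list \<kappa>') \<kappa>' \<and> length \<kappa>' \<le> N \<and>
        residues_mset d N (beta N \<kappa>') = residues_mset d N (beta N \<mu>)"
      using removes_hooks_invariant[OF conjunct1[OF k] d n(1,2)] n(3) by simp
    then show ?thesis using core_unique[OF d, of \<kappa>' N \<kappa>] i k \<kappa>(2) by auto
  qed
  obtain \<kappa>' where \<kappa>': "(removes_hook d)\<^sup>*\<^sup>* \<mu>' \<kappa>' \<and> (\<nexists>\<kappa>''. removes_hook d \<kappa>' \<kappa>'')"
    using core_exists[OF d, of \<mu>'] by blast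
  have "\<kappa>' = \<kappa>" by (rule uniq[OF \<kappa>']) simp
  have "d_core d \<mu> = \<kappa>" unfolding d_core_def
  proof (rule the_equality)
    show "(removes_hook d)\<^sup>*\<^sup>* \<mu> \<kappa> \<and> (\<nexists>\<kappa>'. removes_hook d \<kappa> \<kappa>')" using \<kappa> by simp
    show "\<kappa>' = \<kappa>" if "(removes_hook d)\<^sup>*\<^sup>* \<mu> \<kappa>' \<and> (\<nexists>\<kappa>''. removes_hook d \<kappa>' \<kappa>'')" for \<kappa>'
      by (rule uniq[OF that]) simp
  qed
  moreover have "d_core d \<mu>' = \<kappa>" unfolding d_core_def
  proof (rule the_equality)
    show "(removes_hook d)\<^sup>*\<^sup>* \<mu>' \<kappa> \<and> (\<nexists>\<kappa>'. removes_hook d \<kappa> \<kappa>')" using \<kappa>' \<open>\<kappa>' = \<kappa>\<close> by simp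
    show "\<kappa>' = \<kappa>" if "(removes_hook d)\<^sup>*\<^sup>* \<mu>' \<kappa>' \<and> (\<nexists>\<kappa>''. removes_hook d \<kappa>' \<kappa>'')" for \<kappa>'
      by (rule uniq[OF that]) simp
  qed
  ultimately show ?thesis by simp
qed

text \<open>A transposition of two elements with the same value of \<open>f\<close> cancels the stabilizer of \<open>f\<close>
  in the signed sum.\<close>
lemma signed_stabilizer_sum:
  assumes B: "finite B"
  shows "(\<Sum>p | p permutes B \<and> (\<forall>x\<in>B. f (p x) = f x). sign p) = (if inj_on f B then 1 else 0)"
proof (cases "inj_on f B")
  case True
  have "{p. p permutes B \<and> (\<forall>x\<in>B. f (p x) = f x)} = {id}"
  proof
    show "{p. p permutes B \<and> (\<forall>x\<in>B. f (p x) = f x)} \<subseteq> {id}"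
    proof
      fix p assume "p \<in> {p. p permutes B \<and> (\<forall>x\<in>B. f (p x) = f x)}"
      then have p: "p permutes B" "\<And>x. x \<in> B \<Longrightarrow> f (p x) = f x" by auto
      have "p x = x" for x
      proof (cases "x \<in> B")
        case x: True
        then have "p x \<in> B" using permutes_in_image[OF p(1)] by simp
        then show ?thesis using inj_onD[OF True, of "p x" x] p(2)[OF x] x by simp
      qed (use p(1) in \<open>auto simp: permutes_def\<close>)
      then show "p \<in> {id}" by (auto simp: fun_eq_iff)
    qed
  qed (auto simp: permutes_id)
  then show ?thesis using True by (simp add: sign_id)
next
  case False
  let ?S = "{p. p permutes B \<and> (\<forall>x\<in>B. f (p x) = f x)}"
  obtain u v where uv: "u \<in> B" "v \<in> B" "u \<noteq> v" "f u = f v"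
    using False by (auto simp: inj_on_def)
  let ?t = "Transposition.transpose u v"
  have t: "?t permutes B" using uv by (intro permutes_swap_id) auto
  have tf: "f (?t x) = f x" for x using uv by (auto simp: Transposition.transpose_def)
  have mem: "?t \<circ> p \<in> ?S" if "p \<in> ?S" for p using that t tf by (auto intro: permutes_compose)
  have "(\<Sum>p\<in>?S. sign p) = (\<Sum>p\<in>?S. sign (?t \<circ> p))"
    by (rule sum.reindex_bij_witness[of _ "\<lambda>p. ?t \<circ> p" "\<lambda>p. ?t \<circ> p"])
      (use mem in \<open>auto simp: comp_assoc[symmetric]\<close>)
  also have "\<dots> = (\<Sum>p\<in>?S. - sign p)"
  proof (intro sum.cong refl)
    fix p assume "p \<in> ?S"
    then have "permutation p" using B unfolding permutation_permutes by (intro exI[of _ B]) auto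
    then show "sign (?t \<circ> p) = - sign p" using uv(3) by (simp add: sign_compose permutation_swap_id sign_swap_id)
  qed
  also have "\<dots> = - (\<Sum>p\<in>?S. sign p)" by (rule sum_negf)
  finally show ?thesis using False by simp
qed

subsection \<open>Jacobi-Trudi combinations of characters\<close>

text \<open>Both the permutation characters of the symmetric group on cosets of Young subgroups and those
  of the general linear group on cosets of parabolic subgroups satisfy the assumptions; everything
  that is needed about unipotent characters follows from them.\<close>
locale jt_family = fin_group G for G :: "('g, 'x) monoid_scheme" (structure) +
  fixes n :: nat and h :: "(nat \<Rightarrow> int) \<Rightarrow> 'g \<Rightarrow> complex"
  assumes h_char: "is_character (h a)"
    and h_ip: "(\<Sum>i<n. a i) = int n \<Longrightarrow> ip (h a) (h b) = of_nat (card (nat_mats n a b))"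
begin

definition jt :: "(nat \<Rightarrow> int) \<Rightarrow> 'g \<Rightarrow> complex" where
  "jt \<beta> g = (\<Sum>w | w permutes {..<n}. of_int (sign w) * h (\<lambda>i. \<beta> i - delta n (w i)) g)"

lemma jt_virtual: "is_virtual (jt \<beta>)"
  unfolding jt_def using is_virtual_sum[of "{w. w permutes {..<n}}" "\<lambda>w. h (\<lambda>i. \<beta> i - delta n (w i))" sign]
  by (simp add: finite_permutations is_character_virtual[OF h_char])

lemma sum_delta_permute: "w permutes {..<n} \<Longrightarrow> (\<Sum>i<n. delta n (w i)) = (\<Sum>i<n. delta n i)"
  using sum.permute[of w "{..<n}" "delta n"] by (simp add: comp_def)

lemma ip_h_jt:
  assumes "(\<Sum>i<n. a i) = int n"
  shows "ip (h a) (jt \<gamma>)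
    = of_int (\<Sum>v | v permutes {..<n}. sign v * int (card (nat_mats n a (\<lambda>i. \<gamma> i - delta n (v i)))))"
proof -
  have "ip (h a) (jt \<gamma>)
      = (\<Sum>v | v permutes {..<n}. cnj (of_int (sign v)) * ip (h a) (h (\<lambda>i. \<gamma> i - delta n (v i))))"
    unfolding jt_def by (rule ip_sum_right)
  then show ?thesis by (simp add: h_ip[OF assms])
qed

lemma ip_jt_left: "ip (jt \<beta>) f = (\<Sum>w | w permutes {..<n}. of_int (sign w) * ip (h (\<lambda>i. \<beta> i - delta n (w i))) f)"
  unfolding jt_def by (rule ip_sum_left)

lemma ip_jt_jt:
  assumes \<beta>: "\<And>i. i < n \<Longrightarrow> 0 \<le> \<beta> i" and s: "(\<Sum>i<n. \<beta> i) = int n + (\<Sum>i<n. delta n i)"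
  shows "ip (jt \<beta>) (jt \<gamma>)
    = of_int (\<Sum>w | w permutes {..<n}. if \<forall>i<n. \<gamma> i = \<beta> (w i) then sign w else 0)"
proof -
  have "(\<Sum>i<n. \<beta> i - delta n (w i)) = int n" if "w permutes {..<n}" for w
    using s sum_delta_permute[OF that] by (simp add: sum_subtractf)
  then have "ip (jt \<beta>) (jt \<gamma>) = of_int (\<Sum>w | w permutes {..<n}. \<Sum>v | v permutes {..<n}.
      sign w * sign v * int (card (nat_mats n (\<lambda>i. \<beta> i - delta n (w i)) (\<lambda>i. \<gamma> i - delta n (v i)))))"
    by (simp add: ip_jt_left ip_h_jt sum_distrib_left mult_ac)
  then show ?thesis by (simp only: cauchy_nat_mats[OF \<beta>])
qed

text \<open>The norm is the signed count of the permutations preserving \<beta>.\<close>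

lemma jt_norm:
  assumes "\<And>i. i < n \<Longrightarrow> 0 \<le> \<beta> i" "(\<Sum>i<n. \<beta> i) = int n + (\<Sum>i<n. delta n i)"
  shows "ip (jt \<beta>) (jt \<beta>) = (if inj_on \<beta> {..<n} then 1 else 0)"
proof -
  have "(\<Sum>w | w permutes {..<n}. if \<forall>i<n. \<beta> i = \<beta> (w i) then sign w else 0)
      = (\<Sum>w | w permutes {..<n} \<and> (\<forall>i\<in>{..<n}. \<beta> (w i) = \<beta> i). sign w)"
    by (subst sum.inter_filter[symmetric]) (auto simp: finite_permutations intro!: sum.cong)
  also have "\<dots> = (if inj_on \<beta> {..<n} then 1 else 0)" by (rule signed_stabilizer_sum) simp
  finally show ?thesis using ip_jt_jt[OF assms, of \<beta>] by simp
qed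

end

lemma sum_beta: "length \<alpha> \<le> N \<Longrightarrow> (\<Sum>i<N. beta N \<alpha> i) = int (sum_list \<alpha>) + (\<Sum>i<N. delta N i)"
  using sum_part[of \<alpha> N] by (simp add: beta_def sum.distrib flip: of_nat_sum)

lemma length_le_sum_list: "0 \<notin> set \<alpha> \<Longrightarrow> length \<alpha> \<le> sum_list (\<alpha> :: nat list)"
  by (induction \<alpha>) auto

subsection \<open>Injective pairs of colourings\<close>

text \<open>The two colours place the points in distinct cells; equivalently, no permutation of
  \<open>B\<close> other than the identity preserves both colourings.\<close>

definition inj_pair :: "'e set \<Rightarrow> ('e \<Rightarrow> nat) \<Rightarrow> ('e \<Rightarrow> nat) \<Rightarrow> bool" where
  "inj_pair B f e \<longleftrightarrow> inj_on (\<lambda>x. (f x, e x)) B"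

lemma inj_pair_column_le:
  assumes "finite B" "inj_pair B f e"
  shows "card {x \<in> B. f x < k \<and> e x = j} \<le> k" "card {x \<in> B. f x < k \<and> e x = j} \<le> card {x \<in> B. e x = j}"
proof -
  have "inj_on f {x \<in> B. f x < k \<and> e x = j}" using assms(2) by (auto simp: inj_pair_def inj_on_def)
  then have "card {x \<in> B. f x < k \<and> e x = j} = card (f ` {x \<in> B. f x < k \<and> e x = j})" by (simp add: card_image)
  also have "\<dots> \<le> card {..<k}" by (rule card_mono) auto
  finally show "card {x \<in> B. f x < k \<and> e x = j} \<le> k" by simp
  show "card {x \<in> B. f x < k \<and> e x = j} \<le> card {x \<in> B. e x = j}" using assms(1) by (intro card_mono) auto
qed

lemma card_rows_less:
  assumes "finite B" "colouring N a B f" "k \<le> N"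
  shows "int (card {x \<in> B. f x < k}) = (\<Sum>i<k. a i)"
proof -
  have "card {x \<in> B. f x < k} = (\<Sum>i<k. card {x \<in> {x \<in> B. f x < k}. f x = i})"
    by (rule card_fibres[symmetric]) (use assms in auto)
  also have "\<dots> = (\<Sum>i<k. card {x \<in> B. f x = i})"
    by (intro sum.cong refl arg_cong[of _ _ card]) auto
  finally show ?thesis using assms(2,3) by (simp add: colouring_def)
qed

lemma card_rows_less_columns:
  assumes "finite B" "colouring N b B e"
  shows "card {x \<in> B. f x < k} = (\<Sum>j<N. card {x \<in> B. f x < k \<and> e x = j})"
proof -
  have "e ` {x \<in> B. f x < k} \<subseteq> {..<N}" using assms(2) by (auto simp: colouring_def)
  from card_fibres[OF _ this] show ?thesis using assms(1) by (simp add: conj_assoc)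
qed

subsection \<open>The conjugate partition\<close>

lemma part_conjugate: "part (conjugate_partition \<alpha>) j = card {i. i < length \<alpha> \<and> j < \<alpha> ! i}"
proof -
  have f: "length (filter (\<lambda>p. j < p) \<alpha>) = card {i. i < length \<alpha> \<and> j < \<alpha> ! i}"
    by (rule length_filter_conv_card)
  have mx: "x \<le> foldr max \<alpha> 0" if "x \<in> set \<alpha>" for x using that by (induction \<alpha>) auto
  have "{i. i < length \<alpha> \<and> j < \<alpha> ! i} = {}" if "\<not> j < foldr max \<alpha> 0"
    using that mx nth_mem by fastforce
  then show ?thesis by (auto simp: part_def conjugate_partition_def f)
qed

lemma less_part_conjugate:
  assumes "is_partition n \<alpha>"
  shows "i < part (conjugate_partition \<alpha>) j \<longleftrightarrow> j < part \<alpha> i"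
proof -
  have e: "{i. i < length \<alpha> \<and> j < \<alpha> ! i} = {i. j < part \<alpha> i}" by (auto simp: part_def)
  have fin: "finite {i. j < part \<alpha> i}" unfolding e[symmetric] by simp
  have down: "i' \<in> {i. j < part \<alpha> i}" if "i \<in> {i. j < part \<alpha> i}" "i' \<le> i" for i i'
    using that part_antimono[OF assms, of i' i] by auto
  have "{i. j < part \<alpha> i} = {..<card {i. j < part \<alpha> i}}"
  proof -
    define m where "m = (LEAST i. \<not> j < part \<alpha> i)"
    have "\<exists>i. \<not> j < part \<alpha> i" by (rule exI[of _ "length \<alpha>"]) (simp add: part_def)
    then have "\<not> j < part \<alpha> m" unfolding m_def by (rule LeastI_ex)
    moreover have "j < part \<alpha> i" if "i < m" for i using not_less_Least[of i "\<lambda>i. \<not> j < part \<alpha> i"] that by (auto simp: m_def)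
    moreover have "i < m" if "j < part \<alpha> i" for i
    proof (rule ccontr)
      assume "\<not> i < m"
      then have "j < part \<alpha> m" using down[of i m] that by simp
      with \<open>\<not> j < part \<alpha> m\<close> show False ..
    qed
    ultimately have "{i. j < part \<alpha> i} = {..<m}" by auto
    then show ?thesis by simp
  qed
  then show ?thesis unfolding part_conjugate e by blast
qed

lemma length_conjugate:
  assumes "is_partition n \<alpha>"
  shows "length (conjugate_partition \<alpha>) \<le> n"
proof -
  have "foldr max \<alpha> 0 \<le> sum_list \<alpha>" by (induction \<alpha>) auto
  then show ?thesis using assms by (simp add: conjugate_partition_def is_partition_def is_composition_def)
qed

text \<open>Both sides count the cells in the first \<open>k\<close> rows of the diagram, by columns
  and by rows.\<close>

lemma sum_min_conjugate:
  assumes "is_partition n \<alpha>" and N: "n \<le> N"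
  shows "(\<Sum>j<N. min k (part (conjugate_partition \<alpha>) j)) = (\<Sum>i<k. part \<alpha> i)"
proof -
  have le: "part \<alpha> i \<le> N" for i
    using assms member_le_sum_list[of "\<alpha> ! i" \<alpha>] by (auto simp: part_def is_partition_def is_composition_def)
  have "(\<Sum>j<N. min k (part (conjugate_partition \<alpha>) j)) = (\<Sum>j<N. card {i \<in> {..<k}. j < part \<alpha> i})"
  proof (intro sum.cong refl)
    fix j
    have "{i \<in> {..<k}. j < part \<alpha> i} = {..<min k (part (conjugate_partition \<alpha>) j)}"
      using less_part_conjugate[OF assms(1)] by auto
    then show "min k (part (conjugate_partition \<alpha>) j) = card {i \<in> {..<k}. j < part \<alpha> i}" by simp
  qed
  also have "\<dots> = (\<Sum>j<N. \<Sum>i<k. if j < part \<alpha> i then 1 else 0)" by (simp add: sum.If_cases Int_def)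
  also have "\<dots> = (\<Sum>i<k. \<Sum>j<N. if j < part \<alpha> i then 1 else 0)" by (rule sum.swap)
  also have "\<dots> = (\<Sum>i<k. card {j \<in> {..<N}. j < part \<alpha> i})" by (simp add: sum.If_cases Int_def)
  also have "\<dots> = (\<Sum>i<k. part \<alpha> i)"
  proof (intro sum.cong refl)
    fix i
    have "{j \<in> {..<N}. j < part \<alpha> i} = {..<part \<alpha> i}" using le[of i] by auto
    then show "card {j \<in> {..<N}. j < part \<alpha> i} = part \<alpha> i" by simp
  qed
  finally show ?thesis .
qed

lemma sum_list_conjugate:
  assumes "is_partition n \<alpha>"
  shows "sum_list (conjugate_partition \<alpha>) = n"
proof -
  have len: "length \<alpha> \<le> n" using assms length_le_sum_list by (auto simp: is_partition_def is_composition_def)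
  have "part (conjugate_partition \<alpha>) j \<le> n" for j
  proof -
    have "part (conjugate_partition \<alpha>) j \<le> card {..<length \<alpha>}" unfolding part_conjugate by (rule card_mono) auto
    then show ?thesis using len by simp
  qed
  then have "(\<Sum>j<n. part (conjugate_partition \<alpha>) j) = (\<Sum>j<n. min n (part (conjugate_partition \<alpha>) j))"
    by (simp add: min_absorb2)
  also have "\<dots> = sum_list \<alpha>" using sum_min_conjugate[OF assms order_refl, of n] sum_part[OF len] by simp
  finally show ?thesis
    using sum_part[OF length_conjugate[OF assms]] assms by (simp add: is_partition_def is_composition_def)
qed

text \<open>In the first \<open>k\<close> rows a column holds at most \<open>k\<close> points and at
  most its total; by \<open>sum_min_conjugate\<close> these bounds add up to the number of cells of
  \<alpha> there.\<close>

lemma inj_pair_dominance: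
  assumes B: "finite B" "inj_pair B f e" and f: "colouring N a B f"
    and e: "colouring N (\<lambda>j. int (part (conjugate_partition \<alpha>) j)) B e"
    and \<alpha>: "is_partition n \<alpha>" "n \<le> N" and k: "k \<le> N"
  shows "(\<Sum>i<k. a i) \<le> (\<Sum>i<k. int (part \<alpha> i))"
proof -
  have "int (card {x \<in> B. f x < k}) \<le> int (\<Sum>j<N. min k (part (conjugate_partition \<alpha>) j))"
    unfolding card_rows_less_columns[OF B(1) e] of_nat_le_iff
  proof (rule sum_mono)
    fix j assume "j \<in> {..<N}"
    then have "card {x \<in> B. e x = j} = part (conjugate_partition \<alpha>) j" using e by (simp add: colouring_def)
    then show "card {x \<in> B. f x < k \<and> e x = j} \<le> min k (part (conjugate_partition \<alpha>) j)"
      using inj_pair_column_le[OF B, of k j] by simp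
  qed
  then show ?thesis using card_rows_less[OF B(1) f k] sum_min_conjugate[OF \<alpha>, of k] by simp
qed

text \<open>With row sizes \<alpha> all bounds behind the dominance inequality are attained. The
  count in the column of \<open>x\<close> grows from the first \<open>f x\<close> to the first
  \<open>Suc (f x)\<close> rows, so \<open>f x\<close> is below the column length.\<close>

lemma inj_pair_image:
  assumes B: "finite B" "inj_pair B f e" and f: "colouring N (\<lambda>i. int (part \<alpha> i)) B f"
    and e: "colouring N (\<lambda>j. int (part (conjugate_partition \<alpha>) j)) B e"
    and \<alpha>: "is_partition n \<alpha>" "n \<le> N"
  shows "(\<lambda>x. (f x, e x)) ` B \<subseteq> young_diagram \<alpha>"
proof
  fix z assume "z \<in> (\<lambda>x. (f x, e x)) ` B"
  then obtain x where x: "x \<in> B" "z = (f x, e x)" by auto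
  let ?c = "\<lambda>k j. card {x \<in> B. f x < k \<and> e x = j}"
  let ?m = "\<lambda>k j. min k (part (conjugate_partition \<alpha>) j)"
  have le: "?c k j \<le> ?m k j" if "j < N" for k j
    using inj_pair_column_le[OF B, of k j] e that by (simp add: colouring_def)
  have eq: "?c k j = ?m k j" if k: "k \<le> N" and j: "j < N" for k j
  proof (rule ccontr)
    assume "?c k j \<noteq> ?m k j"
    then have lt: "?c k j < ?m k j" by (rule le_neq_implies_less[OF le[OF j]])
    have "(\<Sum>j<N. ?c k j) < (\<Sum>j<N. ?m k j)"
      using j lt le by (intro sum_strict_mono_ex1) auto
    then have "int (card {x \<in> B. f x < k}) < int (\<Sum>i<k. part \<alpha> i)"
      unfolding card_rows_less_columns[OF B(1) e] sum_min_conjugate[OF \<alpha>] by (simp del: of_nat_sum)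
    then show False using card_rows_less[OF B(1) f k] by simp
  qed
  have fx: "f x < N" "e x < N" using x(1) f e by (auto simp: colouring_def)
  have "{y \<in> B. f y < f x \<and> e y = e x} \<subset> {y \<in> B. f y < Suc (f x) \<and> e y = e x}" using x(1) by auto
  then have "?c (f x) (e x) < ?c (Suc (f x)) (e x)" using B(1) by (intro psubset_card_mono) auto
  then have "f x < part (conjugate_partition \<alpha>) (e x)" using eq fx by (simp add: min_def split: if_splits)
  then show "z \<in> young_diagram \<alpha>" using x(2) less_part_conjugate[OF \<alpha>(1)] by (simp add: young_diagram_part)
qed

text \<open>Once the values below \<open>i\<close> are fixed, the bound gives
  \<open>w i \<le> i\<close>, and injectivity excludes smaller values.\<close>

lemma permutation_sum_le_imp_id:
  assumes w: "w permutes {..<N::nat}" and le: "\<And>k. k \<le> N \<Longrightarrow> (\<Sum>i<k. w i) \<le> (\<Sum>i<k. i)"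
  shows "w = id"
proof -
  have "w i = i" if "i < N" for i
    using that
  proof (induction i rule: less_induct)
    case (less i)
    have below: "w j = j" if "j < i" for j
      by (rule less.IH[OF that]) (use that less.prems in linarith)
    have "(\<Sum>j<i. w j) = (\<Sum>j<i. j)" by (intro sum.cong refl below) simp
    then have 1: "w i \<le> i" using le[of "Suc i"] less.prems by simp
    have 2: "\<not> w i < i"
    proof
      assume lt: "w i < i"
      have "w (w i) = w i" by (rule below[OF lt])
      then have "w i = i" by (rule injD[OF permutes_inj[OF w]])
      with lt show False by simp
    qed
    show ?case by (rule antisym[OF 1 leI[OF 2]])
  qed
  moreover have "w i = i" if "\<not> i < N" for i using w that by (simp add: permutes_def)
  ultimately show ?thesis by (auto simp: fun_eq_iff)
qed

subsection \<open>Symmetric groups\<close>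

lemma sym_group_fin_group: "fin_group (sym_group n)"
proof -
  have "finite (carrier (sym_group n))" by (simp add: sym_group_def finite_permutations)
  then show ?thesis by (intro fin_group.intro fin_group_axioms.intro sym_group_is_group)
qed

definition sym_colourings :: "nat \<Rightarrow> (nat \<Rightarrow> int) \<Rightarrow> (nat \<Rightarrow> nat) set" where
  "sym_colourings n a = {f \<in> extensional {1..n}. colouring n a {1..n} f}"

text \<open>The inverse makes this a left action.\<close>

definition colour_act :: "nat \<Rightarrow> (nat \<Rightarrow> nat) \<Rightarrow> (nat \<Rightarrow> nat) \<Rightarrow> nat \<Rightarrow> nat" where
  "colour_act n p f = (\<lambda>x\<in>{1..n}. f (inv' p x))"

lemma colour_act_eq_iff:
  assumes p: "p permutes {1..n}" and e: "e \<in> sym_colourings n b"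
  shows "colour_act n p f = e \<longleftrightarrow> (\<forall>x\<in>{1..n}. e (p x) = f x)"
proof
  assume a: "colour_act n p f = e"
  have "e (p x) = f x" if "x \<in> {1..n}" for x
    using fun_cong[OF a, of "p x"] that permutes_in_image[OF p, of x] permutes_inverses(2)[OF p]
    by (simp add: colour_act_def)
  then show "\<forall>x\<in>{1..n}. e (p x) = f x" by blast
next
  assume a: "\<forall>x\<in>{1..n}. e (p x) = f x"
  show "colour_act n p f = e"
  proof (rule extensionalityI[of _ "{1..n}"])
    fix x assume x: "x \<in> {1..n}"
    then have "inv' p x \<in> {1..n}" using permutes_in_image[OF permutes_inv[OF p], of x] by simp
    with a have "e (p (inv' p x)) = f (inv' p x)" by blast
    then show "colour_act n p f x = e x" using x by (simp add: colour_act_def permutes_inverses(1)[OF p])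
  qed (use e in \<open>auto simp: colour_act_def sym_colourings_def\<close>)
qed

lemma finite_sym_colourings: "finite (sym_colourings n a)"
proof (rule finite_subset)
  show "sym_colourings n a \<subseteq> PiE {1..n} (\<lambda>_. {..<n})"
    by (auto simp: sym_colourings_def colouring_def PiE_def)
qed (auto intro: finite_PiE)

lemma colour_act_action: "fin_group.is_action (sym_group n) (colour_act n) (sym_colourings n a)"
proof -
  interpret G: fin_group "sym_group n" by (rule sym_group_fin_group)
  show ?thesis
    unfolding G.is_action_def
  proof (intro conjI ballI finite_sym_colourings)
    fix p f assume "p \<in> carrier (sym_group n)" and f: "f \<in> sym_colourings n a"
    then have p: "p permutes {1..n}" by (simp add: sym_group_def)
    have "card {x \<in> {1..n}. f (inv' p x) = i} = card {x \<in> {1..n}. f x = i}" for i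
    proof (rule bij_betw_same_card[of "inv' p"], rule bij_betw_byWitness[of _ p])
      show "\<forall>x\<in>{x \<in> {1..n}. f (inv' p x) = i}. p (inv' p x) = x" using permutes_inverses[OF p] by auto
      show "\<forall>x\<in>{x \<in> {1..n}. f x = i}. inv' p (p x) = x" using permutes_inverses[OF p] by auto
    qed (use permutes_in_image[OF p] permutes_in_image[OF permutes_inv[OF p]] permutes_inverses[OF p] in auto)
    moreover have "f (inv' p x) < n" if "x \<in> {1..n}" for x
    proof -
      have "inv' p x \<in> {1..n}" using that permutes_in_image[OF permutes_inv[OF p], of x] by simp
      moreover have "f ` {1..n} \<subseteq> {..<n}" using f by (simp add: sym_colourings_def colouring_def)
      ultimately show ?thesis by blast
    qed
    moreover have "{x \<in> {1..n}. colour_act n p f x = i} = {x \<in> {1..n}. f (inv' p x) = i}" for i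
      by (auto simp: colour_act_def)
    ultimately show "colour_act n p f \<in> sym_colourings n a"
      using f by (auto simp: sym_colourings_def colouring_def colour_act_def)
  next
    fix f assume "f \<in> sym_colourings n a"
    then show "colour_act n \<one>\<^bsub>sym_group n\<^esub> f = f"
      by (subst colour_act_eq_iff) (auto simp: sym_group_def permutes_id)
  next
    fix p q f assume "p \<in> carrier (sym_group n)" "q \<in> carrier (sym_group n)" "f \<in> sym_colourings n a"
    then have p: "p permutes {1..n}" and q: "q permutes {1..n}" by (auto simp: sym_group_def)
    have "inv' (p \<circ> q) = inv' q \<circ> inv' p"
      using p q by (simp add: o_inv_distrib permutes_bij)
    then show "colour_act n (p \<otimes>\<^bsub>sym_group n\<^esub> q) f = colour_act n p (colour_act n q f)"
      using permutes_in_image[OF permutes_inv[OF p]] by (auto simp: colour_act_def sym_group_def fun_eq_iff)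
  qed
qed

definition sym_h :: "nat \<Rightarrow> (nat \<Rightarrow> int) \<Rightarrow> (nat \<Rightarrow> nat) \<Rightarrow> complex" where
  "sym_h n a p = (if p \<in> carrier (sym_group n)
     then of_nat (fix_count (colour_act n) (sym_colourings n a) p) else 0)"

lemma colouring_cong:
  assumes "\<And>x. x \<in> B \<Longrightarrow> c x = c' x"
  shows "colouring N a B c \<longleftrightarrow> colouring N a B c'"
proof -
  have "{x \<in> B. c x = i} = {x \<in> B. c' x = i}" for i using assms by auto
  moreover have "c ` B = c' ` B" using assms by (rule image_cong[OF refl])
  ultimately show ?thesis by (simp add: colouring_def)
qed

lemma exists_permutation_extending:
  assumes "bij_betw \<phi> {1..n} {1..n::nat}"
  obtains p where "p permutes {1..n}" "\<And>x. x \<in> {1..n} \<Longrightarrow> p x = \<phi> x"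
proof
  show "(\<lambda>x. if x \<in> {1..n} then \<phi> x else x) permutes {1..n}"
  proof (rule bij_imp_permutes)
    show "bij_betw (\<lambda>x. if x \<in> {1..n} then \<phi> x else x) {1..n} {1..n}"
      using assms by (rule bij_betw_cong[THEN iffD1, rotated]) auto
  qed auto
qed auto

lemma fix_count_product:
  "fix_count (\<lambda>g. map_prod (act1 g) (act2 g)) (X \<times> Y) g = fix_count act1 X g * fix_count act2 Y g"
proof -
  have "{x \<in> X \<times> Y. map_prod (act1 g) (act2 g) x = x} = {x \<in> X. act1 g x = x} \<times> {y \<in> Y. act2 g y = y}" by auto
  then show ?thesis by (simp add: fix_count_def card_cartesian_product)
qed

lemma sym_inner:
  assumes "(\<Sum>i<n. a i) = int n"
  shows "(\<Sum>p\<in>carrier (sym_group n). fix_count (colour_act n) (sym_colourings n a) p *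
      fix_count (colour_act n) (sym_colourings n b) p) = card (carrier (sym_group n)) * card (nat_mats n a b)"
proof -
  interpret G: fin_group "sym_group n" by (rule sym_group_fin_group)
  let ?X = "sym_colourings n a \<times> sym_colourings n b"
  let ?act = "\<lambda>p. map_prod (colour_act n p) (colour_act n p)"
  let ?f = "\<lambda>z. colour_matrix n {1..n} (fst z) (snd z)"
  note A = G.is_actionD[OF colour_act_action[of n a]]
  note A' = G.is_actionD[OF colour_act_action[of n b]]
  have act: "G.is_action ?act ?X" unfolding G.is_action_def using A A' by auto
  have inv: "?f x = ?f y \<longleftrightarrow> (\<exists>p\<in>carrier (sym_group n). ?act p x = y)" if xX: "x \<in> ?X" and yX: "y \<in> ?X" for x y
  proof -
    obtain f e where x: "x = (f, e)" "f \<in> sym_colourings n a" "e \<in> sym_colourings n b" using xX by auto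
    obtain f' e' where y: "y = (f', e')" "f' \<in> sym_colourings n a" "e' \<in> sym_colourings n b" using yX by auto
    have im: "f ` {1..n} \<subseteq> {..<n}" "f' ` {1..n} \<subseteq> {..<n}"
      using x y by (auto simp: sym_colourings_def colouring_def)
    show ?thesis
    proof
      assume "?f x = ?f y"
      then have "colour_matrix n {1..n} f e = colour_matrix n {1..n} f' e'" using x y by simp
      from colour_matrix_eq_imp_bij[OF _ _ im this]
      obtain \<phi> where \<phi>: "bij_betw \<phi> {1..n} {1..n}" "\<forall>x\<in>{1..n}. f' (\<phi> x) = f x \<and> e' (\<phi> x) = e x" by auto
      obtain p where p: "p permutes {1..n}" "\<And>x. x \<in> {1..n} \<Longrightarrow> p x = \<phi> x"
        using exists_permutation_extending[OF \<phi>(1)] by metis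
      then have "?act p x = y"
        using \<phi>(2) x y colour_act_eq_iff[OF p(1) y(2), of f] colour_act_eq_iff[OF p(1) y(3), of e] by simp
      then show "\<exists>p\<in>carrier (sym_group n). ?act p x = y" using p(1) by (auto simp: sym_group_def)
    next
      assume "\<exists>p\<in>carrier (sym_group n). ?act p x = y"
      then obtain p where p: "p permutes {1..n}" "?act p x = y" by (auto simp: sym_group_def)
      then have "\<forall>z\<in>{1..n}. f' (p z) = f z" "\<forall>z\<in>{1..n}. e' (p z) = e z"
        using x y colour_act_eq_iff[OF p(1) y(2), of f] colour_act_eq_iff[OF p(1) y(3), of e] by auto
      then have "colour_matrix n {1..n} f e = colour_matrix n {1..n} f' e'"
        using permutes_imp_bij[OF p(1)] by (intro colour_matrix_bij[of _ p]) auto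
      then show "?f x = ?f y" using x y by simp
    qed
  qed
  have "?f ` ?X = nat_mats n a b"
  proof
    show "?f ` ?X \<subseteq> nat_mats n a b"
      by (auto simp: sym_colourings_def intro!: colour_matrix_in_nat_mats)
    show "nat_mats n a b \<subseteq> ?f ` ?X"
    proof
      fix m assume m: "m \<in> nat_mats n a b"
      obtain c e where ce: "colouring n a {1..n} c" "colouring n b {1..n} e" "colour_matrix n {1..n} c e = m"
        using exists_colourings[OF _ m, of "{1..n}"] assms by auto
      let ?c = "restrict c {1..n}" and ?e = "restrict e {1..n}"
      have "colour_matrix n {1..n} ?c ?e = colour_matrix n {1..n} c e"
        by (rule colour_matrix_bij[of _ id]) auto
      moreover have "?c \<in> sym_colourings n a" "?e \<in> sym_colourings n b"
        using ce(1,2) colouring_cong[of "{1..n}" ?c c n a] colouring_cong[of "{1..n}" ?e e n b]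
        by (auto simp: sym_colourings_def)
      ultimately show "m \<in> ?f ` ?X" using ce(3) by (intro image_eqI[of _ _ "(?c, ?e)"]) auto
    qed
  qed
  then show ?thesis using G.burnside_invariant[OF act inv] by (simp add: fix_count_product)
qed

lemma fin_group_ip_fix_counts:
  assumes "fin_group G"
  shows "char_inner_on G (carrier G) (\<lambda>g. if g \<in> carrier G then of_nat (F g) else 0)
      (\<lambda>g. if g \<in> carrier G then of_nat (H g) else 0)
    = of_nat (\<Sum>g\<in>carrier G. F g * H g) / of_nat (card (carrier G))"
  by (simp add: char_inner_on_def)

lemma sym_jt_family: "jt_family (sym_group n) n (sym_h n)"
proof -
  interpret G: fin_group "sym_group n" by (rule sym_group_fin_group)
  show ?thesis
  proof unfold_locales
    fix a
    show "G.is_character (sym_h n a)"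
      using G.is_character_twisted_action[OF colour_act_action[of n a], of "\<lambda>_. 1"]
      unfolding sym_h_def by (simp cong: if_cong)
  next
    fix a b assume "(\<Sum>i<n. a i) = int n"
    then show "G.ip (sym_h n a) (sym_h n b) = of_nat (card (nat_mats n a b))"
      using G.card_carrier_pos
      unfolding sym_h_def fin_group_ip_fix_counts[OF sym_group_fin_group] by (simp add: sym_inner)
  qed
qed

definition sym_e :: "nat \<Rightarrow> (nat \<Rightarrow> int) \<Rightarrow> (nat \<Rightarrow> nat) \<Rightarrow> complex" where
  "sym_e n b p = of_int (sign p) * sym_h n b p"

lemma sym_e_character: "fin_group.is_character (sym_group n) (sym_e n b)"
proof -
  interpret G: fin_group "sym_group n" by (rule sym_group_fin_group)
  have "G.is_character (\<lambda>p. if p \<in> carrier (sym_group n) then of_int (sign p) *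
      of_nat (fix_count (colour_act n) (sym_colourings n b) p) else 0)"
  proof (rule G.is_character_twisted_action[OF colour_act_action])
    fix p q assume "p \<in> carrier (sym_group n)" "q \<in> carrier (sym_group n)"
    then have "permutation p" "permutation q" by (auto intro: sym_group_carrier')
    then show "(of_int (sign (p \<otimes>\<^bsub>sym_group n\<^esub> q)) :: complex) = of_int (sign p) * of_int (sign q)"
      by (simp add: sym_group_def sign_compose)
  qed (simp add: sym_group_def sign_id)
  also have "(\<lambda>p. if p \<in> carrier (sym_group n) then of_int (sign p) *
      of_nat (fix_count (colour_act n) (sym_colourings n b) p) else 0) = sym_e n b"
    by (auto simp: sym_e_def sym_h_def fun_eq_iff)
  finally show ?thesis .
qed

text \<open>Exchanging the sums leaves, for each pair of colourings, the signed sum over its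
  stabilizer, which \<open>signed_stabilizer_sum\<close> evaluates.\<close>

lemma ip_sym_h_e:
  "char_inner_on (sym_group n) (carrier (sym_group n)) (sym_h n a) (sym_e n b)
    = of_nat (card {z \<in> sym_colourings n a \<times> sym_colourings n b. inj_pair {1..n} (fst z) (snd z)})
      / of_nat (card (carrier (sym_group n)))"
proof -
  let ?X = "sym_colourings n a \<times> sym_colourings n b"
  let ?C = "{p. p permutes {1..n}}"
  let ?fix = "\<lambda>p z. \<forall>x\<in>{1..n}. (fst z (p x), snd z (p x)) = (fst z x, snd z x)"
  have C: "carrier (sym_group n) = ?C" by (simp add: sym_group_def)
  have finX: "finite ?X" by (simp add: finite_sym_colourings)
  have fp: "fix_count (colour_act n) (sym_colourings n a) p * fix_count (colour_act n) (sym_colourings n b) p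
      = card {z \<in> ?X. ?fix p z}" if p: "p permutes {1..n}" for p
  proof -
    have 1: "colour_act n p f = f \<longleftrightarrow> (\<forall>x\<in>{1..n}. f (p x) = f x)" if "f \<in> sym_colourings n c" for f c
      by (rule colour_act_eq_iff[OF p that])
    have "{x \<in> sym_colourings n a. colour_act n p x = x} \<times> {x \<in> sym_colourings n b. colour_act n p x = x}
        = {z \<in> ?X. ?fix p z}"
      by (auto simp: 1)
    then show ?thesis by (simp add: fix_count_def card_cartesian_product[symmetric])
  qed
  have "(\<Sum>p\<in>?C. sign p * int (card {z \<in> ?X. ?fix p z})) = (\<Sum>p\<in>?C. \<Sum>z\<in>?X. if ?fix p z then sign p else 0)"
    using finX by (simp add: sum.If_cases Int_def mult.commute)
  also have "\<dots> = (\<Sum>z\<in>?X. \<Sum>p\<in>?C. if ?fix p z then sign p else 0)" by (rule sum.swap)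
  also have "\<dots> = (\<Sum>z\<in>?X. \<Sum>p | p permutes {1..n} \<and> ?fix p z. sign p)"
    by (simp add: sum.If_cases finite_permutations Int_def)
  also have "\<dots> = (\<Sum>z\<in>?X. if inj_pair {1..n} (fst z) (snd z) then 1 else 0)"
    unfolding inj_pair_def by (intro sum.cong refl signed_stabilizer_sum) simp
  also have "\<dots> = int (card {z \<in> ?X. inj_pair {1..n} (fst z) (snd z)})"
    using finX by (simp add: sum.If_cases Int_def)
  finally have main: "(\<Sum>p\<in>?C. sign p * int (card {z \<in> ?X. ?fix p z}))
      = int (card {z \<in> ?X. inj_pair {1..n} (fst z) (snd z)})" .
  have "(\<Sum>p\<in>?C. sym_h n a p * cnj (sym_e n b p))
      = (\<Sum>p\<in>?C. of_int (sign p * int (fix_count (colour_act n) (sym_colourings n a) p *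
          fix_count (colour_act n) (sym_colourings n b) p)))"
    by (intro sum.cong) (auto simp: sym_h_def sym_e_def C)
  also have "\<dots> = of_int (\<Sum>p\<in>?C. sign p * int (card {z \<in> ?X. ?fix p z}))"
    unfolding of_int_sum by (intro sum.cong refl) (simp only: fp mem_Collect_eq)
  finally show ?thesis unfolding char_inner_on_def C main by simp
qed

text \<open>By \<open>inj_pair_image\<close> the injective pairs with these class sizes are the
  bijections onto the Young diagram, and there are as many of them as permutations.\<close>

lemma ip_sym_h_e_conjugate:
  assumes \<alpha>: "is_partition n \<alpha>"
  shows "char_inner_on (sym_group n) (carrier (sym_group n)) (sym_h n (\<lambda>i. int (part \<alpha> i)))
      (sym_e n (\<lambda>j. int (part (conjugate_partition \<alpha>) j))) = 1"
proof -
  interpret G: fin_group "sym_group n" by (rule sym_group_fin_group)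
  let ?a = "\<lambda>i. int (part \<alpha> i)" and ?b = "\<lambda>j. int (part (conjugate_partition \<alpha>) j)"
  let ?P = "{z \<in> sym_colourings n ?a \<times> sym_colourings n ?b. inj_pair {1..n} (fst z) (snd z)}"
  let ?D = "young_diagram \<alpha>"
  have len: "length \<alpha> \<le> n" and sum: "sum_list \<alpha> = n"
    using \<alpha> length_le_sum_list by (auto simp: is_partition_def is_composition_def)
  have D: "?D = (SIGMA i:{..<n}. {..<part \<alpha> i})" using len by (auto simp: young_diagram_part) (auto simp: part_def split: if_splits)
  have cD: "card ?D = n" "finite ?D" unfolding D using sum_part[OF len] sum by simp_all
  have pl: "part \<alpha> i \<le> n" for i
    using member_le_sum_list[of "\<alpha> ! i" \<alpha>] sum by (auto simp: part_def)
  have Dn: "i < n \<and> j < n" if "(i, j) \<in> ?D" for i j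
    using that pl[of i] by (auto simp: D)
  have bij_iff: "z \<in> ?P \<longleftrightarrow> z \<in> extensional {1..n} \<times> extensional {1..n} \<and> bij_betw (\<lambda>x. (fst z x, snd z x)) {1..n} ?D" for z
  proof
    assume z: "z \<in> ?P"
    then have im: "(\<lambda>x. (fst z x, snd z x)) ` {1..n} \<subseteq> ?D"
      by (intro inj_pair_image[OF _ _ _ _ \<alpha> order_refl]) (auto simp: sym_colourings_def)
    moreover have inj: "inj_on (\<lambda>x. (fst z x, snd z x)) {1..n}" using z by (auto simp: inj_pair_def)
    ultimately have "(\<lambda>x. (fst z x, snd z x)) ` {1..n} = ?D"
      using cD by (intro card_subset_eq) (auto simp: card_image)
    then show "z \<in> extensional {1..n} \<times> extensional {1..n} \<and> bij_betw (\<lambda>x. (fst z x, snd z x)) {1..n} ?D"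
      using inj z by (auto simp: bij_betw_def sym_colourings_def)
  next
    assume z: "z \<in> extensional {1..n} \<times> extensional {1..n} \<and> bij_betw (\<lambda>x. (fst z x, snd z x)) {1..n} ?D"
    let ?g = "\<lambda>x. (fst z x, snd z x)"
    have im: "?g ` {1..n} = ?D" and inj: "inj_on ?g {1..n}" using z by (auto simp: bij_betw_def)
    have mem: "?g x \<in> ?D" if "x \<in> {1..n}" for x using im that by blast
    have cnt: "card {x \<in> {1..n}. Q (?g x)} = card {y \<in> ?D. Q y}" for Q
    proof -
      have "?g ` {x \<in> {1..n}. Q (?g x)} = {y \<in> ?D. Q y}" unfolding im[symmetric] by auto
      moreover have "card (?g ` {x \<in> {1..n}. Q (?g x)}) = card {x \<in> {1..n}. Q (?g x)}"
        by (rule card_image, rule inj_on_subset[OF inj]) auto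
      ultimately show ?thesis by simp
    qed
    have "colouring n ?a {1..n} (fst z)"
      unfolding colouring_def
    proof (intro conjI allI impI)
      show "fst z ` {1..n} \<subseteq> {..<n}" using mem Dn by fastforce
      fix i assume "i < n"
      have "{y \<in> ?D. fst y = i} = Pair i ` {..<part \<alpha> i}" by (auto simp: young_diagram_part)
      then show "int (card {x \<in> {1..n}. fst z x = i}) = int (part \<alpha> i)"
        using cnt[of "\<lambda>y. fst y = i"] by (simp add: card_image inj_on_def)
    qed
    moreover have "colouring n ?b {1..n} (snd z)"
      unfolding colouring_def
    proof (intro conjI allI impI)
      show "snd z ` {1..n} \<subseteq> {..<n}" using mem Dn by fastforce
      fix j assume "j < n"
      have "{y \<in> ?D. snd y = j} = (\<lambda>i. (i, j)) ` {..<part (conjugate_partition \<alpha>) j}"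
        using less_part_conjugate[OF \<alpha>] by (auto simp: young_diagram_part)
      then show "int (card {x \<in> {1..n}. snd z x = j}) = int (part (conjugate_partition \<alpha>) j)"
        using cnt[of "\<lambda>y. snd y = j"] by (simp add: card_image inj_on_def)
    qed
    ultimately show "z \<in> ?P" using z inj by (auto simp: sym_colourings_def inj_pair_def)
  qed
  obtain g0 where g0: "bij_betw g0 {1..n} ?D"
    using finite_same_card_bij[of "{1..n}" ?D] cD by auto
  \<comment> \<open>Composing the fixed bijection \<open>g0\<close> with the permutations reaches
    every bijection exactly once.\<close>
  define act where "act p = ((\<lambda>x\<in>{1..n}. fst (g0 (p x))), (\<lambda>x\<in>{1..n}. snd (g0 (p x))))" for p
  have "bij_betw act (carrier (sym_group n)) ?P"
  proof (rule bij_betw_imageI)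
    show "inj_on act (carrier (sym_group n))"
    proof (rule inj_onI)
      fix p q assume "p \<in> carrier (sym_group n)" "q \<in> carrier (sym_group n)" and eq: "act p = act q"
      then have pq: "p permutes {1..n}" "q permutes {1..n}" by (auto simp: sym_group_def)
      show "p = q"
      proof
        fix x
        show "p x = q x"
        proof (cases "x \<in> {1..n}")
          case True
          then have "g0 (p x) = g0 (q x)"
            using eq unfolding act_def by (auto simp: prod_eq_iff dest!: fun_cong[of _ _ x])
          moreover have "p x \<in> {1..n}" "q x \<in> {1..n}" using True permutes_in_image[OF pq(1), of x] permutes_in_image[OF pq(2), of x] by auto
          ultimately show ?thesis by (rule inj_onD[OF bij_betw_imp_inj_on[OF g0]])
        qed (use pq in \<open>auto simp: permutes_def\<close>)
      qed
    qed
    show "act ` carrier (sym_group n) = ?P"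
    proof
      show "act ` carrier (sym_group n) \<subseteq> ?P"
      proof
        fix z assume "z \<in> act ` carrier (sym_group n)"
        then obtain p where p: "p permutes {1..n}" "z = act p" by (auto simp: sym_group_def)
        have "bij_betw (g0 \<circ> p) {1..n} ?D" using permutes_imp_bij[OF p(1)] g0 by (rule bij_betw_trans)
        then have "bij_betw (\<lambda>x. (fst z x, snd z x)) {1..n} ?D"
          by (rule bij_betw_cong[THEN iffD1, rotated]) (auto simp: p(2) act_def)
        then show "z \<in> ?P" unfolding bij_iff using p(2) by (auto simp: act_def)
      qed
      show "?P \<subseteq> act ` carrier (sym_group n)"
      proof
        fix z assume "z \<in> ?P"
        then have z: "z \<in> extensional {1..n} \<times> extensional {1..n}" "bij_betw (\<lambda>x. (fst z x, snd z x)) {1..n} ?D"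
          unfolding bij_iff by auto
        have b: "bij_betw (inv_into {1..n} g0 \<circ> (\<lambda>x. (fst z x, snd z x))) {1..n} {1..n}"
          using z(2) bij_betw_inv_into[OF g0] by (rule bij_betw_trans)
        define \<phi> where "\<phi> = inv_into {1..n} g0 \<circ> (\<lambda>x. (fst z x, snd z x))"
        obtain p where p: "p permutes {1..n}" "\<And>x. x \<in> {1..n} \<Longrightarrow> p x = \<phi> x"
          using exists_permutation_extending[OF b[folded \<phi>_def]] by metis
        have "g0 (p x) = (fst z x, snd z x)" if "x \<in> {1..n}" for x
          unfolding p(2)[OF that] \<phi>_def comp_apply using g0 z(2) that by (intro bij_betw_inv_into_right) (auto simp: bij_betw_def)
        then have "z = act p"
          using z(1) by (auto simp: act_def prod_eq_iff extensional_def fun_eq_iff)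
        then show "z \<in> act ` carrier (sym_group n)" using p(1) by (auto simp: sym_group_def)
      qed
    qed
  qed
  then have "card ?P = card (carrier (sym_group n))" by (simp add: bij_betw_same_card)
  then show ?thesis unfolding ip_sym_h_e using G.card_carrier_pos by simp
qed

subsection \<open>Prefix sums and Young subgroups\<close>

definition psum :: "nat list \<Rightarrow> nat \<Rightarrow> nat" where
  "psum \<nu> j = sum_list (take j \<nu>)"

lemma psum_0 [simp]: "psum \<nu> 0 = 0"
  by (simp add: psum_def)

lemma psum_Suc: "psum \<nu> (Suc j) = psum \<nu> j + part \<nu> j"
  by (cases "j < length \<nu>") (simp_all add: psum_def part_def take_Suc_conv_app_nth)

lemma psum_mono: "i \<le> j \<Longrightarrow> psum \<nu> i \<le> psum \<nu> j"
  by (rule lift_Suc_mono_le[of "psum \<nu>"]) (simp add: psum_Suc)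

lemma psum_ge_length: "length \<nu> \<le> j \<Longrightarrow> psum \<nu> j = sum_list \<nu>"
  by (simp add: psum_def)

text \<open>Points are numbered from \<open>1\<close>, as in \<open>sym_group\<close>, but blocks
  from \<open>0\<close>, as colours are.\<close>

definition block_index :: "nat list \<Rightarrow> nat \<Rightarrow> nat" where
  "block_index \<nu> x = (LEAST j. x \<le> psum \<nu> (Suc j))"

lemma block_index_eq_iff:
  assumes "0 < x" "x \<le> sum_list \<nu>"
  shows "block_index \<nu> x = j \<longleftrightarrow> psum \<nu> j < x \<and> x \<le> psum \<nu> (Suc j)"
proof
  have ex: "x \<le> psum \<nu> (Suc (length \<nu>))" using assms(2) by (simp add: psum_ge_length)
  assume j: "block_index \<nu> x = j"
  have "x \<le> psum \<nu> (Suc j)"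
    unfolding j[symmetric] block_index_def by (rule LeastI[of "\<lambda>j. x \<le> psum \<nu> (Suc j)"]) (rule ex)
  moreover have "psum \<nu> j < x"
  proof (cases j)
    case (Suc k)
    then have "k < (LEAST j. x \<le> psum \<nu> (Suc j))" using j by (simp add: block_index_def)
    from not_less_Least[OF this] Suc show ?thesis by simp
  qed (use assms(1) in simp)
  ultimately show "psum \<nu> j < x \<and> x \<le> psum \<nu> (Suc j)" by simp
next
  assume a: "psum \<nu> j < x \<and> x \<le> psum \<nu> (Suc j)"
  show "block_index \<nu> x = j"
    unfolding block_index_def
  proof (rule Least_equality)
    fix k assume "x \<le> psum \<nu> (Suc k)"
    then show "j \<le> k" using a psum_mono[of "Suc k" j \<nu>] by (meson leD leI le_less_trans not_less_eq_eq order_trans)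
  qed (use a in simp)
qed

lemma block_index_colouring:
  assumes "sum_list \<nu> = n" "length \<nu> \<le> n"
  shows "colouring n (\<lambda>i. int (part \<nu> i)) {1..n} (block_index \<nu>)"
  unfolding colouring_def
proof (intro conjI allI impI)
  show "block_index \<nu> ` {1..n} \<subseteq> {..<n}"
  proof
    fix j assume "j \<in> block_index \<nu> ` {1..n}"
    then obtain x where x: "x \<in> {1..n}" "block_index \<nu> x = j" by auto
    then have "psum \<nu> j < x" using block_index_eq_iff[of x \<nu> j] assms(1) by simp
    then have "j < length \<nu>" using x(1) psum_ge_length[of \<nu> j] assms(1) by (cases "length \<nu> \<le> j") auto
    then show "j \<in> {..<n}" using assms(2) by simp
  qed
  fix i assume "i < n"
  have le: "psum \<nu> (Suc i) \<le> n"
    using psum_mono[of "Suc i" "max (Suc i) (length \<nu>)" \<nu>]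
      psum_ge_length[of \<nu> "max (Suc i) (length \<nu>)"] assms(1) by simp
  have "x \<in> {1..n} \<and> block_index \<nu> x = i \<longleftrightarrow> psum \<nu> i < x \<and> x \<le> psum \<nu> (Suc i)" for x
  proof (cases "x \<in> {1..n}")
    case True
    then show ?thesis using block_index_eq_iff[of x \<nu> i] assms(1) by simp
  next
    case False
    then show ?thesis using le by auto
  qed
  then have "{x \<in> {1..n}. block_index \<nu> x = i} = {psum \<nu> i<..psum \<nu> (Suc i)}"
    by (simp add: set_eq_iff)
  then show "int (card {x \<in> {1..n}. block_index \<nu> x = i}) = int (part \<nu> i)" by (simp add: psum_Suc)
qed

text \<open>The Young subgroup is the stabilizer of the colouring by blocks, and the colourings with
  these class sizes form a single orbit.\<close>

lemma young_perm_character: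
  assumes \<nu>: "sum_list \<nu> = n" "length \<nu> \<le> n"
  shows "perm_character (sym_group n) (young_subgroup \<nu>) = sym_h n (\<lambda>i. int (part \<nu> i))"
proof -
  interpret G: fin_group "sym_group n" by (rule sym_group_fin_group)
  define f0 where "f0 = restrict (block_index \<nu>) {1..n}"
  have f0: "f0 \<in> sym_colourings n (\<lambda>i. int (part \<nu> i))"
    using block_index_colouring[OF \<nu>] colouring_cong[of "{1..n}" f0 "block_index \<nu>"]
    by (auto simp: sym_colourings_def f0_def)
  have f0_iff: "f0 x = j \<longleftrightarrow> psum \<nu> j < x \<and> x \<le> psum \<nu> (Suc j)" if "x \<in> {1..n}" for x j
    using block_index_eq_iff[of x \<nu> j] that \<nu>(1) by (simp add: f0_def)
  define I where "I j = {psum \<nu> j<..psum \<nu> (Suc j)}" for j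
  have I_sub: "I j \<subseteq> {1..n}" for j
    using psum_mono[of "Suc j" "max (Suc j) (length \<nu>)" \<nu>] psum_ge_length[of \<nu> "max (Suc j) (length \<nu>)"] \<nu>(1)
    by (auto simp: I_def)
  have I_iff: "x \<in> I j \<longleftrightarrow> x \<in> {1..n} \<and> f0 x = j" for x j
    using f0_iff[of x j] I_sub[of j] by (auto simp: I_def)
  have "{p \<in> carrier (sym_group n). colour_act n p f0 = f0} = young_subgroup \<nu>"
  proof (rule Set.set_eqI)
    fix p
    show "p \<in> {p \<in> carrier (sym_group n). colour_act n p f0 = f0} \<longleftrightarrow> p \<in> young_subgroup \<nu>"
    proof (cases "p permutes {1..n}")
      case p: True
      have "(\<forall>x\<in>{1..n}. f0 (p x) = f0 x) \<longleftrightarrow> (\<forall>j<length \<nu>. p ` I j = I j)"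
      proof
        assume a: "\<forall>x\<in>{1..n}. f0 (p x) = f0 x"
        show "\<forall>j<length \<nu>. p ` I j = I j"
        proof (intro allI impI card_subset_eq)
          fix j
          show "p ` I j \<subseteq> I j" using a permutes_in_image[OF p] by (auto simp: I_iff simp del: atLeastAtMost_iff)
          show "card (p ` I j) = card (I j)" by (rule card_image) (rule permutes_inj_on[OF p])
        qed (simp add: I_def)
      next
        assume a: "\<forall>j<length \<nu>. p ` I j = I j"
        show "\<forall>x\<in>{1..n}. f0 (p x) = f0 x"
        proof
          fix x assume x: "x \<in> {1..n}"
          then have "x \<in> I (f0 x)" by (simp add: I_iff)
          moreover have "f0 x < length \<nu>"
          proof (rule ccontr)
            assume "\<not> f0 x < length \<nu>"
            then have "psum \<nu> (f0 x) = n" using psum_ge_length[of \<nu> "f0 x"] \<nu>(1) by simp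
            then show False using f0_iff[OF x, of "f0 x"] x by simp
          qed
          ultimately have "p x \<in> I (f0 x)" using a by blast
          then show "f0 (p x) = f0 x" by (simp add: I_iff)
        qed
      qed
      then show ?thesis
        using p \<nu>(1) colour_act_eq_iff[OF p f0, of f0]
        by (simp add: young_subgroup_def sym_group_def I_def psum_def)
    qed (auto simp: young_subgroup_def sym_group_def \<nu>(1))
  qed
  moreover have "perm_character (sym_group n) {p \<in> carrier (sym_group n). colour_act n p f0 = f0}
      = sym_h n (\<lambda>i. int (part \<nu> i))"
    unfolding sym_h_def
  proof (rule G.perm_character_action[OF colour_act_action f0])
    fix f assume f: "f \<in> sym_colourings n (\<lambda>i. int (part \<nu> i))"
    have "card {x \<in> {1..n}. f0 x = t} = card {x \<in> {1..n}. f x = t}" for t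
    proof (cases "t < n")
      case True
      then show ?thesis using f f0 by (simp add: sym_colourings_def colouring_def)
    next
      case False
      have "f0 ` {1..n} \<subseteq> {..<n}" "f ` {1..n} \<subseteq> {..<n}" using f f0 by (simp_all add: sym_colourings_def colouring_def)
      then have "{x \<in> {1..n}. f0 x = t} = {}" "{x \<in> {1..n}. f x = t} = {}" using False by blast+
      then show ?thesis by (simp only: card.empty)
    qed
    from exists_bij_between_fibres[OF _ _ this]
    obtain \<phi> where \<phi>: "bij_betw \<phi> {1..n} {1..n}" "\<forall>x\<in>{1..n}. f (\<phi> x) = f0 x" by auto
    obtain p where p: "p permutes {1..n}" "\<And>x. x \<in> {1..n} \<Longrightarrow> p x = \<phi> x"
      using exists_permutation_extending[OF \<phi>(1)] by metis
    then have "colour_act n p f0 = f" using colour_act_eq_iff[OF p(1) f, of f0] \<phi>(2) by simp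
    then show "\<exists>p\<in>carrier (sym_group n). colour_act n p f0 = f" using p(1) by (auto simp: sym_group_def)
  qed
  ultimately show ?thesis by simp
qed

section \<open>Signs and norms of virtual characters\<close>

context fin_group
begin

lemma ip_cnj: "ip f g = cnj (ip g f)"
  by (simp add: char_inner_on_def mult.commute)

lemma ip_minus_right: "ip f (\<lambda>g. - h g) = - ip f h"
  by (simp add: char_inner_on_def sum_negf)

text \<open>Were the negative of \<open>f\<close> irreducible, its multiplicity in \<theta> would be
  \<open>-1\<close>.\<close>

lemma virtual_irr_of_character:
  assumes "is_virtual f" "ip f f = 1" "is_character \<theta>" "ip \<theta> f = 1"
  shows "f \<in> irr_characters G"
proof (rule ccontr)
  assume "f \<notin> irr_characters G"
  then have "(\<lambda>g. - f g) \<in> irr_characters G" using is_virtual_norm_one[OF assms(1,2)] by blast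
  from ip_character_irr_nat[OF assms(3) this] obtain k where "ip \<theta> (\<lambda>g. - f g) = of_nat k" by blast
  then have "of_nat k = (- 1 :: complex)" using assms(4) by (simp add: ip_minus_right)
  then have "of_nat (Suc k) = (0 :: complex)" unfolding of_nat_Suc by (simp only: add.right_inverse)
  then show False by (simp only: of_nat_eq_0_iff nat.distinct)
qed

lemma ip_norm_zero:
  assumes "ip f f = 0" "g \<in> carrier G"
  shows "f g = 0"
proof -
  have "(\<Sum>y\<in>carrier G. f y * cnj (f y)) = complex_of_real (\<Sum>y\<in>carrier G. (cmod (f y))\<^sup>2)"
    by (simp add: complex_norm_square del: of_real_power)
  then have "complex_of_real (\<Sum>y\<in>carrier G. (cmod (f y))\<^sup>2) = 0"
    using assms(1) card_carrier_pos by (simp add: char_inner_on_def)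
  then have "(\<Sum>y\<in>carrier G. (cmod (f y))\<^sup>2) = 0" by (simp only: of_real_eq_0_iff)
  then show ?thesis using fin assms(2) by (simp add: sum_nonneg_eq_0_iff)
qed

lemma irr_character_one_nonzero:
  assumes "\<chi> \<in> irr_characters G"
  shows "\<chi> \<one> \<noteq> 0"
proof -
  obtain m \<rho> where r: "irreducible_rep G m \<rho>" "\<chi> = rep_character G m \<rho>"
    using assms by (auto simp: irr_characters_def)
  then have "complex_rep G m \<rho>" "m > 0" by (auto simp: irreducible_rep_def)
  then have "\<chi> \<one> = of_nat m" using r by (simp add: rep_character_def complex_rep_one)
  then show ?thesis using \<open>m > 0\<close> by simp
qed

end

text \<open>The row sizes are \<open>part \<alpha> i + w i - i\<close>. An injective pair forces
  them below \<alpha> in the dominance order, so the prefix sums of \<open>w\<close> are at most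
  those of the identity.\<close>

lemma beta_permuted_eq_id:
  assumes \<alpha>: "is_partition n \<alpha>" and w: "w permutes {..<n}"
    and nz: "char_inner_on (sym_group n) (carrier (sym_group n)) (sym_h n (\<lambda>i. beta n \<alpha> i - delta n (w i)))
      (sym_e n (\<lambda>j. int (part (conjugate_partition \<alpha>) j))) \<noteq> 0"
  shows "w = id"
proof -
  let ?a = "\<lambda>i. beta n \<alpha> i - delta n (w i)" and ?b = "\<lambda>j. int (part (conjugate_partition \<alpha>) j)"
  have "{z \<in> sym_colourings n ?a \<times> sym_colourings n ?b. inj_pair {1..n} (fst z) (snd z)} \<noteq> {}"
  proof
    assume e: "{z \<in> sym_colourings n ?a \<times> sym_colourings n ?b. inj_pair {1..n} (fst z) (snd z)} = {}"
    show False using nz unfolding ip_sym_h_e e by simp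
  qed
  then obtain f e where fe: "f \<in> sym_colourings n ?a" "e \<in> sym_colourings n ?b" "inj_pair {1..n} f e" by auto
  show ?thesis
  proof (rule permutation_sum_le_imp_id[OF w])
    fix k assume k: "k \<le> n"
    have "(\<Sum>i<k. ?a i) \<le> (\<Sum>i<k. int (part \<alpha> i))"
      by (rule inj_pair_dominance[OF _ fe(3) _ _ \<alpha> order_refl k]) (use fe in \<open>auto simp: sym_colourings_def\<close>)
    then have "(\<Sum>i<k. int (w i)) \<le> (\<Sum>i<k. int i)"
      by (simp add: beta_def delta_def sum.distrib sum_subtractf)
    then show "(\<Sum>i<k. w i) \<le> (\<Sum>i<k. i)" by (simp flip: of_nat_sum)
  qed
qed

lemma is_partitionD:
  assumes "is_partition n \<alpha>"
  shows "sum_list \<alpha> = n" "length \<alpha> \<le> n"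
  using assms length_le_sum_list by (auto simp: is_partition_def is_composition_def)

lemma is_compositionD:
  assumes "is_composition n \<nu>"
  shows "sum_list \<nu> = n" "length \<nu> \<le> n"
  using assms length_le_sum_list by (auto simp: is_composition_def)

text \<open>Only the term for \<open>w = id\<close> meets the sign-twisted character of the
  conjugate partition, and it does so once. Hence the alternating sum is irreducible with positive
  sign, and it is the common constituent that defines \<open>sym_character\<close>.\<close>

lemma sym_character_jt:
  assumes \<alpha>: "is_partition n \<alpha>"
  shows "sym_character \<alpha> = jt_family.jt n (sym_h n) (beta n \<alpha>)"
    and "jt_family.jt n (sym_h n) (beta n \<alpha>) \<in> irr_characters (sym_group n)"
    and "char_inner_on (sym_group n) (carrier (sym_group n)) (sym_h n (\<lambda>i. int (part \<alpha> i)))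
      (jt_family.jt n (sym_h n) (beta n \<alpha>)) = 1"
proof -
  interpret S: jt_family "sym_group n" n "sym_h n" by (rule sym_jt_family)
  note len = is_partitionD[OF \<alpha>]
  let ?\<phi> = "S.jt (beta n \<alpha>)"
  let ?a = "\<lambda>w i. beta n \<alpha> i - delta n (w i)"
  let ?h = "sym_h n (\<lambda>i. int (part \<alpha> i))"
  let ?e = "sym_e n (\<lambda>j. int (part (conjugate_partition \<alpha>) j))"
  have id: "(\<Sum>w | w permutes {..<n}. of_int (sign w) * F w) = F id"
    if "\<And>w. w permutes {..<n} \<Longrightarrow> w \<noteq> id \<Longrightarrow> F w = 0" for F :: "_ \<Rightarrow> complex"
  proof -
    have "(\<Sum>w | w permutes {..<n}. of_int (sign w) * F w) = (\<Sum>w\<in>{id}. of_int (sign w) * F w)"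
      using that by (intro sum.mono_neutral_right) (auto simp: finite_permutations permutes_id)
    then show ?thesis by (simp add: sign_id)
  qed
  have echar: "S.is_character ?e" by (rule sym_e_character)
  have he: "S.ip ?h ?e = 1" by (rule ip_sym_h_e_conjugate[OF \<alpha>])
  have norm: "S.ip ?\<phi> ?\<phi> = 1"
    using S.jt_norm[of "beta n \<alpha>"] beta_nonneg sum_beta[OF len(2)] len(1) beta_inj[OF \<alpha>] by simp
  have "S.ip ?\<phi> ?e = S.ip (sym_h n (?a id)) ?e"
    unfolding S.ip_jt_left by (rule id) (use beta_permuted_eq_id[OF \<alpha>] in blast)
  then have pe: "S.ip ?\<phi> ?e = 1" using he by (simp add: beta_def)
  then have ep: "S.ip ?e ?\<phi> = 1" using S.ip_cnj[of ?e ?\<phi>] by simp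
  show irr: "?\<phi> \<in> irr_characters (sym_group n)"
    by (rule S.virtual_irr_of_character[OF S.jt_virtual norm echar ep])
  \<comment> \<open>Any other term containing \<open>?\<phi>\<close> would share it with the
    sign-twisted character \<open>?e\<close> and so have nonzero inner product with
    \<open>?e\<close>.\<close>
  have "S.ip ?\<phi> ?\<phi> = S.ip (sym_h n (?a id)) ?\<phi>"
    unfolding S.ip_jt_left[of "beta n \<alpha>" ?\<phi>]
  proof (rule id, rule ccontr)
    fix w assume w: "w permutes {..<n}" "w \<noteq> id" and nz: "S.ip (sym_h n (?a w)) ?\<phi> \<noteq> 0"
    have "S.ip (sym_h n (?a w)) ?e \<noteq> 0"
      by (rule S.common_constituent_ip_nonzero[OF S.h_char echar irr nz]) (simp add: ep)
    from beta_permuted_eq_id[OF \<alpha> w(1) this] w(2) show False by simp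
  qed
  then show hp: "S.ip ?h ?\<phi> = 1" using norm by (simp add: beta_def)
  have "\<exists>!\<chi>. \<chi> \<in> irr_characters (sym_group n) \<and> S.ip ?h \<chi> \<noteq> 0 \<and> S.ip ?e \<chi> \<noteq> 0"
    by (rule S.common_constituent_unique[OF S.h_char echar he])
  then have "(THE \<chi>. \<chi> \<in> irr_characters (sym_group n) \<and> S.ip ?h \<chi> \<noteq> 0 \<and> S.ip ?e \<chi> \<noteq> 0) = ?\<phi>"
    using irr hp ep by (intro the1_equality) auto
  moreover have "(\<lambda>p. of_int (sign p) * perm_character (sym_group n) (young_subgroup (conjugate_partition \<alpha>)) p) = ?e"
    unfolding young_perm_character[OF sum_list_conjugate[OF \<alpha>] length_conjugate[OF \<alpha>]] sym_e_def ..
  moreover have "perm_character (sym_group n) (young_subgroup \<alpha>) = ?h"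
    by (rule young_perm_character[OF len])
  ultimately show "sym_character \<alpha> = ?\<phi>"
    unfolding sym_character_def Let_def len(1) irr_constituents_def multiplicity_in_def
    by (simp add: conj_ac)
qed

text \<open>A colouring with all classes of size one is fixed by the identity only, so this is the
  regular character.\<close>

lemma ip_regular_sym:
  assumes "\<chi> \<in> irr_characters (sym_group n)"
  shows "char_inner_on (sym_group n) (carrier (sym_group n)) (sym_h n (\<lambda>i. int (part (replicate n 1) i))) \<chi> \<noteq> 0"
proof -
  interpret S: fin_group "sym_group n" by (rule sym_group_fin_group)
  let ?a = "\<lambda>i. int (part (replicate n 1) i)"
  have zero: "sym_h n ?a p = 0" if "p \<noteq> id" for p
  proof -
    have "{f \<in> sym_colourings n ?a. colour_act n p f = f} = {}" if p: "p permutes {1..n}"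
    proof (rule ccontr)
      assume "{f \<in> sym_colourings n ?a. colour_act n p f = f} \<noteq> {}"
      then obtain f where f: "f \<in> sym_colourings n ?a" "\<forall>x\<in>{1..n}. f (p x) = f x"
        using colour_act_eq_iff[OF p] by blast
      have im: "f ` {1..n} \<subseteq> {..<n}" using f(1) by (simp add: sym_colourings_def colouring_def)
      have one: "card {x \<in> {1..n}. f x = i} = 1" if "i < n" for i
        using f(1) that by (simp add: sym_colourings_def colouring_def part_def)
      have "p x = x" for x
      proof (cases "x \<in> {1..n}")
        case x: True
        then have "f x < n" using im by blast
        then obtain y where y: "{y \<in> {1..n}. f y = f x} = {y}" using one card_1_singletonE by metis
        have "x \<in> {y \<in> {1..n}. f y = f x}" using x by simp
        moreover have "p x \<in> {y \<in> {1..n}. f y = f x}" using x f(2) permutes_in_image[OF p, of x] by simp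
        ultimately show ?thesis unfolding y by simp
      qed (use p in \<open>auto simp: permutes_def\<close>)
      then show False using \<open>p \<noteq> id\<close> by (auto simp: fun_eq_iff)
    qed
    note empty = this
    show ?thesis
    proof (cases "p permutes {1..n}")
      case True
      from empty[OF True] show ?thesis unfolding sym_h_def fix_count_def by (simp only: card.empty of_nat_0 if_cancel)
    qed (simp add: sym_h_def fix_count_def sym_group_def)
  qed
  have "S.ip (sym_h n ?a) \<chi> = 1 / of_nat (card (carrier (sym_group n))) * (sym_h n ?a id * cnj (\<chi> id))"
  proof -
    have "(\<Sum>p\<in>carrier (sym_group n). sym_h n ?a p * cnj (\<chi> p)) = (\<Sum>p\<in>{id}. sym_h n ?a p * cnj (\<chi> p))"
      using zero S.fin by (intro sum.mono_neutral_right) (auto simp: sym_group_def permutes_id)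
    then show ?thesis by (simp add: char_inner_on_def)
  qed
  moreover have "sym_h n ?a id \<noteq> 0"
  proof -
    have "restrict (block_index (replicate n 1)) {1..n} \<in> sym_colourings n ?a"
      using block_index_colouring[of "replicate n 1" n]
        colouring_cong[of "{1..n}" "restrict (block_index (replicate n 1)) {1..n}" "block_index (replicate n 1)"]
      by (auto simp: sym_colourings_def sum_list_replicate)
    moreover have "colour_act n id f = f" if "f \<in> sym_colourings n ?a" for f
      using that by (subst colour_act_eq_iff) (auto simp: permutes_id)
    ultimately have "{f \<in> sym_colourings n ?a. colour_act n id f = f} \<noteq> {}" by auto
    then show ?thesis
      using finite_sym_colourings[of n ?a] by (simp add: sym_h_def fix_count_def sym_group_def permutes_id card_eq_0_iff)
  qed
  moreover have "\<chi> id \<noteq> 0" using S.irr_character_one_nonzero[OF assms] by (simp add: sym_group_def)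
  ultimately show ?thesis using S.card_carrier_pos by simp
qed

section \<open>The general linear group\<close>

context fin_vs
begin

declare dim_UNIV [simp del]

subsection \<open>Minimal polynomials and regular elements\<close>

text \<open>Justifies the definite description: an annihilator of least degree can be made monic,
  and the difference of two such would have smaller degree.\<close>

lemma minimal_poly_properties:
  assumes g: "g \<in> aut UNIV"
  shows "lead_coeff (minimal_poly scale g) = 1" "pev (minimal_poly scale g) g v = 0"
    "p \<noteq> 0 \<Longrightarrow> (\<And>v. pev p g v = 0) \<Longrightarrow> degree (minimal_poly scale g) \<le> degree p"
proof -
  define P where "P m \<longleftrightarrow> lead_coeff m = 1 \<and> (\<forall>v. pev m g v = 0) \<and>
      (\<forall>p. p \<noteq> 0 \<and> (\<forall>v. pev p g v = 0) \<longrightarrow> degree m \<le> degree p)" for m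
  obtain m0 where "m0 \<noteq> 0" "\<And>v. pev m0 g v = 0" using exists_annihilator[OF subspace_UNIV g] by auto
  then obtain m where m: "m \<noteq> 0" "\<And>v. pev m g v = 0"
    "\<And>p. p \<noteq> 0 \<Longrightarrow> (\<And>v. pev p g v = 0) \<Longrightarrow> degree m \<le> degree p"
    using ex_has_least_nat[of "\<lambda>p. p \<noteq> 0 \<and> (\<forall>v. pev p g v = 0)" m0 degree] by metis
  have ex: "P (Polynomial.smult (inverse (lead_coeff m)) m)"
    using m by (auto simp: P_def pev_smult)
  have uniq: "m1 = m2" if "P m1" "P m2" for m1 m2
  proof (rule ccontr)
    assume ne: "m1 \<noteq> m2"
    have nz: "m1 \<noteq> 0" "m2 \<noteq> 0" using that by (auto simp: P_def)
    have deg: "degree m1 = degree m2" using that nz by (auto simp: P_def intro: antisym)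
    have "degree (m1 - m2) < degree m2"
    proof (rule degree_less_if_less_eqI)
      show "degree (m1 - m2) \<le> degree m2" using deg degree_diff_le[of m1 "degree m2" m2] by simp
      show "poly.coeff (m1 - m2) (degree m2) = 0" using that deg by (simp add: P_def)
      show "m1 - m2 \<noteq> 0" using ne by simp
    qed
    moreover have "degree m2 \<le> degree (m1 - m2)" using that ne by (auto simp: P_def pev_diff)
    ultimately show False by simp
  qed
  have "P (THE m. P m)" by (rule theI[of P]) (use ex uniq in auto)
  moreover have "(THE m. P m) = minimal_poly scale g"
    unfolding minimal_poly_def P_def pev_def ..
  ultimately have M: "P (minimal_poly scale g)" by simp
  show "lead_coeff (minimal_poly scale g) = 1" "pev (minimal_poly scale g) g v = 0" using M by (auto simp: P_def)
  show "p \<noteq> 0 \<Longrightarrow> (\<And>v. pev p g v = 0) \<Longrightarrow> degree (minimal_poly scale g) \<le> degree p"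
    using M by (auto simp: P_def)
qed

lemma d_regular_eq_reg_auts: "d_regular d scale = reg_auts d UNIV"
proof -
  have "(\<forall>f. irreducible f \<and> lead_coeff f = 1 \<and> f dvd minimal_poly scale g \<and> d dvd degree f \<longrightarrow> f = [:-1, 1:])
      \<longleftrightarrow> reg_part d UNIV g = UNIV" if g: "g \<in> aut UNIV" for g
  proof
    let ?m = "minimal_poly scale g"
    note M = minimal_poly_properties[OF g]
    assume "\<forall>f. irreducible f \<and> lead_coeff f = 1 \<and> f dvd ?m \<and> d dvd degree f \<longrightarrow> f = [:-1, 1:]"
    moreover have "?m \<noteq> 0" using M(1) by auto
    ultimately have "regular_poly d ?m"
      by (auto simp: regular_poly_def singular_factor_def monic_irreducible_def)
    then show "reg_part d UNIV g = UNIV" using M(2) by (auto simp: reg_part_def)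
  next
    let ?m = "minimal_poly scale g"
    note M = minimal_poly_properties[OF g]
    assume reg: "reg_part d UNIV g = UNIV"
    show "\<forall>f. irreducible f \<and> lead_coeff f = 1 \<and> f dvd ?m \<and> d dvd degree f \<longrightarrow> f = [:-1, 1:]"
    proof (intro allI impI, rule ccontr)
      fix f assume f: "irreducible f \<and> lead_coeff f = 1 \<and> f dvd ?m \<and> d dvd degree f" "f \<noteq> [:-1, 1:]"
      then have sf: "singular_factor d f" by (simp add: singular_factor_def monic_irreducible_def)
      from f(1) have "f dvd ?m" by simp
      then obtain q where q: "?m = f * q" by (rule dvdE) (rule that)
      have "?m \<noteq> 0" using M(1) by auto
      then have nz: "f \<noteq> 0" "q \<noteq> 0" using q by auto
      then have "degree q < degree ?m"
        using q sf monic_irreducible_degree[of f] by (simp add: degree_mult_eq singular_factor_def)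
      \<comment> \<open>The cofactor \<open>q\<close> has smaller degree than the minimal polynomial
        and so does not annihilate; since \<open>f\<close> kills its image, the singular part is
        nonzero.\<close>
      then obtain v where v: "pev q g v \<noteq> 0" using M(3)[OF nz(2)] by (metis not_le)
      have "pev f g (pev q g v) = 0"
        using M(2)[of v] unfolding q by (simp add: pev_mult[OF subspace_UNIV g])
      then have "pev q g v \<in> sing_part d UNIV g"
        using singular_factor_singular_poly[OF sf] by (auto simp: sing_part_def)
      then show False using reg_sing_Int[OF subspace_UNIV g, of "pev q g v" d] v reg by simp
    qed
  qed
  moreover have "carrier (GL_group scale) = aut UNIV" by (simp flip: aut_group_UNIV)
  ultimately show ?thesis by (auto simp: d_regular_def reg_auts_def)
qed

subsection \<open>Permutation characters on cosets of parabolic subgroups\<close>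

definition gl_h :: "(nat \<Rightarrow> int) \<Rightarrow> ('v \<Rightarrow> 'v) \<Rightarrow> complex" where
  "gl_h a g = (if g \<in> aut UNIV then of_nat (hchar (dim UNIV) UNIV a g) else 0)"

lemma gl_jt_family: "jt_family (GL_group scale) (dim UNIV) gl_h"
proof -
  interpret G: fin_group "GL_group scale"
    using aut_group_fin_group[OF subspace_UNIV] by (simp only: aut_group_UNIV)
  have car: "carrier (GL_group scale) = aut UNIV" by (simp flip: aut_group_UNIV)
  show ?thesis
  proof unfold_locales
    fix a
    have "G.is_action flag_act (flags (dim UNIV) UNIV a)"
      using flag_act_action[OF subspace_UNIV] by (simp only: aut_group_UNIV)
    from G.is_character_twisted_action[OF this, of "\<lambda>_. 1"]
    have "G.is_character (\<lambda>g. if g \<in> carrier (GL_group scale)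
        then of_nat (fix_count flag_act (flags (dim UNIV) UNIV a) g) else 0)"
      by (simp cong: if_cong)
    then show "G.is_character (gl_h a)" by (simp only: gl_h_def[abs_def] hchar_eq_fix_count car)
  next
    fix a b assume s: "(\<Sum>i<dim UNIV. a i) = int (dim UNIV)"
    have "(\<Sum>g\<in>aut UNIV. gl_h a g * cnj (gl_h b g))
        = of_nat (\<Sum>g\<in>aut UNIV. hchar (dim UNIV) UNIV a g * hchar (dim UNIV) UNIV b g)"
      unfolding of_nat_sum by (intro sum.cong refl) (simp add: gl_h_def)
    also have "\<dots> = of_nat (card (aut UNIV)) * of_nat (card (nat_mats (dim UNIV) a b))"
      by (simp only: hchar_inner[OF subspace_UNIV s] of_nat_mult)
    finally show "G.ip (gl_h a) (gl_h b) = of_nat (card (nat_mats (dim UNIV) a b))"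
      using G.card_carrier_pos by (simp add: char_inner_on_def car)
  qed
qed

lemma gl_h_negative:
  assumes "i < dim UNIV" "a i < 0"
  shows "gl_h a g = 0"
proof -
  have "flags (dim UNIV) UNIV a = {}" using flags_dims_nonneg[of _ "dim UNIV" UNIV a i] assms by fastforce
  then show ?thesis by (simp add: gl_h_def hchar_def)
qed

lemma gl_jt_eq_schar:
  "jt_family.jt (dim UNIV) gl_h \<beta> g = (if g \<in> aut UNIV then of_int (schar (dim UNIV) UNIV \<beta> g) else 0)"
proof -
  interpret G: jt_family "GL_group scale" "dim UNIV" gl_h by (rule gl_jt_family)
  show ?thesis by (simp add: G.jt_def gl_h_def schar_def)
qed

definition base_flag :: "'v list \<Rightarrow> nat list \<Rightarrow> nat \<Rightarrow> 'v set" where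
  "base_flag bs \<nu> i = (if i \<le> dim UNIV then span (set (take (psum \<nu> i) bs)) else {})"

lemma ordered_basis_length:
  assumes "ordered_basis scale bs"
  shows "length bs = dim UNIV"
  using assms dim_span_eq_card_independent[of "set bs"] distinct_card[of bs] by (simp add: ordered_basis_def)

lemma base_flag_in_flags:
  assumes bs: "ordered_basis scale bs" and \<nu>: "sum_list \<nu> = dim UNIV" "length \<nu> \<le> dim UNIV"
  shows "base_flag bs \<nu> \<in> flags (dim UNIV) UNIV (\<lambda>i. int (part \<nu> i))"
proof -
  note len = ordered_basis_length[OF bs]
  have le: "psum \<nu> i \<le> dim UNIV" for i
    using psum_mono[of i "max i (length \<nu>)" \<nu>] psum_ge_length[of \<nu> "max i (length \<nu>)"] \<nu>(1) by simp
  have dim: "dim (span (set (take (psum \<nu> i) bs))) = psum \<nu> i" for i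
    using dim_span_subset_independent[of "set bs" "set (take (psum \<nu> i) bs)"] bs len le[of i]
      distinct_card[OF distinct_take, of bs] set_take_subset[of "psum \<nu> i" bs] by (simp add: ordered_basis_def min_def)
  have mono: "span (set (take (psum \<nu> i) bs)) \<subseteq> span (set (take (psum \<nu> (Suc i)) bs))" for i
    using psum_mono[of i "Suc i" \<nu>] by (intro span_mono set_take_subset_set_take) simp
  have "span (set (take (psum \<nu> (dim UNIV)) bs)) = UNIV"
    using psum_ge_length[OF \<nu>(2)] \<nu>(1) len bs by (simp add: ordered_basis_def)
  then show ?thesis
    using dim dim[of "Suc _"] mono unfolding flags_def base_flag_def psum_Suc by (auto simp: psum_Suc subspace_span simp del: dim_span)
qed

text \<open>From \<open>length \<nu>\<close> on, the base flag is the whole space, which every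
  automorphism preserves.\<close>

lemma parabolic_eq_stabilizer:
  assumes bs: "ordered_basis scale bs" and \<nu>: "sum_list \<nu> = dim UNIV" "length \<nu> \<le> dim UNIV"
  shows "parabolic scale bs \<nu> = {g \<in> carrier (GL_group scale). flag_act g (base_flag bs \<nu>) = base_flag bs \<nu>}"
proof -
  have "(\<forall>j\<le>length \<nu>. g ` span (set (take (psum \<nu> j) bs)) = span (set (take (psum \<nu> j) bs)))
      \<longleftrightarrow> flag_act g (base_flag bs \<nu>) = base_flag bs \<nu>" if g: "g \<in> aut UNIV" for g
  proof -
    have top: "span (set (take (psum \<nu> j) bs)) = UNIV" if "length \<nu> \<le> j" for j
      using psum_ge_length[OF that] \<nu>(1) ordered_basis_length[OF bs] bs by (simp add: ordered_basis_def)
    have "g ` span (set (take (psum \<nu> j) bs)) = span (set (take (psum \<nu> j) bs))" if "\<not> j \<le> length \<nu>" for j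
      using top[of j] that autD(4)[OF g] by simp
    note stable = this
    show ?thesis
    proof
      assume a: "\<forall>j\<le>length \<nu>. g ` span (set (take (psum \<nu> j) bs)) = span (set (take (psum \<nu> j) bs))"
      show "flag_act g (base_flag bs \<nu>) = base_flag bs \<nu>"
      proof
        fix j
        have "g ` span (set (take (psum \<nu> j) bs)) = span (set (take (psum \<nu> j) bs))"
          using a stable[of j] by (cases "j \<le> length \<nu>") simp_all
        then show "flag_act g (base_flag bs \<nu>) j = base_flag bs \<nu> j" by (simp add: flag_act_def base_flag_def)
      qed
    next
      assume a: "flag_act g (base_flag bs \<nu>) = base_flag bs \<nu>"
      show "\<forall>j\<le>length \<nu>. g ` span (set (take (psum \<nu> j) bs)) = span (set (take (psum \<nu> j) bs))"
      proof (intro allI impI)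
        fix j assume "j \<le> length \<nu>"
        then show "g ` span (set (take (psum \<nu> j) bs)) = span (set (take (psum \<nu> j) bs))"
          using fun_cong[OF a, of j] \<nu>(2) by (simp add: flag_act_def base_flag_def)
      qed
    qed
  qed
  moreover have "carrier (GL_group scale) = aut UNIV" by (simp flip: aut_group_UNIV)
  ultimately show ?thesis by (auto simp: parabolic_def psum_def)
qed

lemma parabolic_perm_character:
  assumes bs: "ordered_basis scale bs" and \<nu>: "sum_list \<nu> = dim UNIV" "length \<nu> \<le> dim UNIV"
  shows "perm_character (GL_group scale) (parabolic scale bs \<nu>) = gl_h (\<lambda>i. int (part \<nu> i))"
proof -
  let ?n = "dim UNIV" and ?a = "\<lambda>i. int (part \<nu> i)"
  interpret G: fin_group "GL_group scale"
    using aut_group_fin_group[OF subspace_UNIV] by (simp only: aut_group_UNIV)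
  have car: "carrier (GL_group scale) = aut UNIV" by (simp flip: aut_group_UNIV)
  note F0 = base_flag_in_flags[OF assms]
  have act: "G.is_action flag_act (flags ?n UNIV ?a)"
    using flag_act_action[OF subspace_UNIV] by (simp only: aut_group_UNIV)
  have "perm_character (GL_group scale) {g \<in> carrier (GL_group scale). flag_act g (base_flag bs \<nu>) = base_flag bs \<nu>}
      = (\<lambda>g. if g \<in> carrier (GL_group scale) then of_nat (fix_count flag_act (flags ?n UNIV ?a) g) else 0)"
  proof (rule G.perm_character_action[OF act F0])
    fix F assume F: "F \<in> flags ?n UNIV ?a"
    \<comment> \<open>The lemma on pairs, applied to the same flag twice, yields a basis adapted to
      one flag.\<close>
    obtain B c where B: "independent B" "span B = UNIV" "colouring ?n ?a B c" "base_flag bs \<nu> = colour_flag ?n B c"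
      by (rule flags_pair_coloured[OF F0 F0])
    obtain C e where C: "independent C" "span C = UNIV" "colouring ?n ?a C e" "F = colour_flag ?n C e"
      by (rule flags_pair_coloured[OF F F])
    have "card {x \<in> B. c x = t} = card {y \<in> C. e y = t}" for t
    proof (cases "t < ?n")
      case True
      then show ?thesis using B(3) C(3) by (simp add: colouring_def)
    next
      case False
      then have "{x \<in> B. c x = t} = {}" "{y \<in> C. e y = t} = {}" using B(3) C(3) by (auto simp: colouring_def)
      then show ?thesis by (simp only: card.empty)
    qed
    from exists_bij_between_fibres[OF fin_sub fin_sub this]
    obtain \<phi> where \<phi>: "bij_betw \<phi> B C" "\<forall>x\<in>B. e (\<phi> x) = c x" by auto
    then have "\<phi> ` B = C" by (simp add: bij_betw_def)
    with exists_aut_extending[OF B(1,2) C(2)]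
    obtain g where g: "g \<in> aut UNIV" "\<And>x. x \<in> B \<Longrightarrow> g x = \<phi> x" by metis
    have "g ` B = C" using g(2) \<open>\<phi> ` B = C\<close> by auto
    from colour_flag_act[OF subspace_UNIV g(1) B(2) this, of e c ?n]
    have "flag_act g (base_flag bs \<nu>) = F" using g(2) \<phi>(2) B(4) C(4) by simp
    then show "\<exists>g\<in>carrier (GL_group scale). flag_act g (base_flag bs \<nu>) = F" using g(1) car by auto
  qed
  then show ?thesis
    by (simp only: parabolic_eq_stabilizer[OF assms] gl_h_def[abs_def] hchar_eq_fix_count car)
qed

end

text \<open>Zero parts only repeat prefix sums, and a parabolic subgroup depends on the set of these
  sums alone.\<close>

lemma prefix_sums_filter:
  "psum (filter (\<lambda>x. x \<noteq> 0) \<nu>) ` {..length (filter (\<lambda>x. x \<noteq> 0) \<nu>)} = psum \<nu> ` {..length \<nu>}"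
proof (induction \<nu>)
  case (Cons x \<nu>)
  have c: "psum (x # \<nu>) ` {..length (x # \<nu>)} = insert 0 ((+) x ` psum \<nu> ` {..length \<nu>})" for x and \<nu> :: "nat list"
    by (simp add: psum_def image_image atMost_Suc_eq_insert_0)
  have z: "0 \<in> psum \<nu> ` {..length \<nu>}" for \<nu> by (rule image_eqI[of _ _ 0]) simp_all
  show ?case
  proof (cases "x = 0")
    case True
    then show ?thesis unfolding c using z[of \<nu>] Cons.IH by (simp add: insert_absorb)
  next
    case False
    then have "filter (\<lambda>x. x \<noteq> 0) (x # \<nu>) = x # filter (\<lambda>x. x \<noteq> 0) \<nu>" by simp
    then show ?thesis by (simp only: c Cons.IH)
  qed
qed simp

lemma parabolic_filter: "parabolic scale bs (filter (\<lambda>x. x \<noteq> 0) \<nu>) = parabolic scale bs \<nu>"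
proof -
  have "parabolic scale bs \<nu> = {g \<in> carrier (GL_group scale). \<forall>k\<in>psum \<nu> ` {..length \<nu>}.
      g ` Modules.module.span scale (set (take k bs)) = Modules.module.span scale (set (take k bs))}" for \<nu>
    by (auto simp: parabolic_def psum_def)
  then show ?thesis by (simp only: prefix_sums_filter)
qed

text \<open>Jumps may be zero, parts of a composition may not. Deleting zeros moves the later jumps
  and changes the flags, but not the stabilizer, and so not the permutation character.\<close>

lemma (in fin_vs) gl_h_composition:
  assumes bs: "ordered_basis scale bs" and s: "(\<Sum>i<dim UNIV. a i) = int (dim UNIV)"
    and nonneg: "\<And>i. i < dim UNIV \<Longrightarrow> 0 \<le> a i"
  shows "\<exists>\<nu>. is_composition (dim UNIV) \<nu> \<and> gl_h a = gl_h (\<lambda>i. int (part \<nu> i))"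
proof -
  define \<nu>' where "\<nu>' = map (\<lambda>i. nat (a i)) [0..<dim UNIV]"
  define \<nu> where "\<nu> = filter (\<lambda>x. x \<noteq> 0) \<nu>'"
  have "int (sum_list \<nu>') = (\<Sum>i<dim UNIV. a i)"
    unfolding \<nu>'_def interv_sum_list_conv_sum_set_nat of_nat_sum
    using nonneg by (intro sum.cong) auto
  then have \<nu>': "sum_list \<nu>' = dim UNIV" "length \<nu>' \<le> dim UNIV" using s by (simp_all add: \<nu>'_def)
  have "sum_list (filter (\<lambda>x. x \<noteq> 0) xs) = sum_list xs" for xs :: "nat list" by (induction xs) auto
  then have comp: "is_composition (dim UNIV) \<nu>" using \<nu>' by (auto simp: \<nu>_def is_composition_def)
  have "gl_h a = gl_h (\<lambda>i. int (part \<nu>' i))"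
    unfolding gl_h_def[abs_def] hchar_def
    using nonneg by (subst flags_cong[of "dim UNIV" a "\<lambda>i. int (part \<nu>' i)"]) (auto simp: part_def \<nu>'_def)
  also have "\<dots> = perm_character (GL_group scale) (parabolic scale bs \<nu>')"
    by (rule parabolic_perm_character[OF bs \<nu>', symmetric])
  also have "\<dots> = gl_h (\<lambda>i. int (part \<nu> i))"
    using parabolic_perm_character[OF bs is_compositionD[OF comp]] by (simp only: \<nu>_def parabolic_filter)
  finally show ?thesis using comp by blast
qed

subsection \<open>Constituents of Jacobi-Trudi combinations\<close>

text \<open>Makes the expansion of the alternating sums in terms of the \<open>h a\<close> triangular.\<close>
lemma delta_form_increase:
  assumes w: "w permutes {..<n}" "w \<noteq> id"
  shows "(\<Sum>i<n. delta n i * a i) < (\<Sum>i<n. delta n i * (a i + delta n i - delta n (w i)))"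
proof -
  have sq: "(\<Sum>i<n. (delta n (w i))\<^sup>2) = (\<Sum>i<n. (delta n i)\<^sup>2)"
    using sum.permute[OF w(1), of "\<lambda>i. (delta n i)\<^sup>2"] by (simp add: comp_def)
  have "2 * (\<Sum>i<n. delta n i * (delta n i - delta n (w i)))
      = (\<Sum>i<n. (delta n i - delta n (w i))\<^sup>2 + (delta n i)\<^sup>2 - (delta n (w i))\<^sup>2)"
    unfolding sum_distrib_left by (intro sum.cong refl) (simp add: power2_eq_square algebra_simps)
  also have "\<dots> = (\<Sum>i<n. (delta n i - delta n (w i))\<^sup>2)"
    using sq by (simp add: sum.distrib sum_subtractf)
  also have "\<dots> > 0"
  proof -
    obtain i where i: "w i \<noteq> i" using w(2) by (auto simp: fun_eq_iff)
    then have "i < n" using w(1) by (auto simp: permutes_def)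
    then show ?thesis using i by (intro sum_pos2[of _ i]) (auto simp: delta_def)
  qed
  finally have "0 < (\<Sum>i<n. delta n i * (delta n i - delta n (w i)))" by simp
  moreover have "(\<Sum>i<n. delta n i * (a i + delta n i - delta n (w i)))
      = (\<Sum>i<n. delta n i * a i) + (\<Sum>i<n. delta n i * (delta n i - delta n (w i)))"
    unfolding sum.distrib[symmetric] by (intro sum.cong refl) (simp add: algebra_simps)
  ultimately show ?thesis by simp
qed

context jt_family
begin

text \<open>\<open>h a\<close> is the alternating sum for \<open>a + delta\<close> up to signed
  terms with a larger value of the form \<open>Q\<close>. As \<open>Q\<close> is bounded on
  nonnegative sequences of sum \<open>n\<close>, descent shows that orthogonality to all these
  alternating sums implies orthogonality to \<open>h a\<close>.\<close>

lemma exists_jt_constituent: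
  assumes neg: "\<And>a g. \<exists>i<n. a i < 0 \<Longrightarrow> h a g = 0"
    and a: "(\<Sum>i<n. a i) = int n" and nz: "ip (h a) \<psi> \<noteq> 0"
  shows "\<exists>\<beta>. (\<forall>i<n. 0 \<le> \<beta> i) \<and> (\<Sum>i<n. \<beta> i) = int n + (\<Sum>i<n. delta n i) \<and> ip (jt \<beta>) \<psi> \<noteq> 0"
proof (rule ccontr)
  assume "\<not> ?thesis"
  then have none: "ip (jt \<beta>) \<psi> = 0"
    if "\<forall>i<n. 0 \<le> \<beta> i" "(\<Sum>i<n. \<beta> i) = int n + (\<Sum>i<n. delta n i)" for \<beta>
    using that by auto
  define Q where "Q a = (\<Sum>i<n. delta n i * a i)" for a
  have "ip (h a) \<psi> = 0" if "(\<Sum>i<n. a i) = int n" for a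
    using that
  proof (induction "nat (int n * int n + 1 - Q a)" arbitrary: a rule: less_induct)
    case less
    show ?case
    proof (cases "\<exists>i<n. a i < 0")
      case True
      then have "h a g = 0" for g by (rule neg)
      then show ?thesis by (simp add: char_inner_on_def)
    next
      case False
      then have pos: "0 \<le> a i" if "i < n" for i using that not_less by blast
      let ?\<beta> = "\<lambda>i. a i + delta n i"
      have "ip (jt ?\<beta>) \<psi> = 0"
      proof (rule none, intro allI impI)
        show "0 \<le> ?\<beta> i" if "i < n" for i using pos[OF that] that by (simp add: delta_def)
        show "(\<Sum>i<n. ?\<beta> i) = int n + (\<Sum>i<n. delta n i)" unfolding sum.distrib less.prems ..
      qed
      then have s: "(\<Sum>w | w permutes {..<n}. of_int (sign w) * ip (h (\<lambda>i. ?\<beta> i - delta n (w i))) \<psi>) = 0"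
        by (simp only: ip_jt_left)
      have "Q a \<le> (\<Sum>i<n. int n * a i)"
        unfolding Q_def using pos by (intro sum_mono mult_right_mono) (auto simp: delta_def)
      then have le: "Q a \<le> int n * int n" using less.prems by (simp flip: sum_distrib_left)
      have "ip (h (\<lambda>i. ?\<beta> i - delta n (w i))) \<psi> = 0" if w: "w permutes {..<n}" "w \<noteq> id" for w
      proof (rule less.hyps)
        have "Q a < Q (\<lambda>i. ?\<beta> i - delta n (w i))" unfolding Q_def by (rule delta_form_increase[OF w])
        then show "nat (int n * int n + 1 - Q (\<lambda>i. ?\<beta> i - delta n (w i))) < nat (int n * int n + 1 - Q a)"
          using le by linarith
        show "(\<Sum>i<n. ?\<beta> i - delta n (w i)) = int n"
          using less.prems sum_delta_permute[OF w(1)] by (simp add: sum.distrib sum_subtractf)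
      qed
      then have "(\<Sum>w | w permutes {..<n}. of_int (sign w) * ip (h (\<lambda>i. ?\<beta> i - delta n (w i))) \<psi>)
          = (\<Sum>w\<in>{id}. of_int (sign w) * ip (h (\<lambda>i. ?\<beta> i - delta n (w i))) \<psi>)"
        by (intro sum.mono_neutral_right) (auto simp: finite_permutations permutes_id)
      then show ?thesis using s by (simp add: sign_id)
    qed
  qed
  then show False using a nz by blast
qed

text \<open>An alternating sum that meets \<psi> is nonzero, so its norm is one and it is
  irreducible up to sign; orthogonality identifies it with \<psi> up to sign.\<close>

lemma irr_eq_jt:
  assumes neg: "\<And>a g. \<exists>i<n. a i < 0 \<Longrightarrow> h a g = 0"
    and a: "(\<Sum>i<n. a i) = int n" and \<psi>: "\<psi> \<in> irr_characters G" and nz: "ip (h a) \<psi> \<noteq> 0"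
  shows "\<exists>\<beta>. \<psi> = jt \<beta> \<or> \<psi> = (\<lambda>g. - jt \<beta> g)"
proof -
  have "\<exists>\<beta>. (\<forall>i<n. 0 \<le> \<beta> i) \<and> (\<Sum>i<n. \<beta> i) = int n + (\<Sum>i<n. delta n i) \<and> ip (jt \<beta>) \<psi> \<noteq> 0"
    by (rule exists_jt_constituent[OF _ a nz]) (rule neg)
  then obtain \<beta> where \<beta>: "\<forall>i<n. 0 \<le> \<beta> i" "(\<Sum>i<n. \<beta> i) = int n + (\<Sum>i<n. delta n i)" "ip (jt \<beta>) \<psi> \<noteq> 0"
    by (elim exE conjE) (rule that)
  have norm: "ip (jt \<beta>) (jt \<beta>) = (if inj_on \<beta> {..<n} then 1 else 0)"
    by (rule jt_norm[OF \<beta>(1)[rule_format] \<beta>(2)])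
  have "ip (jt \<beta>) (jt \<beta>) \<noteq> 0"
  proof
    assume "ip (jt \<beta>) (jt \<beta>) = 0"
    from ip_norm_zero[OF this] have "ip (jt \<beta>) \<psi> = 0" unfolding char_inner_on_def by simp
    with \<beta>(3) show False ..
  qed
  then have "ip (jt \<beta>) (jt \<beta>) = 1" unfolding norm by presburger
  from is_virtual_norm_one[OF jt_virtual this] show ?thesis
  proof
    assume "jt \<beta> \<in> irr_characters G"
    then have "\<psi> = jt \<beta>" using irr_characters_orthonormal[OF _ \<psi>, of "jt \<beta>"] \<beta>(3) by (metis (full_types))
    then show ?thesis by blast
  next
    assume m: "(\<lambda>g. - jt \<beta> g) \<in> irr_characters G"
    have "ip (\<lambda>g. - jt \<beta> g) \<psi> \<noteq> 0" using \<beta>(3) by (simp add: char_inner_on_def sum_negf)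
    then have "\<psi> = (\<lambda>g. - jt \<beta> g)" using irr_characters_orthonormal[OF m \<psi>] by (metis (full_types))
    then show ?thesis by blast
  qed
qed

end

subsection \<open>Unipotent characters\<close>

context fin_vs
begin

text \<open>Both sides are the same signed count of matrices. This is the bridge between the two
  labellings.\<close>

lemma gl_sym_ip:
  assumes "(\<Sum>i<dim UNIV. a i) = int (dim UNIV)"
  shows "char_inner_on (GL_group scale) (carrier (GL_group scale)) (gl_h a) (jt_family.jt (dim UNIV) gl_h \<beta>)
    = char_inner_on (sym_group (dim UNIV)) (carrier (sym_group (dim UNIV))) (sym_h (dim UNIV) a)
        (jt_family.jt (dim UNIV) (sym_h (dim UNIV)) \<beta>)"
proof -
  interpret G: jt_family "GL_group scale" "dim UNIV" gl_h by (rule gl_jt_family)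
  interpret S: jt_family "sym_group (dim UNIV)" "dim UNIV" "sym_h (dim UNIV)" by (rule sym_jt_family)
  show ?thesis unfolding G.ip_h_jt[OF assms] S.ip_h_jt[OF assms] ..
qed

lemma unipotent_characters_eq:
  assumes bs: "ordered_basis scale bs"
  shows "unipotent_characters scale bs
    = irr_constituents (GL_group scale) (gl_h (\<lambda>i. int (part (replicate (dim UNIV) 1) i)))"
  unfolding unipotent_characters_def borel_def ordered_basis_length[OF bs]
  by (subst parabolic_perm_character[OF bs]) (simp_all add: sum_list_replicate)

lemma part_sum_dim: "sum_list \<nu> = n \<Longrightarrow> length \<nu> \<le> n \<Longrightarrow> (\<Sum>i<n. int (part \<nu> i)) = int n"
  using sum_part[of \<nu> n] by (simp flip: of_nat_sum)

text \<open>The multiplicities in the parabolic permutation characters determine the inner products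
  with all \<open>gl_h a\<close>, hence with the alternating sum itself. There the value is its
  norm, one, which proves uniqueness in the definition.\<close>

lemma unipotent_character_eq_jt:
  assumes bs: "ordered_basis scale bs" and \<mu>: "is_partition (dim UNIV) \<mu>"
  shows "unipotent_character scale bs \<mu> = jt_family.jt (dim UNIV) gl_h (beta (dim UNIV) \<mu>)"
proof -
  let ?n = "dim UNIV"
  interpret G: jt_family "GL_group scale" ?n gl_h by (rule gl_jt_family)
  interpret S: jt_family "sym_group ?n" ?n "sym_h ?n" by (rule sym_jt_family)
  let ?\<beta> = "beta ?n \<mu>"
  let ?\<chi> = "G.jt ?\<beta>"
  note len = is_partitionD[OF \<mu>]
  have sum: "(\<Sum>i<?n. ?\<beta> i) = int ?n + (\<Sum>i<?n. delta ?n i)" using sum_beta[OF len(2)] len(1) by simp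
  have norm: "G.ip ?\<chi> ?\<chi> = 1"
    using G.jt_norm[of ?\<beta>] beta_nonneg sum beta_inj[OF \<mu>] by simp
  have "G.ip (gl_h (\<lambda>i. int (part \<mu> i))) ?\<chi> = 1"
    using gl_sym_ip[OF part_sum_dim[OF len]] sym_character_jt(3)[OF \<mu>] by simp
  then have irr: "?\<chi> \<in> irr_characters (GL_group scale)"
    by (rule G.virtual_irr_of_character[OF G.jt_virtual norm G.h_char])
  have "(\<Sum>i<?n. int (part (replicate ?n 1) i)) = int ?n"
    by (rule part_sum_dim) (simp_all add: sum_list_replicate)
  then have unip: "?\<chi> \<in> unipotent_characters scale bs"
    using irr ip_regular_sym[OF sym_character_jt(2)[OF \<mu>]]
    by (simp add: unipotent_characters_eq[OF bs] irr_constituents_def multiplicity_in_def gl_sym_ip)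
  let ?M = "\<lambda>\<chi>. \<forall>\<nu>. is_composition (sum_list \<mu>) \<nu> \<longrightarrow>
      multiplicity_in (GL_group scale) \<chi> (perm_character (GL_group scale) (parabolic scale bs \<nu>))
      = multiplicity_in (sym_group (sum_list \<mu>)) (sym_character \<mu>)
          (perm_character (sym_group (sum_list \<mu>)) (young_subgroup \<nu>))"
  have M_iff: "?M \<chi> \<longleftrightarrow> (\<forall>\<nu>. is_composition ?n \<nu> \<longrightarrow>
      G.ip (gl_h (\<lambda>i. int (part \<nu> i))) \<chi> = G.ip (gl_h (\<lambda>i. int (part \<nu> i))) ?\<chi>)" for \<chi>
    unfolding len(1)
  proof (intro all_cong1 imp_cong refl)
    fix \<nu> assume \<nu>: "is_composition ?n \<nu>"
    note c = is_compositionD[OF \<nu>]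
    show "multiplicity_in (GL_group scale) \<chi> (perm_character (GL_group scale) (parabolic scale bs \<nu>))
        = multiplicity_in (sym_group ?n) (sym_character \<mu>) (perm_character (sym_group ?n) (young_subgroup \<nu>))
      \<longleftrightarrow> G.ip (gl_h (\<lambda>i. int (part \<nu> i))) \<chi> = G.ip (gl_h (\<lambda>i. int (part \<nu> i))) ?\<chi>"
      unfolding multiplicity_in_def parabolic_perm_character[OF bs c] young_perm_character[OF c]
        sym_character_jt(1)[OF \<mu>] gl_sym_ip[OF part_sum_dim[OF c]] ..
  qed
  show ?thesis
    unfolding unipotent_character_def
  proof (rule the_equality)
    show "?\<chi> \<in> unipotent_characters scale bs \<and> ?M ?\<chi>" using unip M_iff by blast
  next
    fix \<chi> assume "\<chi> \<in> unipotent_characters scale bs \<and> ?M \<chi>"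
    then have \<chi>: "\<chi> \<in> irr_characters (GL_group scale)"
      "\<And>\<nu>. is_composition ?n \<nu> \<Longrightarrow> G.ip (gl_h (\<lambda>i. int (part \<nu> i))) \<chi> = G.ip (gl_h (\<lambda>i. int (part \<nu> i))) ?\<chi>"
      unfolding M_iff by (auto simp: unipotent_characters_def irr_constituents_def)
    have eq: "G.ip (gl_h a) \<chi> = G.ip (gl_h a) ?\<chi>" if "(\<Sum>i<?n. a i) = int ?n" for a
    proof (cases "\<exists>i<?n. a i < 0")
      case True
      then have "gl_h a g = 0" for g using gl_h_negative by blast
      then show ?thesis by (simp add: char_inner_on_def)
    next
      case False
      then have "0 \<le> a i" if "i < ?n" for i using that not_less by blast
      from gl_h_composition[OF bs that this] obtain \<nu> where
        "is_composition ?n \<nu>" "gl_h a = gl_h (\<lambda>i. int (part \<nu> i))" by blast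
      then show ?thesis using \<chi>(2) by simp
    qed
    have "G.ip ?\<chi> \<chi> = G.ip ?\<chi> ?\<chi>"
      unfolding G.ip_jt_left[of ?\<beta>]
    proof (intro sum.cong refl arg_cong2[of _ _ _ _ times] eq)
      fix w assume "w \<in> {w. w permutes {..<?n}}"
      then show "(\<Sum>i<?n. ?\<beta> i - delta ?n (w i)) = int ?n"
        using sum G.sum_delta_permute[of w] by (simp add: sum_subtractf)
    qed
    then show "\<chi> = ?\<chi>" using norm G.irr_characters_orthonormal[OF irr \<chi>(1)] by (simp split: if_splits)
  qed
qed

text \<open>Covers every unipotent character whether or not it is given by a label, since a chain of
  links may pass through any of them.\<close>

lemma unipotent_eq_jt:
  assumes bs: "ordered_basis scale bs" and \<psi>: "\<psi> \<in> unipotent_characters scale bs"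
  shows "\<exists>\<beta>. \<psi> = jt_family.jt (dim UNIV) gl_h \<beta> \<or> \<psi> = (\<lambda>g. - jt_family.jt (dim UNIV) gl_h \<beta> g)"
proof -
  interpret G: jt_family "GL_group scale" "dim UNIV" gl_h by (rule gl_jt_family)
  let ?a = "\<lambda>i. int (part (replicate (dim UNIV) 1) i)"
  have "\<psi> \<in> irr_characters (GL_group scale)" "G.ip (gl_h ?a) \<psi> \<noteq> 0"
    using \<psi> unfolding unipotent_characters_eq[OF bs] irr_constituents_def multiplicity_in_def by auto
  moreover have "(\<Sum>i<dim UNIV. ?a i) = int (dim UNIV)"
    by (rule part_sum_dim) (simp_all add: sum_list_replicate)
  ultimately show ?thesis by (intro G.irr_eq_jt[of ?a]) (auto simp: gl_h_negative)
qed

subsection \<open>Blocks and residues\<close>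

text \<open>A relation, because neither the sequence nor the sign representing a character need be
  unique.\<close>

definition has_residues :: "nat \<Rightarrow> (('v \<Rightarrow> 'v) \<Rightarrow> complex) \<Rightarrow> int multiset \<Rightarrow> bool" where
  "has_residues d \<psi> M \<longleftrightarrow> (\<exists>\<beta>. residues_mset d (dim UNIV) \<beta> = M \<and>
     (\<psi> = jt_family.jt (dim UNIV) gl_h \<beta> \<or> \<psi> = (\<lambda>g. - jt_family.jt (dim UNIV) gl_h \<beta> g)))"

lemma directly_linked_residues:
  assumes link: "directly_linked d scale \<chi> \<psi>" and M: "has_residues d \<chi> M" "has_residues d \<psi> M'"
  shows "M = M'"
proof (rule ccontr)
  assume ne: "M \<noteq> M'"
  let ?n = "dim UNIV" and ?jt = "jt_family.jt (dim UNIV) gl_h"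
  obtain \<beta> s where \<beta>: "residues_mset d ?n \<beta> = M" "\<And>g. \<chi> g = s * ?jt \<beta> g"
    using M(1) unfolding has_residues_def by (metis mult_1 mult_minus1)
  obtain \<gamma> t where \<gamma>: "residues_mset d ?n \<gamma> = M'" "\<And>g. \<psi> g = t * ?jt \<gamma> g"
    using M(2) unfolding has_residues_def by (metis mult_1 mult_minus1)
  have "(\<Sum>g\<in>reg_auts d UNIV. \<chi> g * cnj (\<psi> g))
      = (\<Sum>g\<in>reg_auts d UNIV. s * cnj t * of_int (schar ?n UNIV \<beta> g * schar ?n UNIV \<gamma> g))"
    by (intro sum.cong refl) (simp add: \<beta>(2) \<gamma>(2) gl_jt_eq_schar reg_auts_def)
  also have "\<dots> = s * cnj t * of_int (\<Sum>g\<in>reg_auts d UNIV. schar ?n UNIV \<beta> g * schar ?n UNIV \<gamma> g)"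
    by (simp only: sum_distrib_left of_int_sum)
  also have "\<dots> = 0"
    using schar_reg_orthogonal[OF subspace_UNIV, of d ?n \<beta> \<gamma>] ne \<beta>(1) \<gamma>(1) by simp
  finally show False
    using link by (simp add: directly_linked_def char_inner_on_def d_regular_eq_reg_auts)
qed

theorem unipotent_block_residues:
  assumes bs: "ordered_basis scale bs" and B: "B \<in> unipotent_blocks d scale bs"
    and "\<chi> \<in> B" "\<psi> \<in> B" "has_residues d \<chi> M" "has_residues d \<psi> M'"
  shows "M = M'"
proof -
  let ?U = "unipotent_characters scale bs"
  let ?E = "{(\<chi>, \<psi>). \<chi> \<in> ?U \<and> \<psi> \<in> ?U \<and> directly_linked d scale \<chi> \<psi>}"
  have ex: "\<exists>M. has_residues d \<chi> M" if "\<chi> \<in> ?U" for \<chi>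
    using unipotent_eq_jt[OF bs that] unfolding has_residues_def by blast
  \<comment> \<open>Each intermediate character has some residues by \<open>unipotent_eq_jt\<close>,
    and a single link forces any two choices at its ends to agree.\<close>
  have chain: "M = M'" if "(x, y) \<in> ?E\<^sup>+" "has_residues d x M" "has_residues d y M'" for x y M M'
    using that(1,3)
  proof (induction arbitrary: M' rule: trancl_induct)
    case (base y)
    then show ?case using directly_linked_residues that(2) by blast
  next
    case (step y z)
    then obtain M1 where M1: "has_residues d y M1" using ex by auto
    have "M = M1" by (rule step.IH[OF M1])
    also have "M1 = M'" using directly_linked_residues[OF _ M1 step.prems] step.hyps(2) by blast
    finally show ?case .
  qed
  obtain x where x: "x \<in> ?U" "B = ?E\<^sup>+ `` {x}" using B unfolding unipotent_blocks_def quotient_def by auto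
  obtain M0 where M0: "has_residues d x M0" using ex[OF x(1)] by auto
  have "(x, \<chi>) \<in> ?E\<^sup>+" "(x, \<psi>) \<in> ?E\<^sup>+" using assms(3,4) unfolding x(2) by blast+
  from chain[OF this(1) M0 assms(5)] chain[OF this(2) M0 assms(6)] show ?thesis by simp
qed

end

lemma finite_span_finite_field:
  fixes scale :: "'k::{field, finite} \<Rightarrow> 'v::ab_group_add \<Rightarrow> 'v"
  assumes "vector_space scale" "finite S"
  shows "finite (Modules.module.span scale S)"
proof -
  interpret vector_space scale by (rule assms(1))
  show ?thesis
    using assms(2)
  proof (induction S)
    case (insert a S)
    have "span (insert a S) \<subseteq> (\<lambda>(c, x). scale c a + x) ` (UNIV \<times> span S)"
    proof
      fix x assume "x \<in> span (insert a S)"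
      then obtain k where "x - scale k a \<in> span S" unfolding span_insert by auto
      then show "x \<in> (\<lambda>(c, x). scale c a + x) ` (UNIV \<times> span S)"
        by (intro image_eqI[of _ _ "(k, x - scale k a)"]) auto
    qed
    then show ?case by (rule finite_subset) (use insert.IH in simp)
  qed simp
qed

theorem theorem4p3:
  fixes scale :: "'k::{field, finite} \<Rightarrow> 'v::ab_group_add \<Rightarrow> 'v"
    and bs :: "'v list" and n d :: nat and \<mu> \<mu>' :: "nat list"
  assumes "vector_space scale"
    and "n > 0" and "vector_space.dim scale UNIV = n"
    and "ordered_basis scale bs"
    and "d > 0"
    and "is_partition n \<mu>" and "is_partition n \<mu>'"
    and "\<exists>B\<in>unipotent_blocks d scale bs.
           unipotent_character scale bs \<mu> \<in> B \<and> unipotent_character scale bs \<mu>' \<in> B"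
  shows "d_core d \<mu> = d_core d \<mu>'"
proof -
  \<comment> \<open>A finite spanning list over a finite field makes the whole space finite, as
    \<open>fin_vs\<close> requires.\<close>
  have "finite (Modules.module.span scale (set bs))" by (rule finite_span_finite_field[OF assms(1)]) simp
  then have "finite (UNIV :: 'v set)" using assms(4) by (simp add: ordered_basis_def)
  then interpret fin_vs scale using assms(1) by (intro fin_vs.intro fin_vs_axioms.intro)
  obtain B where B: "B \<in> unipotent_blocks d scale bs"
    "unipotent_character scale bs \<mu> \<in> B" "unipotent_character scale bs \<mu>' \<in> B"
    using assms(8) by auto
  have r: "has_residues d (unipotent_character scale bs \<alpha>) (residues_mset d n (beta n \<alpha>))"
    if "is_partition n \<alpha>" for \<alpha>
    using unipotent_character_eq_jt[OF assms(4), of \<alpha>] that assms(3) unfolding has_residues_def by blast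
  have "residues_mset d n (beta n \<mu>) = residues_mset d n (beta n \<mu>')"
    by (rule unipotent_block_residues[OF assms(4) B r[OF assms(6)] r[OF assms(7)]])
  then show ?thesis
    by (rule d_core_eqI[OF assms(5,6) is_partitionD(2)[OF assms(6)] assms(7) is_partitionD(2)[OF assms(7)]])
qed

end
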